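(* Let $(\mathcal{R},\partial)$ be a commutative differential ring with a quasi-integration $\mathrm{Q}$, and let $\mathrm{IDR}(\mathcal{R})$ (with its $\partial$ and $\int$) and $\iota:\mathcal{R}\to\mathrm{IDR}(\mathcal{R})$ be as defined in the context. Let $(\mathcal{S},\partial,\int)$ be a commutative integro-differential ring and let $\varphi:\mathcal{R}\to\mathcal{S}$ be a differential ring homomorphism. Then there exists a unique integro-differential ring homomorphism $\eta:\mathrm{IDR}(\mathcal{R})\to\mathcal{S}$ such that $\eta(\iota(f))=\varphi(f)$ for all $f\in\mathcal{R}$.
   Context: Rings and algebras have a unit, homomorphisms preserve it. A differential ring is a ring with an additive map $\partial$ satisfying the Leibniz rule; its ring of constants is $\ker\partial$. An integro-differential ring $(\mathcal{S},\partial,\int)$ is a differential ring with a $\ker(\partial)$-linear map $\int:\mathcal{S}\to\mathcal{S}$ such that $\partial\int=\mathrm{id}$. Differential ring homomorphisms are ring homomorphisms commuting with $\partial$; integro-differential ring homomorphisms are ring homomorphisms commuting with $\partial$ and $\int$. Setting: $(\mathcal{R},\partial)$ is a commutative differential ring, $\mathcal{C}=\ker\partial$, and all tensor and symmetric products are over $\mathcal{C}$. A quasi-integration is a $\mathcal{C}$-linear $\mathrm{Q}:\mathcal{R}\to\mathcal{R}$ with $\partial\mathrm{Q}\partial=\partial$ and $\mathrm{Q}\partial\mathrm{Q}=\mathrm{Q}$; one such $\mathrm{Q}$ is fixed. Put $\mathcal{R}_{\mathrm{J}}=\mathrm{Q}\mathcal{R}$ and $\mathcal{R}_{\mathrm{T}}=\ker\mathrm{Q}$,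 so $\mathcal{R}=\mathcal{C}\oplus\mathcal{R}_{\mathrm{J}}=(\partial\mathcal{R})\oplus\mathcal{R}_{\mathrm{T}}$. Tensors: $\mathcal{T}=\bigoplus_{n\ge0}\mathcal{R}_{\mathrm{T}}^{\otimes n}$ with empty tensor $1_{\mathcal{T}}$; $\widetilde{\mathcal{T}}=\bigoplus_{n\ge1}\mathcal{R}_{\mathrm{T}}^{\otimes n}$. The shuffle product $\sqcup\!\sqcup$ on $\mathcal{T}$ is the $\mathcal{C}$-bilinear product with $t\sqcup\!\sqcup s=t\otimes s$ if $t$ or $s$ has length $0$ and $t\sqcup\!\sqcup s=t_1\otimes((t_2\otimes\dots\otimes t_n)\sqcup\!\sqcup s)+s_1\otimes(t\sqcup\!\sqcup(s_2\otimes\dots\otimes s_m))$ for pure tensors of lengths $n,m\ge1$. For a pure tensor $f=f_1\otimes\dots\otimes f_n$, $f_i^j:=f_i\otimes\dots\otimes f_j$, and $f_i^j=1_{\mathcal{T}}$ if $i=j+1$. Constants: $M_1=\mathcal{R}_{\mathrm{J}}\otimes\mathcal{T}$, $M_2=\widetilde{\mathcal{T}}^{\odot2}$ (symmetric square). $\varepsilon(M_1),\varepsilon(M_2)$ are isomorphic copies with isomorphisms $\varepsilon$; for $r\in\mathcal{R}_{\mathrm{J}}$, $\varepsilon(r)$ means $\varepsilon(r\otimes1_{\mathcal{T}})$. $\mathcal{C}_1=\mathrm{Sym}(\varepsilon(M_1))$ and $\mathcal{C}_2=\mathrm{Sym}(\varepsilon(M_2))/J_2$ (unital symmetric $\mathcal{C}$-algebras),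 where $J_2$ is the ideal generated by all $$\varepsilon((f\sqcup\!\sqcup g)\odot h)-\varepsilon(f\odot(g\sqcup\!\sqcup h))+\sum_{j=0}^{m-1}\Big(\sum_{i=\max(0,1-j)}^{n-1}\varepsilon(f_{i+1}^n\odot g_{j+1}^m)\cdot\varepsilon((f_1^i\sqcup\!\sqcup g_1^j)\odot h)-\sum_{k=\max(0,1-j)}^{l-1}\varepsilon(f\odot(g_1^j\sqcup\!\sqcup h_1^k))\cdot\varepsilon(g_{j+1}^m\odot h_{k+1}^l)\Big)$$ for $n,m,l\ge1$ and pure tensors $f\in\mathcal{R}_{\mathrm{T}}^{\otimes n}$, $g\in\mathcal{R}_{\mathrm{T}}^{\otimes m}$, $h\in\mathcal{R}_{\mathrm{T}}^{\otimes l}$. Elements $\varepsilon(\cdot)$ of $\mathcal{C}_2$ denote classes. Product on $\mathcal{C}_2\otimes\mathcal{T}$: the $\mathcal{C}$-bilinear map with, for $c,d\in\mathcal{C}_2$ and pure tensors $f,g$ of lengths $n,m\ge0$, $$(c\otimes f)\cdot(d\otimes g)=(c\cdot d)\otimes(f\sqcup\!\sqcup g)+\sum_{i=0}^{n-1}\sum_{j=0}^{m-1}\big(c\cdot d\cdot\varepsilon(f_{i+1}^n\odot g_{j+1}^m)\big)\otimes(f_1^i\sqcup\!\sqcup g_1^j);$$ this makes $\mathcal{C}_2\otimes\mathcal{T}$ a commutative $\mathcal{C}$-algebra with unit $1\otimes1_{\mathcal{T}}$. $\mathrm{IDR}(\mathcal{R}):=\mathcal{R}\otimes\mathcal{C}_1\otimes\mathcal{C}_2\otimes\mathcal{T}$,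 the tensor product of the commutative $\mathcal{C}$-algebras $\mathcal{R}$, $\mathcal{C}_1$ and $\mathcal{C}_2\otimes\mathcal{T}$; $\iota(f)=f\otimes1\otimes1\otimes1_{\mathcal{T}}$ for $f\in\mathcal{R}$. For $f_0\in\mathcal{R}$, $c=c_1\otimes c_2\in\mathcal{C}_1\otimes\mathcal{C}_2$ and a pure tensor $f\in\mathcal{R}_{\mathrm{T}}^{\otimes n}$, the $\mathcal{C}$-linear maps $\partial,\int$ on $\mathrm{IDR}(\mathcal{R})$ are given as follows. $\partial(f_0\otimes c\otimes f)=(\partial f_0)\otimes c\otimes f$ if $n=0$ and $(\partial f_0)\otimes c\otimes f+(f_0f_1)\otimes c\otimes f_2^n$ if $n>0$. For $n=0$: $\int(f_0\otimes c\otimes f)=(\mathrm{Q}f_0)\otimes c\otimes f-1\otimes(c_1\cdot\varepsilon(\mathrm{Q}f_0))\otimes c_2\otimes f+1\otimes c\otimes((f_0-\partial\mathrm{Q}f_0)\otimes f)$. For $n>0$, recursively: $\int(f_0\otimes c\otimes f)=(\mathrm{Q}f_0)\otimes c\otimes f-1\otimes(c_1\cdot\varepsilon((\mathrm{Q}f_0)\otimes f))\otimes c_2\otimes1_{\mathcal{T}}-\int(((\mathrm{Q}f_0)f_1)\otimes c\otimes f_2^n)+1\otimes c\otimes((f_0-\partial\mathrm{Q}f_0)\otimes f)$. With these, $\mathrm{IDR}(\mathcal{R})$ is a commutative integro-differential ring. *)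

theory Defs
  imports "HOL-Algebra.Module" "HOL-Algebra.QuotRing" "HOL-Library.Multiset"
begin

section \<open>Differential and integro-differential rings\<close>

text \<open>Rings are \<open>cring\<close>s, so the zero ring is allowed.\<close>

locale comm_differential_ring = cring R for R (structure) +
  fixes deriv :: "'a \<Rightarrow> 'a"
  assumes deriv_closed: "x \<in> carrier R \<Longrightarrow> deriv x \<in> carrier R"
    and deriv_add: "\<lbrakk>x \<in> carrier R; y \<in> carrier R\<rbrakk> \<Longrightarrow> deriv (x \<oplus> y) = deriv x \<oplus> deriv y"
    and deriv_mult: "\<lbrakk>x \<in> carrier R; y \<in> carrier R\<rbrakk> \<Longrightarrow>
      deriv (x \<otimes> y) = deriv x \<otimes> y \<oplus> x \<otimes> deriv y"

definition (in comm_differential_ring) constants :: "'a set" where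
  "constants = {c \<in> carrier R. deriv c = \<zero>}"

definition (in comm_differential_ring) const_linear :: "('a \<Rightarrow> 'a) \<Rightarrow> bool" where
  "const_linear h \<longleftrightarrow> h \<in> carrier R \<rightarrow> carrier R \<and>
     (\<forall>x\<in>carrier R. \<forall>y\<in>carrier R. h (x \<oplus> y) = h x \<oplus> h y) \<and>
     (\<forall>c\<in>constants. \<forall>x\<in>carrier R. h (c \<otimes> x) = c \<otimes> h x)"

locale comm_integro_differential_ring = comm_differential_ring +
  fixes integ :: "'a \<Rightarrow> 'a"
  assumes integ_linear: "const_linear integ"
    and deriv_integ: "x \<in> carrier R \<Longrightarrow> deriv (integ x) = x"

locale comm_differential_ring_quasi = comm_differential_ring +
  fixes Q :: "'a \<Rightarrow> 'a"
  assumes Q_linear: "const_linear Q"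
    and deriv_Q_deriv: "x \<in> carrier R \<Longrightarrow> deriv (Q (deriv x)) = deriv x"
    and Q_deriv_Q: "x \<in> carrier R \<Longrightarrow> Q (deriv (Q x)) = Q x"

definition differential_ring_hom ::
  "('a, 'm) ring_scheme \<Rightarrow> ('a \<Rightarrow> 'a) \<Rightarrow> ('b, 'n) ring_scheme \<Rightarrow> ('b \<Rightarrow> 'b) \<Rightarrow> ('a \<Rightarrow> 'b) set" where
  "differential_ring_hom R dR S dS = {h \<in> ring_hom R S. \<forall>x\<in>carrier R. h (dR x) = dS (h x)}"

definition integro_differential_ring_hom ::
  "('a, 'm) ring_scheme \<Rightarrow> ('a \<Rightarrow> 'a) \<Rightarrow> ('a \<Rightarrow> 'a) \<Rightarrow>
   ('b, 'n) ring_scheme \<Rightarrow> ('b \<Rightarrow> 'b) \<Rightarrow> ('b \<Rightarrow> 'b) \<Rightarrow> ('a \<Rightarrow> 'b) set" where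
  "integro_differential_ring_hom R dR iR S dS iS =
    {h \<in> differential_ring_hom R dR S dS. \<forall>x\<in>carrier R. h (iR x) = iS (h x)}"


section \<open>Modules and algebras over a commutative ring\<close>

text \<open>
  Modules and algebras are records of the library type \<open>module\<close>, which contains fields for
  a multiplication and a unit.  For a record that is only used as a module these two fields
  are \<open>undefined\<close> (or are inherited from an ambient ring) and play no role.
\<close>

definition linear_map ::
  "('c, 'm) ring_scheme \<Rightarrow> ('c, 'a) module \<Rightarrow> ('c, 'b) module \<Rightarrow> ('a \<Rightarrow> 'b) \<Rightarrow> bool" where
  "linear_map C M N h \<longleftrightarrow> h \<in> carrier M \<rightarrow> carrier N \<and>
     (\<forall>x\<in>carrier M. \<forall>y\<in>carrier M. h (x \<oplus>\<^bsub>M\<^esub> y) = h x \<oplus>\<^bsub>N\<^esub> h y) \<and>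
     (\<forall>c\<in>carrier C. \<forall>x\<in>carrier M. h (c \<odot>\<^bsub>M\<^esub> x) = c \<odot>\<^bsub>N\<^esub> h x)"

definition bilinear_map ::
  "('c, 'm) ring_scheme \<Rightarrow> ('c, 'a) module \<Rightarrow> ('c, 'b) module \<Rightarrow> ('c, 'd) module \<Rightarrow>
   ('a \<Rightarrow> 'b \<Rightarrow> 'd) \<Rightarrow> bool" where
  "bilinear_map C M N P h \<longleftrightarrow>
     (\<forall>x\<in>carrier M. linear_map C N P (h x)) \<and>
     (\<forall>y\<in>carrier N. linear_map C M P (\<lambda>x. h x y))"

text \<open>
  The (bi)linear map with prescribed values on given families of elements.  It is only used
  for families that span the module, such as pure tensors, so that the map is determined on
  the carriers; its values outside the carriers are irrelevant.
\<close>

definition linear_ext ::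
  "('c, 'm) ring_scheme \<Rightarrow> ('c, 'a) module \<Rightarrow> ('c, 'b) module \<Rightarrow>
   'i set \<Rightarrow> ('i \<Rightarrow> 'a) \<Rightarrow> ('i \<Rightarrow> 'b) \<Rightarrow> 'a \<Rightarrow> 'b" where
  "linear_ext C M N I e v = (SOME h. linear_map C M N h \<and> (\<forall>i\<in>I. h (e i) = v i))"

definition bilinear_ext ::
  "('c, 'm) ring_scheme \<Rightarrow> ('c, 'a) module \<Rightarrow> ('c, 'b) module \<Rightarrow> ('c, 'd) module \<Rightarrow>
   'i set \<Rightarrow> ('i \<Rightarrow> 'a) \<Rightarrow> 'j set \<Rightarrow> ('j \<Rightarrow> 'b) \<Rightarrow> ('i \<Rightarrow> 'j \<Rightarrow> 'd) \<Rightarrow> 'a \<Rightarrow> 'b \<Rightarrow> 'd" where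
  "bilinear_ext C M N P I e J e' v =
     (SOME h. bilinear_map C M N P h \<and> (\<forall>i\<in>I. \<forall>j\<in>J. h (e i) (e' j) = v i j))"

text \<open>A ring as an algebra over any of its subrings.\<close>

definition ring_algebra :: "('c, 'm) ring_scheme \<Rightarrow> ('c, 'c) module" where
  "ring_algebra R = \<lparr>carrier = carrier R, monoid.mult = monoid.mult R, monoid.one = monoid.one R,
     ring.zero = ring.zero R, ring.add = ring.add R, module.smult = monoid.mult R\<rparr>"

definition direct_sum :: "'i set \<Rightarrow> ('i \<Rightarrow> ('c, 'a) module) \<Rightarrow> ('c, 'i \<Rightarrow> 'a) module" where
  "direct_sum I M =
    \<lparr>carrier = {x \<in> \<Pi>\<^sub>E i\<in>I. carrier (M i). finite {i \<in> I. x i \<noteq> \<zero>\<^bsub>M i\<^esub>}},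
     monoid.mult = undefined, monoid.one = undefined,
     ring.zero = (\<lambda>i\<in>I. \<zero>\<^bsub>M i\<^esub>),
     ring.add = (\<lambda>x y. \<lambda>i\<in>I. x i \<oplus>\<^bsub>M i\<^esub> y i),
     module.smult = (\<lambda>c x. \<lambda>i\<in>I. c \<odot>\<^bsub>M i\<^esub> x i)\<rparr>"

definition direct_sum_incl :: "'i set \<Rightarrow> ('i \<Rightarrow> ('c, 'a) module) \<Rightarrow> 'i \<Rightarrow> 'a \<Rightarrow> 'i \<Rightarrow> 'a" where
  "direct_sum_incl I M i x = (\<lambda>j\<in>I. if j = i then x else \<zero>\<^bsub>M j\<^esub>)"

definition submodule_span :: "('c, 'm) ring_scheme \<Rightarrow> ('c, 'a) module \<Rightarrow> 'a set \<Rightarrow> 'a set" where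
  "submodule_span C M X = \<Inter>{H. submodule H C M \<and> X \<subseteq> H}"

text \<open>
  Quotient of a module by a submodule, or of an algebra by an ideal: the library's quotient
  ring, equipped with the induced scalar multiplication.
\<close>

definition quotient_module :: "('c, 'a) module \<Rightarrow> 'a set \<Rightarrow> ('c, 'a set) module" where
  "quotient_module M H = ring.extend (M Quot H)
     (module.fields (\<lambda>c X. \<Union>x\<in>X. H +>\<^bsub>M\<^esub> (c \<odot>\<^bsub>M\<^esub> x)))"

definition free_module :: "('c, 'm) ring_scheme \<Rightarrow> 'x set \<Rightarrow> ('c, 'x \<Rightarrow> 'c) module" where
  "free_module C X = direct_sum X (\<lambda>_. ring_algebra C)"

definition free_gen :: "('c, 'm) ring_scheme \<Rightarrow> 'x set \<Rightarrow> 'x \<Rightarrow> 'x \<Rightarrow> 'c" where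
  "free_gen C X x = direct_sum_incl X (\<lambda>_. ring_algebra C) x \<one>\<^bsub>C\<^esub>"

text \<open>The elements of \<open>F\<close> that have to vanish for \<open>s :: M \<Rightarrow> F\<close> to become linear.\<close>

definition linearity_rels ::
  "('c, 'm) ring_scheme \<Rightarrow> ('c, 'a) module \<Rightarrow> ('c, 'b) module \<Rightarrow> ('a \<Rightarrow> 'b) \<Rightarrow> 'b set" where
  "linearity_rels C M F s =
     {s (x \<oplus>\<^bsub>M\<^esub> y) \<ominus>\<^bsub>F\<^esub> (s x \<oplus>\<^bsub>F\<^esub> s y) | x y. x \<in> carrier M \<and> y \<in> carrier M} \<union>
     {s (c \<odot>\<^bsub>M\<^esub> x) \<ominus>\<^bsub>F\<^esub> (c \<odot>\<^bsub>F\<^esub> s x) | c x. c \<in> carrier C \<and> x \<in> carrier M}"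


subsection \<open>Tensor products\<close>

definition tensor_rels ::
  "('c, 'm) ring_scheme \<Rightarrow> ('c, 'a) module \<Rightarrow> ('c, 'b) module \<Rightarrow> ('a \<times> 'b \<Rightarrow> 'c) set" where
  "tensor_rels C M N =
    (let X = carrier M \<times> carrier N; F = free_module C X; g = free_gen C X in
      submodule_span C F
        ((\<Union>y\<in>carrier N. linearity_rels C M F (\<lambda>x. g (x, y))) \<union>
         (\<Union>x\<in>carrier M. linearity_rels C N F (\<lambda>y. g (x, y)))))"

definition tensor_module ::
  "('c, 'm) ring_scheme \<Rightarrow> ('c, 'a) module \<Rightarrow> ('c, 'b) module \<Rightarrow>
   ('c, ('a \<times> 'b \<Rightarrow> 'c) set) module" where
  "tensor_module C M N =
     quotient_module (free_module C (carrier M \<times> carrier N)) (tensor_rels C M N)"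

definition tensor ::
  "('c, 'm) ring_scheme \<Rightarrow> ('c, 'a) module \<Rightarrow> ('c, 'b) module \<Rightarrow>
   'a \<Rightarrow> 'b \<Rightarrow> ('a \<times> 'b \<Rightarrow> 'c) set" where
  "tensor C M N x y = (let X = carrier M \<times> carrier N in
     tensor_rels C M N +>\<^bsub>free_module C X\<^esub> free_gen C X (x, y))"

definition tensor_algebra_product ::
  "('c, 'm) ring_scheme \<Rightarrow> ('c, 'a) module \<Rightarrow> ('c, 'b) module \<Rightarrow>
   ('c, ('a \<times> 'b \<Rightarrow> 'c) set) module" where
  "tensor_algebra_product C A B =
    (let M = tensor_module C A B; P = carrier A \<times> carrier B;
         e = (\<lambda>(x, y). tensor C A B x y) in
      M\<lparr>monoid.mult := bilinear_ext C M M M P e P e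
           (\<lambda>(x, y) (x', y'). tensor C A B (x \<otimes>\<^bsub>A\<^esub> x') (y \<otimes>\<^bsub>B\<^esub> y')),
        monoid.one := tensor C A B \<one>\<^bsub>A\<^esub> \<one>\<^bsub>B\<^esub>\<rparr>)"


subsection \<open>Tensor powers and their direct sum\<close>

text \<open>The \<open>n\<close>-fold tensor power; a list of length \<open>n\<close> stands for the pure tensor of its entries.\<close>

definition words :: "('c, 'a) module \<Rightarrow> nat \<Rightarrow> 'a list set" where
  "words M n = {w. set w \<subseteq> carrier M \<and> length w = n}"

definition tensor_power_rels ::
  "('c, 'm) ring_scheme \<Rightarrow> ('c, 'a) module \<Rightarrow> nat \<Rightarrow> ('a list \<Rightarrow> 'c) set" where
  "tensor_power_rels C M n =
    (let F = free_module C (words M n); g = free_gen C (words M n) in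
      submodule_span C F
        (\<Union>(u, v) \<in> {(u, v). set u \<union> set v \<subseteq> carrier M \<and> length u + 1 + length v = n}.
           linearity_rels C M F (\<lambda>x. g (u @ [x] @ v))))"

definition tensor_power ::
  "('c, 'm) ring_scheme \<Rightarrow> ('c, 'a) module \<Rightarrow> nat \<Rightarrow> ('c, ('a list \<Rightarrow> 'c) set) module" where
  "tensor_power C M n = quotient_module (free_module C (words M n)) (tensor_power_rels C M n)"

definition tensors ::
  "('c, 'm) ring_scheme \<Rightarrow> ('c, 'a) module \<Rightarrow> ('c, nat \<Rightarrow> ('a list \<Rightarrow> 'c) set) module" where
  "tensors C M = direct_sum UNIV (tensor_power C M)"

definition pure_tensor ::
  "('c, 'm) ring_scheme \<Rightarrow> ('c, 'a) module \<Rightarrow> 'a list \<Rightarrow> nat \<Rightarrow> ('a list \<Rightarrow> 'c) set" where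
  "pure_tensor C M w = (let n = length w; X = words M n in
     direct_sum_incl UNIV (tensor_power C M) n
       (tensor_power_rels C M n +>\<^bsub>free_module C X\<^esub> free_gen C X w))"

definition tensors_pos ::
  "('c, 'm) ring_scheme \<Rightarrow> ('c, 'a) module \<Rightarrow> ('c, nat \<Rightarrow> ('a list \<Rightarrow> 'c) set) module" where
  "tensors_pos C M =
    (tensors C M)\<lparr>carrier := {t \<in> carrier (tensors C M). t 0 = \<zero>\<^bsub>tensor_power C M 0\<^esub>}\<rparr>"

text \<open>The linear map \<open>t \<mapsto> x \<otimes> t\<close>.\<close>

definition tensor_cons ::
  "('c, 'm) ring_scheme \<Rightarrow> ('c, 'a) module \<Rightarrow> 'a \<Rightarrow>
   (nat \<Rightarrow> ('a list \<Rightarrow> 'c) set) \<Rightarrow> nat \<Rightarrow> ('a list \<Rightarrow> 'c) set" where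
  "tensor_cons C M x = linear_ext C (tensors C M) (tensors C M)
     (lists (carrier M)) (pure_tensor C M) (\<lambda>w. pure_tensor C M (x # w))"

text \<open>
  The shuffle product is only needed on pure tensors.  Pure tensors of length 0 are scalar
  multiples of the empty word, so by bilinearity it suffices to treat words.
\<close>

fun shuffle ::
  "('c, 'm) ring_scheme \<Rightarrow> ('c, 'a) module \<Rightarrow> 'a list \<Rightarrow> 'a list \<Rightarrow>
   nat \<Rightarrow> ('a list \<Rightarrow> 'c) set" where
  "shuffle C M [] g = pure_tensor C M g"
| "shuffle C M f [] = pure_tensor C M f"
| "shuffle C M (x # f) (y # g) =
     tensor_cons C M x (shuffle C M f (y # g)) \<oplus>\<^bsub>tensors C M\<^esub>
     tensor_cons C M y (shuffle C M (x # f) g)"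


subsection \<open>Symmetric powers and the symmetric algebra\<close>

text \<open>
  The \<open>n\<close>-th symmetric power; a multiset of size \<open>n\<close> stands for the symmetric product of its
  entries, so commutativity is built into the generators.
\<close>

definition multiwords :: "('c, 'a) module \<Rightarrow> nat \<Rightarrow> 'a multiset set" where
  "multiwords M n = {u. set_mset u \<subseteq> carrier M \<and> size u = n}"

definition sym_power_rels ::
  "('c, 'm) ring_scheme \<Rightarrow> ('c, 'a) module \<Rightarrow> nat \<Rightarrow> ('a multiset \<Rightarrow> 'c) set" where
  "sym_power_rels C M n =
    (let F = free_module C (multiwords M n); g = free_gen C (multiwords M n) in
      submodule_span C F
        (\<Union>u \<in> {u. set_mset u \<subseteq> carrier M \<and> size u + 1 = n}.
           linearity_rels C M F (\<lambda>x. g (add_mset x u))))"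

definition sym_power ::
  "('c, 'm) ring_scheme \<Rightarrow> ('c, 'a) module \<Rightarrow> nat \<Rightarrow> ('c, ('a multiset \<Rightarrow> 'c) set) module" where
  "sym_power C M n = quotient_module (free_module C (multiwords M n)) (sym_power_rels C M n)"

definition sym_prod ::
  "('c, 'm) ring_scheme \<Rightarrow> ('c, 'a) module \<Rightarrow> 'a multiset \<Rightarrow> ('a multiset \<Rightarrow> 'c) set" where
  "sym_prod C M u = (let n = size u; X = multiwords M n in
     sym_power_rels C M n +>\<^bsub>free_module C X\<^esub> free_gen C X u)"

definition sym_monomial ::
  "('c, 'm) ring_scheme \<Rightarrow> ('c, 'a) module \<Rightarrow> 'a multiset \<Rightarrow> nat \<Rightarrow> ('a multiset \<Rightarrow> 'c) set" where
  "sym_monomial C M u = direct_sum_incl UNIV (sym_power C M) (size u) (sym_prod C M u)"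

definition sym_algebra ::
  "('c, 'm) ring_scheme \<Rightarrow> ('c, 'a) module \<Rightarrow> ('c, nat \<Rightarrow> ('a multiset \<Rightarrow> 'c) set) module" where
  "sym_algebra C M =
    (let D = direct_sum UNIV (sym_power C M); U = {u. set_mset u \<subseteq> carrier M};
         e = sym_monomial C M in
      D\<lparr>monoid.mult := bilinear_ext C D D D U e U e (\<lambda>u v. e (u + v)), monoid.one := e {#}\<rparr>)"


section \<open>The ring IDR and its operations\<close>

context comm_differential_ring_quasi
begin

abbreviation C where "C \<equiv> R\<lparr>carrier := constants\<rparr>"

abbreviation R_alg where "R_alg \<equiv> ring_algebra R"

definition R\<^sub>J where "R\<^sub>J = R_alg\<lparr>carrier := Q ` carrier R\<rparr>"

definition R\<^sub>T where "R\<^sub>T = R_alg\<lparr>carrier := {x \<in> carrier R. Q x = \<zero>}\<rparr>"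

abbreviation T where "T \<equiv> tensors C R\<^sub>T"

abbreviation T_pos where "T_pos \<equiv> tensors_pos C R\<^sub>T"

abbreviation W where "W \<equiv> lists (carrier R\<^sub>T)"

abbreviation pure where "pure \<equiv> pure_tensor C R\<^sub>T"

abbreviation sh where "sh \<equiv> shuffle C R\<^sub>T"

definition M\<^sub>1 where "M\<^sub>1 = tensor_module C R\<^sub>J T"

definition M\<^sub>2 where "M\<^sub>2 = sym_power C T_pos 2"

text \<open>
  The isomorphic copy of a module inside its symmetric algebra is the image under the
  canonical embedding in degree one.  \<open>\<epsilon>\<^sub>1 r t\<close> is the constant of the tensor of \<open>r\<close> and \<open>t\<close>;
  \<open>\<epsilon>' s t\<close> and \<open>\<epsilon>\<^sub>2 s t\<close> are the constants of the symmetric product of \<open>s\<close> and \<open>t\<close>, before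
  and after passing to the quotient by \<open>J\<^sub>2\<close>.
\<close>

definition C\<^sub>1 where "C\<^sub>1 = sym_algebra C M\<^sub>1"

definition \<epsilon>\<^sub>1 where "\<epsilon>\<^sub>1 r t = sym_monomial C M\<^sub>1 {#tensor C R\<^sub>J T r t#}"

definition Sym\<^sub>2 where "Sym\<^sub>2 = sym_algebra C M\<^sub>2"

definition \<epsilon>' where "\<epsilon>' s t = sym_monomial C M\<^sub>2 {#sym_prod C T_pos {#s, t#}#}"

text \<open>
  With 0-based lists, \<open>take i f\<close> and \<open>drop i f\<close> are the segments of \<open>f\<close> with indices
  \<open>1..i\<close> and \<open>i+1..n\<close>.  Since subtraction is truncated, \<open>1 - j\<close> is \<open>max 0 (1 - j)\<close>.
\<close>

definition J\<^sub>2_gen where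
  "J\<^sub>2_gen f g h =
    \<epsilon>' (sh f g) (pure h) \<ominus>\<^bsub>Sym\<^sub>2\<^esub> \<epsilon>' (pure f) (sh g h) \<oplus>\<^bsub>Sym\<^sub>2\<^esub>
    (\<Oplus>\<^bsub>Sym\<^sub>2\<^esub> j \<in> {0..<length g}.
      (\<Oplus>\<^bsub>Sym\<^sub>2\<^esub> i \<in> {1 - j..<length f}.
         \<epsilon>' (pure (drop i f)) (pure (drop j g)) \<otimes>\<^bsub>Sym\<^sub>2\<^esub> \<epsilon>' (sh (take i f) (take j g)) (pure h))
      \<ominus>\<^bsub>Sym\<^sub>2\<^esub>
      (\<Oplus>\<^bsub>Sym\<^sub>2\<^esub> k \<in> {1 - j..<length h}.
         \<epsilon>' (pure f) (sh (take j g) (take k h)) \<otimes>\<^bsub>Sym\<^sub>2\<^esub> \<epsilon>' (pure (drop j g)) (pure (drop k h))))"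

definition J\<^sub>2 where
  "J\<^sub>2 = Idl\<^bsub>Sym\<^sub>2\<^esub> {J\<^sub>2_gen f g h | f g h. {f, g, h} \<subseteq> W - {[]}}"

definition C\<^sub>2 where "C\<^sub>2 = quotient_module Sym\<^sub>2 J\<^sub>2"

definition \<epsilon>\<^sub>2 where "\<epsilon>\<^sub>2 s t = J\<^sub>2 +>\<^bsub>Sym\<^sub>2\<^esub> \<epsilon>' s t"

definition C\<^sub>2T_mult where
  "C\<^sub>2T_mult =
    (let M = tensor_module C C\<^sub>2 T; e = (\<lambda>(c, f). tensor C C\<^sub>2 T c (pure f)) in
      bilinear_ext C M M M (carrier C\<^sub>2 \<times> W) e (carrier C\<^sub>2 \<times> W) e
        (\<lambda>(c, f) (d, g).
           tensor C C\<^sub>2 T (c \<otimes>\<^bsub>C\<^sub>2\<^esub> d) (sh f g) \<oplus>\<^bsub>M\<^esub>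
           (\<Oplus>\<^bsub>M\<^esub> i \<in> {0..<length f}. \<Oplus>\<^bsub>M\<^esub> j \<in> {0..<length g}.
              tensor C C\<^sub>2 T (c \<otimes>\<^bsub>C\<^sub>2\<^esub> d \<otimes>\<^bsub>C\<^sub>2\<^esub> \<epsilon>\<^sub>2 (pure (drop i f)) (pure (drop j g)))
                (sh (take i f) (take j g)))))"

definition C\<^sub>2T where
  "C\<^sub>2T = (tensor_module C C\<^sub>2 T)
     \<lparr>monoid.mult := C\<^sub>2T_mult, monoid.one := tensor C C\<^sub>2 T \<one>\<^bsub>C\<^sub>2\<^esub> (pure [])\<rparr>"

definition IDR where
  "IDR = tensor_algebra_product C R_alg (tensor_algebra_product C C\<^sub>1 C\<^sub>2T)"

text \<open>The element \<open>f\<^sub>0 \<otimes> c\<^sub>1 \<otimes> c\<^sub>2 \<otimes> f\<close> for a pure tensor \<open>f\<close>; these elements span \<open>IDR\<close>.\<close>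

definition IDR_pure where
  "IDR_pure f\<^sub>0 c\<^sub>1 c\<^sub>2 f =
     tensor C R_alg (tensor_algebra_product C C\<^sub>1 C\<^sub>2T) f\<^sub>0
       (tensor C C\<^sub>1 C\<^sub>2T c\<^sub>1 (tensor C C\<^sub>2 T c\<^sub>2 (pure f)))"

definition IDR_incl where
  "IDR_incl f = IDR_pure f \<one>\<^bsub>C\<^sub>1\<^esub> \<one>\<^bsub>C\<^sub>2\<^esub> []"

fun deriv_pure where
  "deriv_pure f\<^sub>0 c\<^sub>1 c\<^sub>2 [] = IDR_pure (deriv f\<^sub>0) c\<^sub>1 c\<^sub>2 []"
| "deriv_pure f\<^sub>0 c\<^sub>1 c\<^sub>2 (f\<^sub>1 # f) =
     IDR_pure (deriv f\<^sub>0) c\<^sub>1 c\<^sub>2 (f\<^sub>1 # f) \<oplus>\<^bsub>IDR\<^esub> IDR_pure (f\<^sub>0 \<otimes> f\<^sub>1) c\<^sub>1 c\<^sub>2 f"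

fun integ_pure where
  "integ_pure f\<^sub>0 c\<^sub>1 c\<^sub>2 [] =
     IDR_pure (Q f\<^sub>0) c\<^sub>1 c\<^sub>2 []
     \<ominus>\<^bsub>IDR\<^esub> IDR_pure \<one> (c\<^sub>1 \<otimes>\<^bsub>C\<^sub>1\<^esub> \<epsilon>\<^sub>1 (Q f\<^sub>0) (pure [])) c\<^sub>2 []
     \<oplus>\<^bsub>IDR\<^esub> IDR_pure \<one> c\<^sub>1 c\<^sub>2 [f\<^sub>0 \<ominus> deriv (Q f\<^sub>0)]"
| "integ_pure f\<^sub>0 c\<^sub>1 c\<^sub>2 (f\<^sub>1 # f) =
     IDR_pure (Q f\<^sub>0) c\<^sub>1 c\<^sub>2 (f\<^sub>1 # f)
     \<ominus>\<^bsub>IDR\<^esub> IDR_pure \<one> (c\<^sub>1 \<otimes>\<^bsub>C\<^sub>1\<^esub> \<epsilon>\<^sub>1 (Q f\<^sub>0) (pure (f\<^sub>1 # f))) c\<^sub>2 []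
     \<ominus>\<^bsub>IDR\<^esub> integ_pure (Q f\<^sub>0 \<otimes> f\<^sub>1) c\<^sub>1 c\<^sub>2 f
     \<oplus>\<^bsub>IDR\<^esub> IDR_pure \<one> c\<^sub>1 c\<^sub>2 ((f\<^sub>0 \<ominus> deriv (Q f\<^sub>0)) # f\<^sub>1 # f)"

abbreviation IDR_index where
  "IDR_index \<equiv> carrier R \<times> carrier C\<^sub>1 \<times> carrier C\<^sub>2 \<times> W"

definition IDR_deriv where
  "IDR_deriv = linear_ext C IDR IDR IDR_index
     (\<lambda>(f\<^sub>0, c\<^sub>1, c\<^sub>2, f). IDR_pure f\<^sub>0 c\<^sub>1 c\<^sub>2 f) (\<lambda>(f\<^sub>0, c\<^sub>1, c\<^sub>2, f). deriv_pure f\<^sub>0 c\<^sub>1 c\<^sub>2 f)"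

definition IDR_integ where
  "IDR_integ = linear_ext C IDR IDR IDR_index
     (\<lambda>(f\<^sub>0, c\<^sub>1, c\<^sub>2, f). IDR_pure f\<^sub>0 c\<^sub>1 c\<^sub>2 f) (\<lambda>(f\<^sub>0, c\<^sub>1, c\<^sub>2, f). integ_pure f\<^sub>0 c\<^sub>1 c\<^sub>2 f)"

end

end

theory Submission
  imports Defs
begin

text \<open>
  All maps of the construction are fixed by their values on pure tensors.  They exist because
  each module involved is spanned by a family of pure tensors that is universal for
  multilinear families, and this universality passes to tensor products, tensor powers,
  symmetric powers and their direct sums.

  Existence of \<open>\<eta>\<close>: in \<open>S\<close> let \<open>E = id - \<integral> \<circ> \<partial>\<close>, which takes values in the constants and is linear
  over them, and let \<open>I(f\<^sub>1 \<otimes> \<dots> \<otimes> f\<^sub>n) = \<integral> \<phi>(f\<^sub>1) \<integral> \<phi>(f\<^sub>2) \<dots> \<integral> \<phi>(f\<^sub>n)\<close>.  Iterated integration by parts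
  gives the product formula
  \<open>I(f) I(g) = I(sh f g) + \<Sum>\<^sub>i \<Sum>\<^sub>j E(I(f\<^bsub>i+1..n\<^esub>) I(g\<^bsub>j+1..m\<^esub>)) I(sh f\<^bsub>1..i\<^esub> g\<^bsub>1..j\<^esub>)\<close>,
  which mirrors the product of \<open>C\<^sub>2T\<close>.  Applying \<open>E\<close> to \<open>(I(f) I(g)) I(h) = I(f) (I(g) I(h))\<close> yields
  exactly the relations generating \<open>J\<^sub>2\<close>.  Hence \<open>\<epsilon>\<^sub>1 r t \<mapsto> E(\<phi>(r) I(t))\<close> and
  \<open>\<epsilon>\<^sub>2 s t \<mapsto> E(I(s) I(t))\<close> extend to algebra homomorphisms \<open>\<eta>\<^sub>1\<close> and \<open>\<eta>\<^sub>2\<close>, and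
  \<open>\<eta>(f\<^sub>0 \<otimes> c\<^sub>1 \<otimes> c\<^sub>2 \<otimes> f) = \<phi>(f\<^sub>0) \<eta>\<^sub>1(c\<^sub>1) \<eta>\<^sub>2(c\<^sub>2) I(f)\<close>.

  Uniqueness: \<open>IDR\<close> is generated by the image of \<open>R\<close> under addition, multiplication and
  integration, since \<open>1 \<otimes> 1 \<otimes> 1 \<otimes> (x \<otimes> t)\<close> is an integral for \<open>x\<close> in \<open>R\<^sub>T\<close>,
  \<open>\<epsilon>\<^sub>1\<close> can be solved for in the formula for the integration, and the summand for \<open>i = j = 0\<close> of
  the product formula isolates \<open>\<epsilon>\<^sub>2\<close>.
\<close>

section \<open>Linear maps and submodules\<close>

text \<open>The operations of the construction are Hilbert choices, so nothing is known about them
  until some map with the prescribed values has been exhibited. These values are recursive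
  (\<open>shuffle\<close>, \<open>integ_pure\<close>) and cut words at moving positions (the product
  of \<open>C\<^sub>2T\<close>), so the labour lies in their linearity in every single letter;
  \<open>universal\<close> and \<open>linear_condition\<close> turn exactly that into existence.

  The truncated sums in the generators of \<open>J\<^sub>2\<close> are explained by the target ring:
  the missing summand \<open>i = j = 0\<close> would contain \<open>E\<close> of one iterated
  integral of positive length, and \<open>E\<close> annihilates integrals.

  Two kinds of scalars meet in \<open>S\<close>. Constants of \<open>R\<close> act through
  \<open>\<phi>\<close>, which makes \<open>S\<close> an algebra over \<open>C\<close>. The values
  of \<open>E\<close>, however, are arbitrary constants of \<open>S\<close>, and they can be pulled
  out of iterated integrals only because \<open>\<integral>\<close> is linear over all constants of
  \<open>S\<close>, not merely over the image of \<open>C\<close>.\<close>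

lemma linear_mapI:
  assumes "\<And>x. x \<in> carrier M \<Longrightarrow> h x \<in> carrier N"
    and "\<And>x y. x \<in> carrier M \<Longrightarrow> y \<in> carrier M \<Longrightarrow> h (x \<oplus>\<^bsub>M\<^esub> y) = h x \<oplus>\<^bsub>N\<^esub> h y"
    and "\<And>c x. c \<in> carrier C \<Longrightarrow> x \<in> carrier M \<Longrightarrow> h (c \<odot>\<^bsub>M\<^esub> x) = c \<odot>\<^bsub>N\<^esub> h x"
  shows "linear_map C M N h"
  using assms by (auto simp: linear_map_def)

lemma linear_mapD:
  assumes "linear_map C M N h"
  shows "x \<in> carrier M \<Longrightarrow> h x \<in> carrier N"
    and "x \<in> carrier M \<Longrightarrow> y \<in> carrier M \<Longrightarrow> h (x \<oplus>\<^bsub>M\<^esub> y) = h x \<oplus>\<^bsub>N\<^esub> h y"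
    and "c \<in> carrier C \<Longrightarrow> x \<in> carrier M \<Longrightarrow> h (c \<odot>\<^bsub>M\<^esub> x) = c \<odot>\<^bsub>N\<^esub> h x"
  using assms by (auto simp: linear_map_def)

text \<open>\<open>linear_map\<close> constrains a function only on the carrier, and families are
  prescribed only there, so a linear map often has to be traded for another function with the same
  values. \<open>M\<close> has to be a module so that sums and multiples stay where the two
  functions agree.\<close>

lemma linear_map_cong:
  assumes "linear_map C M N h" "module C M" "\<And>x. x \<in> carrier M \<Longrightarrow> h x = k x"
  shows "linear_map C M N k"
proof -
  interpret module C M by fact
  show ?thesis
    by (rule linear_mapI) (simp_all add: assms(3)[symmetric] linear_mapD[OF assms(1)])
qed

lemma linear_map_zero:
  assumes "module C M" "module C N" "linear_map C M N h"
  shows "h \<zero>\<^bsub>M\<^esub> = \<zero>\<^bsub>N\<^esub>"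
proof -
  interpret M: module C M by fact
  interpret N: module C N by fact
  have "h (\<zero>\<^bsub>C\<^esub> \<odot>\<^bsub>M\<^esub> \<zero>\<^bsub>M\<^esub>) = \<zero>\<^bsub>C\<^esub> \<odot>\<^bsub>N\<^esub> h \<zero>\<^bsub>M\<^esub>"
    by (rule linear_mapD(3)[OF assms(3)]) auto
  then show ?thesis using linear_mapD(1)[OF assms(3) M.M.zero_closed] by simp
qed

lemma linear_map_a_inv:
  assumes "module C M" "module C N" "linear_map C M N h" "x \<in> carrier M"
  shows "h (\<ominus>\<^bsub>M\<^esub> x) = \<ominus>\<^bsub>N\<^esub> h x"
proof -
  interpret M: module C M by fact
  interpret N: module C N by fact
  have "h (\<ominus>\<^bsub>M\<^esub> x) \<oplus>\<^bsub>N\<^esub> h x = \<zero>\<^bsub>N\<^esub>"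
    using linear_mapD(2)[OF assms(3), of "\<ominus>\<^bsub>M\<^esub> x" x] assms(4) linear_map_zero[OF assms(1-3)]
    by (simp add: M.M.l_neg)
  then show ?thesis using linear_mapD(1)[OF assms(3)] assms(4)
    by (metis M.M.a_inv_closed N.M.minus_equality)
qed

lemma linear_map_minus:
  assumes "module C M" "module C N" "linear_map C M N h" "x \<in> carrier M" "y \<in> carrier M"
  shows "h (x \<ominus>\<^bsub>M\<^esub> y) = h x \<ominus>\<^bsub>N\<^esub> h y"
proof -
  interpret M: module C M by fact
  show ?thesis unfolding a_minus_def
    using assms linear_map_a_inv[OF assms(1-4)] linear_map_a_inv[OF assms(1-3,5)]
    by (simp add: linear_mapD(2)[OF assms(3)])
qed

lemma linear_map_finsum:
  assumes "module C M" "module C N" "linear_map C M N h"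
    and "finite A" "\<And>i. i \<in> A \<Longrightarrow> f i \<in> carrier M"
  shows "h (finsum M f A) = (\<Oplus>\<^bsub>N\<^esub>i\<in>A. h (f i))"
  using assms(4,5)
proof (induction A)
  case empty
  interpret M: module C M by fact
  interpret N: module C N by fact
  show ?case by (simp add: linear_map_zero[OF assms(1-3)])
next
  case (insert a A)
  interpret M: module C M by fact
  interpret N: module C N by fact
  note h = linear_mapD[OF assms(3)]
  show ?case using insert
    by (simp add: h M.M.finsum_insert N.M.finsum_insert Pi_def)
qed

lemma linear_map_comp:
  assumes "linear_map C M N h" "linear_map C N P k"
  shows "linear_map C M P (\<lambda>x. k (h x))"
  by (rule linear_mapI) (simp_all add: linear_mapD[OF assms(1)] linear_mapD[OF assms(2)])

lemma linear_map_id: "linear_map C M M (\<lambda>x. x)"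
  by (auto simp: linear_map_def)

lemma linear_map_fun_zero:
  assumes "module C N"
  shows "linear_map C M N (\<lambda>x. \<zero>\<^bsub>N\<^esub>)"
proof -
  interpret N: module C N by fact
  show ?thesis by (rule linear_mapI) auto
qed

lemma linear_map_fun_add:
  assumes "module C N" "linear_map C M N h" "linear_map C M N k"
  shows "linear_map C M N (\<lambda>x. h x \<oplus>\<^bsub>N\<^esub> k x)"
proof -
  interpret N: module C N by fact
  note d = linear_mapD[OF assms(2)] linear_mapD[OF assms(3)]
  show ?thesis
    by (rule linear_mapI) (simp_all add: d N.M.a_ac N.smult_r_distr)
qed

lemma linear_map_fun_smult:
  assumes "module C N" "linear_map C M N h" "a \<in> carrier C"
  shows "linear_map C M N (\<lambda>x. a \<odot>\<^bsub>N\<^esub> h x)"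
proof -
  interpret N: module C N by fact
  note d = linear_mapD[OF assms(2)]
  show ?thesis
    using assms(3) by (intro linear_mapI)
      (simp_all add: d N.M.a_ac N.smult_r_distr N.smult_assoc1[symmetric] N.R.m_comm)
qed

lemma linear_map_fun_a_inv:
  assumes "module C N" "linear_map C M N h"
  shows "linear_map C M N (\<lambda>x. \<ominus>\<^bsub>N\<^esub> h x)"
proof -
  interpret N: module C N by fact
  note d = linear_mapD[OF assms(2)]
  show ?thesis
    by (rule linear_mapI) (simp_all add: d N.M.minus_add N.smult_r_minus)
qed

lemma linear_map_fun_minus:
  assumes "module C N" "linear_map C M N h" "linear_map C M N k"
  shows "linear_map C M N (\<lambda>x. h x \<ominus>\<^bsub>N\<^esub> k x)"
  unfolding a_minus_def by (intro linear_map_fun_add linear_map_fun_a_inv assms)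

lemma linear_map_fun_finsum:
  assumes "module C N" "finite A" "\<And>i. i \<in> A \<Longrightarrow> linear_map C M N (h i)"
  shows "linear_map C M N (\<lambda>x. \<Oplus>\<^bsub>N\<^esub>i\<in>A. h i x)"
proof -
  interpret N: module C N by fact
  have d: "i \<in> A \<Longrightarrow> x \<in> carrier M \<Longrightarrow> h i x \<in> carrier N" for i x
    by (simp add: linear_mapD(1)[OF assms(3)])
  show ?thesis
  proof (rule linear_mapI)
    fix x y assume x: "x \<in> carrier M" and y: "y \<in> carrier M"
    have "(\<Oplus>\<^bsub>N\<^esub>i\<in>A. h i (x \<oplus>\<^bsub>M\<^esub> y)) = (\<Oplus>\<^bsub>N\<^esub>i\<in>A. h i x \<oplus>\<^bsub>N\<^esub> h i y)"
      using x y by (intro N.M.finsum_cong') (auto simp: d linear_mapD(2)[OF assms(3)])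
    then show "(\<Oplus>\<^bsub>N\<^esub>i\<in>A. h i (x \<oplus>\<^bsub>M\<^esub> y)) = (\<Oplus>\<^bsub>N\<^esub>i\<in>A. h i x) \<oplus>\<^bsub>N\<^esub> (\<Oplus>\<^bsub>N\<^esub>i\<in>A. h i y)"
      using x y d by (simp add: N.M.finsum_addf Pi_def)
  next
    fix c x assume c: "c \<in> carrier C" and x: "x \<in> carrier M"
    have "(\<Oplus>\<^bsub>N\<^esub>i\<in>A. h i (c \<odot>\<^bsub>M\<^esub> x)) = (\<Oplus>\<^bsub>N\<^esub>i\<in>A. c \<odot>\<^bsub>N\<^esub> h i x)"
      using c x by (intro N.M.finsum_cong') (auto simp: d linear_mapD(3)[OF assms(3)])
    then show "(\<Oplus>\<^bsub>N\<^esub>i\<in>A. h i (c \<odot>\<^bsub>M\<^esub> x)) = c \<odot>\<^bsub>N\<^esub> (\<Oplus>\<^bsub>N\<^esub>i\<in>A. h i x)"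
      using c x d assms(2) by (simp add: N.finsum_smult_ldistr Pi_def)
  qed (use d in auto)
qed

lemma submodule_zero_closed: "submodule H C M \<Longrightarrow> \<zero>\<^bsub>M\<^esub> \<in> H"
  using subgroup.one_closed[OF submodule.axioms(1)] by fastforce

text \<open>Preimages of submodules are the predicates for induction over spanning families: the
  behaviour of spans under linear maps and the vanishing of maps on relations are both reduced to
  generators in this way.\<close>

lemma linear_map_vimage_submodule:
  assumes "module C M" "module C N" "linear_map C M N h" "submodule K C N"
  shows "submodule {x \<in> carrier M. h x \<in> K} C M"
proof -
  interpret M: module C M by fact
  interpret N: module C N by fact
  note K = N.submoduleE[OF assms(4)]
  show ?thesis
    by (rule M.submoduleI)
      (use K in \<open>auto simp: linear_mapD[OF assms(3)] linear_map_zero[OF assms(1-3)]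
        linear_map_a_inv[OF assms(1-3)] submodule_zero_closed[OF assms(4)]\<close>)
qed

lemma zero_submodule:
  assumes "module C M"
  shows "submodule {\<zero>\<^bsub>M\<^esub>} C M"
proof -
  interpret M: module C M by fact
  show ?thesis by (rule M.submoduleI) auto
qed

lemma linear_map_eq_submodule:
  assumes "module C M" "module C N" "linear_map C M N h" "linear_map C M N k"
  shows "submodule {x \<in> carrier M. h x = k x} C M"
proof -
  interpret M: module C M by fact
  interpret N: module C N by fact
  note d = linear_mapD[OF assms(3)] linear_mapD[OF assms(4)]
  show ?thesis
    by (rule M.submoduleI)
      (auto simp: d linear_map_zero[OF assms(1,2)] assms(3,4) linear_map_a_inv[OF assms(1,2)])
qed

lemma submodule_span_subset: "X \<subseteq> submodule_span C M X"
  by (auto simp: submodule_span_def)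

lemma submodule_span_least: "submodule H C M \<Longrightarrow> X \<subseteq> H \<Longrightarrow> submodule_span C M X \<subseteq> H"
  by (auto simp: submodule_span_def)

lemma submodule_span_submodule:
  assumes "module C M" "X \<subseteq> carrier M"
  shows "submodule (submodule_span C M X) C M"
proof -
  interpret M: module C M by fact
  have *: "submodule_span C M X \<subseteq> carrier M"
    by (intro submodule_span_least M.carrier_is_submodule assms)
  show ?thesis
    by (rule M.submoduleI[OF *])
      (auto simp: submodule_span_def M.submoduleE submodule_zero_closed intro: submodule.smult_closed)
qed

lemma span_carrier_induct:
  assumes "submodule_span C M X = carrier M" "submodule H C M" "X \<subseteq> H" "x \<in> carrier M"
  shows "x \<in> H"
  using submodule_span_least[OF assms(2,3)] assms(1,4) by auto

lemma span_carrierI: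
  assumes "module C M" "X \<subseteq> carrier M"
    and "\<And>H. submodule H C M \<Longrightarrow> X \<subseteq> H \<Longrightarrow> carrier M \<subseteq> H"
  shows "submodule_span C M X = carrier M"
proof -
  interpret M: module C M by fact
  show ?thesis
    using submodule_span_least[OF M.carrier_is_submodule assms(2)]
      assms(3)[OF submodule_span_submodule[OF assms(1,2)] submodule_span_subset] by auto
qed

lemma linear_map_eqI:
  assumes "module C M" "module C N" "linear_map C M N h" "linear_map C M N k"
    and "submodule_span C M (e ` I) = carrier M" "\<And>i. i \<in> I \<Longrightarrow> h (e i) = k (e i)" "x \<in> carrier M"
  shows "h x = k x"
proof -
  have "e ` I \<subseteq> carrier M"
    using assms(5) submodule_span_subset by metis
  then show ?thesis
    using span_carrier_induct[OF assms(5) linear_map_eq_submodule[OF assms(1-4)] _ assms(7)] assms(6)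
    by auto
qed

lemma linear_map_span_image:
  assumes "module C M" "module C N" "linear_map C M N h" "submodule_span C M X = carrier M"
    and "submodule K C N" "h ` X \<subseteq> K" "x \<in> carrier M"
  shows "h x \<in> K"
proof -
  have "X \<subseteq> carrier M"
    using assms(4) submodule_span_subset by metis
  then show ?thesis
    using span_carrier_induct[OF assms(4) linear_map_vimage_submodule[OF assms(1-3,5)] _ assms(7)]
      assms(6) by auto
qed

lemma bilinear_mapI:
  assumes "\<And>x. x \<in> carrier M \<Longrightarrow> linear_map C N P (h x)"
    and "\<And>y. y \<in> carrier N \<Longrightarrow> linear_map C M P (\<lambda>x. h x y)"
  shows "bilinear_map C M N P h"
  using assms by (auto simp: bilinear_map_def)

lemma bilinear_mapD:
  assumes "bilinear_map C M N P h"
  shows "x \<in> carrier M \<Longrightarrow> linear_map C N P (h x)"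
    and "y \<in> carrier N \<Longrightarrow> linear_map C M P (\<lambda>x. h x y)"
  using assms by (auto simp: bilinear_map_def)

lemma bilinear_map_closed:
  assumes "bilinear_map C M N P h" "x \<in> carrier M" "y \<in> carrier N"
  shows "h x y \<in> carrier P"
  by (rule linear_mapD(1)[OF bilinear_mapD(1)[OF assms(1,2)] assms(3)])

lemma bilinear_map_comp:
  assumes "bilinear_map C M N P h" "linear_map C K M f" "linear_map C L N g"
  shows "bilinear_map C K L P (\<lambda>x y. h (f x) (g y))"
  using assms by (intro bilinear_mapI linear_map_comp[OF assms(2), where k = "\<lambda>x. h x _"]
    linear_map_comp[OF assms(3)] bilinear_mapD[OF assms(1)] linear_mapD(1)[OF assms(2)]
    linear_mapD(1)[OF assms(3)])

text \<open>Two passes of \<open>linear_map_eqI\<close>: the second argument is freed while the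
  first is still a generator, then the first argument is freed with the second one
  arbitrary.\<close>

lemma bilinear_map_eqI:
  assumes "module C M" "module C N" "module C P"
    and "bilinear_map C M N P h" "bilinear_map C M N P k"
    and "submodule_span C M (e ` I) = carrier M" "submodule_span C N (e' ` J) = carrier N"
    and "\<And>i j. i \<in> I \<Longrightarrow> j \<in> J \<Longrightarrow> h (e i) (e' j) = k (e i) (e' j)"
    and "x \<in> carrier M" "y \<in> carrier N"
  shows "h x y = k x y"
proof -
  have e: "i \<in> I \<Longrightarrow> e i \<in> carrier M" for i
    using assms(6) submodule_span_subset[of "e ` I"] by blast
  have "h (e i) y = k (e i) y" if i: "i \<in> I" for i
    by (rule linear_map_eqI[OF assms(2,3) bilinear_mapD(1)[OF assms(4) e[OF i]]
          bilinear_mapD(1)[OF assms(5) e[OF i]] assms(7) assms(8)[OF i] assms(10)])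
  then show ?thesis
    by (rule linear_map_eqI[OF assms(1,3) bilinear_mapD(2)[OF assms(4,10)]
          bilinear_mapD(2)[OF assms(5,10)] assms(6) _ assms(9)])
qed

text \<open>The module axioms are equations and pass to images. \<open>p\<close> cannot be called
  linear here because \<open>N\<close> is not yet known to be a module, hence the separate
  hypotheses. It serves for the projection to a quotient and, with the identity, for records that
  differ in other fields.\<close>

lemma module_surj_image:
  assumes "module C M" and surj: "carrier N = p ` carrier M"
    and add: "\<And>x y. x \<in> carrier M \<Longrightarrow> y \<in> carrier M \<Longrightarrow> p x \<oplus>\<^bsub>N\<^esub> p y = p (x \<oplus>\<^bsub>M\<^esub> y)"
    and smult: "\<And>c x. c \<in> carrier C \<Longrightarrow> x \<in> carrier M \<Longrightarrow> c \<odot>\<^bsub>N\<^esub> p x = p (c \<odot>\<^bsub>M\<^esub> x)"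
    and zero: "\<zero>\<^bsub>N\<^esub> = p \<zero>\<^bsub>M\<^esub>"
  shows "module C N"
proof -
  interpret M: module C M by fact
  show ?thesis
  proof (rule moduleI[OF M.R.is_cring abelian_groupI])
    fix x assume "x \<in> carrier N"
    then obtain x' where "x' \<in> carrier M" "x = p x'" using surj by auto
    then show "\<exists>y\<in>carrier N. y \<oplus>\<^bsub>N\<^esub> x = \<zero>\<^bsub>N\<^esub>"
      by (intro bexI[of _ "p (\<ominus>\<^bsub>M\<^esub> x')"]) (auto simp: surj add zero M.M.l_neg)
  qed (auto simp: surj add smult zero M.M.a_ac M.smult_l_distr M.smult_r_distr M.smult_assoc1)
qed

text \<open>The algebras are obtained by updating \<open>mult\<close> and \<open>one\<close> in the
  record of a module. This lemma and its companions for linear maps and spans carry facts about the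
  module over to the updated record.\<close>

lemma module_transfer_cong:
  assumes "module C M" "carrier N = carrier M" "ring.zero N = ring.zero M" "ring.add N = ring.add M"
    "module.smult N = module.smult M"
  shows "module C N"
  by (rule module_surj_image[OF assms(1), where p = id]) (simp_all add: assms)

lemma linear_map_transfer_cong:
  assumes "carrier N = carrier M" "ring.add N = ring.add M" "module.smult N = module.smult M"
  shows "linear_map C N = linear_map C M" "linear_map C P N = linear_map C P M"
  unfolding linear_map_def fun_eq_iff using assms by simp_all

lemma submodule_smult_closed:
  assumes "submodule H C M" "c \<in> carrier C" "x \<in> H"
  shows "c \<odot>\<^bsub>M\<^esub> x \<in> H"
  using assms by (rule submodule.smult_closed)

lemma ring_algebra_simps [simp]:
  "carrier (ring_algebra R) = carrier R" "ring.zero (ring_algebra R) = ring.zero R"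
  "ring.add (ring_algebra R) = ring.add R" "monoid.mult (ring_algebra R) = monoid.mult R"
  "monoid.one (ring_algebra R) = monoid.one R" "module.smult (ring_algebra R) = monoid.mult R"
  by (simp_all add: ring_algebra_def)

lemma ring_algebra_module:
  assumes "cring C"
  shows "module C (ring_algebra C)"
proof -
  interpret cring C by fact
  show ?thesis
    by (rule moduleI[OF assms abelian_groupI])
      (auto simp: a_ac l_distr r_distr m_assoc intro: bexI[where x = "\<ominus>\<^bsub>C\<^esub> _"] l_neg)
qed


section \<open>Direct sums, quotients and presentations\<close>

lemma (in abelian_group) minus_eq_zero_iff:
  assumes "x \<in> carrier G" "y \<in> carrier G"
  shows "x \<ominus> y = \<zero> \<longleftrightarrow> x = y"
  using assms minus_equality[of x "\<ominus> y"] by (auto simp: a_minus_def r_neg)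

section \<open>Direct sums of modules\<close>

lemma direct_sum_simps:
  "carrier (direct_sum I M) = {x \<in> \<Pi>\<^sub>E i\<in>I. carrier (M i). finite {i \<in> I. x i \<noteq> \<zero>\<^bsub>M i\<^esub>}}"
  "\<zero>\<^bsub>direct_sum I M\<^esub> = (\<lambda>i\<in>I. \<zero>\<^bsub>M i\<^esub>)"
  "x \<oplus>\<^bsub>direct_sum I M\<^esub> y = (\<lambda>i\<in>I. x i \<oplus>\<^bsub>M i\<^esub> y i)"
  "c \<odot>\<^bsub>direct_sum I M\<^esub> x = (\<lambda>i\<in>I. c \<odot>\<^bsub>M i\<^esub> x i)"
  by (simp_all add: direct_sum_def)

lemma direct_sum_nth_closed:
  "x \<in> carrier (direct_sum I M) \<Longrightarrow> i \<in> I \<Longrightarrow> x i \<in> carrier (M i)"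
  by (auto simp: direct_sum_simps)

context
  fixes C :: "('c, 'm) ring_scheme" and I :: "'i set" and M :: "'i \<Rightarrow> ('c, 'a) module"
  assumes mod: "\<And>i. i \<in> I \<Longrightarrow> module C (M i)" and C: "cring C"
begin

lemma direct_sum_module: "module C (direct_sum I M)"
proof -
  have z: "i \<in> I \<Longrightarrow> \<zero>\<^bsub>M i\<^esub> \<in> carrier (M i)" for i
    using abelian_group.axioms(1)[OF module.axioms(2)[OF mod]] abelian_monoid.zero_closed by blast
  note ac = abelian_monoid.a_closed[OF abelian_group.axioms(1)[OF module.axioms(2)[OF mod]]]
    and aa = abelian_monoid.a_assoc[OF abelian_group.axioms(1)[OF module.axioms(2)[OF mod]]]
    and acm = abelian_monoid.a_comm[OF abelian_group.axioms(1)[OF module.axioms(2)[OF mod]]]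
    and lz = abelian_monoid.l_zero[OF abelian_group.axioms(1)[OF module.axioms(2)[OF mod]]]
    and sc = module.smult_closed[OF mod]
    and ainv = abelian_group.a_inv_closed[OF module.axioms(2)[OF mod]]
    and lneg = abelian_group.l_neg[OF module.axioms(2)[OF mod]]
    and srn = module.smult_r_null[OF mod]
  have mz: "\<ominus>\<^bsub>M i\<^esub> \<zero>\<^bsub>M i\<^esub> = \<zero>\<^bsub>M i\<^esub>" if "i \<in> I" for i
  proof -
    interpret module C "M i" by (rule mod[OF that])
    show ?thesis by simp
  qed
  have fin_add: "finite {i \<in> I. x i \<oplus>\<^bsub>M i\<^esub> y i \<noteq> \<zero>\<^bsub>M i\<^esub>}"
    if "finite {i \<in> I. x i \<noteq> \<zero>\<^bsub>M i\<^esub>}" "finite {i \<in> I. y i \<noteq> \<zero>\<^bsub>M i\<^esub>}" for x y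
    by (rule finite_subset[OF _ finite_UnI[OF that]]) (auto simp: lz z)
  have fin_smult: "finite {i \<in> I. c \<odot>\<^bsub>M i\<^esub> x i \<noteq> \<zero>\<^bsub>M i\<^esub>}"
    if "finite {i \<in> I. x i \<noteq> \<zero>\<^bsub>M i\<^esub>}" "c \<in> carrier C" for x c
    by (rule finite_subset[OF _ that(1)]) (use that(2) in \<open>auto simp: srn\<close>)
  have fin_neg: "finite {i \<in> I. \<ominus>\<^bsub>M i\<^esub> x i \<noteq> \<zero>\<^bsub>M i\<^esub>}"
    if "finite {i \<in> I. x i \<noteq> \<zero>\<^bsub>M i\<^esub>}" for x
    by (rule finite_subset[OF _ that]) (auto simp: mz)
  have cl: "x i \<in> carrier (M i)" if "x \<in> carrier (direct_sum I M)" "i \<in> I" for x i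
    using that by (rule direct_sum_nth_closed)
  have fin: "finite {i \<in> I. x i \<noteq> \<zero>\<^bsub>M i\<^esub>}" if "x \<in> carrier (direct_sum I M)" for x
    using that by (simp add: direct_sum_simps)
  have ext: "x i = undefined" if "x \<in> carrier (direct_sum I M)" "i \<notin> I" for x i
    using that by (auto simp: direct_sum_simps)
  have mem: "restrict f I \<in> carrier (direct_sum I M)"
    if "\<And>i. i \<in> I \<Longrightarrow> f i \<in> carrier (M i)" "finite {i \<in> I. f i \<noteq> \<zero>\<^bsub>M i\<^esub>}" for f
  proof -
    have "{i \<in> I. restrict f I i \<noteq> \<zero>\<^bsub>M i\<^esub>} = {i \<in> I. f i \<noteq> \<zero>\<^bsub>M i\<^esub>}" by auto
    then show ?thesis using that by (auto simp: direct_sum_simps)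
  qed
  show ?thesis
  proof (rule moduleI[OF C abelian_groupI])
    fix x assume x: "x \<in> carrier (direct_sum I M)"
    show "\<exists>y\<in>carrier (direct_sum I M). y \<oplus>\<^bsub>direct_sum I M\<^esub> x = \<zero>\<^bsub>direct_sum I M\<^esub>"
    proof
      show "(\<lambda>i\<in>I. \<ominus>\<^bsub>M i\<^esub> x i) \<in> carrier (direct_sum I M)"
        by (intro mem ainv cl x fin_neg fin)
      show "(\<lambda>i\<in>I. \<ominus>\<^bsub>M i\<^esub> x i) \<oplus>\<^bsub>direct_sum I M\<^esub> x = \<zero>\<^bsub>direct_sum I M\<^esub>"
        using cl[OF x] lneg by (auto simp: direct_sum_simps(2-4) fun_eq_iff)
    qed
  next
    fix x assume x: "x \<in> carrier (direct_sum I M)"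
    show "\<zero>\<^bsub>direct_sum I M\<^esub> \<oplus>\<^bsub>direct_sum I M\<^esub> x = x"
      using cl[OF x] ext[OF x] lz by (auto simp: direct_sum_simps(2-4) fun_eq_iff)
    show "\<one>\<^bsub>C\<^esub> \<odot>\<^bsub>direct_sum I M\<^esub> x = x"
      using cl[OF x] ext[OF x] module.smult_one[OF mod] by (auto simp: direct_sum_simps(2-4) fun_eq_iff)
  next
    fix x y assume "x \<in> carrier (direct_sum I M)" "y \<in> carrier (direct_sum I M)"
    then show "x \<oplus>\<^bsub>direct_sum I M\<^esub> y = y \<oplus>\<^bsub>direct_sum I M\<^esub> x"
      using cl acm by (auto simp: direct_sum_simps(3) fun_eq_iff)
  qed (auto simp: direct_sum_simps(2-4) fun_eq_iff cl aa ac sc mem fin fin_add fin_smult z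
      module.smult_l_distr[OF mod] module.smult_r_distr[OF mod] module.smult_assoc1[OF mod]
      intro!: mem)
qed

lemma direct_sum_incl_linear:
  assumes "i \<in> I"
  shows "linear_map C (M i) (direct_sum I M) (direct_sum_incl I M i)"
proof -
  have z: "j \<in> I \<Longrightarrow> \<zero>\<^bsub>M j\<^esub> \<in> carrier (M j)" for j
    using abelian_group.axioms(1)[OF module.axioms(2)[OF mod]] abelian_monoid.zero_closed by blast
  note lz = abelian_monoid.l_zero[OF abelian_group.axioms(1)[OF module.axioms(2)[OF mod]]]
    and srn = module.smult_r_null[OF mod]
  have "finite {j \<in> I. (if j = i then x else \<zero>\<^bsub>M j\<^esub>) \<noteq> \<zero>\<^bsub>M j\<^esub>}" for x
    by (rule finite_subset[of _ "{i}"]) auto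
  moreover have "{j \<in> I. direct_sum_incl I M i x j \<noteq> \<zero>\<^bsub>M j\<^esub>} =
      {j \<in> I. (if j = i then x else \<zero>\<^bsub>M j\<^esub>) \<noteq> \<zero>\<^bsub>M j\<^esub>}" for x
    by (auto simp: direct_sum_incl_def)
  ultimately show ?thesis
    by (intro linear_mapI)
      (auto simp: direct_sum_simps direct_sum_incl_def fun_eq_iff z lz srn PiE_iff)
qed

text \<open>Induction on a finite set containing the support: resetting one coordinate to zero
  leaves an element supported on a smaller set, and the removed coordinate lies in a single
  summand.\<close>

lemma direct_sum_induct:
  assumes H: "submodule H C (direct_sum I M)"
    and incl: "\<And>i x. i \<in> I \<Longrightarrow> x \<in> carrier (M i) \<Longrightarrow> direct_sum_incl I M i x \<in> H"
    and x: "x \<in> carrier (direct_sum I M)"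
  shows "x \<in> H"
proof -
  interpret D: module C "direct_sum I M" by (rule direct_sum_module)
  have z: "j \<in> I \<Longrightarrow> \<zero>\<^bsub>M j\<^esub> \<in> carrier (M j)" for j
    using abelian_group.axioms(1)[OF module.axioms(2)[OF mod]] abelian_monoid.zero_closed by blast
  note lz = abelian_monoid.l_zero[OF abelian_group.axioms(1)[OF module.axioms(2)[OF mod]]]
    and rz = abelian_monoid.r_zero[OF abelian_group.axioms(1)[OF module.axioms(2)[OF mod]]]
  have "\<forall>x\<in>carrier (direct_sum I M). {i \<in> I. x i \<noteq> \<zero>\<^bsub>M i\<^esub>} \<subseteq> A \<longrightarrow> x \<in> H"
    if "finite A" for A
    using that
  proof (induction A)
    case empty
    have "x = \<zero>\<^bsub>direct_sum I M\<^esub>" if "x \<in> carrier (direct_sum I M)" "{i \<in> I. x i \<noteq> \<zero>\<^bsub>M i\<^esub>} \<subseteq> {}" for x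
    proof
      fix i show "x i = \<zero>\<^bsub>direct_sum I M\<^esub> i"
        using that by (cases "i \<in> I") (auto simp: direct_sum_simps)
    qed
    then show ?case using submodule_zero_closed[OF H] by auto
  next
    case (insert a A)
    show ?case
    proof (intro ballI impI)
      fix x assume x: "x \<in> carrier (direct_sum I M)" and s: "{i \<in> I. x i \<noteq> \<zero>\<^bsub>M i\<^esub>} \<subseteq> insert a A"
      show "x \<in> H"
      proof (cases "a \<in> I")
        case False
        then show ?thesis using insert.IH x s by auto
      next
        case True
        let ?y = "x(a := \<zero>\<^bsub>M a\<^esub>)"
        have "{i \<in> I. ?y i \<noteq> \<zero>\<^bsub>M i\<^esub>} \<subseteq> {i \<in> I. x i \<noteq> \<zero>\<^bsub>M i\<^esub>}" by auto
        then have "finite {i \<in> I. ?y i \<noteq> \<zero>\<^bsub>M i\<^esub>}"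
          by (rule finite_subset) (use x in \<open>simp add: direct_sum_simps\<close>)
        moreover have "?y \<in> (\<Pi>\<^sub>E i\<in>I. carrier (M i))"
          using x z True by (auto simp: direct_sum_simps PiE_iff extensional_def)
        ultimately have y: "?y \<in> carrier (direct_sum I M)"
          by (simp only: direct_sum_simps mem_Collect_eq)
        moreover have "{i \<in> I. ?y i \<noteq> \<zero>\<^bsub>M i\<^esub>} \<subseteq> A" using s by auto
        ultimately have "?y \<in> H" using insert.IH by blast
        have "direct_sum_incl I M a (x a) \<in> H"
          by (intro incl True direct_sum_nth_closed[OF x])
        have "x = direct_sum_incl I M a (x a) \<oplus>\<^bsub>direct_sum I M\<^esub> ?y"
        proof
          fix i
          consider "i = a" | "i \<in> I" "i \<noteq> a" | "i \<notin> I" by blast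
          then show "x i = (direct_sum_incl I M a (x a) \<oplus>\<^bsub>direct_sum I M\<^esub> ?y) i"
          proof cases
            case 1
            then show ?thesis
              using True rz[OF True direct_sum_nth_closed[OF x True]]
              by (simp add: direct_sum_simps(3) direct_sum_incl_def)
          next
            case 2
            then show ?thesis
              using lz[OF 2(1) direct_sum_nth_closed[OF x 2(1)]]
              by (simp add: direct_sum_simps(3) direct_sum_incl_def)
          next
            case 3
            have "x \<in> (\<Pi>\<^sub>E i\<in>I. carrier (M i))" using x by (simp add: direct_sum_simps(1))
            from PiE_arb[OF this 3] 3 show ?thesis
              by (simp add: direct_sum_simps(3))
          qed
        qed
        note eq = this
        have "direct_sum_incl I M a (x a) \<oplus>\<^bsub>direct_sum I M\<^esub> ?y \<in> H"
          by (rule D.submoduleE(5)[OF H]) fact+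
        then show ?thesis by (simp only: eq[symmetric])
      qed
    qed
  qed
  moreover have "finite {i \<in> I. x i \<noteq> \<zero>\<^bsub>M i\<^esub>}" using x by (simp add: direct_sum_simps(1))
  ultimately show ?thesis using x by blast
qed

lemma direct_sum_extend:
  assumes N: "module C N" and g: "\<And>i. i \<in> I \<Longrightarrow> linear_map C (M i) N (g i)"
  obtains h where "linear_map C (direct_sum I M) N h"
    "\<And>i x. i \<in> I \<Longrightarrow> x \<in> carrier (M i) \<Longrightarrow> h (direct_sum_incl I M i x) = g i x"
proof -
  interpret N: module C N by fact
  interpret D: module C "direct_sum I M" by (rule direct_sum_module)
  define h where "h x = (\<Oplus>\<^bsub>N\<^esub>i\<in>{i \<in> I. x i \<noteq> \<zero>\<^bsub>M i\<^esub>}. g i (x i))" for x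
  have gz: "i \<in> I \<Longrightarrow> g i \<zero>\<^bsub>M i\<^esub> = \<zero>\<^bsub>N\<^esub>" for i
    by (rule linear_map_zero[OF mod N g])
  note gd = linear_mapD[OF g]
  have cl: "x i \<in> carrier (M i)" if "x \<in> carrier (direct_sum I M)" "i \<in> I" for x i
    using that by (rule direct_sum_nth_closed)
  have fin: "finite {i \<in> I. x i \<noteq> \<zero>\<^bsub>M i\<^esub>}" if "x \<in> carrier (direct_sum I M)" for x
    using that by (simp add: direct_sum_simps)
  \<comment> \<open>The support depends on \<open>x\<close>, so for additivity the sums for
    \<open>x\<close>, \<open>y\<close> and their sum have to be compared over one finite set; the
    indices added contribute images of zero.\<close>
  have h_eq: "h x = (\<Oplus>\<^bsub>N\<^esub>i\<in>A. g i (x i))"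
    if "x \<in> carrier (direct_sum I M)" "finite A" "{i \<in> I. x i \<noteq> \<zero>\<^bsub>M i\<^esub>} \<subseteq> A" "A \<subseteq> I" for x A
    unfolding h_def using that gz cl gd(1)
    by (intro N.M.add.finprod_mono_neutral_cong_left) (auto simp: subset_iff)
  have "linear_map C (direct_sum I M) N h"
  proof (rule linear_mapI)
    fix x assume x: "x \<in> carrier (direct_sum I M)"
    then show "h x \<in> carrier N"
      unfolding h_def using cl gd(1) by (intro N.M.finsum_closed) auto
    fix y assume y: "y \<in> carrier (direct_sum I M)"
    let ?A = "{i \<in> I. x i \<noteq> \<zero>\<^bsub>M i\<^esub>} \<union> {i \<in> I. y i \<noteq> \<zero>\<^bsub>M i\<^esub>}"
    have "h (x \<oplus>\<^bsub>direct_sum I M\<^esub> y) = (\<Oplus>\<^bsub>N\<^esub>i\<in>?A. g i ((x \<oplus>\<^bsub>direct_sum I M\<^esub> y) i))"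
      by (rule h_eq[OF D.M.a_closed[OF x y]]) (use x y fin abelian_monoid.l_zero[OF abelian_group.axioms(1)[OF module.axioms(2)[OF mod]]]
        abelian_monoid.zero_closed[OF abelian_group.axioms(1)[OF module.axioms(2)[OF mod]]]
        in \<open>auto simp: direct_sum_simps(3)\<close>)
    also have "\<dots> = (\<Oplus>\<^bsub>N\<^esub>i\<in>?A. g i (x i) \<oplus>\<^bsub>N\<^esub> g i (y i))"
      using x y cl gd(1,2) by (intro N.M.finsum_cong') (auto simp: direct_sum_simps(3))
    also have "\<dots> = (\<Oplus>\<^bsub>N\<^esub>i\<in>?A. g i (x i)) \<oplus>\<^bsub>N\<^esub> (\<Oplus>\<^bsub>N\<^esub>i\<in>?A. g i (y i))"
      using x y cl gd(1) by (intro N.M.finsum_addf) auto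
    also have "\<dots> = h x \<oplus>\<^bsub>N\<^esub> h y"
      using h_eq[OF x, of ?A] h_eq[OF y, of ?A] fin x y by simp
    finally show "h (x \<oplus>\<^bsub>direct_sum I M\<^esub> y) = h x \<oplus>\<^bsub>N\<^esub> h y" .
  next
    fix c x assume c: "c \<in> carrier C" and x: "x \<in> carrier (direct_sum I M)"
    let ?A = "{i \<in> I. x i \<noteq> \<zero>\<^bsub>M i\<^esub>}"
    have "h (c \<odot>\<^bsub>direct_sum I M\<^esub> x) = (\<Oplus>\<^bsub>N\<^esub>i\<in>?A. g i ((c \<odot>\<^bsub>direct_sum I M\<^esub> x) i))"
      by (rule h_eq[OF D.smult_closed[OF c x]]) (use x c fin module.smult_r_null[OF mod] in \<open>auto simp: direct_sum_simps(4)\<close>)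
    also have "\<dots> = (\<Oplus>\<^bsub>N\<^esub>i\<in>?A. c \<odot>\<^bsub>N\<^esub> g i (x i))"
      using x c cl gd by (intro N.M.finsum_cong') (auto simp: direct_sum_simps(4))
    also have "\<dots> = c \<odot>\<^bsub>N\<^esub> h x"
      unfolding h_def using x c fin cl gd(1) by (intro N.finsum_smult_ldistr[symmetric]) auto
    finally show "h (c \<odot>\<^bsub>direct_sum I M\<^esub> x) = c \<odot>\<^bsub>N\<^esub> h x" .
  qed
  moreover have "h (direct_sum_incl I M i x) = g i x" if "i \<in> I" "x \<in> carrier (M i)" for i x
  proof -
    have "h (direct_sum_incl I M i x) = (\<Oplus>\<^bsub>N\<^esub>j\<in>{i}. g j (direct_sum_incl I M i x j))"
      using that by (intro h_eq linear_mapD(1)[OF direct_sum_incl_linear])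
        (auto simp: direct_sum_incl_def split: if_splits)
    then show ?thesis using that gd(1) by (simp add: direct_sum_incl_def)
  qed
  ultimately show thesis by (rule that)
qed

end

section \<open>Free modules\<close>

context
  fixes C :: "('c, 'm) ring_scheme" and X :: "'x set"
  assumes C: "cring C"
begin

lemma free_module_module: "module C (free_module C X)"
  unfolding free_module_def by (intro direct_sum_module ring_algebra_module C)

lemma free_gen_closed: "x \<in> X \<Longrightarrow> free_gen C X x \<in> carrier (free_module C X)"
proof -
  interpret cring C by (rule C)
  show "x \<in> X \<Longrightarrow> ?thesis"
    unfolding free_module_def free_gen_def
    by (rule linear_mapD(1)[OF direct_sum_incl_linear[OF ring_algebra_module C]]) (auto simp: C)
qed

lemma free_module_span: "submodule_span C (free_module C X) (free_gen C X ` X) = carrier (free_module C X)"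
proof (rule span_carrierI[OF free_module_module])
  interpret cring C by (rule C)
  show "free_gen C X ` X \<subseteq> carrier (free_module C X)"
    using free_gen_closed by auto
  fix H assume H: "submodule H C (free_module C X)" "free_gen C X ` X \<subseteq> H"
  have "direct_sum_incl X (\<lambda>_. ring_algebra C) x c \<in> H" if "x \<in> X" "c \<in> carrier C" for x c
  proof -
    have "c \<odot>\<^bsub>free_module C X\<^esub> free_gen C X x \<in> H"
      using H that by (auto intro: submodule_smult_closed)
    moreover have "linear_map C (ring_algebra C) (free_module C X) (direct_sum_incl X (\<lambda>_. ring_algebra C) x)"
      unfolding free_module_def
      by (rule direct_sum_incl_linear[OF ring_algebra_module C]) (auto simp: C that)
    from linear_mapD(3)[OF this, of c "\<one>\<^bsub>C\<^esub>"] have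
      "c \<odot>\<^bsub>free_module C X\<^esub> free_gen C X x = direct_sum_incl X (\<lambda>_. ring_algebra C) x c"
      using that by (simp add: free_gen_def)
    ultimately show ?thesis by simp
  qed
  note incl = this
  have "x \<in> H" if "x \<in> carrier (free_module C X)" for x
    using H(1) incl that unfolding free_module_def ring_algebra_simps(1)[symmetric, of C]
    by (rule direct_sum_induct[OF ring_algebra_module[OF C] C])
  then show "carrier (free_module C X) \<subseteq> H"
    by blast
qed

lemma free_module_extend:
  assumes N: "module C N" and f: "f \<in> X \<rightarrow> carrier N"
  obtains h where "linear_map C (free_module C X) N h" "\<And>x. x \<in> X \<Longrightarrow> h (free_gen C X x) = f x"
proof -
  interpret N: module C N by (rule N)
  have "linear_map C (ring_algebra C) N (\<lambda>c. c \<odot>\<^bsub>N\<^esub> f x)" if "x \<in> X" for x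
    using funcset_mem[OF f that] by (intro linear_mapI) (simp_all add: N.smult_l_distr N.smult_assoc1)
  then obtain h where h: "linear_map C (direct_sum X (\<lambda>_. ring_algebra C)) N h"
    "\<And>x c. x \<in> X \<Longrightarrow> c \<in> carrier (ring_algebra C) \<Longrightarrow> h (direct_sum_incl X (\<lambda>_. ring_algebra C) x c) = c \<odot>\<^bsub>N\<^esub> f x"
    using direct_sum_extend[OF ring_algebra_module[OF C] C N, of X "\<lambda>x c. c \<odot>\<^bsub>N\<^esub> f x"] by blast
  show thesis
    using h funcset_mem[OF f] by (intro that[of h]) (simp_all add: free_module_def free_gen_def)
qed

end

section \<open>Quotient modules\<close>

lemma quotient_module_simps:
  "carrier (quotient_module M H) = a_rcosets\<^bsub>M\<^esub> H"
  "\<zero>\<^bsub>quotient_module M H\<^esub> = H"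
  "ring.add (quotient_module M H) = set_add M"
  "monoid.mult (quotient_module M H) = rcoset_mult M H"
  "\<one>\<^bsub>quotient_module M H\<^esub> = H +>\<^bsub>M\<^esub> \<one>\<^bsub>M\<^esub>"
  "c \<odot>\<^bsub>quotient_module M H\<^esub> X = (\<Union>x\<in>X. H +>\<^bsub>M\<^esub> (c \<odot>\<^bsub>M\<^esub> x))"
  by (simp_all add: quotient_module_def ring.extend_def module.fields_def FactRing_def)

context
  fixes C :: "('c, 'm) ring_scheme" and M :: "('c, 'a) module" and H :: "'a set"
  assumes mod: "module C M" and H: "submodule H C M"
begin

interpretation M: module C M by (rule mod)

interpretation H: abelian_subgroup H M
  by (intro abelian_subgroupI3 additive_subgroup.intro submodule.axioms(1)[OF H] M.M.abelian_group_axioms)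

lemma quotient_carrier: "carrier (quotient_module M H) = (\<lambda>x. H +>\<^bsub>M\<^esub> x) ` carrier M"
  by (auto simp: quotient_module_simps A_RCOSETS_def')

lemma quotient_eq_iff:
  assumes "x \<in> carrier M" "y \<in> carrier M"
  shows "H +>\<^bsub>M\<^esub> x = H +>\<^bsub>M\<^esub> y \<longleftrightarrow> x \<ominus>\<^bsub>M\<^esub> y \<in> H"
proof
  assume "H +>\<^bsub>M\<^esub> x = H +>\<^bsub>M\<^esub> y"
  then have "x \<in> H +>\<^bsub>M\<^esub> y"
    using H.a_rcos_self[OF assms(1)] by simp
  then show "x \<ominus>\<^bsub>M\<^esub> y \<in> H"
    unfolding a_minus_def by (rule H.a_rcos_module_imp[OF assms(2)])
next
  assume "x \<ominus>\<^bsub>M\<^esub> y \<in> H"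
  then have "x \<in> H +>\<^bsub>M\<^esub> y"
    unfolding a_minus_def by (rule H.a_rcos_module_rev[OF assms(2,1)])
  then show "H +>\<^bsub>M\<^esub> x = H +>\<^bsub>M\<^esub> y"
    using H.a_repr_independence'[OF _ assms(2)] by simp
qed

lemma quotient_add:
  "x \<in> carrier M \<Longrightarrow> y \<in> carrier M \<Longrightarrow>
    (H +>\<^bsub>M\<^esub> x) \<oplus>\<^bsub>quotient_module M H\<^esub> (H +>\<^bsub>M\<^esub> y) = H +>\<^bsub>M\<^esub> (x \<oplus>\<^bsub>M\<^esub> y)"
  by (simp add: quotient_module_simps H.a_rcos_sum)

text \<open>The scalar multiplication of the quotient is a union over all representatives. Two
  representatives differ by an element of \<open>H\<close>, and \<open>H\<close> is closed under
  scalars, so all cosets in the union coincide; the union is over a nonempty set because a coset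
  contains its representative.\<close>

lemma quotient_smult:
  assumes "c \<in> carrier C" "x \<in> carrier M"
  shows "c \<odot>\<^bsub>quotient_module M H\<^esub> (H +>\<^bsub>M\<^esub> x) = H +>\<^bsub>M\<^esub> (c \<odot>\<^bsub>M\<^esub> x)"
proof -
  have "H +>\<^bsub>M\<^esub> (c \<odot>\<^bsub>M\<^esub> y) = H +>\<^bsub>M\<^esub> (c \<odot>\<^bsub>M\<^esub> x)" if "y \<in> H +>\<^bsub>M\<^esub> x" for y
  proof -
    have y: "y \<in> carrier M"
      using H.a_elemrcos_carrier[OF assms(2) that] .
    have "y \<ominus>\<^bsub>M\<^esub> x \<in> H"
      unfolding a_minus_def using that by (rule H.a_rcos_module_imp[OF assms(2)])
    then have "c \<odot>\<^bsub>M\<^esub> (y \<ominus>\<^bsub>M\<^esub> x) \<in> H"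
      by (rule submodule_smult_closed[OF H assms(1)])
    then show ?thesis
      using y assms
      by (simp add: quotient_eq_iff a_minus_def M.smult_r_distr M.smult_r_minus)
  qed
  moreover have "H +>\<^bsub>M\<^esub> x \<noteq> {}"
    using H.a_rcos_self[OF assms(2)] by blast
  ultimately show ?thesis
    unfolding quotient_module_simps by (intro SUP_eq_const) auto
qed

lemma quotient_module_module: "module C (quotient_module M H)"
proof (rule module_surj_image[OF mod quotient_carrier])
  show "\<zero>\<^bsub>quotient_module M H\<^esub> = H +>\<^bsub>M\<^esub> \<zero>\<^bsub>M\<^esub>"
    using H.a_rcos_const[OF H.zero_closed] by (simp add: quotient_module_simps(2))
qed (simp_all add: quotient_add quotient_smult)

lemma quotient_proj_linear: "linear_map C M (quotient_module M H) (\<lambda>x. H +>\<^bsub>M\<^esub> x)"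
  by (rule linear_mapI) (simp_all add: quotient_add quotient_smult quotient_carrier)

lemma quotient_extend:
  assumes N: "module C N" and h: "linear_map C M N h" and z: "\<And>x. x \<in> H \<Longrightarrow> h x = \<zero>\<^bsub>N\<^esub>"
  obtains k where "linear_map C (quotient_module M H) N k"
    "\<And>x. x \<in> carrier M \<Longrightarrow> k (H +>\<^bsub>M\<^esub> x) = h x"
proof -
  interpret N: module C N by (rule N)
  define k where "k X = h (SOME x. x \<in> carrier M \<and> X = H +>\<^bsub>M\<^esub> x)" for X
  have k: "k (H +>\<^bsub>M\<^esub> x) = h x" if x: "x \<in> carrier M" for x
  proof -
    define y where "y = (SOME y. y \<in> carrier M \<and> H +>\<^bsub>M\<^esub> x = H +>\<^bsub>M\<^esub> y)"
    have y: "y \<in> carrier M \<and> H +>\<^bsub>M\<^esub> x = H +>\<^bsub>M\<^esub> y"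
      unfolding y_def by (rule someI[of _ x]) (simp add: x)
    then have "x \<ominus>\<^bsub>M\<^esub> y \<in> H" using quotient_eq_iff x by blast
    then have "h x \<ominus>\<^bsub>N\<^esub> h y = \<zero>\<^bsub>N\<^esub>"
      using z linear_map_minus[OF mod N h x] y by force
    then have "h x = h y"
      using x y linear_mapD(1)[OF h] N.M.minus_eq_zero_iff by blast
    then show ?thesis by (simp add: k_def y_def)
  qed
  show thesis
  proof (rule that[of k])
    show "linear_map C (quotient_module M H) N k"
      by (rule linear_mapI)
        (auto simp: quotient_carrier quotient_add quotient_smult k linear_mapD[OF h])
  qed (rule k)
qed

end

section \<open>Presentations by generators and relations, the common form of tensor products, tensor
  powers and symmetric powers\<close>

definition presented :: "('c, 'm) ring_scheme \<Rightarrow> 'x set \<Rightarrow> ('x \<Rightarrow> 'c) set \<Rightarrow> ('c, ('x \<Rightarrow> 'c) set) module" where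
  "presented C X K = quotient_module (free_module C X) (submodule_span C (free_module C X) K)"

definition presented_gen :: "('c, 'm) ring_scheme \<Rightarrow> 'x set \<Rightarrow> ('x \<Rightarrow> 'c) set \<Rightarrow> 'x \<Rightarrow> ('x \<Rightarrow> 'c) set" where
  "presented_gen C X K x = submodule_span C (free_module C X) K +>\<^bsub>free_module C X\<^esub> free_gen C X x"

context
  fixes C :: "('c, 'm) ring_scheme" and X :: "'x set" and K :: "('x \<Rightarrow> 'c) set"
  assumes C: "cring C" and K: "K \<subseteq> carrier (free_module C X)"
begin

private abbreviation "F \<equiv> free_module C X"

interpretation F: module C F by (rule free_module_module[OF C])

private lemma sub: "submodule (submodule_span C F K) C F"
  by (rule submodule_span_submodule[OF F.module_axioms K])

lemma presented_module: "module C (presented C X K)"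
  unfolding presented_def by (rule quotient_module_module[OF F.module_axioms sub])

lemma presented_proj_linear:
  "linear_map C F (presented C X K) (\<lambda>x. submodule_span C F K +>\<^bsub>F\<^esub> x)"
  unfolding presented_def by (rule quotient_proj_linear[OF F.module_axioms sub])

lemma presented_gen_closed: "x \<in> X \<Longrightarrow> presented_gen C X K x \<in> carrier (presented C X K)"
  unfolding presented_gen_def
  by (rule linear_mapD(1)[OF presented_proj_linear free_gen_closed[OF C]])

lemma presented_span:
  "submodule_span C (presented C X K) (presented_gen C X K ` X) = carrier (presented C X K)"
proof (rule span_carrierI[OF presented_module])
  show "presented_gen C X K ` X \<subseteq> carrier (presented C X K)"
    using presented_gen_closed by auto
  fix H assume H: "submodule H C (presented C X K)" "presented_gen C X K ` X \<subseteq> H"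
  have "submodule_span C F K +>\<^bsub>F\<^esub> y \<in> H" if "y \<in> carrier F" for y
    by (rule linear_map_span_image[OF F.module_axioms presented_module presented_proj_linear
          free_module_span[OF C] H(1) _ that])
      (use H(2) in \<open>auto simp: presented_gen_def\<close>)
  then show "carrier (presented C X K) \<subseteq> H"
    unfolding presented_def using quotient_carrier[OF F.module_axioms sub] by auto
qed

lemma presented_rel_zero:
  assumes "r \<in> K"
  shows "submodule_span C F K +>\<^bsub>F\<^esub> r = \<zero>\<^bsub>presented C X K\<^esub>"
proof -
  have r: "r \<in> submodule_span C F K" "r \<in> carrier F"
    using assms K submodule_span_subset[of K C F] by blast+
  have "r \<ominus>\<^bsub>F\<^esub> \<zero>\<^bsub>F\<^esub> = r"
    using r(2) by (simp add: a_minus_def)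
  then have "submodule_span C F K +>\<^bsub>F\<^esub> r = submodule_span C F K +>\<^bsub>F\<^esub> \<zero>\<^bsub>F\<^esub>"
    using r by (intro iffD2[OF quotient_eq_iff[OF F.module_axioms sub]]) simp_all
  also have "\<dots> = \<zero>\<^bsub>presented C X K\<^esub>"
    by (rule linear_map_zero[OF F.module_axioms presented_module presented_proj_linear])
  finally show ?thesis .
qed

text \<open>The map \<open>h\<close> on the free module is produced inside the proof, so hypothesis
  \<open>z\<close> quantifies over all linear maps with the prescribed values on generators: the
  vanishing on relations has to follow from those values alone. It is required on the generating set
  \<open>K\<close> only, since the kernel is a submodule.\<close>

lemma presented_extend:
  assumes N: "module C N" and f: "f \<in> X \<rightarrow> carrier N"
    and z: "\<And>h r. linear_map C F N h \<Longrightarrow> (\<And>x. x \<in> X \<Longrightarrow> h (free_gen C X x) = f x) \<Longrightarrow> r \<in> K \<Longrightarrow> h r = \<zero>\<^bsub>N\<^esub>"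
  obtains k where "linear_map C (presented C X K) N k"
    "\<And>x. x \<in> X \<Longrightarrow> k (presented_gen C X K x) = f x"
proof -
  obtain h where h: "linear_map C F N h" "\<And>x. x \<in> X \<Longrightarrow> h (free_gen C X x) = f x"
    using free_module_extend[OF C N f] by blast
  have "submodule {x \<in> carrier F. h x \<in> {\<zero>\<^bsub>N\<^esub>}} C F"
    by (intro linear_map_vimage_submodule[OF F.module_axioms N h(1)] zero_submodule N)
  then have "submodule_span C F K \<subseteq> {x \<in> carrier F. h x \<in> {\<zero>\<^bsub>N\<^esub>}}"
    by (rule submodule_span_least) (use K z h in auto)
  then obtain k where k: "linear_map C (presented C X K) N k"
    "\<And>x. x \<in> carrier F \<Longrightarrow> k (submodule_span C F K +>\<^bsub>F\<^esub> x) = h x"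
    unfolding presented_def using quotient_extend[OF F.module_axioms sub N h(1)] by blast
  show thesis
    by (rule that[OF k(1)]) (simp add: presented_gen_def k(2) h(2) free_gen_closed[OF C])
qed

text \<open>\<open>s\<close> is a slot: it inserts an element of \<open>L\<close> into an otherwise
  fixed generator index. The relations in \<open>linearity_rels\<close> are differences of the two
  sides of the linearity laws, so they become these laws in the quotient.\<close>

lemma presented_gen_linear:
  assumes L: "module C L" and s: "s \<in> carrier L \<rightarrow> X"
    and r: "linearity_rels C L F (\<lambda>x. free_gen C X (s x)) \<subseteq> K"
  shows "linear_map C L (presented C X K) (\<lambda>x. presented_gen C X K (s x))"
proof -
  interpret L: module C L by (rule L)
  interpret P: module C "presented C X K" by (rule presented_module)
  note p = linear_mapD[OF presented_proj_linear]
  let ?p = "\<lambda>x. submodule_span C F K +>\<^bsub>F\<^esub> x"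
  have g: "x \<in> carrier L \<Longrightarrow> free_gen C X (s x) \<in> carrier F" for x
    using s by (auto intro: free_gen_closed[OF C])
  have eq: "?p a = ?p b" if "a \<ominus>\<^bsub>F\<^esub> b \<in> K" "a \<in> carrier F" "b \<in> carrier F" for a b
  proof -
    have "?p a \<ominus>\<^bsub>presented C X K\<^esub> ?p b = \<zero>\<^bsub>presented C X K\<^esub>"
      using presented_rel_zero[OF that(1)]
        linear_map_minus[OF F.module_axioms presented_module presented_proj_linear that(2,3)] by simp
    then show ?thesis using p(1)[OF that(2)] p(1)[OF that(3)] P.M.minus_eq_zero_iff by blast
  qed
  show ?thesis
  proof (rule linear_mapI)
    show "presented_gen C X K (s x) \<in> carrier (presented C X K)" if "x \<in> carrier L" for x
      using s that by (auto intro: presented_gen_closed)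
    fix x y assume x: "x \<in> carrier L" and y: "y \<in> carrier L"
    have "free_gen C X (s (x \<oplus>\<^bsub>L\<^esub> y)) \<ominus>\<^bsub>F\<^esub> (free_gen C X (s x) \<oplus>\<^bsub>F\<^esub> free_gen C X (s y)) \<in> K"
      using r x y unfolding linearity_rels_def by blast
    from eq[OF this] show "presented_gen C X K (s (x \<oplus>\<^bsub>L\<^esub> y)) =
        presented_gen C X K (s x) \<oplus>\<^bsub>presented C X K\<^esub> presented_gen C X K (s y)"
      using x y by (simp add: presented_gen_def g p)
  next
    fix c x assume c: "c \<in> carrier C" and x: "x \<in> carrier L"
    have "free_gen C X (s (c \<odot>\<^bsub>L\<^esub> x)) \<ominus>\<^bsub>F\<^esub> (c \<odot>\<^bsub>F\<^esub> free_gen C X (s x)) \<in> K"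
      using r x c unfolding linearity_rels_def by blast
    from eq[OF this] show "presented_gen C X K (s (c \<odot>\<^bsub>L\<^esub> x)) =
        c \<odot>\<^bsub>presented C X K\<^esub> presented_gen C X K (s x)"
      using x c by (simp add: presented_gen_def g p)
  qed
qed

end

lemma linearity_rels_closed:
  assumes "module C F" "module C L" "s \<in> carrier L \<rightarrow> carrier F"
  shows "linearity_rels C L F s \<subseteq> carrier F"
proof -
  interpret F: module C F by fact
  interpret L: module C L by fact
  show ?thesis using assms(3) by (auto simp: linearity_rels_def Pi_iff)
qed

lemma linearity_rels_vanish:
  assumes "module C F" "module C L" "module C N" "linear_map C F N h" "s \<in> carrier L \<rightarrow> carrier F"
    and "linear_map C L N (\<lambda>x. h (s x))" "r \<in> linearity_rels C L F s"
  shows "h r = \<zero>\<^bsub>N\<^esub>"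
proof -
  interpret F: module C F by fact
  interpret L: module C L by fact
  interpret N: module C N by fact
  have s: "x \<in> carrier L \<Longrightarrow> s x \<in> carrier F" for x using assms(5) by auto
  show ?thesis
    using assms(7) linear_mapD(1)[OF assms(6)]
    by (auto simp: linearity_rels_def linear_map_minus[OF assms(1,3,4)] s linear_mapD[OF assms(4)]
        linear_mapD(2,3)[OF assms(6)] N.M.minus_eq_zero_iff)
qed


section \<open>Spanning families with a universal property\<close>

text \<open>
  The predicate \<open>ok\<close> is the multilinearity condition that a family in \<open>P\<close> has to satisfy in order
  to be the image of the spanning family \<open>e\<close> of \<open>M\<close> under a linear map.  The target module \<open>P\<close> is
  a parameter since a definition cannot quantify over its type.
\<close>

definition universal ::
  "('c, 'm) ring_scheme \<Rightarrow> ('c, 'a) module \<Rightarrow> 'i set \<Rightarrow> ('i \<Rightarrow> 'a) \<Rightarrow>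
   (('i \<Rightarrow> 'p) \<Rightarrow> bool) \<Rightarrow> ('c, 'p) module \<Rightarrow> bool" where
  "universal C M I e ok P \<longleftrightarrow>
     e \<in> I \<rightarrow> carrier M \<and> submodule_span C M (e ` I) = carrier M \<and>
     (\<forall>f \<in> I \<rightarrow> carrier P. ok f \<longrightarrow> (\<exists>h. linear_map C M P h \<and> (\<forall>i\<in>I. h (e i) = f i)))"

text \<open>The admissible families form a submodule of the families with values in
  \<open>P\<close>, and admissibility depends only on the values on \<open>I\<close>. This is what
  is needed to conclude that a family which is admissible at the generators of another module is
  admissible at all of its elements.\<close>

definition linear_condition ::
  "('c, 'm) ring_scheme \<Rightarrow> ('c, 'p) module \<Rightarrow> 'i set \<Rightarrow> (('i \<Rightarrow> 'p) \<Rightarrow> bool) \<Rightarrow> bool" where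
  "linear_condition C P I ok \<longleftrightarrow>
     ok (\<lambda>_. \<zero>\<^bsub>P\<^esub>) \<and>
     (\<forall>f\<in>I \<rightarrow> carrier P. \<forall>g\<in>I \<rightarrow> carrier P. ok f \<longrightarrow> ok g \<longrightarrow> ok (\<lambda>i. f i \<oplus>\<^bsub>P\<^esub> g i)) \<and>
     (\<forall>c\<in>carrier C. \<forall>f\<in>I \<rightarrow> carrier P. ok f \<longrightarrow> ok (\<lambda>i. c \<odot>\<^bsub>P\<^esub> f i)) \<and>
     (\<forall>f\<in>I \<rightarrow> carrier P. \<forall>g. (\<forall>i\<in>I. f i = g i) \<longrightarrow> ok f \<longrightarrow> ok g)"

lemma linear_conditionD:
  assumes "linear_condition C P I ok"
  shows "ok (\<lambda>_. \<zero>\<^bsub>P\<^esub>)"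
    and "f \<in> I \<rightarrow> carrier P \<Longrightarrow> g \<in> I \<rightarrow> carrier P \<Longrightarrow> ok f \<Longrightarrow> ok g \<Longrightarrow> ok (\<lambda>i. f i \<oplus>\<^bsub>P\<^esub> g i)"
    and "c \<in> carrier C \<Longrightarrow> f \<in> I \<rightarrow> carrier P \<Longrightarrow> ok f \<Longrightarrow> ok (\<lambda>i. c \<odot>\<^bsub>P\<^esub> f i)"
    and "f \<in> I \<rightarrow> carrier P \<Longrightarrow> (\<And>i. i \<in> I \<Longrightarrow> f i = g i) \<Longrightarrow> ok f \<Longrightarrow> ok g"
proof -
  note a = assms[unfolded linear_condition_def]
  show "ok (\<lambda>_. \<zero>\<^bsub>P\<^esub>)" by (rule a[THEN conjunct1])
  show "f \<in> I \<rightarrow> carrier P \<Longrightarrow> g \<in> I \<rightarrow> carrier P \<Longrightarrow> ok f \<Longrightarrow> ok g \<Longrightarrow> ok (\<lambda>i. f i \<oplus>\<^bsub>P\<^esub> g i)"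
    by (rule a[THEN conjunct2, THEN conjunct1, rule_format])
  show "c \<in> carrier C \<Longrightarrow> f \<in> I \<rightarrow> carrier P \<Longrightarrow> ok f \<Longrightarrow> ok (\<lambda>i. c \<odot>\<^bsub>P\<^esub> f i)"
    by (rule a[THEN conjunct2, THEN conjunct2, THEN conjunct1, rule_format])
  show "f \<in> I \<rightarrow> carrier P \<Longrightarrow> (\<And>i. i \<in> I \<Longrightarrow> f i = g i) \<Longrightarrow> ok f \<Longrightarrow> ok g"
    by (rule a[THEN conjunct2, THEN conjunct2, THEN conjunct2, rule_format])
qed

lemma universalD:
  assumes "universal C M I e ok P"
  shows "i \<in> I \<Longrightarrow> e i \<in> carrier M"
    and "submodule_span C M (e ` I) = carrier M"
  using assms unfolding universal_def by auto

lemma universal_ex: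
  assumes "universal C M I e ok P" "f \<in> I \<rightarrow> carrier P" "ok f"
  shows "\<exists>h. linear_map C M P h \<and> (\<forall>i\<in>I. h (e i) = f i)"
  using assms(1)[unfolded universal_def, THEN conjunct2, THEN conjunct2, rule_format, OF assms(2,3)] .

lemma universal_extend:
  assumes "universal C M I e ok P" "\<And>i. i \<in> I \<Longrightarrow> f i \<in> carrier P" "ok f"
  obtains h where "linear_map C M P h" "\<And>i. i \<in> I \<Longrightarrow> h (e i) = f i"
proof -
  have "f \<in> I \<rightarrow> carrier P" using assms(2) by blast
  then show thesis using universal_ex[OF assms(1) _ assms(3)] that by blast
qed

text \<open>Multilinearity on words and on multisets is linearity along a set of slots, so this one
  statement covers both. Each slot maps into \<open>I\<close>, which makes the condition depend only
  on values there.\<close>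

lemma linear_condition_slots:
  assumes "module C P"
    and "\<And>s. s \<in> A \<Longrightarrow> module C (L s) \<and> s \<in> carrier (L s) \<rightarrow> I"
  shows "linear_condition C P I (\<lambda>f. \<forall>s\<in>A. linear_map C (L s) P (\<lambda>x. f (s x)))"
  unfolding linear_condition_def
proof (intro conjI ballI allI impI)
  fix f g s assume "f \<in> I \<rightarrow> carrier P" and eq: "\<forall>i\<in>I. f i = g i"
    and ok: "\<forall>s\<in>A. linear_map C (L s) P (\<lambda>x. f (s x))" and s: "s \<in> A"
  show "linear_map C (L s) P (\<lambda>x. g (s x))"
    by (rule linear_map_cong[OF ok[rule_format, OF s]]) (use assms(2)[OF s] eq in auto)
qed (auto intro: linear_map_fun_zero linear_map_fun_add linear_map_fun_smult assms)

lemma linear_condition_conj: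
  assumes "linear_condition C P I ok" "linear_condition C P I ok'"
  shows "linear_condition C P I (\<lambda>f. ok f \<and> ok' f)"
  unfolding linear_condition_def
proof (intro conjI ballI allI impI; (elim conjE)?)
  fix f g assume f: "f \<in> I \<rightarrow> carrier P" and eq: "\<forall>i\<in>I. f i = g i" and ok: "ok f" "ok' f"
  show "ok g" by (rule linear_conditionD(4)[OF assms(1) f eq[rule_format] ok(1)])
  show "ok' g" by (rule linear_conditionD(4)[OF assms(2) f eq[rule_format] ok(2)])
qed (simp_all add: linear_conditionD(1-3)[OF assms(1)] linear_conditionD(1-3)[OF assms(2)])

lemma linear_condition_pull:
  assumes "linear_condition C P I ok" "\<And>j i. j \<in> J \<Longrightarrow> i \<in> I \<Longrightarrow> k j i \<in> K"
  shows "linear_condition C P K (\<lambda>f. \<forall>j\<in>J. ok (\<lambda>i. f (k j i)))"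
  unfolding linear_condition_def
proof (intro conjI ballI allI impI)
  fix f g j assume f: "f \<in> K \<rightarrow> carrier P" and g: "g \<in> K \<rightarrow> carrier P"
    and ok: "\<forall>j\<in>J. ok (\<lambda>i. f (k j i))" "\<forall>j\<in>J. ok (\<lambda>i. g (k j i))" and j: "j \<in> J"
  show "ok (\<lambda>i. f (k j i) \<oplus>\<^bsub>P\<^esub> g (k j i))"
    by (rule linear_conditionD(2)[OF assms(1)]) (use f g j ok assms(2)[OF j] in auto)
next
  fix c f j assume c: "c \<in> carrier C" and f: "f \<in> K \<rightarrow> carrier P"
    and ok: "\<forall>j\<in>J. ok (\<lambda>i. f (k j i))" and j: "j \<in> J"
  show "ok (\<lambda>i. c \<odot>\<^bsub>P\<^esub> f (k j i))"
    by (rule linear_conditionD(3)[OF assms(1)]) (use c f j ok assms(2)[OF j] in auto)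
next
  fix f g j assume f: "f \<in> K \<rightarrow> carrier P" and eq: "\<forall>i\<in>K. f i = g i"
    and ok: "\<forall>j\<in>J. ok (\<lambda>i. f (k j i))" and j: "j \<in> J"
  show "ok (\<lambda>i. g (k j i))"
    by (rule linear_conditionD(4)[OF assms(1), of "\<lambda>i. f (k j i)"])
      (use f eq j ok assms(2)[OF j] in auto)
qed (use linear_conditionD(1)[OF assms(1)] in blast)

lemma linear_condition_prod:
  assumes "linear_condition C P I okM" "linear_condition C P J okN"
  shows "linear_condition C P (I \<times> J)
    (\<lambda>v. (\<forall>j\<in>J. okM (\<lambda>i. v (i, j))) \<and> (\<forall>i\<in>I. okN (\<lambda>j. v (i, j))))"
  by (intro linear_condition_conj linear_condition_pull[OF assms(1), where k = "\<lambda>j i. (i, j)"]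
      linear_condition_pull[OF assms(2), where k = "\<lambda>i j. (i, j)"]) auto

lemma linear_condition_linear_map:
  assumes "module C P" "module C M"
  shows "linear_condition C P (carrier M) (linear_map C M P)"
  using linear_condition_slots[OF assms(1), of "{\<lambda>x. x}" "\<lambda>_. M" "carrier M"] assms(2) by simp

lemma universal_self:
  assumes "module C M"
  shows "universal C M (carrier M) (\<lambda>x. x) (linear_map C M P) P"
  unfolding universal_def
  using span_carrierI[OF assms, of "carrier M"] by auto

text \<open>For each \<open>j\<close> the family extends in the first variable to a linear map
  \<open>h j\<close>; for each \<open>x\<close> the family of all \<open>h j x\<close> then extends
  in the second variable. The second extension needs admissibility at every \<open>x\<close>,
  whereas it is given only at the generators \<open>e i\<close>.\<close>

lemma universal_bilinear:
  assumes M: "module C M" and N: "module C N" and P: "module C P"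
    and uM: "universal C M I e okM P" and uN: "universal C N J e' okN P"
    and lc: "linear_condition C P J okN"
    and v: "\<And>i j. i \<in> I \<Longrightarrow> j \<in> J \<Longrightarrow> v i j \<in> carrier P"
    and okM: "\<And>j. j \<in> J \<Longrightarrow> okM (\<lambda>i. v i j)"
    and okN: "\<And>i. i \<in> I \<Longrightarrow> okN (\<lambda>j. v i j)"
  obtains b where "bilinear_map C M N P b" "\<And>i j. i \<in> I \<Longrightarrow> j \<in> J \<Longrightarrow> b (e i) (e' j) = v i j"
proof -
  interpret M: module C M by fact
  interpret N: module C N by fact
  interpret P: module C P by fact
  have "\<forall>j\<in>J. \<exists>h. linear_map C M P h \<and> (\<forall>i\<in>I. h (e i) = v i j)"
    by (intro ballI universal_ex[OF uM] okM Pi_I v)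
  from bchoice[OF this] obtain h where
      "\<forall>j\<in>J. linear_map C M P (h j) \<and> (\<forall>i\<in>I. h j (e i) = v i j)" ..
  then have h: "\<And>j. j \<in> J \<Longrightarrow> linear_map C M P (h j)"
      "\<And>i j. i \<in> I \<Longrightarrow> j \<in> J \<Longrightarrow> h j (e i) = v i j"
    by blast+
  note hd = linear_mapD[OF h(1)]
  \<comment> \<open>The set of \<open>x\<close> at which the intermediate family is admissible is a
    submodule by \<open>lc\<close>, and it contains the generators, so it is everything.\<close>
  have "submodule {x \<in> carrier M. okN (\<lambda>j. h j x)} C M"
  proof (rule M.submoduleI)
    have "okN (\<lambda>j. h j \<zero>\<^bsub>M\<^esub>)"
      by (rule linear_conditionD(4)[OF lc _ _ linear_conditionD(1)[OF lc]])
        (auto simp: linear_map_zero[OF M P h(1)])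
    then show "\<zero>\<^bsub>M\<^esub> \<in> {x \<in> carrier M. okN (\<lambda>j. h j x)}" by simp
    have sm: "okN (\<lambda>j. h j (c \<odot>\<^bsub>M\<^esub> x))" if "c \<in> carrier C" "x \<in> carrier M" "okN (\<lambda>j. h j x)" for c x
      by (rule linear_conditionD(4)[OF lc _ _ linear_conditionD(3)[OF lc that(1) _ that(3)]])
        (simp_all add: that hd)
    then show "c \<odot>\<^bsub>M\<^esub> x \<in> {x \<in> carrier M. okN (\<lambda>j. h j x)}"
      if "c \<in> carrier C" "x \<in> {x \<in> carrier M. okN (\<lambda>j. h j x)}" for c x
      using that by simp
    have "okN (\<lambda>j. h j (x \<oplus>\<^bsub>M\<^esub> y))" if "x \<in> carrier M" "okN (\<lambda>j. h j x)" "y \<in> carrier M" "okN (\<lambda>j. h j y)" for x y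
      by (rule linear_conditionD(4)[OF lc _ _ linear_conditionD(2)[OF lc, of "\<lambda>j. h j x" "\<lambda>j. h j y"]])
        (simp_all add: that hd)
    then show "x \<oplus>\<^bsub>M\<^esub> y \<in> {x \<in> carrier M. okN (\<lambda>j. h j x)}"
      if "x \<in> {x \<in> carrier M. okN (\<lambda>j. h j x)}" "y \<in> {x \<in> carrier M. okN (\<lambda>j. h j x)}" for x y
      using that by simp
    show "\<ominus>\<^bsub>M\<^esub> x \<in> {x \<in> carrier M. okN (\<lambda>j. h j x)}"
      if x: "x \<in> {x \<in> carrier M. okN (\<lambda>j. h j x)}" for x
    proof -
      \<comment> \<open>\<open>linear_condition\<close> speaks of sums and multiples only, so the
        negative is written as the multiple by minus one.\<close>
      have "\<ominus>\<^bsub>M\<^esub> x = (\<ominus>\<^bsub>C\<^esub> \<one>\<^bsub>C\<^esub>) \<odot>\<^bsub>M\<^esub> x"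
        using x M.smult_l_minus[of "\<one>\<^bsub>C\<^esub>" x] by simp
      then show ?thesis using sm[of "\<ominus>\<^bsub>C\<^esub> \<one>\<^bsub>C\<^esub>" x] x by simp
    qed
  qed auto
  moreover have "e ` I \<subseteq> {x \<in> carrier M. okN (\<lambda>j. h j x)}"
  proof clarify
    fix i assume i: "i \<in> I"
    have "okN (\<lambda>j. h j (e i))"
      by (rule linear_conditionD(4)[OF lc _ _ okN[OF i]]) (use v h i in auto)
    then show "e i \<in> carrier M \<and> okN (\<lambda>j. h j (e i))" using universalD(1)[OF uM i] by simp
  qed
  ultimately have ok: "okN (\<lambda>j. h j x)" if "x \<in> carrier M" for x
    using span_carrier_induct[OF universalD(2)[OF uM] _ _ that] by blast
  have "\<forall>x\<in>carrier M. \<exists>k. linear_map C N P k \<and> (\<forall>j\<in>J. k (e' j) = h j x)"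
    by (intro ballI universal_ex[OF uN] ok Pi_I hd(1))
  from bchoice[OF this] obtain b where
      "\<forall>x\<in>carrier M. linear_map C N P (b x) \<and> (\<forall>j\<in>J. b x (e' j) = h j x)" ..
  then have b: "\<And>x. x \<in> carrier M \<Longrightarrow> linear_map C N P (b x)"
      "\<And>x j. x \<in> carrier M \<Longrightarrow> j \<in> J \<Longrightarrow> b x (e' j) = h j x"
    by blast+
  have "bilinear_map C M N P b"
  proof (rule bilinear_mapI[OF b(1)])
    fix y assume y: "y \<in> carrier N"
    \<comment> \<open>\<open>b x\<close> was chosen separately for each \<open>x\<close>. Linearity
      in \<open>x\<close> therefore compares two linear maps of \<open>y\<close>, and they agree on
      the generators \<open>e' j\<close>, where \<open>b x\<close> has the value
      \<open>h j x\<close>.\<close>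
    show "linear_map C M P (\<lambda>x. b x y)"
    proof (rule linear_mapI)
      show "b x y \<in> carrier P" if "x \<in> carrier M" for x
        by (rule linear_mapD(1)[OF b(1)[OF that] y])
      fix x x' assume x: "x \<in> carrier M" "x' \<in> carrier M"
      show "b (x \<oplus>\<^bsub>M\<^esub> x') y = b x y \<oplus>\<^bsub>P\<^esub> b x' y"
        by (rule linear_map_eqI[OF N P b(1) linear_map_fun_add[OF P b(1) b(1)] universalD(2)[OF uN] _ y])
          (use x b(2) hd in auto)
    next
      fix c x assume c: "c \<in> carrier C" and x: "x \<in> carrier M"
      show "b (c \<odot>\<^bsub>M\<^esub> x) y = c \<odot>\<^bsub>P\<^esub> b x y"
        by (rule linear_map_eqI[OF N P b(1) linear_map_fun_smult[OF P b(1) c] universalD(2)[OF uN] _ y])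
          (use c x b(2) hd in auto)
    qed
  qed
  then show thesis
    using b(2) h(2) universalD(1)[OF uM] by (intro that) auto
qed

text \<open>The chosen map need not be the witness \<open>b\<close>; from here on only the two
  properties obtained below are available, and on spanning families they determine it.\<close>

lemma bilinear_ext_works:
  assumes "bilinear_map C M N P b" "\<And>i j. i \<in> I \<Longrightarrow> j \<in> J \<Longrightarrow> b (e i) (e' j) = v i j"
  shows "bilinear_map C M N P (bilinear_ext C M N P I e J e' v)"
    and "i \<in> I \<Longrightarrow> j \<in> J \<Longrightarrow> bilinear_ext C M N P I e J e' v (e i) (e' j) = v i j"
proof -
  have "bilinear_map C M N P (bilinear_ext C M N P I e J e' v) \<and>
    (\<forall>i\<in>I. \<forall>j\<in>J. bilinear_ext C M N P I e J e' v (e i) (e' j) = v i j)"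
    unfolding bilinear_ext_def by (rule someI[of _ b]) (use assms in auto)
  then show "bilinear_map C M N P (bilinear_ext C M N P I e J e' v)"
    and "i \<in> I \<Longrightarrow> j \<in> J \<Longrightarrow> bilinear_ext C M N P I e J e' v (e i) (e' j) = v i j"
    by auto
qed

lemma linear_ext_works:
  assumes "universal C M I e ok N" "\<And>i. i \<in> I \<Longrightarrow> v i \<in> carrier N" "ok v"
  shows "linear_map C M N (linear_ext C M N I e v)"
    and "i \<in> I \<Longrightarrow> linear_ext C M N I e v (e i) = v i"
proof -
  obtain h where "linear_map C M N h \<and> (\<forall>i\<in>I. h (e i) = v i)"
    using universal_ex[OF assms(1) Pi_I[OF assms(2)] assms(3)] by blast
  then have "linear_map C M N (linear_ext C M N I e v) \<and> (\<forall>i\<in>I. linear_ext C M N I e v (e i) = v i)"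
    unfolding linear_ext_def by (rule someI[of _ h])
  then show "linear_map C M N (linear_ext C M N I e v)"
    and "i \<in> I \<Longrightarrow> linear_ext C M N I e v (e i) = v i"
    by auto
qed


section \<open>Tensor products, tensor powers and symmetric powers\<close>

context
  fixes C :: "('c, 'm) ring_scheme" and M :: "('c, 'a) module" and N :: "('c, 'b) module"
  assumes C: "cring C" and M: "module C M" and N: "module C N"
begin

private definition "tX = carrier M \<times> carrier N"

private definition "tK =
  (\<Union>y\<in>carrier N. linearity_rels C M (free_module C tX) (\<lambda>x. free_gen C tX (x, y))) \<union>
  (\<Union>x\<in>carrier M. linearity_rels C N (free_module C tX) (\<lambda>y. free_gen C tX (x, y)))"

private lemma tensor_module_eq: "tensor_module C M N = presented C tX tK"
  and tensor_eq: "tensor C M N x y = presented_gen C tX tK (x, y)"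
  by (simp_all add: tensor_module_def presented_def tensor_rels_def tX_def tK_def Let_def
      tensor_def presented_gen_def)

private lemma tK: "tK \<subseteq> carrier (free_module C tX)"
  unfolding tK_def
  by (intro Un_least UN_least linearity_rels_closed free_module_module C M N)
    (auto intro!: free_gen_closed[OF C] simp: tX_def)

lemma tensor_module_module: "module C (tensor_module C M N)"
  unfolding tensor_module_eq by (rule presented_module[OF C tK])

lemma tensor_bilinear: "bilinear_map C M N (tensor_module C M N) (tensor C M N)"
  unfolding tensor_module_eq tensor_eq
  by (intro bilinear_mapI presented_gen_linear[OF C tK] M N) (auto simp: tX_def tK_def)

lemma tensor_extend:
  assumes P: "module C P" and b: "bilinear_map C M N P b"
  obtains h where "linear_map C (tensor_module C M N) P h"
    "\<And>x y. x \<in> carrier M \<Longrightarrow> y \<in> carrier N \<Longrightarrow> h (tensor C M N x y) = b x y"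
proof -
  have "\<exists>k. linear_map C (presented C tX tK) P k \<and>
      (\<forall>z\<in>tX. k (presented_gen C tX tK z) = (\<lambda>(x, y). b x y) z)"
  proof (rule presented_extend[OF C tK P, of "\<lambda>(x, y). b x y"])
    show "(\<lambda>(x, y). b x y) \<in> tX \<rightarrow> carrier P"
      by (auto simp: tX_def bilinear_map_closed[OF b])
    fix h r assume h: "linear_map C (free_module C tX) P h"
      and hg: "\<And>z. z \<in> tX \<Longrightarrow> h (free_gen C tX z) = (\<lambda>(x, y). b x y) z" and r: "r \<in> tK"
    have 1: "linear_map C M P (\<lambda>x. h (free_gen C tX (x, y)))" if y: "y \<in> carrier N" for y
      by (rule linear_map_cong[OF bilinear_mapD(2)[OF b y] M]) (use y hg in \<open>auto simp: tX_def\<close>)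
    have 2: "linear_map C N P (\<lambda>y. h (free_gen C tX (x, y)))" if x: "x \<in> carrier M" for x
      by (rule linear_map_cong[OF bilinear_mapD(1)[OF b x] N]) (use x hg in \<open>auto simp: tX_def\<close>)
    show "h r = \<zero>\<^bsub>P\<^esub>"
      using r unfolding tK_def
    proof (elim UnE UN_E)
      fix y assume y: "y \<in> carrier N"
        and r: "r \<in> linearity_rels C M (free_module C tX) (\<lambda>x. free_gen C tX (x, y))"
      have "(\<lambda>x. free_gen C tX (x, y)) \<in> carrier M \<rightarrow> carrier (free_module C tX)"
        using y by (auto intro!: free_gen_closed[OF C] simp: tX_def)
      then show ?thesis
        by (rule linearity_rels_vanish[OF free_module_module[OF C] M P h _ 1[OF y] r])
    next
      fix x assume x: "x \<in> carrier M"
        and r: "r \<in> linearity_rels C N (free_module C tX) (\<lambda>y. free_gen C tX (x, y))"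
      have "(\<lambda>y. free_gen C tX (x, y)) \<in> carrier N \<rightarrow> carrier (free_module C tX)"
        using x by (auto intro!: free_gen_closed[OF C] simp: tX_def)
      then show ?thesis
        by (rule linearity_rels_vanish[OF free_module_module[OF C] N P h _ 2[OF x] r])
    qed
  qed blast
  then show thesis
    unfolding tensor_module_eq[symmetric] tensor_eq[symmetric]
    using that by (auto simp: tX_def tensor_eq)
qed

lemma tensor_closed: "x \<in> carrier M \<Longrightarrow> y \<in> carrier N \<Longrightarrow> tensor C M N x y \<in> carrier (tensor_module C M N)"
  by (rule bilinear_map_closed[OF tensor_bilinear])

lemma tensor_span':
  "submodule_span C (tensor_module C M N) ((\<lambda>(x, y). tensor C M N x y) ` (carrier M \<times> carrier N)) =
    carrier (tensor_module C M N)"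
  using presented_span[OF C tK]
  by (simp add: tensor_module_eq tensor_eq tX_def[symmetric] case_prod_unfold)

lemma tensor_span:
  assumes "submodule_span C M (e ` I) = carrier M" "submodule_span C N (e' ` J) = carrier N"
  shows "submodule_span C (tensor_module C M N) ((\<lambda>(i, j). tensor C M N (e i) (e' j)) ` (I \<times> J)) =
    carrier (tensor_module C M N)"
proof (rule span_carrierI[OF tensor_module_module])
  have e: "e i \<in> carrier M" if "i \<in> I" for i
    using assms(1) submodule_span_subset[of "e ` I"] that by blast
  have e': "e' j \<in> carrier N" if "j \<in> J" for j
    using assms(2) submodule_span_subset[of "e' ` J"] that by blast
  show "(\<lambda>(i, j). tensor C M N (e i) (e' j)) ` (I \<times> J) \<subseteq> carrier (tensor_module C M N)"
    by (auto intro: tensor_closed e e')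
  fix H assume H: "submodule H C (tensor_module C M N)"
    "(\<lambda>(i, j). tensor C M N (e i) (e' j)) ` (I \<times> J) \<subseteq> H"
  have 1: "tensor C M N (e i) y \<in> H" if "i \<in> I" "y \<in> carrier N" for i y
    by (rule linear_map_span_image[OF N tensor_module_module bilinear_mapD(1)[OF tensor_bilinear e[OF that(1)]]
          assms(2) H(1) _ that(2)]) (use H(2) that(1) in auto)
  have "tensor C M N x y \<in> H" if "x \<in> carrier M" "y \<in> carrier N" for x y
    by (rule linear_map_span_image[OF M tensor_module_module bilinear_mapD(2)[OF tensor_bilinear that(2)]
          assms(1) H(1) _ that(1)]) (use 1 that(2) in auto)
  then have "(\<lambda>(x, y). tensor C M N x y) ` (carrier M \<times> carrier N) \<subseteq> H" by auto
  from span_carrier_induct[OF tensor_span' H(1) this]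
  show "carrier (tensor_module C M N) \<subseteq> H" by blast
qed

text \<open>The condition produced is again a \<open>linear_condition\<close> by
  \<open>linear_condition_prod\<close>, so the construction can be iterated. This is how the
  fourfold product underlying \<open>IDR\<close> gets its spanning family of pure tensors.\<close>

lemma universal_tensor:
  assumes P: "module C P" and uM: "universal C M I e okM P" and uN: "universal C N J e' okN P"
    and lc: "linear_condition C P J okN"
  shows "universal C (tensor_module C M N) (I \<times> J) (\<lambda>(i, j). tensor C M N (e i) (e' j))
    (\<lambda>v. (\<forall>j\<in>J. okM (\<lambda>i. v (i, j))) \<and> (\<forall>i\<in>I. okN (\<lambda>j. v (i, j)))) P"
  unfolding universal_def
proof (intro conjI ballI impI)
  show "(\<lambda>(i, j). tensor C M N (e i) (e' j)) \<in> I \<times> J \<rightarrow> carrier (tensor_module C M N)"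
    by (auto intro: tensor_closed universalD(1)[OF uM] universalD(1)[OF uN])
  show "submodule_span C (tensor_module C M N) ((\<lambda>(i, j). tensor C M N (e i) (e' j)) ` (I \<times> J)) =
    carrier (tensor_module C M N)"
    by (rule tensor_span[OF universalD(2)[OF uM] universalD(2)[OF uN]])
  fix v assume v: "v \<in> I \<times> J \<rightarrow> carrier P"
    and ok: "(\<forall>j\<in>J. okM (\<lambda>i. v (i, j))) \<and> (\<forall>i\<in>I. okN (\<lambda>j. v (i, j)))"
  obtain b where b: "bilinear_map C M N P b" "\<And>i j. i \<in> I \<Longrightarrow> j \<in> J \<Longrightarrow> b (e i) (e' j) = v (i, j)"
    by (rule universal_bilinear[OF M N P uM uN lc, of "\<lambda>i j. v (i, j)"]) (use v ok in auto)
  obtain h where "linear_map C (tensor_module C M N) P h"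
    "\<And>x y. x \<in> carrier M \<Longrightarrow> y \<in> carrier N \<Longrightarrow> h (tensor C M N x y) = b x y"
    using tensor_extend[OF P b(1)] by blast
  then show "\<exists>h. linear_map C (tensor_module C M N) P h \<and>
      (\<forall>z\<in>I \<times> J. h (case z of (i, j) \<Rightarrow> tensor C M N (e i) (e' j)) = v z)"
    using b(2) universalD(1)[OF uM] universalD(1)[OF uN] by (intro exI[of _ h]) auto
qed

end

lemma linear_map_restrict_domain:
  "linear_map C M N h \<Longrightarrow> H \<subseteq> carrier M \<Longrightarrow> linear_map C (M\<lparr>carrier := H\<rparr>) N h"
  unfolding linear_map_def by (auto simp: subset_iff)

lemma linear_map_restrict_range:
  "linear_map C M N h \<Longrightarrow> (\<And>x. x \<in> carrier M \<Longrightarrow> h x \<in> H) \<Longrightarrow> linear_map C M (N\<lparr>carrier := H\<rparr>) h"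
  unfolding linear_map_def by auto

definition word_multilinear ::
  "('c, 'm) ring_scheme \<Rightarrow> ('c, 'a) module \<Rightarrow> ('c, 'p) module \<Rightarrow> ('a list \<Rightarrow> 'p) \<Rightarrow> bool" where
  "word_multilinear C M P f \<longleftrightarrow>
     (\<forall>u\<in>lists (carrier M). \<forall>v\<in>lists (carrier M). linear_map C M P (\<lambda>x. f (u @ [x] @ v)))"

definition word_slots :: "('c, 'a) module \<Rightarrow> nat \<Rightarrow> ('a \<Rightarrow> 'a list) set" where
  "word_slots M n = {\<lambda>x. u @ [x] @ v | u v. set u \<union> set v \<subseteq> carrier M \<and> length u + 1 + length v = n}"

definition mset_slots :: "('c, 'a) module \<Rightarrow> nat \<Rightarrow> ('a \<Rightarrow> 'a multiset) set" where
  "mset_slots M n = {\<lambda>x. add_mset x u | u. set_mset u \<subseteq> carrier M \<and> size u + 1 = n}"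

definition mset_multilinear ::
  "('c, 'm) ring_scheme \<Rightarrow> ('c, 'a) module \<Rightarrow> ('c, 'p) module \<Rightarrow> nat set \<Rightarrow> ('a multiset \<Rightarrow> 'p) \<Rightarrow> bool" where
  "mset_multilinear C M P A f \<longleftrightarrow>
     (\<forall>u. set_mset u \<subseteq> carrier M \<and> size u + 1 \<in> A \<longrightarrow> linear_map C M P (\<lambda>x. f (add_mset x u)))"

lemma all_word_slots:
  "(\<forall>n. \<forall>s\<in>word_slots M n. Z s) \<longleftrightarrow>
    (\<forall>u\<in>lists (carrier M). \<forall>v\<in>lists (carrier M). Z (\<lambda>x. u @ [x] @ v))"
  unfolding word_slots_def in_lists_conv_set by blast

lemma all_mset_slots:
  "(\<forall>s\<in>mset_slots M n. Z s) \<longleftrightarrow>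
    (\<forall>u. set_mset u \<subseteq> carrier M \<and> size u + 1 = n \<longrightarrow> Z (\<lambda>x. add_mset x u))"
  unfolding mset_slots_def by blast

lemma word_multilinear_slots:
  "word_multilinear C M P = (\<lambda>f. \<forall>n. \<forall>s\<in>word_slots M n. linear_map C M P (\<lambda>x. f (s x)))"
  by (rule ext) (simp only: all_word_slots word_multilinear_def)

lemma mset_multilinear_slots:
  "mset_multilinear C M P A = (\<lambda>f. \<forall>n\<in>A. \<forall>s\<in>mset_slots M n. linear_map C M P (\<lambda>x. f (s x)))"
  by (rule ext) (auto simp: all_mset_slots mset_multilinear_def)

text \<open>
  The \<open>n\<close>-fold tensor power and the \<open>n\<close>-th symmetric power are both presented by generators
  indexed by \<open>X n\<close> and linearity in the slots \<open>Sl n\<close>; this treats the two direct sums at once.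
\<close>

locale graded_presentation =
  fixes C :: "('c, 'm) ring_scheme" and M :: "('c, 'a) module"
    and X :: "nat \<Rightarrow> 'x set" and Sl :: "nat \<Rightarrow> ('a \<Rightarrow> 'x) set"
  assumes C: "cring C" and M: "module C M"
    and slots: "s \<in> Sl n \<Longrightarrow> x \<in> carrier M \<Longrightarrow> s x \<in> X n"
begin

definition K where
  "K n = (\<Union>s\<in>Sl n. linearity_rels C M (free_module C (X n)) (\<lambda>x. free_gen C (X n) (s x)))"

definition G where "G n = presented C (X n) (K n)"

definition gen where "gen n = presented_gen C (X n) (K n)"

definition tot where "tot = direct_sum UNIV G"

definition tgen where "tgen n x = direct_sum_incl UNIV G n (gen n x)"

lemma K_closed: "K n \<subseteq> carrier (free_module C (X n))"
  unfolding K_def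
  by (intro UN_least linearity_rels_closed free_module_module C M)
    (auto intro: free_gen_closed[OF C] slots)

lemma G_module: "module C (G n)"
  unfolding G_def by (rule presented_module[OF C K_closed])

lemma gen_closed: "x \<in> X n \<Longrightarrow> gen n x \<in> carrier (G n)"
  unfolding G_def gen_def by (rule presented_gen_closed[OF C K_closed])

lemma gen_linear: "s \<in> Sl n \<Longrightarrow> linear_map C M (G n) (\<lambda>x. gen n (s x))"
  unfolding G_def gen_def
  by (rule presented_gen_linear[OF C K_closed M]) (auto simp: K_def slots)

lemma universal_G:
  assumes P: "module C P"
  shows "universal C (G n) (X n) (gen n) (\<lambda>f. \<forall>s\<in>Sl n. linear_map C M P (\<lambda>x. f (s x))) P"
  unfolding universal_def
proof (intro conjI ballI impI)
  show "gen n \<in> X n \<rightarrow> carrier (G n)" using gen_closed by auto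
  show "submodule_span C (G n) (gen n ` X n) = carrier (G n)"
    unfolding G_def gen_def by (rule presented_span[OF C K_closed])
  fix f assume f: "f \<in> X n \<rightarrow> carrier P" and ok: "\<forall>s\<in>Sl n. linear_map C M P (\<lambda>x. f (s x))"
  show "\<exists>h. linear_map C (G n) P h \<and> (\<forall>i\<in>X n. h (gen n i) = f i)"
    unfolding G_def gen_def
  proof (rule presented_extend[OF C K_closed P f])
    fix h r assume h: "linear_map C (free_module C (X n)) P h"
      and hg: "\<And>x. x \<in> X n \<Longrightarrow> h (free_gen C (X n) x) = f x" and r: "r \<in> K n"
    from r obtain s where s: "s \<in> Sl n"
        "r \<in> linearity_rels C M (free_module C (X n)) (\<lambda>x. free_gen C (X n) (s x))"
      unfolding K_def by auto
    have "linear_map C M P (\<lambda>x. h (free_gen C (X n) (s x)))"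
      by (rule linear_map_cong[OF ok[rule_format, OF s(1)] M]) (use s(1) slots hg in auto)
    then show "h r = \<zero>\<^bsub>P\<^esub>"
      by (intro linearity_rels_vanish[OF free_module_module[OF C] M P h _ _ s(2)])
        (auto intro: free_gen_closed[OF C] slots[OF s(1)])
  qed blast
qed

lemma tot_module: "module C tot"
  unfolding tot_def by (rule direct_sum_module[OF G_module C])

lemma incl_linear: "linear_map C (G n) tot (direct_sum_incl UNIV G n)"
  unfolding tot_def by (rule direct_sum_incl_linear[OF G_module C]) auto

lemma tgen_linear: "s \<in> Sl n \<Longrightarrow> linear_map C M tot (\<lambda>x. tgen n (s x))"
  unfolding tgen_def by (rule linear_map_comp[OF gen_linear incl_linear])

lemma tgen_closed: "x \<in> X n \<Longrightarrow> tgen n x \<in> carrier tot"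
  unfolding tgen_def by (rule linear_mapD(1)[OF incl_linear gen_closed])

text \<open>\<open>tgen\<close> takes the degree as an argument, while pure tensors and monomials
  read it off the length or size of their index. The family \<open>tg\<close> and hypothesis
  \<open>N\<close> bridge this difference.\<close>

lemma universal_tot:
  assumes P: "module C P" and N: "\<And>x n. x \<in> X n \<Longrightarrow> tg x = tgen n x"
  shows "universal C tot (\<Union>n. X n) tg (\<lambda>f. \<forall>n. \<forall>s\<in>Sl n. linear_map C M P (\<lambda>x. f (s x))) P"
  unfolding universal_def
proof (intro conjI ballI impI)
  show sub: "tg \<in> (\<Union>n. X n) \<rightarrow> carrier tot" using tgen_closed N by auto
  show "submodule_span C tot (tg ` (\<Union>n. X n)) = carrier tot"
  proof (rule span_carrierI[OF tot_module])
    show "tg ` (\<Union>n. X n) \<subseteq> carrier tot" using sub by auto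
    fix H assume H: "submodule H C tot" "tg ` (\<Union>n. X n) \<subseteq> H"
    have "tgen n x \<in> H" if "x \<in> X n" for n x
      using H(2) N[OF that] that by (metis UN_I UNIV_I image_subset_iff)
    note tg = this
    have "direct_sum_incl UNIV G n y \<in> H" if "y \<in> carrier (G n)" for n y
      by (rule linear_map_span_image[OF G_module tot_module incl_linear universalD(2)[OF universal_G[OF P]]
            H(1) _ that]) (auto intro: tg[unfolded tgen_def])
    then show "carrier tot \<subseteq> H"
      using direct_sum_induct[of UNIV C G, OF G_module C H(1)[unfolded tot_def]] unfolding tot_def by blast
  qed
  fix f assume f: "f \<in> (\<Union>n. X n) \<rightarrow> carrier P" and ok: "\<forall>n. \<forall>s\<in>Sl n. linear_map C M P (\<lambda>x. f (s x))"
  have "\<exists>h. linear_map C (G n) P h \<and> (\<forall>x\<in>X n. h (gen n x) = f x)" for n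
    by (rule universal_ex[OF universal_G[OF P]]) (use f ok in auto)
  then obtain g where g: "\<And>n. linear_map C (G n) P (g n)" "\<And>n x. x \<in> X n \<Longrightarrow> g n (gen n x) = f x"
    by metis
  obtain h where h: "linear_map C (direct_sum UNIV G) P h"
    "\<And>i x. x \<in> carrier (G i) \<Longrightarrow> h (direct_sum_incl UNIV G i x) = g i x"
    by (rule direct_sum_extend[where I = UNIV and M = G and C = C, OF G_module C P g(1)]) blast
  then show "\<exists>h. linear_map C tot P h \<and> (\<forall>i\<in>\<Union>n. X n. h (tg i) = f i)"
    unfolding tot_def using N g(2) gen_closed by (intro exI[of _ h]) (auto simp: tgen_def)
qed

end

locale tensors_of =
  fixes C :: "('c, 'm) ring_scheme" and M :: "('c, 'a) module"
  assumes C: "cring C" and M: "module C M"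
begin

sublocale graded_presentation C M "words M"
  "word_slots M"
  by (rule graded_presentation.intro) (auto simp: C M words_def word_slots_def)

lemma G_eq: "G = tensor_power C M"
proof
  fix n
  have "K n = (\<Union>(u, v) \<in> {(u, v). set u \<union> set v \<subseteq> carrier M \<and> length u + 1 + length v = n}.
      linearity_rels C M (free_module C (words M n)) (\<lambda>x. free_gen C (words M n) (u @ [x] @ v)))"
    unfolding K_def word_slots_def by blast
  then show "G n = tensor_power C M n"
    unfolding G_def presented_def tensor_power_def tensor_power_rels_def Let_def by simp
qed

lemma tot_eq: "tot = tensors C M"
  unfolding tot_def tensors_def G_eq ..

lemma pure_eq: "pure_tensor C M w = tgen (length w) w"
proof -
  have "K n = (\<Union>(u, v) \<in> {(u, v). set u \<union> set v \<subseteq> carrier M \<and> length u + 1 + length v = n}.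
      linearity_rels C M (free_module C (words M n)) (\<lambda>x. free_gen C (words M n) (u @ [x] @ v)))" for n
    unfolding K_def word_slots_def by blast
  then show ?thesis
    unfolding tgen_def pure_tensor_def G_eq gen_def presented_gen_def tensor_power_rels_def Let_def
    by simp
qed

lemma lists_eq: "lists (carrier M) = (\<Union>n. words M n)"
  by (auto simp: words_def)

lemma tensors_module: "module C (tensors C M)"
  using tot_module by (simp add: tot_eq)

lemma universal_pure:
  assumes "module C P"
  shows "universal C (tensors C M) (lists (carrier M)) (pure_tensor C M) (word_multilinear C M P) P"
proof -
  have "universal C tot (\<Union>n. words M n) (pure_tensor C M)
    (\<lambda>f. \<forall>n. \<forall>s\<in>word_slots M n. linear_map C M P (\<lambda>x. f (s x))) P"
    by (rule universal_tot[OF assms]) (auto simp: pure_eq words_def)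
  then show ?thesis by (simp only: lists_eq tot_eq word_multilinear_slots)
qed

lemma pure_closed: "w \<in> lists (carrier M) \<Longrightarrow> pure_tensor C M w \<in> carrier (tensors C M)"
  by (rule universalD(1)[OF universal_pure[OF M]])

lemma pure_span: "submodule_span C (tensors C M) (pure_tensor C M ` lists (carrier M)) = carrier (tensors C M)"
  by (rule universalD(2)[OF universal_pure[OF M]])

lemma pure_multilinear: "word_multilinear C M (tensors C M) (pure_tensor C M)"
  unfolding word_multilinear_def
proof (intro ballI)
  fix u v assume "u \<in> lists (carrier M)" "v \<in> lists (carrier M)"
  then have "linear_map C M tot (\<lambda>x. tgen (length u + 1 + length v) (u @ [x] @ v))"
    by (intro tgen_linear) (auto simp: word_slots_def in_lists_conv_set)
  then show "linear_map C M (tensors C M) (\<lambda>x. pure_tensor C M (u @ [x] @ v))"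
    by (simp add: pure_eq tot_eq)
qed

lemma word_multilinear_condition:
  assumes "module C P"
  shows "linear_condition C P (lists (carrier M)) (word_multilinear C M P)"
proof -
  have "linear_condition C P (lists (carrier M))
     (\<lambda>f. \<forall>s\<in>(\<Union>n. word_slots M n). linear_map C M P (\<lambda>x. f (s x)))"
    by (rule linear_condition_slots[OF assms]) (auto simp: M word_slots_def)
  then show ?thesis by (simp add: word_multilinear_slots)
qed

lemma pure_nth_zero:
  assumes "w \<noteq> []"
  shows "pure_tensor C M w 0 = \<zero>\<^bsub>tensor_power C M 0\<^esub>"
  using assms by (simp add: pure_eq tgen_def direct_sum_incl_def G_eq)

lemma tensors_pos_submodule: "submodule (carrier (tensors_pos C M)) C (tensors C M)"
proof -
  interpret T: module C "tensors C M" by (rule tensors_module)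
  interpret Z: module C "tensor_power C M 0" using G_module[of 0] by (simp add: G_eq)
  have "linear_map C (tensors C M) (tensor_power C M 0) (\<lambda>t. t 0)"
    by (rule linear_mapI)
      (auto simp: tensors_def direct_sum_simps intro: direct_sum_nth_closed)
  from linear_map_vimage_submodule[OF T.module_axioms Z.module_axioms this zero_submodule[OF Z.module_axioms]]
  show ?thesis by (simp add: tensors_pos_def)
qed

lemma tensors_pos_module: "module C (tensors_pos C M)"
  using submodule.submodule_is_module[OF tensors_pos_submodule tensors_module]
  by (simp add: tensors_pos_def)

lemma pure_pos_closed: "w \<in> lists (carrier M) \<Longrightarrow> w \<noteq> [] \<Longrightarrow> pure_tensor C M w \<in> carrier (tensors_pos C M)"
  using pure_closed pure_nth_zero by (simp add: tensors_pos_def)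

lemma tensors_pos_subset: "carrier (tensors_pos C M) \<subseteq> carrier (tensors C M)"
  by (auto simp: tensors_pos_def)

text \<open>A spanning set of the whole tensor module does not by itself restrict to a submodule.
  The way out is the linear map \<open>p\<close> that kills the empty word and fixes all others: it
  sends every generator into \<open>H\<close>, hence every tensor, and it is the identity on tensors
  of positive degree.\<close>

lemma pure_pos_span:
  "submodule_span C (tensors_pos C M) (pure_tensor C M ` (lists (carrier M) - {[]})) = carrier (tensors_pos C M)"
proof (rule span_carrierI[OF tensors_pos_module])
  interpret T: module C "tensors C M" by (rule tensors_module)
  interpret Tp: module C "tensors_pos C M" by (rule tensors_pos_module)
  show "pure_tensor C M ` (lists (carrier M) - {[]}) \<subseteq> carrier (tensors_pos C M)"
    using pure_pos_closed by auto
  fix H assume H: "submodule H C (tensors_pos C M)" "pure_tensor C M ` (lists (carrier M) - {[]}) \<subseteq> H"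
  have z: "\<zero>\<^bsub>tensors_pos C M\<^esub> = \<zero>\<^bsub>tensors C M\<^esub>" by (simp add: tensors_pos_def)
  have "word_multilinear C M (tensors_pos C M) (\<lambda>w. if w = [] then \<zero>\<^bsub>tensors_pos C M\<^esub> else pure_tensor C M w)"
    unfolding word_multilinear_def
  proof (intro ballI)
    fix u v assume uv: "u \<in> lists (carrier M)" "v \<in> lists (carrier M)"
    have "linear_map C M (tensors_pos C M) (\<lambda>x. pure_tensor C M (u @ [x] @ v))"
      using linear_map_restrict_range[OF pure_multilinear[unfolded word_multilinear_def, rule_format, OF uv],
          of "carrier (tensors_pos C M)"] pure_pos_closed uv
      by (simp add: tensors_pos_def)
    then show "linear_map C M (tensors_pos C M)
        (\<lambda>x. if u @ [x] @ v = [] then \<zero>\<^bsub>tensors_pos C M\<^esub> else pure_tensor C M (u @ [x] @ v))"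
      by simp
  qed
  then obtain p where p: "linear_map C (tensors C M) (tensors_pos C M) p"
    "\<And>w. w \<in> lists (carrier M) \<Longrightarrow> p (pure_tensor C M w) =
       (if w = [] then \<zero>\<^bsub>tensors_pos C M\<^esub> else pure_tensor C M w)"
    using universal_extend[OF universal_pure[OF tensors_pos_module],
        of "\<lambda>w. if w = [] then \<zero>\<^bsub>tensors_pos C M\<^esub> else pure_tensor C M w"] pure_pos_closed
    by (metis (no_types, lifting) Tp.M.zero_closed)
  have pos: "submodule_span C (tensors C M) (pure_tensor C M ` lists (carrier M)) = carrier (tensors C M)"
    by (rule pure_span)
  interpret Z: module C "tensor_power C M 0" using G_module[of 0] by (simp add: G_eq)
  have G: "module C (tensor_power C M i)" for i using G_module[of i] by (simp add: G_eq)
  have pT: "linear_map C (tensors C M) (tensors C M) p"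
    using p(1) tensors_pos_subset unfolding linear_map_def
    by (auto simp: tensors_pos_def)
  \<comment> \<open>Resetting the component of degree 0 is linear and agrees with \<open>p\<close>
    on words, so it is \<open>p\<close>; on tensors whose component of degree 0 already vanishes it
    does nothing.\<close>
  have "linear_map C (tensors C M) (tensors C M) (\<lambda>t. t(0 := \<zero>\<^bsub>tensor_power C M 0\<^esub>))"
  proof (rule linear_mapI)
    fix t assume t: "t \<in> carrier (tensors C M)"
    have "finite {i. (t(0 := \<zero>\<^bsub>tensor_power C M 0\<^esub>)) i \<noteq> \<zero>\<^bsub>tensor_power C M i\<^esub>}"
      by (rule finite_subset[of _ "{i. t i \<noteq> \<zero>\<^bsub>tensor_power C M i\<^esub>}"])
        (use t in \<open>auto simp: tensors_def direct_sum_simps\<close>)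
    then show "t(0 := \<zero>\<^bsub>tensor_power C M 0\<^esub>) \<in> carrier (tensors C M)"
      using t by (auto simp: tensors_def direct_sum_simps)
  qed (auto simp: tensors_def direct_sum_simps fun_eq_iff)
  then have eq: "p t = t(0 := \<zero>\<^bsub>tensor_power C M 0\<^esub>)" if "t \<in> carrier (tensors C M)" for t
  proof (rule linear_map_eqI[OF tensors_module tensors_module pT _ pos _ that])
    fix w assume w: "w \<in> lists (carrier M)"
    show "p (pure_tensor C M w) = (pure_tensor C M w)(0 := \<zero>\<^bsub>tensor_power C M 0\<^esub>)"
    proof (cases "w = []")
      case True
      have "(pure_tensor C M [])(0 := \<zero>\<^bsub>tensor_power C M 0\<^esub>) = \<zero>\<^bsub>tensors C M\<^esub>"
        by (auto simp: pure_eq tgen_def direct_sum_incl_def G_eq tensors_def direct_sum_simps fun_eq_iff)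
      then show ?thesis using True w by (simp add: p(2) z)
    next
      case False
      then show ?thesis using pure_nth_zero[OF False] p(2)[OF w] by (auto simp: fun_eq_iff)
    qed
  qed
  have pH: "p t \<in> H" if "t \<in> carrier (tensors C M)" for t
    by (rule linear_map_span_image[OF tensors_module tensors_pos_module p(1) pos H(1) _ that])
      (use H(2) submodule_zero_closed[OF H(1)] in \<open>clarify, subst p(2), auto\<close>)
  show "carrier (tensors_pos C M) \<subseteq> H"
  proof
    fix t assume "t \<in> carrier (tensors_pos C M)"
    then have "t \<in> carrier (tensors C M)" "t 0 = \<zero>\<^bsub>tensor_power C M 0\<^esub>"
      by (simp_all add: tensors_pos_def)
    then show "t \<in> H" using pH[of t] eq[of t] by (simp add: fun_upd_idem)
  qed
qed

end

locale sym_powers_of =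
  fixes C :: "('c, 'm) ring_scheme" and M :: "('c, 'a) module"
  assumes C: "cring C" and M: "module C M"
begin

sublocale graded_presentation C M "multiwords M"
  "mset_slots M"
  by (rule graded_presentation.intro) (auto simp: C M multiwords_def mset_slots_def)

lemma K_eq: "K n = (\<Union>u \<in> {u. set_mset u \<subseteq> carrier M \<and> size u + 1 = n}.
      linearity_rels C M (free_module C (multiwords M n)) (\<lambda>x. free_gen C (multiwords M n) (add_mset x u)))"
  unfolding K_def mset_slots_def by blast

lemma G_eq: "G = sym_power C M"
  by (rule ext) (simp only: G_def presented_def sym_power_def sym_power_rels_def Let_def K_eq)

lemma multiwords_size: "u \<in> multiwords M n \<Longrightarrow> size u = n"
  by (simp add: multiwords_def)

lemma gen_eq: "u \<in> multiwords M n \<Longrightarrow> sym_prod C M u = gen n u"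
  by (simp add: gen_def presented_gen_def sym_prod_def sym_power_rels_def Let_def K_eq multiwords_size)

lemma tot_eq: "tot = direct_sum UNIV (sym_power C M)"
  unfolding tot_def G_eq ..

lemma sym_power_module: "module C (sym_power C M n)"
  using G_module[of n] by (simp add: G_eq)

lemma universal_cong_fam:
  assumes "universal C N I e ok P" "\<And>i. i \<in> I \<Longrightarrow> e i = e' i"
  shows "universal C N I e' ok P"
proof -
  have "e ` I = e' ` I" using assms(2) by auto
  moreover have "e \<in> I \<rightarrow> carrier N \<longleftrightarrow> e' \<in> I \<rightarrow> carrier N"
    by (rule Pi_cong) (rule assms(2))
  ultimately show ?thesis using assms(1) by (simp add: universal_def assms(2))
qed

lemma universal_sym_prod:
  assumes "module C P"
  shows "universal C (sym_power C M n) (multiwords M n) (sym_prod C M) (mset_multilinear C M P {n}) P"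
proof -
  have "universal C (G n) (multiwords M n) (gen n) (mset_multilinear C M P {n}) P"
    using universal_G[OF assms, of n] by (simp add: mset_multilinear_slots)
  then show ?thesis
    unfolding G_eq by (rule universal_cong_fam) (simp add: gen_eq)
qed

lemma sym_prod_linear:
  assumes "set_mset u \<subseteq> carrier M" "size u + 1 = n"
  shows "linear_map C M (sym_power C M n) (\<lambda>x. sym_prod C M (add_mset x u))"
proof -
  have "linear_map C M (G n) (\<lambda>x. gen n (add_mset x u))"
    by (rule gen_linear) (use assms in \<open>auto simp: mset_slots_def\<close>)
  then show ?thesis
    unfolding G_eq
    by (rule linear_map_cong[OF _ M]) (subst gen_eq[of _ n], use assms in \<open>auto simp: multiwords_def\<close>)
qed

lemma sym_monomial_eq: "set_mset u \<subseteq> carrier M \<Longrightarrow> sym_monomial C M u = tgen (size u) u"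
  unfolding sym_monomial_def tgen_def G_eq by (simp add: gen_eq[of _ "size u"] multiwords_def)

lemma msets_eq: "{u. set_mset u \<subseteq> carrier M} = (\<Union>n. multiwords M n)"
  by (auto simp: multiwords_def)

lemma universal_sym_monomial:
  assumes "module C P"
  shows "universal C (direct_sum UNIV (sym_power C M)) {u. set_mset u \<subseteq> carrier M} (sym_monomial C M)
    (mset_multilinear C M P UNIV) P"
proof -
  have "universal C tot (\<Union>n. multiwords M n) (sym_monomial C M)
    (\<lambda>f. \<forall>n. \<forall>s\<in>mset_slots M n. linear_map C M P (\<lambda>x. f (s x))) P"
    by (rule universal_tot[OF assms]) (auto simp: sym_monomial_eq multiwords_def)
  then show ?thesis by (simp add: msets_eq tot_eq mset_multilinear_slots)
qed

lemma sym_monomial_multilinear: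
  "mset_multilinear C M (direct_sum UNIV (sym_power C M)) UNIV (sym_monomial C M)"
  unfolding mset_multilinear_def
proof (intro allI impI)
  fix u assume u: "set_mset u \<subseteq> carrier M \<and> size u + 1 \<in> UNIV"
  have "linear_map C M tot (\<lambda>x. tgen (size u + 1) (add_mset x u))"
    by (rule tgen_linear) (use u in \<open>auto simp: mset_slots_def\<close>)
  then show "linear_map C M (direct_sum UNIV (sym_power C M)) (\<lambda>x. sym_monomial C M (add_mset x u))"
    unfolding tot_eq by (rule linear_map_cong[OF _ M]) (use u in \<open>auto simp: sym_monomial_eq\<close>)
qed

lemma mset_multilinear_condition:
  assumes "module C P"
  shows "linear_condition C P {u. set_mset u \<subseteq> carrier M} (mset_multilinear C M P UNIV)"
proof -
  have "linear_condition C P {u. set_mset u \<subseteq> carrier M}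
     (\<lambda>f. \<forall>s\<in>(\<Union>n. mset_slots M n). linear_map C M P (\<lambda>x. f (s x)))"
    by (rule linear_condition_slots[OF assms]) (auto simp: M mset_slots_def)
  then show ?thesis by (simp add: mset_multilinear_slots)
qed

end


section \<open>Algebras\<close>

lemma submodule_transfer_cong:
  fixes M N :: "('c, 'a) module"
  assumes "carrier N = carrier M" "ring.zero N = ring.zero M" "ring.add N = ring.add M"
    "module.smult N = module.smult M"
  shows "submodule H C N \<longleftrightarrow> submodule H C M"
proof -
  have "add_monoid N = add_monoid M" using assms by simp
  then show ?thesis using assms by (simp add: submodule_def submodule_axioms_def)
qed

lemma submodule_span_transfer_cong:
  fixes M N :: "('c, 'a) module"
  assumes "carrier N = carrier M" "ring.zero N = ring.zero M" "ring.add N = ring.add M"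
    "module.smult N = module.smult M"
  shows "submodule_span C N X = submodule_span C M X"
  unfolding submodule_span_def submodule_transfer_cong[OF assms] ..

lemma algebra_mult_bilinear:
  assumes "algebra C A"
  shows "bilinear_map C A A A (monoid.mult A)"
proof -
  interpret algebra C A by fact
  have "x \<otimes>\<^bsub>A\<^esub> (c \<odot>\<^bsub>A\<^esub> y) = c \<odot>\<^bsub>A\<^esub> (x \<otimes>\<^bsub>A\<^esub> y)"
    if "x \<in> carrier A" "y \<in> carrier A" "c \<in> carrier C" for x y c
    using that smult_assoc2[of c y x] by (simp add: m_comm)
  then show ?thesis
    by (intro bilinear_mapI linear_mapI) (simp_all add: r_distr l_distr smult_assoc2)
qed

text \<open>Each ring law equates two maps that are linear in every argument, so it suffices to know
  it on the spanning family. Associativity takes three stages, which free the last, the middle and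
  finally the first argument.\<close>

lemma algebra_spanI:
  assumes A: "module C A" and mult: "bilinear_map C A A A (monoid.mult A)"
    and span: "submodule_span C A (e ` I) = carrier A" and one: "\<one>\<^bsub>A\<^esub> \<in> carrier A"
    and comm: "\<And>i j. i \<in> I \<Longrightarrow> j \<in> I \<Longrightarrow> e i \<otimes>\<^bsub>A\<^esub> e j = e j \<otimes>\<^bsub>A\<^esub> e i"
    and assoc: "\<And>i j k. i \<in> I \<Longrightarrow> j \<in> I \<Longrightarrow> k \<in> I \<Longrightarrow>
      (e i \<otimes>\<^bsub>A\<^esub> e j) \<otimes>\<^bsub>A\<^esub> e k = e i \<otimes>\<^bsub>A\<^esub> (e j \<otimes>\<^bsub>A\<^esub> e k)"
    and one_left: "\<And>i. i \<in> I \<Longrightarrow> \<one>\<^bsub>A\<^esub> \<otimes>\<^bsub>A\<^esub> e i = e i"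
  shows "algebra C A"
proof -
  interpret module C A by fact
  note cl = bilinear_map_closed[OF mult]
  note l = bilinear_mapD(1)[OF mult] and r = bilinear_mapD(2)[OF mult]
  note ld = linear_mapD[OF l] and rd = linear_mapD[OF r]
  have e: "e i \<in> carrier A" if "i \<in> I" for i
    using span submodule_span_subset[of "e ` I"] that by blast
  have flip: "bilinear_map C A A A (\<lambda>x y. y \<otimes>\<^bsub>A\<^esub> x)"
    by (intro bilinear_mapI l r)
  have comm': "x \<otimes>\<^bsub>A\<^esub> y = y \<otimes>\<^bsub>A\<^esub> x" if "x \<in> carrier A" "y \<in> carrier A" for x y
    by (rule bilinear_map_eqI[OF A A A mult flip span span comm that])
  have one': "\<one>\<^bsub>A\<^esub> \<otimes>\<^bsub>A\<^esub> x = x" if "x \<in> carrier A" for x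
    by (rule linear_map_eqI[OF A A l[OF one] linear_map_id span one_left that])
  have 1: "(e i \<otimes>\<^bsub>A\<^esub> e j) \<otimes>\<^bsub>A\<^esub> z = e i \<otimes>\<^bsub>A\<^esub> (e j \<otimes>\<^bsub>A\<^esub> z)"
    if "i \<in> I" "j \<in> I" "z \<in> carrier A" for i j z
    by (rule linear_map_eqI[OF A A l linear_map_comp[OF l l] span assoc]) (use that e cl in auto)
  have 2: "(e i \<otimes>\<^bsub>A\<^esub> y) \<otimes>\<^bsub>A\<^esub> z = e i \<otimes>\<^bsub>A\<^esub> (y \<otimes>\<^bsub>A\<^esub> z)"
    if "i \<in> I" "y \<in> carrier A" "z \<in> carrier A" for i y z
    by (rule linear_map_eqI[OF A A linear_map_comp[OF l r] linear_map_comp[OF r l] span 1])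
      (use that e in auto)
  have assoc': "(x \<otimes>\<^bsub>A\<^esub> y) \<otimes>\<^bsub>A\<^esub> z = x \<otimes>\<^bsub>A\<^esub> (y \<otimes>\<^bsub>A\<^esub> z)"
    if "x \<in> carrier A" "y \<in> carrier A" "z \<in> carrier A" for x y z
    by (rule linear_map_eqI[OF A A linear_map_comp[OF r r] r span 2])
      (use that e cl in auto)
  have "comm_monoid A"
    by (rule comm_monoidI) (use cl one assoc' one' comm' in auto)
  then have "cring A"
    by (intro cringI M.abelian_group_axioms) (simp_all add: rd)
  then show ?thesis
    by (intro algebraI R.is_cring)
      (simp_all add: smult_l_distr smult_r_distr smult_assoc1 rd)
qed

lemma algebra_surj_image:
  assumes "algebra C M" and surj: "carrier N = p ` carrier M"
    and add: "\<And>x y. x \<in> carrier M \<Longrightarrow> y \<in> carrier M \<Longrightarrow> p x \<oplus>\<^bsub>N\<^esub> p y = p (x \<oplus>\<^bsub>M\<^esub> y)"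
    and smult: "\<And>c x. c \<in> carrier C \<Longrightarrow> x \<in> carrier M \<Longrightarrow> c \<odot>\<^bsub>N\<^esub> p x = p (c \<odot>\<^bsub>M\<^esub> x)"
    and mult: "\<And>x y. x \<in> carrier M \<Longrightarrow> y \<in> carrier M \<Longrightarrow> p x \<otimes>\<^bsub>N\<^esub> p y = p (x \<otimes>\<^bsub>M\<^esub> y)"
    and zero: "\<zero>\<^bsub>N\<^esub> = p \<zero>\<^bsub>M\<^esub>" and one: "\<one>\<^bsub>N\<^esub> = p \<one>\<^bsub>M\<^esub>"
  shows "algebra C N"
proof -
  interpret M: algebra C M by fact
  interpret N: module C N
    by (rule module_surj_image[OF M.module_axioms surj add smult zero])
  have "comm_monoid N"
    by (rule comm_monoidI) (auto simp: surj mult one M.m_assoc intro: arg_cong[where f = p, OF M.m_comm])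
  then have "cring N"
    by (intro cringI N.M.abelian_group_axioms) (auto simp: surj mult add M.l_distr)
  then show ?thesis
    by (intro algebraI M.R_cring)
      (auto simp: N.smult_l_distr N.smult_r_distr N.smult_assoc1, auto simp: surj mult smult M.smult_assoc2)
qed

lemma algebra_ideal_submodule:
  assumes "algebra C A" "ideal J A"
  shows "submodule J C A"
proof -
  interpret A: algebra C A by fact
  interpret J: ideal J A by fact
  show ?thesis
  proof (rule A.submoduleI)
    fix c x assume c: "c \<in> carrier C" and x: "x \<in> J"
    then have xA: "x \<in> carrier A" by simp
    have "c \<odot>\<^bsub>A\<^esub> x = (c \<odot>\<^bsub>A\<^esub> \<one>\<^bsub>A\<^esub>) \<otimes>\<^bsub>A\<^esub> x"
      using c xA by (simp add: A.smult_assoc2)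
    also have "\<dots> \<in> J" using c x by (intro J.I_l_closed) auto
    finally show "c \<odot>\<^bsub>A\<^esub> x \<in> J" .
  qed (auto simp: J.a_subset)
qed

section \<open>Quotients of algebras by ideals\<close>

context
  fixes C :: "('c, 'm) ring_scheme" and A :: "('c, 'a) module" and J :: "'a set"
  assumes A: "algebra C A" and J: "ideal J A"
begin

interpretation A: algebra C A by (rule A)

interpretation J: ideal J A by (rule J)

private lemma J_sub: "submodule J C A" by (rule algebra_ideal_submodule[OF A J])

lemma quotient_algebra_mult:
  "x \<in> carrier A \<Longrightarrow> y \<in> carrier A \<Longrightarrow>
    (J +>\<^bsub>A\<^esub> x) \<otimes>\<^bsub>quotient_module A J\<^esub> (J +>\<^bsub>A\<^esub> y) = J +>\<^bsub>A\<^esub> (x \<otimes>\<^bsub>A\<^esub> y)"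
  by (simp add: quotient_module_simps J.rcoset_mult_add)

lemma quotient_algebra: "algebra C (quotient_module A J)"
proof (rule algebra_surj_image[OF A quotient_carrier[OF A.module_axioms J_sub]])
  show "\<zero>\<^bsub>quotient_module A J\<^esub> = J +>\<^bsub>A\<^esub> \<zero>\<^bsub>A\<^esub>"
    using linear_map_zero[OF A.module_axioms quotient_module_module[OF A.module_axioms J_sub]
      quotient_proj_linear[OF A.module_axioms J_sub]] by simp
qed (simp_all add: quotient_add[OF A.module_axioms J_sub] quotient_smult[OF A.module_axioms J_sub]
    quotient_algebra_mult quotient_module_simps(5))

lemma quotient_algebra_extend:
  assumes K: "algebra C K" and h: "linear_map C A K h" "h \<one>\<^bsub>A\<^esub> = \<one>\<^bsub>K\<^esub>"
    "\<And>x y. x \<in> carrier A \<Longrightarrow> y \<in> carrier A \<Longrightarrow> h (x \<otimes>\<^bsub>A\<^esub> y) = h x \<otimes>\<^bsub>K\<^esub> h y"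
    and z: "\<And>x. x \<in> J \<Longrightarrow> h x = \<zero>\<^bsub>K\<^esub>"
  obtains k where "linear_map C (quotient_module A J) K k"
    "k \<one>\<^bsub>quotient_module A J\<^esub> = \<one>\<^bsub>K\<^esub>"
    "\<And>x y. x \<in> carrier (quotient_module A J) \<Longrightarrow> y \<in> carrier (quotient_module A J) \<Longrightarrow>
       k (x \<otimes>\<^bsub>quotient_module A J\<^esub> y) = k x \<otimes>\<^bsub>K\<^esub> k y"
    "\<And>x. x \<in> carrier A \<Longrightarrow> k (J +>\<^bsub>A\<^esub> x) = h x"
proof -
  interpret K: algebra C K by fact
  obtain k where k: "linear_map C (quotient_module A J) K k" "\<And>x. x \<in> carrier A \<Longrightarrow> k (J +>\<^bsub>A\<^esub> x) = h x"
    using quotient_extend[OF A.module_axioms J_sub K.module_axioms h(1) z] by blast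
  show thesis
  proof (rule that[OF k(1) _ _ k(2)])
    fix x y assume "x \<in> carrier (quotient_module A J)" "y \<in> carrier (quotient_module A J)"
    then show "k (x \<otimes>\<^bsub>quotient_module A J\<^esub> y) = k x \<otimes>\<^bsub>K\<^esub> k y"
      by (auto simp: quotient_carrier[OF A.module_axioms J_sub] quotient_algebra_mult k(2) h(3))
  qed (simp_all add: quotient_module_simps(5) k(2) h(2))
qed

end

lemma ideal_kernel:
  assumes A: "algebra C A" and K: "algebra C K" and h: "linear_map C A K h"
    "\<And>x y. x \<in> carrier A \<Longrightarrow> y \<in> carrier A \<Longrightarrow> h (x \<otimes>\<^bsub>A\<^esub> y) = h x \<otimes>\<^bsub>K\<^esub> h y"
  shows "ideal {x \<in> carrier A. h x = \<zero>\<^bsub>K\<^esub>} A"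
proof -
  interpret A: algebra C A by fact
  interpret K: algebra C K by fact
  have "submodule {x \<in> carrier A. h x \<in> {\<zero>\<^bsub>K\<^esub>}} C A"
    by (intro linear_map_vimage_submodule[OF A.module_axioms K.module_axioms h(1)]
        zero_submodule K.module_axioms)
  then have "subgroup {x \<in> carrier A. h x = \<zero>\<^bsub>K\<^esub>} (add_monoid A)"
    using submodule.axioms(1) by fastforce
  then show ?thesis
    by (intro idealI A.ring_axioms) (auto simp: h(2) linear_mapD(1)[OF h(1)])
qed


subsection \<open>Products over multisets\<close>

text \<open>A fold over a multiset is only meaningful if its steps commute on the whole type, while
  \<open>K\<close> is commutative only on its carrier. The guard makes every step outside the
  carrier the identity.\<close>

definition mset_prod :: "('k, 'm) monoid_scheme \<Rightarrow> ('a \<Rightarrow> 'k) \<Rightarrow> 'a multiset \<Rightarrow> 'k" where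
  "mset_prod K e u = fold_mset
     (\<lambda>m s. if e m \<in> carrier K \<and> s \<in> carrier K then e m \<otimes>\<^bsub>K\<^esub> s else s) \<one>\<^bsub>K\<^esub> u"

context comm_monoid
begin

lemma mset_prod_empty [simp]: "mset_prod G e {#} = \<one>"
  by (simp add: mset_prod_def)

lemma mset_prod_closed_add:
  assumes "\<And>m. m \<in># u \<Longrightarrow> e m \<in> carrier G"
  shows "mset_prod G e u \<in> carrier G"
    and "e m \<in> carrier G \<Longrightarrow> mset_prod G e (add_mset m u) = e m \<otimes> mset_prod G e u"
proof -
  interpret comp_fun_commute "\<lambda>m s. if e m \<in> carrier G \<and> s \<in> carrier G then e m \<otimes> s else s"
    by unfold_locales (auto simp: fun_eq_iff m_lcomm)
  have add: "mset_prod G e (add_mset m u) = e m \<otimes> mset_prod G e u"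
    if "e m \<in> carrier G" "mset_prod G e u \<in> carrier G" for m u
    using that by (simp add: mset_prod_def fold_mset_add_mset)
  show cl: "mset_prod G e u \<in> carrier G"
    using assms by (induction u) (auto simp: add)
  show "e m \<in> carrier G \<Longrightarrow> mset_prod G e (add_mset m u) = e m \<otimes> mset_prod G e u"
    by (rule add[OF _ cl])
qed

lemma mset_prod_union:
  assumes "\<And>m. m \<in># u \<Longrightarrow> e m \<in> carrier G" "\<And>m. m \<in># v \<Longrightarrow> e m \<in> carrier G"
  shows "mset_prod G e (u + v) = mset_prod G e u \<otimes> mset_prod G e v"
  using assms(1)
proof (induction u)
  case (add m u)
  have "e m' \<in> carrier G" if "m' \<in># u + v" for m' using add.prems assms(2) that by auto
  then show ?case
    using add mset_prod_closed_add(2)[of "u + v" e m] mset_prod_closed_add[of u e]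
      mset_prod_closed_add(1)[of v e] assms(2) by (simp add: m_assoc)
qed (simp add: mset_prod_closed_add assms(2))

end

lemma mset_prod_multilinear:
  assumes "algebra C K" "linear_map C M K e" "module C M"
  shows "mset_multilinear C M K UNIV (mset_prod K e)"
  unfolding mset_multilinear_def
proof (intro allI impI)
  interpret K: algebra C K by fact
  fix u assume u: "set_mset u \<subseteq> carrier M \<and> size u + 1 \<in> UNIV"
  note ed = linear_mapD[OF assms(2)]
  have eu: "m \<in># u \<Longrightarrow> e m \<in> carrier K" for m using u ed(1) by auto
  have "linear_map C M K (\<lambda>x. e x \<otimes>\<^bsub>K\<^esub> mset_prod K e u)"
    by (rule linear_map_comp[OF assms(2) bilinear_mapD(2)[OF algebra_mult_bilinear[OF assms(1)]
      K.mset_prod_closed_add(1)[OF eu]]])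
  then show "linear_map C M K (\<lambda>x. mset_prod K e (add_mset x u))"
    by (rule linear_map_cong[OF _ assms(3)]) (simp add: K.mset_prod_closed_add(2)[OF eu] ed)
qed


subsection \<open>The symmetric algebra\<close>

context sym_powers_of
begin

abbreviation "D \<equiv> direct_sum UNIV (sym_power C M)"

abbreviation "U \<equiv> {u. set_mset u \<subseteq> carrier M}"

abbreviation "SA \<equiv> sym_algebra C M"

lemma sym_algebra_simps:
  "carrier SA = carrier D" "ring.zero SA = ring.zero D"
  "ring.add SA = ring.add D" "module.smult SA = module.smult D"
  "\<one>\<^bsub>SA\<^esub> = sym_monomial C M {#}"
  by (simp_all add: sym_algebra_def Let_def)

lemma D_module: "module C D"
  using tot_module by (simp add: tot_eq)

lemma SA_module: "module C SA"
  by (rule module_transfer_cong[OF D_module]) (simp_all add: sym_algebra_simps)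

lemma linear_D: "linear_map C SA = linear_map C D" "linear_map C L SA = linear_map C L D"
  by (rule linear_map_transfer_cong; simp add: sym_algebra_simps)+

lemma sym_monomial_closed: "set_mset u \<subseteq> carrier M \<Longrightarrow> sym_monomial C M u \<in> carrier SA"
  using universalD(1)[OF universal_sym_monomial[OF D_module]] by (simp add: sym_algebra_simps)

lemma sym_algebra_span: "submodule_span C SA (sym_monomial C M ` U) = carrier SA"
  using universalD(2)[OF universal_sym_monomial[OF D_module]]
    submodule_span_transfer_cong[of SA D C "sym_monomial C M ` U"]
  by (simp add: sym_algebra_simps)

text \<open>Adding a fixed multiset turns a slot into a slot, so the prescribed product is
  multilinear in the first argument, and in the second one because union of multisets is
  commutative.\<close>

lemma sym_algebra_mult:
  "bilinear_map C SA SA SA (monoid.mult SA)"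
  "set_mset u \<subseteq> carrier M \<Longrightarrow> set_mset v \<subseteq> carrier M \<Longrightarrow>
    sym_monomial C M u \<otimes>\<^bsub>SA\<^esub> sym_monomial C M v = sym_monomial C M (u + v)"
proof -
  have ml: "linear_map C M D (\<lambda>x. sym_monomial C M (add_mset x u))" if "set_mset u \<subseteq> carrier M" for u
    using sym_monomial_multilinear that by (auto simp: mset_multilinear_def)
  have 1: "mset_multilinear C M D UNIV (\<lambda>i. sym_monomial C M (i + j))" if "j \<in> U" for j
    unfolding mset_multilinear_def
  proof (intro allI impI)
    fix u assume "set_mset u \<subseteq> carrier M \<and> size u + 1 \<in> UNIV"
    then show "linear_map C M D (\<lambda>x. sym_monomial C M (add_mset x u + j))"
      using ml[of "u + j"] that by simp
  qed
  have 2: "mset_multilinear C M D UNIV (\<lambda>j. sym_monomial C M (i + j))" if "i \<in> U" for i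
    using 1[OF that] by (simp add: add.commute)
  obtain b where b: "bilinear_map C D D D b"
    "\<And>u v. u \<in> U \<Longrightarrow> v \<in> U \<Longrightarrow> b (sym_monomial C M u) (sym_monomial C M v) = sym_monomial C M (u + v)"
  proof (rule universal_bilinear[OF D_module D_module D_module universal_sym_monomial[OF D_module]
      universal_sym_monomial[OF D_module] mset_multilinear_condition[OF D_module],
      where v = "\<lambda>u v. sym_monomial C M (u + v)"])
    show "sym_monomial C M (i + j) \<in> carrier D" if "i \<in> U" "j \<in> U" for i j
      using sym_monomial_closed[of "i + j"] that by (simp add: sym_algebra_simps)
  qed (use 1 2 in blast)+
  have m: "monoid.mult SA = bilinear_ext C D D D U (sym_monomial C M) U (sym_monomial C M)
      (\<lambda>u v. sym_monomial C M (u + v))"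
    by (simp add: sym_algebra_def Let_def)
  note ext = bilinear_ext_works[of C D D D b U U "sym_monomial C M" "sym_monomial C M"
      "\<lambda>u v. sym_monomial C M (u + v)", OF b]
  show "bilinear_map C SA SA SA (monoid.mult SA)"
    using ext(1) unfolding m bilinear_map_def linear_D sym_algebra_simps .
  show "set_mset u \<subseteq> carrier M \<Longrightarrow> set_mset v \<subseteq> carrier M \<Longrightarrow>
    sym_monomial C M u \<otimes>\<^bsub>SA\<^esub> sym_monomial C M v = sym_monomial C M (u + v)"
    using ext(2)[of u v] unfolding m by blast
qed

lemma sym_algebra_algebra: "algebra C SA"
proof (rule algebra_spanI[OF SA_module sym_algebra_mult(1) sym_algebra_span])
  show "\<one>\<^bsub>SA\<^esub> \<in> carrier SA"
    unfolding sym_algebra_simps(5) by (rule sym_monomial_closed) simp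
next
  fix i j assume "i \<in> U" "j \<in> U"
  then show "sym_monomial C M i \<otimes>\<^bsub>SA\<^esub> sym_monomial C M j = sym_monomial C M j \<otimes>\<^bsub>SA\<^esub> sym_monomial C M i"
    by (simp add: sym_algebra_mult(2) add.commute)
next
  fix i j k assume "i \<in> U" "j \<in> U" "k \<in> U"
  then show "(sym_monomial C M i \<otimes>\<^bsub>SA\<^esub> sym_monomial C M j) \<otimes>\<^bsub>SA\<^esub> sym_monomial C M k =
      sym_monomial C M i \<otimes>\<^bsub>SA\<^esub> (sym_monomial C M j \<otimes>\<^bsub>SA\<^esub> sym_monomial C M k)"
    by (simp add: sym_algebra_mult(2) add.assoc)
next
  fix i assume "i \<in> U"
  then show "\<one>\<^bsub>SA\<^esub> \<otimes>\<^bsub>SA\<^esub> sym_monomial C M i = sym_monomial C M i"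
    unfolding sym_algebra_simps(5) by (simp add: sym_algebra_mult(2))
qed

lemma sym_gen_linear: "linear_map C M SA (\<lambda>m. sym_monomial C M {#m#})"
  using sym_monomial_multilinear by (simp add: mset_multilinear_def linear_D)

text \<open>Induction for subalgebras: degree-one generators suffice, and of these only the ones
  coming from a spanning set \<open>X\<close> of \<open>M\<close>, since they depend linearly on the
  element of \<open>M\<close>.\<close>

lemma sym_algebra_induct:
  assumes H: "submodule H C SA" "\<one>\<^bsub>SA\<^esub> \<in> H" "\<And>x y. x \<in> H \<Longrightarrow> y \<in> H \<Longrightarrow> x \<otimes>\<^bsub>SA\<^esub> y \<in> H"
    and X: "submodule_span C M X = carrier M" "\<And>m. m \<in> X \<Longrightarrow> sym_monomial C M {#m#} \<in> H"
    and x: "x \<in> carrier SA"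
  shows "x \<in> H"
proof -
  have m: "sym_monomial C M {#m#} \<in> H" if "m \<in> carrier M" for m
    by (rule linear_map_span_image[OF M SA_module sym_gen_linear X(1) H(1) _ that]) (use X(2) in blast)
  have "set_mset u \<subseteq> carrier M \<Longrightarrow> sym_monomial C M u \<in> H" for u
  proof (induction u)
    case empty
    then show ?case using H(2) by (simp add: sym_algebra_simps)
  next
    case (add m u)
    have "sym_monomial C M {#m#} \<otimes>\<^bsub>SA\<^esub> sym_monomial C M u \<in> H"
      using add m by (intro H(3)) auto
    then show ?case using add.prems by (simp add: sym_algebra_mult(2))
  qed
  then show ?thesis
    by (intro span_carrier_induct[OF sym_algebra_span H(1) _ x]) auto
qed

text \<open>A monomial goes to the product of the values of \<open>e\<close> over its multiset. This
  is multilinear, hence extends linearly, and it turns unions of multisets into products, hence is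
  multiplicative.\<close>

lemma sym_algebra_extend:
  assumes B: "algebra C B" and e: "linear_map C M B e"
  obtains h where "linear_map C SA B h" "h \<one>\<^bsub>SA\<^esub> = \<one>\<^bsub>B\<^esub>"
    "\<And>x y. x \<in> carrier SA \<Longrightarrow> y \<in> carrier SA \<Longrightarrow> h (x \<otimes>\<^bsub>SA\<^esub> y) = h x \<otimes>\<^bsub>B\<^esub> h y"
    "\<And>m. m \<in> carrier M \<Longrightarrow> h (sym_monomial C M {#m#}) = e m"
proof -
  interpret B: algebra C B by fact
  have cl: "m \<in># u \<Longrightarrow> e m \<in> carrier B" if "u \<in> U" for u m
    using that linear_mapD(1)[OF e] by auto
  have "mset_prod B e \<in> U \<rightarrow> carrier B"
    by (intro Pi_I B.mset_prod_closed_add(1)) (rule cl)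
  from universal_ex[OF universal_sym_monomial[OF B.module_axioms] this mset_prod_multilinear[OF B e M]]
  obtain h where h: "linear_map C D B h" "\<And>u. u \<in> U \<Longrightarrow> h (sym_monomial C M u) = mset_prod B e u"
    by blast
  have hSA: "linear_map C SA B h" using h(1) by (simp add: linear_D)
  have "h (x \<otimes>\<^bsub>SA\<^esub> y) = h x \<otimes>\<^bsub>B\<^esub> h y" if "x \<in> carrier SA" "y \<in> carrier SA" for x y
  proof (rule bilinear_map_eqI[OF SA_module SA_module B.module_axioms _ _ sym_algebra_span sym_algebra_span _ that])
    show "bilinear_map C SA SA B (\<lambda>x y. h (x \<otimes>\<^bsub>SA\<^esub> y))"
      using sym_algebra_mult(1) hSA by (intro bilinear_mapI linear_map_comp[OF _ hSA] bilinear_mapD[OF sym_algebra_mult(1)])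
    show "bilinear_map C SA SA B (\<lambda>x y. h x \<otimes>\<^bsub>B\<^esub> h y)"
      by (rule bilinear_map_comp[OF algebra_mult_bilinear[OF B] hSA hSA])
    fix u v assume "u \<in> U" "v \<in> U"
    then show "h (sym_monomial C M u \<otimes>\<^bsub>SA\<^esub> sym_monomial C M v) =
        h (sym_monomial C M u) \<otimes>\<^bsub>B\<^esub> h (sym_monomial C M v)"
      using B.mset_prod_union[of u e v] cl by (simp add: sym_algebra_mult(2) h(2))
  qed
  moreover have "h (sym_monomial C M {#m#}) = e m" if "m \<in> carrier M" for m
    using h(2)[of "{#m#}"] that linear_mapD(1)[OF e that] B.mset_prod_closed_add(2)[of "{#}" e m] by simp
  ultimately show thesis
    using that[OF hSA] h(2)[of "{#}"] by (simp add: sym_algebra_simps)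
qed

end


subsection \<open>Tensor products of algebras\<close>

lemma tensor_algebra_product_simps:
  "carrier (tensor_algebra_product C A B) = carrier (tensor_module C A B)"
  "ring.zero (tensor_algebra_product C A B) = ring.zero (tensor_module C A B)"
  "ring.add (tensor_algebra_product C A B) = ring.add (tensor_module C A B)"
  "module.smult (tensor_algebra_product C A B) = module.smult (tensor_module C A B)"
  "\<one>\<^bsub>tensor_algebra_product C A B\<^esub> = tensor C A B \<one>\<^bsub>A\<^esub> \<one>\<^bsub>B\<^esub>"
  by (simp_all add: tensor_algebra_product_def Let_def)

context
  fixes C :: "('c, 'm) ring_scheme" and A :: "('c, 'a) module" and B :: "('c, 'b) module"
  assumes C: "cring C" and A: "module C A" and B: "module C B"
begin

private abbreviation "TP \<equiv> tensor_algebra_product C A B"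

private abbreviation "TM \<equiv> tensor_module C A B"

private lemma TM_module: "module C TM" by (rule tensor_module_module[OF C A B])

lemma tensor_product_module: "module C TP"
  by (rule module_transfer_cong[OF TM_module]) (simp_all add: tensor_algebra_product_simps)

lemma tensor_product_linear:
  "linear_map C TP = linear_map C TM" "linear_map C L TP = linear_map C L TM"
  by (rule linear_map_transfer_cong; simp add: tensor_algebra_product_simps)+

lemma tensor_product_bilinear: "bilinear_map C A B TP (tensor C A B)"
  using tensor_bilinear[OF C A B] by (simp add: bilinear_map_def tensor_product_linear)

lemma tensor_product_span:
  assumes "submodule_span C TM X = carrier TM"
  shows "submodule_span C TP X = carrier TP"
  using assms submodule_span_transfer_cong[of TP TM C X]
  by (simp add: tensor_algebra_product_simps)

lemma universal_tensor_product:
  assumes "module C P" "universal C A I e okM P" "universal C B J e' okN P" "linear_condition C P J okN"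
  shows "universal C TP (I \<times> J) (\<lambda>(i, j). tensor C A B (e i) (e' j))
    (\<lambda>v. (\<forall>j\<in>J. okM (\<lambda>i. v (i, j))) \<and> (\<forall>i\<in>I. okN (\<lambda>j. v (i, j)))) P"
  using universal_tensor[OF C A B assms] tensor_product_span
  by (simp add: universal_def tensor_product_linear tensor_algebra_product_simps)

text \<open>The factors are modules with bilinear products rather than algebras, the form in which
  \<open>C\<^sub>2T\<close> and the products built from it are available. The pairs of arbitrary
  elements serve as spanning family, so \<open>universal_self\<close> supplies both
  conditions.\<close>

lemma tensor_product_mult:
  assumes multA: "bilinear_map C A A A (monoid.mult A)" and multB: "bilinear_map C B B B (monoid.mult B)"
  shows "bilinear_map C TP TP TP (monoid.mult TP)"
    and "x \<in> carrier A \<Longrightarrow> x' \<in> carrier A \<Longrightarrow> y \<in> carrier B \<Longrightarrow> y' \<in> carrier B \<Longrightarrow>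
      tensor C A B x y \<otimes>\<^bsub>TP\<^esub> tensor C A B x' y' = tensor C A B (x \<otimes>\<^bsub>A\<^esub> x') (y \<otimes>\<^bsub>B\<^esub> y')"
proof -
  let ?P = "carrier A \<times> carrier B" and ?e = "\<lambda>(x, y). tensor C A B x y"
    and ?v = "\<lambda>(x, y) (x', y'). tensor C A B (x \<otimes>\<^bsub>A\<^esub> x') (y \<otimes>\<^bsub>B\<^esub> y')"
    and ?ok = "\<lambda>v. (\<forall>j\<in>carrier B. linear_map C A TM (\<lambda>i. v (i, j))) \<and>
      (\<forall>i\<in>carrier A. linear_map C B TM (\<lambda>j. v (i, j)))"
  have u: "universal C TM ?P ?e ?ok TM"
    by (rule universal_tensor[OF C A B TM_module universal_self[OF A] universal_self[OF B]
          linear_condition_linear_map[OF TM_module B]])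
  have lc: "linear_condition C TM ?P ?ok"
    by (rule linear_condition_prod[OF linear_condition_linear_map[OF TM_module A]
          linear_condition_linear_map[OF TM_module B]])
  note Acl = bilinear_map_closed[OF multA] and Bcl = bilinear_map_closed[OF multB]
  note t = tensor_bilinear[OF C A B]
  have l: "linear_map C A TM (\<lambda>x. tensor C A B (f x) y)" if "linear_map C A A f" "y \<in> carrier B" for f y
    by (rule linear_map_comp[OF that(1) bilinear_mapD(2)[OF t that(2)]])
  have r: "linear_map C B TM (\<lambda>y. tensor C A B x (f y))" if "linear_map C B B f" "x \<in> carrier A" for f x
    by (rule linear_map_comp[OF that(1) bilinear_mapD(1)[OF t that(2)]])
  obtain b where b: "bilinear_map C TM TM TM b" "\<And>p q. p \<in> ?P \<Longrightarrow> q \<in> ?P \<Longrightarrow> b (?e p) (?e q) = ?v p q"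
  proof (rule universal_bilinear[OF TM_module TM_module TM_module u u lc, where v = ?v])
    show "?v p q \<in> carrier TM" if "p \<in> ?P" "q \<in> ?P" for p q
      using that by (auto intro!: tensor_closed[OF C A B] Acl Bcl)
    show "?ok (\<lambda>p. ?v p q)" if "q \<in> ?P" for q
      using that by (auto intro!: l r Acl Bcl bilinear_mapD[OF multA] bilinear_mapD[OF multB])
    show "?ok (?v p)" if "p \<in> ?P" for p
      using that by (auto intro!: l r Acl Bcl bilinear_mapD[OF multA] bilinear_mapD[OF multB])
  qed blast
  have m: "monoid.mult TP = bilinear_ext C TM TM TM ?P ?e ?P ?e ?v"
    by (simp add: tensor_algebra_product_def Let_def)
  note ext = bilinear_ext_works[of C TM TM TM b ?P ?P ?e ?e ?v, OF b]
  show "bilinear_map C TP TP TP (monoid.mult TP)"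
    using ext(1)
    unfolding m bilinear_map_def tensor_product_linear tensor_algebra_product_simps .
  show "x \<in> carrier A \<Longrightarrow> x' \<in> carrier A \<Longrightarrow> y \<in> carrier B \<Longrightarrow> y' \<in> carrier B \<Longrightarrow>
      tensor C A B x y \<otimes>\<^bsub>TP\<^esub> tensor C A B x' y' = tensor C A B (x \<otimes>\<^bsub>A\<^esub> x') (y \<otimes>\<^bsub>B\<^esub> y')"
    using ext(2)[of "(x, y)" "(x', y')"] unfolding m by simp
qed

end


section \<open>The shuffle product\<close>

text \<open>The recursion pattern of \<open>shuffle\<close> without its ring and module parameters.
  It also drives the product formula for iterated integrals, where differentiating a product strips
  a letter from one of the two words.\<close>

lemma shuffle_words_induct [case_names Nil1 Nil2 Cons]:
  assumes "\<And>g. P [] g" "\<And>x f. P (x # f) []"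
    and "\<And>x f y g. P f (y # g) \<Longrightarrow> P (x # f) g \<Longrightarrow> P (x # f) (y # g)"
  shows "P f g"
proof (induction f arbitrary: g)
  case (Cons x f)
  show ?case by (induction g) (auto intro: assms Cons)
qed (rule assms)

context tensors_of
begin

lemma word_multilinearD:
  "word_multilinear C M P f \<Longrightarrow> u \<in> lists (carrier M) \<Longrightarrow> v \<in> lists (carrier M) \<Longrightarrow>
    linear_map C M P (\<lambda>x. f (u @ [x] @ v))"
  by (simp add: word_multilinear_def)

lemma word_multilinearI:
  "(\<And>u v. u \<in> lists (carrier M) \<Longrightarrow> v \<in> lists (carrier M) \<Longrightarrow> linear_map C M P (\<lambda>x. f (u @ [x] @ v)))
    \<Longrightarrow> word_multilinear C M P f"
  by (simp add: word_multilinear_def)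

lemma word_multilinear_comp:
  assumes "word_multilinear C M P f" "linear_map C P P' h"
  shows "word_multilinear C M P' (\<lambda>w. h (f w))"
  by (rule word_multilinearI, rule linear_map_comp[OF word_multilinearD[OF assms(1)] assms(2)])

lemma pure_slot_linear:
  "u \<in> lists (carrier M) \<Longrightarrow> v \<in> lists (carrier M) \<Longrightarrow>
    linear_map C M (tensors C M) (\<lambda>x. pure_tensor C M (u @ x # v))"
  using pure_multilinear by (simp add: word_multilinear_def)

context
  fixes x assumes x: "x \<in> carrier M"
begin

private lemma cons_multilinear: "word_multilinear C M (tensors C M) (\<lambda>w. pure_tensor C M (x # w))"
proof (rule word_multilinearI)
  fix u v assume "u \<in> lists (carrier M)" "v \<in> lists (carrier M)"
  then show "linear_map C M (tensors C M) (\<lambda>y. pure_tensor C M (x # u @ [y] @ v))"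
    using pure_slot_linear[of "x # u" v] x by simp
qed

lemma cons_linear: "linear_map C (tensors C M) (tensors C M) (tensor_cons C M x)"
  unfolding tensor_cons_def
  by (rule linear_ext_works(1)[OF universal_pure[OF tensors_module]])
    (simp_all add: x pure_closed cons_multilinear)

lemma cons_pure: "w \<in> lists (carrier M) \<Longrightarrow> tensor_cons C M x (pure_tensor C M w) = pure_tensor C M (x # w)"
  unfolding tensor_cons_def
  by (rule linear_ext_works(2)[OF universal_pure[OF tensors_module]])
    (simp_all add: x pure_closed cons_multilinear)

lemma cons_pos: "t \<in> carrier (tensors C M) \<Longrightarrow> tensor_cons C M x t \<in> carrier (tensors_pos C M)"
  by (rule linear_map_span_image[OF tensors_module tensors_module cons_linear pure_span tensors_pos_submodule])
    (auto simp: cons_pure[unfolded in_lists_conv_set] x intro!: pure_pos_closed)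

end

text \<open>Each \<open>tensor_cons C M x\<close> is a choice of its own, so linearity in
  \<open>x\<close> has to be tested on pure tensors, where it is linearity of a pure tensor in its
  first letter.\<close>

lemma cons_linear_left:
  assumes t: "t \<in> carrier (tensors C M)"
  shows "linear_map C M (tensors C M) (\<lambda>x. tensor_cons C M x t)"
proof (rule linear_mapI)
  interpret M: module C M by (rule M)
  note cl = linear_mapD(1)[OF cons_linear]
  show "tensor_cons C M x t \<in> carrier (tensors C M)" if "x \<in> carrier M" for x
    by (rule cl[OF that t])
  fix x y assume x: "x \<in> carrier M" and y: "y \<in> carrier M"
  show "tensor_cons C M (x \<oplus>\<^bsub>M\<^esub> y) t = tensor_cons C M x t \<oplus>\<^bsub>tensors C M\<^esub> tensor_cons C M y t"
    by (rule linear_map_eqI[OF tensors_module tensors_module cons_linear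
          linear_map_fun_add[OF tensors_module cons_linear cons_linear] pure_span _ t])
      (use x y linear_mapD(2)[OF pure_slot_linear[of "[]"]] in \<open>simp_all add: cons_pure\<close>)
next
  interpret M: module C M by (rule M)
  fix c x assume c: "c \<in> carrier C" and x: "x \<in> carrier M"
  show "tensor_cons C M (c \<odot>\<^bsub>M\<^esub> x) t = c \<odot>\<^bsub>tensors C M\<^esub> tensor_cons C M x t"
    by (rule linear_map_eqI[OF tensors_module tensors_module cons_linear
          linear_map_fun_smult[OF tensors_module cons_linear c] pure_span _ t])
      (use x c linear_mapD(3)[OF pure_slot_linear[of "[]"]] in \<open>simp_all add: cons_pure\<close>)
qed

lemma shuffle_Nil2 [simp]: "shuffle C M f [] = pure_tensor C M f"
  by (cases f) simp_all

lemma shuffle_closed: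
  "f \<in> lists (carrier M) \<Longrightarrow> g \<in> lists (carrier M) \<Longrightarrow> shuffle C M f g \<in> carrier (tensors C M)"
proof (induction f g rule: shuffle_words_induct)
  case (Cons x f y g)
  interpret T: module C "tensors C M" by (rule tensors_module)
  show ?case using Cons linear_mapD(1)[OF cons_linear] by simp
qed (simp_all add: pure_closed)

lemma shuffle_pos_closed:
  assumes "f \<in> lists (carrier M)" "g \<in> lists (carrier M)" "f \<noteq> [] \<or> g \<noteq> []"
  shows "shuffle C M f g \<in> carrier (tensors_pos C M)"
proof -
  interpret T: module C "tensors C M" by (rule tensors_module)
  show ?thesis
    using assms
  proof (cases f; cases g)
    fix x f' y g' assume fg: "f = x # f'" "g = y # g'"
    show ?thesis
      unfolding fg shuffle.simps
      using T.submoduleE(5)[OF tensors_pos_submodule cons_pos cons_pos] assms(1,2) fg shuffle_closed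
      by simp
  qed (simp_all add: pure_pos_closed)
qed

lemma shuffle_commute:
  "f \<in> lists (carrier M) \<Longrightarrow> g \<in> lists (carrier M) \<Longrightarrow> shuffle C M f g = shuffle C M g f"
proof (induction f g rule: shuffle_words_induct)
  case (Cons x f y g)
  interpret T: module C "tensors C M" by (rule tensors_module)
  show ?case using Cons linear_mapD(1)[OF cons_linear] shuffle_closed
    by (simp add: T.M.a_comm)
qed simp_all

text \<open>The induction follows the shuffle recursion on the prefix \<open>u\<close> and on
  \<open>g\<close>. Once \<open>u\<close> is used up, the varied letter is at the head: it is then
  either split off by \<open>tensor_cons\<close>, which is linear in it, or kept while
  \<open>g\<close> gets shorter, whence the inner induction on \<open>g\<close>.\<close>

lemma shuffle_multilinear_left:
  assumes "g \<in> lists (carrier M)"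
  shows "word_multilinear C M (tensors C M) (\<lambda>f. shuffle C M f g)"
proof (rule word_multilinearI)
  fix u v assume "u \<in> lists (carrier M)" and v: "v \<in> lists (carrier M)"
  then show "linear_map C M (tensors C M) (\<lambda>z. shuffle C M (u @ [z] @ v) g)"
    using assms
  proof (induction u g rule: shuffle_words_induct)
    case (Nil1 g)
    then show ?case
    proof (induction g)
      case Nil
      then show ?case using pure_slot_linear[of "[]" v] by simp
    next
      case (Cons y g)
      have "linear_map C M (tensors C M) (\<lambda>z. tensor_cons C M z (shuffle C M v (y # g)) \<oplus>\<^bsub>tensors C M\<^esub>
          tensor_cons C M y (shuffle C M ([] @ [z] @ v) g))"
        using Cons by (intro linear_map_fun_add[OF tensors_module] cons_linear_left shuffle_closed v
            linear_map_comp[OF Cons.IH cons_linear]) auto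
      then show ?case by simp
    qed
  next
    case (Nil2 x f)
    then show ?case using pure_slot_linear[of "x # f" v] by simp
  next
    case (Cons x f y g)
    have "linear_map C M (tensors C M)
        (\<lambda>z. tensor_cons C M x (shuffle C M (f @ [z] @ v) (y # g)) \<oplus>\<^bsub>tensors C M\<^esub>
          tensor_cons C M y (shuffle C M ((x # f) @ [z] @ v) g))"
      using Cons.prems by (intro linear_map_fun_add[OF tensors_module] linear_map_comp[OF Cons.IH(1) cons_linear]
          linear_map_comp[OF Cons.IH(2) cons_linear]) auto
    then show ?case by simp
  qed
qed

lemma shuffle_multilinear_right:
  assumes "f \<in> lists (carrier M)"
  shows "word_multilinear C M (tensors C M) (\<lambda>g. shuffle C M f g)"
proof (rule word_multilinearI)
  fix u v assume uv: "u \<in> lists (carrier M)" "v \<in> lists (carrier M)"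
  show "linear_map C M (tensors C M) (\<lambda>z. shuffle C M f (u @ [z] @ v))"
    by (rule linear_map_cong[OF word_multilinearD[OF shuffle_multilinear_left[OF assms] uv] M],
        rule shuffle_commute) (use uv assms in auto)
qed

text \<open>The number of cuts does not depend on the varied letter, so linearity can be shown cut
  by cut. For \<open>i \<le> length u\<close> the letter belongs to the suffix, otherwise to the
  prefix. The suffix is never empty because \<open>i\<close> is below the length, which matters
  since the second kind of constants exists only for tensors of positive degree.\<close>

lemma word_multilinear_cut_sum:
  assumes P: "module C P"
    and prefix: "\<And>i s. s \<in> lists (carrier M) \<Longrightarrow> s \<noteq> [] \<Longrightarrow> word_multilinear C M P (\<lambda>p. \<Phi> i p s)"
    and suffix: "\<And>i p. p \<in> lists (carrier M) \<Longrightarrow> word_multilinear C M P (\<lambda>s. \<Phi> i p s)"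
  shows "word_multilinear C M P (\<lambda>f. \<Oplus>\<^bsub>P\<^esub>i\<in>{0..<length f}. \<Phi> i (take i f) (drop i f))"
proof (rule word_multilinearI)
  fix u v assume u: "u \<in> lists (carrier M)" and v: "v \<in> lists (carrier M)"
  let ?n = "length u + 1 + length v"
  have "linear_map C M P (\<lambda>x. \<Phi> i (take i (u @ [x] @ v)) (drop i (u @ [x] @ v)))" if "i \<in> {0..<?n}" for i
  proof (cases "i \<le> length u")
    case True
    then show ?thesis
      using word_multilinearD[OF suffix, of "take i u" "drop i u" v i] u v
      by (auto dest: in_set_takeD in_set_dropD)
  next
    case False
    then have i: "i - length u = Suc (i - length u - 1)" by simp
    have "drop (i - length u - 1) v \<noteq> []" using that False by auto
    then have "linear_map C M P
        (\<lambda>x. \<Phi> i (u @ [x] @ take (i - length u - 1) v) (drop (i - length u - 1) v))"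
      using u v by (intro word_multilinearD[OF prefix]) (auto dest: in_set_takeD in_set_dropD)
    moreover have "take i (u @ [x] @ v) = u @ [x] @ take (i - length u - 1) v"
      "drop i (u @ [x] @ v) = drop (i - length u - 1) v" for x
      using False i by (simp_all add: take_Cons' drop_Cons')
    ultimately show ?thesis by simp
  qed
  then have "linear_map C M P (\<lambda>x. \<Oplus>\<^bsub>P\<^esub>i\<in>{0..<?n}. \<Phi> i (take i (u @ [x] @ v)) (drop i (u @ [x] @ v)))"
    by (intro linear_map_fun_finsum[OF P]) auto
  then show "linear_map C M P (\<lambda>x. \<Oplus>\<^bsub>P\<^esub>i\<in>{0..<length (u @ [x] @ v)}.
      \<Phi> i (take i (u @ [x] @ v)) (drop i (u @ [x] @ v)))"
    by simp
qed

end


section \<open>The operations of the free integro-differential ring\<close>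

context comm_differential_ring
begin

lemma deriv_zero: "deriv \<zero> = \<zero>"
  using deriv_add[of \<zero> \<zero>] deriv_closed[of \<zero>] by simp

lemma deriv_one: "deriv \<one> = \<zero>"
  using deriv_mult[of \<one> \<one>] deriv_closed[of \<one>] by simp

lemma deriv_a_inv: "x \<in> carrier R \<Longrightarrow> deriv (\<ominus> x) = \<ominus> deriv x"
  using deriv_add[of "\<ominus> x" x] deriv_closed by (simp add: l_neg deriv_zero minus_equality)

lemma constants_subset: "constants \<subseteq> carrier R"
  by (auto simp: constants_def)

lemma constants_cring: "cring (R\<lparr>carrier := constants\<rparr>)"
proof (rule cringI)
  show "abelian_group (R\<lparr>carrier := constants\<rparr>)"
    by (rule abelian_groupI)
      (auto simp: constants_def deriv_zero deriv_add deriv_a_inv a_ac r_neg intro!: exI[of _ "\<ominus> _"])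
  show "comm_monoid (R\<lparr>carrier := constants\<rparr>)"
    by (rule comm_monoidI) (auto simp: constants_def deriv_one deriv_mult m_ac)
qed (auto simp: constants_def l_distr)

end

section \<open>The decomposition of \<open>R\<close> given by \<open>Q\<close>, and the two algebras
  of constants\<close>

context comm_differential_ring_quasi
begin

lemma C_cring: "cring C" by (rule constants_cring)

lemma R_alg_algebra: "algebra C R_alg"
  using constants_subset
  by (intro algebraI C_cring cringI abelian_groupI comm_monoidI)
    (auto simp: a_ac m_ac l_distr r_distr r_neg subset_iff intro!: bexI[where x = "\<ominus> _"])

lemma R_alg_module: "module C R_alg"
  using R_alg_algebra by (simp add: algebra_def)

lemma const_linear_map: "const_linear h \<Longrightarrow> linear_map C R_alg R_alg h"
  by (simp add: const_linear_def linear_map_def)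

lemma Q_linear_map: "linear_map C R_alg R_alg Q"
  by (rule const_linear_map[OF Q_linear])

lemma deriv_linear_map: "linear_map C R_alg R_alg deriv"
  by (rule linear_mapI) (auto simp: constants_def deriv_closed deriv_add deriv_mult)

lemma Q_closed: "x \<in> carrier R \<Longrightarrow> Q x \<in> carrier R"
  using linear_mapD(1)[OF Q_linear_map] by simp

lemma RJ_submodule: "submodule (Q ` carrier R) C R_alg"
proof -
  interpret M: module C R_alg by (rule R_alg_module)
  note q = linear_mapD[OF Q_linear_map, simplified]
  show ?thesis
  proof (rule M.submoduleI)
    show "\<zero>\<^bsub>R_alg\<^esub> \<in> Q ` carrier R"
      using linear_map_zero[OF R_alg_module R_alg_module Q_linear_map]
      by (auto intro!: image_eqI[where x = \<zero>])
    fix a assume "a \<in> Q ` carrier R"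
    then obtain x where x: "x \<in> carrier R" "a = Q x" by auto
    then show "\<ominus>\<^bsub>R_alg\<^esub> a \<in> Q ` carrier R"
      using linear_map_a_inv[OF R_alg_module R_alg_module Q_linear_map, of x]
        M.M.a_inv_closed[of x] by (auto intro!: image_eqI[where x = "\<ominus>\<^bsub>R_alg\<^esub> x"])
  next
    fix a b assume "a \<in> Q ` carrier R" "b \<in> Q ` carrier R"
    then obtain x y where "x \<in> carrier R" "a = Q x" "y \<in> carrier R" "b = Q y" by auto
    then show "a \<oplus>\<^bsub>R_alg\<^esub> b \<in> Q ` carrier R"
      by (auto simp: q intro!: image_eqI[where x = "x \<oplus> y"])
  next
    fix c a assume "c \<in> carrier C" "a \<in> Q ` carrier R"
    then obtain x where "c \<in> constants" "x \<in> carrier R" "a = Q x" by auto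
    then show "c \<odot>\<^bsub>R_alg\<^esub> a \<in> Q ` carrier R"
      using constants_subset by (auto simp: q intro!: image_eqI[where x = "c \<otimes> x"])
  qed (use q in auto)
qed

lemma RT_submodule: "submodule {x \<in> carrier R. Q x = \<zero>} C R_alg"
  using linear_map_vimage_submodule[OF R_alg_module R_alg_module Q_linear_map
      zero_submodule[OF R_alg_module]] by simp

lemma RJ_module: "module C R\<^sub>J"
  unfolding R\<^sub>J_def by (rule submodule.submodule_is_module[OF RJ_submodule R_alg_module])

lemma RT_module: "module C R\<^sub>T"
  unfolding R\<^sub>T_def by (rule submodule.submodule_is_module[OF RT_submodule R_alg_module])

lemma RT_carrier: "carrier R\<^sub>T = {x \<in> carrier R. Q x = \<zero>}"
  by (simp add: R\<^sub>T_def)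

lemma RJ_carrier: "carrier R\<^sub>J = Q ` carrier R"
  by (simp add: R\<^sub>J_def)

lemma RT_subset: "carrier R\<^sub>T \<subseteq> carrier R"
  by (auto simp: R\<^sub>T_def)

lemma RJ_subset: "carrier R\<^sub>J \<subseteq> carrier R"
  using Q_closed by (auto simp: R\<^sub>J_def)

lemma RT_incl: "linear_map C R\<^sub>T R_alg (\<lambda>x. x)"
  by (rule linear_mapI) (use RT_subset in \<open>auto simp: R\<^sub>T_def\<close>)

lemma RJ_incl: "linear_map C R\<^sub>J R_alg (\<lambda>x. x)"
  by (rule linear_mapI) (use RJ_subset in \<open>auto simp: R\<^sub>J_def\<close>)

lemma Q_linear_RJ: "linear_map C R_alg R\<^sub>J Q"
  unfolding R\<^sub>J_def by (rule linear_map_restrict_range[OF Q_linear_map]) simp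

lemma a_inv_R_alg: "a_inv R_alg x = \<ominus> x"
  by (simp add: a_inv_def m_inv_def)

text \<open>From \<open>Q \<circ> \<partial> \<circ> Q = Q\<close> it follows that \<open>Q\<close>
  annihilates this difference, which is the component of \<open>x\<close> in
  \<open>R\<^sub>T\<close> when \<open>R\<close> is split into the image of the derivation and
  \<open>R\<^sub>T\<close>.\<close>

lemma rest_RT: "x \<in> carrier R \<Longrightarrow> x \<ominus> deriv (Q x) \<in> carrier R\<^sub>T"
  using linear_map_minus[OF R_alg_module R_alg_module Q_linear_map, of x "deriv (Q x)"]
  by (simp add: RT_carrier a_minus_def a_inv_R_alg deriv_closed Q_closed Q_deriv_Q r_neg)

sublocale T: tensors_of C R\<^sub>T
  by (rule tensors_of.intro) (rule C_cring RT_module)+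

sublocale Tp: sym_powers_of C T_pos
  by (rule sym_powers_of.intro) (rule C_cring T.tensors_pos_module)+

lemma M1_module: "module C M\<^sub>1"
  unfolding M\<^sub>1_def by (rule tensor_module_module[OF C_cring RJ_module T.tensors_module])

lemma M2_module: "module C M\<^sub>2"
  unfolding M\<^sub>2_def by (rule Tp.sym_power_module)

sublocale S1: sym_powers_of C M\<^sub>1
  by (rule sym_powers_of.intro) (rule C_cring M1_module)+

sublocale S2: sym_powers_of C M\<^sub>2
  by (rule sym_powers_of.intro) (rule C_cring M2_module)+

lemma C1_algebra: "algebra C C\<^sub>1"
  unfolding C\<^sub>1_def by (rule S1.sym_algebra_algebra)

lemma Sym2_algebra: "algebra C Sym\<^sub>2"
  unfolding Sym\<^sub>2_def by (rule S2.sym_algebra_algebra)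

lemma eps1_bilinear: "bilinear_map C R\<^sub>J T C\<^sub>1 \<epsilon>\<^sub>1"
  using tensor_bilinear[OF C_cring RJ_module T.tensors_module] S1.sym_gen_linear
  unfolding bilinear_map_def \<epsilon>\<^sub>1_def C\<^sub>1_def M\<^sub>1_def
  by (auto intro: linear_map_comp[where k = "\<lambda>m. sym_monomial _ _ {#m#}"])

lemma eps'_commute: "\<epsilon>' s t = \<epsilon>' t s"
  by (simp add: \<epsilon>'_def add_mset_commute)

text \<open>The index is the multiset of the two arguments, so one slot settles both by
  symmetry.\<close>

lemma eps'_bilinear: "bilinear_map C T_pos T_pos Sym\<^sub>2 \<epsilon>'"
proof -
  have "linear_map C T_pos Sym\<^sub>2 (\<lambda>s. \<epsilon>' s t)" if t: "t \<in> carrier T_pos" for t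
  proof -
    have "linear_map C T_pos M\<^sub>2 (\<lambda>s. sym_prod C T_pos (add_mset s {#t#}))"
      unfolding M\<^sub>2_def by (rule Tp.sym_prod_linear) (use t in auto)
    then show ?thesis
      unfolding \<epsilon>'_def Sym\<^sub>2_def by (rule linear_map_comp[OF _ S2.sym_gen_linear])
  qed
  note l = this
  have eq: "\<epsilon>' s = (\<lambda>t. \<epsilon>' t s)" for s
    by (rule ext) (rule eps'_commute)
  have "linear_map C T_pos Sym\<^sub>2 (\<epsilon>' s)" if "s \<in> carrier T_pos" for s
    by (subst eq) (rule l[OF that])
  then show ?thesis
    by (intro bilinear_mapI l)
qed

lemma W_take_drop: "f \<in> W \<Longrightarrow> take i f \<in> W" "f \<in> W \<Longrightarrow> drop i f \<in> W"
  by (auto dest: in_set_takeD in_set_dropD)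

lemma pure_drop_pos: "f \<in> W \<Longrightarrow> i < length f \<Longrightarrow> pure (drop i f) \<in> carrier T_pos"
  by (rule T.pure_pos_closed[OF W_take_drop(2)]) auto

lemma J2_gen_closed:
  assumes f: "f \<in> W" "f \<noteq> []" and g: "g \<in> W" "g \<noteq> []" and h: "h \<in> W" "h \<noteq> []"
  shows "J\<^sub>2_gen f g h \<in> carrier Sym\<^sub>2"
proof -
  interpret S: algebra C Sym\<^sub>2 by (rule Sym2_algebra)
  note e = bilinear_map_closed[OF eps'_bilinear]
  \<comment> \<open>The bound \<open>1 - j\<close> excludes precisely \<open>i = j = 0\<close>, the
    only case in which both prefixes are empty and their shuffle falls outside
    \<open>T_pos\<close>.\<close>
  have pos: "sh (take i u) (take j v) \<in> carrier T_pos"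
    if "u \<in> W" "v \<in> W" "i \<in> {1 - j..<length u}" "j < length v" for i j u v
    using that by (intro T.shuffle_pos_closed W_take_drop) auto
  have pos': "sh (take j v) (take i u) \<in> carrier T_pos"
    if "u \<in> W" "v \<in> W" "i \<in> {1 - j..<length u}" "j < length v" for i j u v
    using that by (intro T.shuffle_pos_closed W_take_drop) auto
  let ?A = "\<lambda>j. \<Oplus>\<^bsub>Sym\<^sub>2\<^esub> i \<in> {1 - j..<length f}.
      \<epsilon>' (pure (drop i f)) (pure (drop j g)) \<otimes>\<^bsub>Sym\<^sub>2\<^esub> \<epsilon>' (sh (take i f) (take j g)) (pure h)"
  let ?B = "\<lambda>j. \<Oplus>\<^bsub>Sym\<^sub>2\<^esub> k \<in> {1 - j..<length h}.
      \<epsilon>' (pure f) (sh (take j g) (take k h)) \<otimes>\<^bsub>Sym\<^sub>2\<^esub> \<epsilon>' (pure (drop j g)) (pure (drop k h))"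
  have "?A j \<in> carrier Sym\<^sub>2" "?B j \<in> carrier Sym\<^sub>2" if "j < length g" for j
    by (intro S.finsum_closed Pi_I S.m_closed e pure_drop_pos T.pure_pos_closed pos pos';
        use f g h that in auto)+
  then have "?A j \<ominus>\<^bsub>Sym\<^sub>2\<^esub> ?B j \<in> carrier Sym\<^sub>2" if "j \<in> {0..<length g}" for j
    using that by (intro S.minus_closed) simp_all
  then have "(\<Oplus>\<^bsub>Sym\<^sub>2\<^esub> j \<in> {0..<length g}. ?A j \<ominus>\<^bsub>Sym\<^sub>2\<^esub> ?B j) \<in> carrier Sym\<^sub>2"
    by (rule S.finsum_closed[OF Pi_I])
  moreover have "\<epsilon>' (sh f g) (pure h) \<in> carrier Sym\<^sub>2" "\<epsilon>' (pure f) (sh g h) \<in> carrier Sym\<^sub>2"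
    using f g h by (auto intro!: e T.shuffle_pos_closed T.pure_pos_closed)
  ultimately show ?thesis
    unfolding J\<^sub>2_gen_def by (intro S.a_closed S.minus_closed)
qed

lemma J2_ideal: "ideal J\<^sub>2 Sym\<^sub>2"
proof -
  interpret S: algebra C Sym\<^sub>2 by (rule Sym2_algebra)
  show ?thesis
    unfolding J\<^sub>2_def by (rule S.genideal_ideal) (auto intro!: J2_gen_closed)
qed

lemma C2_algebra: "algebra C C\<^sub>2"
  unfolding C\<^sub>2_def by (rule quotient_algebra[OF Sym2_algebra J2_ideal])

lemma C2_proj_linear: "linear_map C Sym\<^sub>2 C\<^sub>2 (\<lambda>x. J\<^sub>2 +>\<^bsub>Sym\<^sub>2\<^esub> x)"
  using quotient_proj_linear[OF _ algebra_ideal_submodule[OF Sym2_algebra J2_ideal]] Sym2_algebra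
  unfolding C\<^sub>2_def by (simp add: algebra_def)

lemma C2_module: "module C C\<^sub>2" and C1_module: "module C C\<^sub>1"
  using C2_algebra C1_algebra by (simp_all add: algebra_def)

lemma eps2_bilinear: "bilinear_map C T_pos T_pos C\<^sub>2 \<epsilon>\<^sub>2"
  unfolding \<epsilon>\<^sub>2_def
  by (intro bilinear_mapI linear_map_comp[OF _ C2_proj_linear] bilinear_mapD[OF eps'_bilinear])

lemma eps2_commute: "\<epsilon>\<^sub>2 s t = \<epsilon>\<^sub>2 t s"
  by (simp add: \<epsilon>\<^sub>2_def eps'_commute)


subsection \<open>The product on the constants tensored with the tensor algebra\<close>

abbreviation TC where "TC \<equiv> tensor_module C C\<^sub>2 T"

lemma TC_module: "module C TC"
  by (rule tensor_module_module[OF C_cring C2_module T.tensors_module])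

lemma TC_tensor: "bilinear_map C C\<^sub>2 T TC (tensor C C\<^sub>2 T)"
  by (rule tensor_bilinear[OF C_cring C2_module T.tensors_module])

definition TC_multilinear where
  "TC_multilinear P v \<longleftrightarrow> (\<forall>w\<in>W. linear_map C C\<^sub>2 P (\<lambda>c. v (c, w))) \<and>
     (\<forall>c\<in>carrier C\<^sub>2. word_multilinear C R\<^sub>T P (\<lambda>w. v (c, w)))"

lemma TC_universal:
  assumes "module C P"
  shows "universal C TC (carrier C\<^sub>2 \<times> W) (\<lambda>(c, f). tensor C C\<^sub>2 T c (pure f)) (TC_multilinear P) P"
  using universal_tensor[OF C_cring C2_module T.tensors_module assms universal_self[OF C2_module]
      T.universal_pure[OF assms] T.word_multilinear_condition[OF assms]]
  by (simp add: TC_multilinear_def[abs_def])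

lemma TC_condition:
  assumes "module C P"
  shows "linear_condition C P (carrier C\<^sub>2 \<times> W) (TC_multilinear P)"
  using linear_condition_prod[OF linear_condition_linear_map[OF assms C2_module]
      T.word_multilinear_condition[OF assms]]
  by (simp add: TC_multilinear_def[abs_def])

text \<open>One summand of the double sum in the product. Prefixes and suffixes are separate
  arguments, not cuts of one word, so that they can be varied independently as
  \<open>word_multilinear_cut_sum\<close> demands.\<close>

definition cross where
  "cross c d p s q t = tensor C C\<^sub>2 T (c \<otimes>\<^bsub>C\<^sub>2\<^esub> d \<otimes>\<^bsub>C\<^sub>2\<^esub> \<epsilon>\<^sub>2 (pure s) (pure t)) (sh p q)"

definition TC_product where
  "TC_product c f d g =
     tensor C C\<^sub>2 T (c \<otimes>\<^bsub>C\<^sub>2\<^esub> d) (sh f g) \<oplus>\<^bsub>TC\<^esub>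
     (\<Oplus>\<^bsub>TC\<^esub> i \<in> {0..<length f}. \<Oplus>\<^bsub>TC\<^esub> j \<in> {0..<length g}.
        cross c d (take i f) (drop i f) (take j g) (drop j g))"

lemma cross_closed:
  assumes "c \<in> carrier C\<^sub>2" "d \<in> carrier C\<^sub>2" "p \<in> W" "s \<in> W" "s \<noteq> []" "q \<in> W" "t \<in> W" "t \<noteq> []"
  shows "cross c d p s q t \<in> carrier TC"
proof -
  interpret C2: algebra C C\<^sub>2 by (rule C2_algebra)
  show ?thesis unfolding cross_def using assms
    by (intro bilinear_map_closed[OF TC_tensor] C2.m_closed bilinear_map_closed[OF eps2_bilinear]
        T.shuffle_closed T.pure_pos_closed)
qed

lemma cross_linear_const:
  assumes "d \<in> carrier C\<^sub>2" "p \<in> W" "s \<in> W" "s \<noteq> []" "q \<in> W" "t \<in> W" "t \<noteq> []"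
  shows "linear_map C C\<^sub>2 TC (\<lambda>c. cross c d p s q t)"
proof -
  have e: "\<epsilon>\<^sub>2 (pure s) (pure t) \<in> carrier C\<^sub>2" and sh: "sh p q \<in> carrier T"
    using assms by (auto intro!: bilinear_map_closed[OF eps2_bilinear] T.shuffle_closed T.pure_pos_closed)
  note m = bilinear_mapD(2)[OF algebra_mult_bilinear[OF C2_algebra]]
  show ?thesis unfolding cross_def
    by (rule linear_map_comp[OF linear_map_comp[OF m[OF assms(1)] m[OF e]] bilinear_mapD(2)[OF TC_tensor sh]])
qed

lemma cross_prefix:
  assumes "c \<in> carrier C\<^sub>2" "d \<in> carrier C\<^sub>2" "s \<in> W" "s \<noteq> []" "q \<in> W" "t \<in> W" "t \<noteq> []"
  shows "word_multilinear C R\<^sub>T TC (\<lambda>p. cross c d p s q t)"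
proof -
  interpret C2: algebra C C\<^sub>2 by (rule C2_algebra)
  have e: "c \<otimes>\<^bsub>C\<^sub>2\<^esub> d \<otimes>\<^bsub>C\<^sub>2\<^esub> \<epsilon>\<^sub>2 (pure s) (pure t) \<in> carrier C\<^sub>2"
    using assms by (intro C2.m_closed bilinear_map_closed[OF eps2_bilinear] T.pure_pos_closed)
  show ?thesis unfolding cross_def
    by (rule T.word_multilinear_comp[OF T.shuffle_multilinear_left[OF assms(5)] bilinear_mapD(1)[OF TC_tensor e]])
qed

lemma pure_pos_multilinear: "word_multilinear C R\<^sub>T T_pos pure"
proof (rule T.word_multilinearI)
  fix u v assume uv: "u \<in> W" "v \<in> W"
  have "linear_map C R\<^sub>T (T\<lparr>carrier := carrier T_pos\<rparr>) (\<lambda>x. pure (u @ [x] @ v))"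
    by (rule linear_map_restrict_range[OF T.word_multilinearD[OF T.pure_multilinear uv]])
      (use uv in \<open>auto intro!: T.pure_pos_closed\<close>)
  then show "linear_map C R\<^sub>T T_pos (\<lambda>x. pure (u @ [x] @ v))"
    by (simp add: tensors_pos_def)
qed

lemma cross_suffix:
  assumes "c \<in> carrier C\<^sub>2" "d \<in> carrier C\<^sub>2" "p \<in> W" "q \<in> W" "t \<in> W" "t \<noteq> []"
  shows "word_multilinear C R\<^sub>T TC (\<lambda>s. cross c d p s q t)"
proof -
  interpret C2: algebra C C\<^sub>2 by (rule C2_algebra)
  have t: "pure t \<in> carrier T_pos" and sh: "sh p q \<in> carrier T" and cd: "c \<otimes>\<^bsub>C\<^sub>2\<^esub> d \<in> carrier C\<^sub>2"
    using assms by (auto intro!: T.shuffle_closed T.pure_pos_closed)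
  have "linear_map C T_pos TC (\<lambda>s. tensor C C\<^sub>2 T (c \<otimes>\<^bsub>C\<^sub>2\<^esub> d \<otimes>\<^bsub>C\<^sub>2\<^esub> \<epsilon>\<^sub>2 s (pure t)) (sh p q))"
    by (rule linear_map_comp[OF linear_map_comp[OF bilinear_mapD(2)[OF eps2_bilinear t]
          bilinear_mapD(1)[OF algebra_mult_bilinear[OF C2_algebra] cd]] bilinear_mapD(2)[OF TC_tensor sh]])
  from T.word_multilinear_comp[OF pure_pos_multilinear this] show ?thesis
    unfolding cross_def .
qed

text \<open>Product in \<open>C\<^sub>2\<close>, shuffle and \<open>\<epsilon>\<^sub>2\<close> are
  all symmetric. Linearity in the data of the second factor is thereby inherited from the
  first.\<close>

lemma cross_commute:
  assumes "c \<in> carrier C\<^sub>2" "d \<in> carrier C\<^sub>2" "p \<in> W" "q \<in> W"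
  shows "cross c d p s q t = cross d c q t p s"
proof -
  interpret C2: algebra C C\<^sub>2 by (rule C2_algebra)
  show ?thesis using assms
    by (simp add: cross_def C2.m_comm[of c d] T.shuffle_commute[of p q] eps2_commute[of "pure s"])
qed

text \<open>A word with a slot in it is never empty, so agreement on nonempty words is
  enough.\<close>

lemma word_multilinear_cong:
  assumes "word_multilinear C R\<^sub>T P F" "\<And>w. w \<in> W \<Longrightarrow> w \<noteq> [] \<Longrightarrow> F w = G w"
  shows "word_multilinear C R\<^sub>T P G"
proof (rule T.word_multilinearI)
  fix u v assume uv: "u \<in> W" "v \<in> W"
  show "linear_map C R\<^sub>T P (\<lambda>x. G (u @ [x] @ v))"
    by (rule linear_map_cong[OF T.word_multilinearD[OF assms(1) uv] RT_module])
      (rule assms(2), use uv in auto)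
qed

lemma TC_product_closed:
  assumes "c \<in> carrier C\<^sub>2" "d \<in> carrier C\<^sub>2" "f \<in> W" "g \<in> W"
  shows "TC_product c f d g \<in> carrier TC"
proof -
  interpret C2: algebra C C\<^sub>2 by (rule C2_algebra)
  interpret TC: module C TC by (rule TC_module)
  show ?thesis unfolding TC_product_def using assms
    by (intro TC.M.a_closed TC.M.finsum_closed Pi_I bilinear_map_closed[OF TC_tensor] T.shuffle_closed
        cross_closed W_take_drop C2.m_closed) auto
qed

text \<open>Only the outer sum runs over cuts of the varied word; the inner one has a fixed number
  of terms. Hence the outer sum is the instance of \<open>word_multilinear_cut_sum\<close>, and its
  hypotheses are checked termwise in \<open>j\<close>.\<close>

lemma TC_product_left:
  assumes "d \<in> carrier C\<^sub>2" "g \<in> W"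
  shows "TC_multilinear TC (\<lambda>(c, f). TC_product c f d g)"
  unfolding TC_multilinear_def case_prod_conv
proof (intro conjI ballI)
  interpret C2: algebra C C\<^sub>2 by (rule C2_algebra)
  fix f assume f: "f \<in> W"
  show "linear_map C C\<^sub>2 TC (\<lambda>c. TC_product c f d g)"
    unfolding TC_product_def using f assms
    by (intro linear_map_fun_add[OF TC_module] linear_map_fun_finsum[OF TC_module] cross_linear_const
        linear_map_comp[OF bilinear_mapD(2)[OF algebra_mult_bilinear[OF C2_algebra]]
          bilinear_mapD(2)[OF TC_tensor]] T.shuffle_closed W_take_drop) auto
next
  interpret C2: algebra C C\<^sub>2 by (rule C2_algebra)
  fix c assume c: "c \<in> carrier C\<^sub>2"
  have 1: "word_multilinear C R\<^sub>T TC (\<lambda>f. tensor C C\<^sub>2 T (c \<otimes>\<^bsub>C\<^sub>2\<^esub> d) (sh f g))"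
    by (rule T.word_multilinear_comp[OF T.shuffle_multilinear_left bilinear_mapD(1)[OF TC_tensor]])
      (use c assms in auto)
  have sum: "word_multilinear C R\<^sub>T TC (\<lambda>f. \<Oplus>\<^bsub>TC\<^esub> j \<in> {0..<length g}. F j f)"
    if "\<And>j. j < length g \<Longrightarrow> word_multilinear C R\<^sub>T TC (F j)" for F
    using that by (intro T.word_multilinearI linear_map_fun_finsum[OF TC_module])
      (auto simp: word_multilinear_def)
  have 2: "word_multilinear C R\<^sub>T TC (\<lambda>f. \<Oplus>\<^bsub>TC\<^esub> i \<in> {0..<length f}.
      \<Oplus>\<^bsub>TC\<^esub> j \<in> {0..<length g}. cross c d (take i f) (drop i f) (take j g) (drop j g))"
    by (rule T.word_multilinear_cut_sum[OF TC_module]; rule sum, rule cross_prefix cross_suffix)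
      (use c assms W_take_drop in auto)
  show "word_multilinear C R\<^sub>T TC (\<lambda>f. TC_product c f d g)"
    unfolding TC_product_def
    by (intro T.word_multilinearI linear_map_fun_add[OF TC_module] T.word_multilinearD[OF 1]
        T.word_multilinearD[OF 2])
qed

text \<open>Here the varied word is cut in the inner sum, so \<open>word_multilinear_cut_sum\<close>
  is applied for each fixed \<open>i\<close>; linearity of the summands comes from the other side
  through \<open>cross_commute\<close>.\<close>

lemma TC_product_right:
  assumes "c \<in> carrier C\<^sub>2" "f \<in> W"
  shows "TC_multilinear TC (\<lambda>(d, g). TC_product c f d g)"
  unfolding TC_multilinear_def case_prod_conv
proof (intro conjI ballI)
  interpret C2: algebra C C\<^sub>2 by (rule C2_algebra)
  fix g assume g: "g \<in> W"
  have "linear_map C C\<^sub>2 TC (\<lambda>d. cross c d (take i f) (drop i f) (take j g) (drop j g))"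
    if "i < length f" "j < length g" for i j
  proof -
    have "linear_map C C\<^sub>2 TC (\<lambda>d. cross d c (take j g) (drop j g) (take i f) (drop i f))"
      using that g assms by (intro cross_linear_const W_take_drop) auto
    then show ?thesis
      by (rule linear_map_cong[OF _ C2_module]) (rule cross_commute, use g assms W_take_drop in auto)
  qed
  then show "linear_map C C\<^sub>2 TC (\<lambda>d. TC_product c f d g)"
    unfolding TC_product_def using g assms
    by (intro linear_map_fun_add[OF TC_module] linear_map_fun_finsum[OF TC_module]
        linear_map_comp[OF bilinear_mapD(1)[OF algebra_mult_bilinear[OF C2_algebra]]
          bilinear_mapD(2)[OF TC_tensor]] T.shuffle_closed) auto
next
  interpret C2: algebra C C\<^sub>2 by (rule C2_algebra)
  fix d assume d: "d \<in> carrier C\<^sub>2"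
  have 1: "word_multilinear C R\<^sub>T TC (\<lambda>g. tensor C C\<^sub>2 T (c \<otimes>\<^bsub>C\<^sub>2\<^esub> d) (sh f g))"
    by (rule T.word_multilinear_comp[OF T.shuffle_multilinear_right bilinear_mapD(1)[OF TC_tensor]])
      (use d assms in auto)
  have prefix: "word_multilinear C R\<^sub>T TC (\<lambda>q. cross c d p s q t)"
    if "p \<in> W" "s \<in> W" "s \<noteq> []" "t \<in> W" "t \<noteq> []" for p s t
    by (rule word_multilinear_cong[OF cross_prefix[of d c t p s] cross_commute])
      (use that d assms in auto)
  have suffix: "word_multilinear C R\<^sub>T TC (\<lambda>t. cross c d p s q t)"
    if "p \<in> W" "s \<in> W" "s \<noteq> []" "q \<in> W" for p s q
    by (rule word_multilinear_cong[OF cross_suffix[of d c q p s] cross_commute])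
      (use that d assms in auto)
  have 2: "word_multilinear C R\<^sub>T TC (\<lambda>g. \<Oplus>\<^bsub>TC\<^esub> j \<in> {0..<length g}.
      cross c d (take i f) (drop i f) (take j g) (drop j g))" if "i < length f" for i
    by (rule T.word_multilinear_cut_sum[OF TC_module]; rule prefix suffix)
      (use that assms W_take_drop in auto)
  have "linear_map C R\<^sub>T TC (\<lambda>x. TC_product c f d (u @ [x] @ v))" if uv: "u \<in> W" "v \<in> W" for u v
    unfolding TC_product_def
    by (intro linear_map_fun_add[OF TC_module] T.word_multilinearD[OF 1] uv
        linear_map_fun_finsum[OF TC_module] T.word_multilinearD[OF 2]) auto
  then show "word_multilinear C R\<^sub>T TC (\<lambda>g. TC_product c f d g)"
    by (rule T.word_multilinearI)
qed

lemma C2T_mult_works: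
  "bilinear_map C TC TC TC C\<^sub>2T_mult"
  "c \<in> carrier C\<^sub>2 \<Longrightarrow> d \<in> carrier C\<^sub>2 \<Longrightarrow> f \<in> W \<Longrightarrow> g \<in> W \<Longrightarrow>
     C\<^sub>2T_mult (tensor C C\<^sub>2 T c (pure f)) (tensor C C\<^sub>2 T d (pure g)) = TC_product c f d g"
proof -
  let ?I = "carrier C\<^sub>2 \<times> W" and ?e = "\<lambda>(c, f). tensor C C\<^sub>2 T c (pure f)"
    and ?v = "\<lambda>(c, f) (d, g). TC_product c f d g"
  obtain b where b: "bilinear_map C TC TC TC b" "\<And>p q. p \<in> ?I \<Longrightarrow> q \<in> ?I \<Longrightarrow> b (?e p) (?e q) = ?v p q"
  proof (rule universal_bilinear[OF TC_module TC_module TC_module TC_universal[OF TC_module]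
        TC_universal[OF TC_module] TC_condition[OF TC_module], where v = ?v])
    show "?v p q \<in> carrier TC" if "p \<in> ?I" "q \<in> ?I" for p q
      using that by (auto intro!: TC_product_closed)
    show "TC_multilinear TC (\<lambda>p. ?v p q)" if "q \<in> ?I" for q
    proof (cases q)
      case (Pair d g)
      then show ?thesis using TC_product_left[of d g] that by (simp add: split_def)
    qed
    show "TC_multilinear TC (?v p)" if "p \<in> ?I" for p
    proof (cases p)
      case (Pair c f)
      then show ?thesis using TC_product_right[of c f] that by (simp add: split_def)
    qed
  qed blast
  have m: "C\<^sub>2T_mult = bilinear_ext C TC TC TC ?I ?e ?I ?e ?v"
    unfolding C\<^sub>2T_mult_def TC_product_def cross_def Let_def ..
  note ext = bilinear_ext_works[of C TC TC TC b ?I ?I ?e ?e ?v, OF b]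
  show "bilinear_map C TC TC TC C\<^sub>2T_mult"
    unfolding m by (rule ext(1))
  show "c \<in> carrier C\<^sub>2 \<Longrightarrow> d \<in> carrier C\<^sub>2 \<Longrightarrow> f \<in> W \<Longrightarrow> g \<in> W \<Longrightarrow>
     C\<^sub>2T_mult (tensor C C\<^sub>2 T c (pure f)) (tensor C C\<^sub>2 T d (pure g)) = TC_product c f d g"
    using ext(2)[of "(c, f)" "(d, g)"] unfolding m by simp
qed

end


context comm_differential_ring_quasi
begin

subsection \<open>The algebra IDR\<close>

lemma C2T_simps:
  "carrier C\<^sub>2T = carrier TC" "ring.zero C\<^sub>2T = ring.zero TC" "ring.add C\<^sub>2T = ring.add TC"
  "module.smult C\<^sub>2T = module.smult TC" "monoid.mult C\<^sub>2T = C\<^sub>2T_mult"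
  "\<one>\<^bsub>C\<^sub>2T\<^esub> = tensor C C\<^sub>2 T \<one>\<^bsub>C\<^sub>2\<^esub> (pure [])"
  by (simp_all add: C\<^sub>2T_def)

lemma C2T_module: "module C C\<^sub>2T"
  by (rule module_transfer_cong[OF TC_module]) (simp_all add: C2T_simps)

lemma C2T_linear: "linear_map C C\<^sub>2T = linear_map C TC" "linear_map C L C\<^sub>2T = linear_map C L TC"
  by (rule linear_map_transfer_cong; simp add: C2T_simps)+

lemma C2T_tensor: "bilinear_map C C\<^sub>2 T C\<^sub>2T (tensor C C\<^sub>2 T)"
  using TC_tensor by (simp add: bilinear_map_def C2T_linear)

lemma C2T_mult: "bilinear_map C C\<^sub>2T C\<^sub>2T C\<^sub>2T (monoid.mult C\<^sub>2T)"
  using C2T_mult_works(1) unfolding bilinear_map_def C2T_linear C2T_simps .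

lemma C2T_universal:
  assumes "module C P"
  shows "universal C C\<^sub>2T (carrier C\<^sub>2 \<times> W) (\<lambda>(c, f). tensor C C\<^sub>2 T c (pure f)) (TC_multilinear P) P"
  using TC_universal[OF assms] submodule_span_transfer_cong[of C\<^sub>2T TC C]
  by (simp add: universal_def C2T_linear C2T_simps)

abbreviation CT where "CT \<equiv> tensor_algebra_product C C\<^sub>1 C\<^sub>2T"

lemma CT_module: "module C CT"
  by (rule tensor_product_module[OF C_cring C1_module C2T_module])

lemma CT_mult: "bilinear_map C CT CT CT (monoid.mult CT)"
  by (rule tensor_product_mult(1)[OF C_cring C1_module C2T_module algebra_mult_bilinear[OF C1_algebra] C2T_mult])

lemma IDR_module: "module C IDR"
  unfolding IDR_def by (rule tensor_product_module[OF C_cring R_alg_module CT_module])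

lemma IDR_mult: "bilinear_map C IDR IDR IDR (monoid.mult IDR)"
  unfolding IDR_def
  by (rule tensor_product_mult(1)[OF C_cring R_alg_module CT_module algebra_mult_bilinear[OF R_alg_algebra] CT_mult])

text \<open>Products of pure tensors in \<open>C\<^sub>2T\<close> are sums, so
  \<open>IDR_pure\<close> is not closed under multiplication. With an arbitrary element of
  \<open>C\<^sub>2T\<close> in the last place it becomes so, see \<open>triple_mult\<close>.\<close>

definition triple where
  "triple a c y = tensor C R_alg CT a (tensor C C\<^sub>1 C\<^sub>2T c y)"

lemma IDR_pure_triple: "IDR_pure a c d w = triple a c (tensor C C\<^sub>2 T d (pure w))"
  by (simp add: IDR_pure_def triple_def)

lemma CT_tensor: "bilinear_map C C\<^sub>1 C\<^sub>2T CT (tensor C C\<^sub>1 C\<^sub>2T)"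
  by (rule tensor_product_bilinear[OF C_cring C1_module C2T_module])

lemma IDR_tensor: "bilinear_map C R_alg CT IDR (tensor C R_alg CT)"
  unfolding IDR_def by (rule tensor_product_bilinear[OF C_cring R_alg_module CT_module])

lemma triple_linear:
  "c \<in> carrier C\<^sub>1 \<Longrightarrow> y \<in> carrier C\<^sub>2T \<Longrightarrow> linear_map C R_alg IDR (\<lambda>a. triple a c y)"
  "a \<in> carrier R \<Longrightarrow> y \<in> carrier C\<^sub>2T \<Longrightarrow> linear_map C C\<^sub>1 IDR (\<lambda>c. triple a c y)"
  "a \<in> carrier R \<Longrightarrow> c \<in> carrier C\<^sub>1 \<Longrightarrow> linear_map C C\<^sub>2T IDR (\<lambda>y. triple a c y)"
proof -
  assume "c \<in> carrier C\<^sub>1" "y \<in> carrier C\<^sub>2T"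
  then show "linear_map C R_alg IDR (\<lambda>a. triple a c y)"
    unfolding triple_def by (rule bilinear_mapD(2)[OF IDR_tensor bilinear_map_closed[OF CT_tensor]])
next
  assume a: "a \<in> carrier R" and y: "y \<in> carrier C\<^sub>2T"
  have a': "a \<in> carrier R_alg" using a by simp
  show "linear_map C C\<^sub>1 IDR (\<lambda>c. triple a c y)"
    unfolding triple_def by (rule linear_map_comp[OF bilinear_mapD(2)[OF CT_tensor y] bilinear_mapD(1)[OF IDR_tensor a']])
next
  assume a: "a \<in> carrier R" and c: "c \<in> carrier C\<^sub>1"
  have a': "a \<in> carrier R_alg" using a by simp
  show "linear_map C C\<^sub>2T IDR (\<lambda>y. triple a c y)"
    unfolding triple_def by (rule linear_map_comp[OF bilinear_mapD(1)[OF CT_tensor c] bilinear_mapD(1)[OF IDR_tensor a']])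
qed

lemma triple_mult:
  assumes "a \<in> carrier R" "a' \<in> carrier R" "c \<in> carrier C\<^sub>1" "c' \<in> carrier C\<^sub>1" "y \<in> carrier C\<^sub>2T" "y' \<in> carrier C\<^sub>2T"
  shows "triple a c y \<otimes>\<^bsub>IDR\<^esub> triple a' c' y' = triple (a \<otimes> a') (c \<otimes>\<^bsub>C\<^sub>1\<^esub> c') (y \<otimes>\<^bsub>C\<^sub>2T\<^esub> y')"
proof -
  have cl: "tensor C C\<^sub>1 C\<^sub>2T c y \<in> carrier CT" "tensor C C\<^sub>1 C\<^sub>2T c' y' \<in> carrier CT"
    using assms by (auto intro: bilinear_map_closed[OF CT_tensor])
  show ?thesis
    unfolding triple_def IDR_def
    using tensor_product_mult(2)[OF C_cring R_alg_module CT_module algebra_mult_bilinear[OF R_alg_algebra] CT_mult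
        _ _ cl, of a a']
      tensor_product_mult(2)[OF C_cring C1_module C2T_module algebra_mult_bilinear[OF C1_algebra] C2T_mult,
        of c c' y y'] assms
    by simp
qed

text \<open>The nested condition that two rounds of \<open>universal_tensor_product\<close> produce,
  flattened to one clause per factor and written for a curried family.\<close>

definition IDR_multilinear where
  "IDR_multilinear P v \<longleftrightarrow>
     (\<forall>c\<in>carrier C\<^sub>1. \<forall>d\<in>carrier C\<^sub>2. \<forall>w\<in>W. linear_map C R_alg P (\<lambda>a. v a c d w)) \<and>
     (\<forall>a\<in>carrier R. \<forall>d\<in>carrier C\<^sub>2. \<forall>w\<in>W. linear_map C C\<^sub>1 P (\<lambda>c. v a c d w)) \<and>
     (\<forall>a\<in>carrier R. \<forall>c\<in>carrier C\<^sub>1. \<forall>w\<in>W. linear_map C C\<^sub>2 P (\<lambda>d. v a c d w)) \<and>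
     (\<forall>a\<in>carrier R. \<forall>c\<in>carrier C\<^sub>1. \<forall>d\<in>carrier C\<^sub>2. word_multilinear C R\<^sub>T P (\<lambda>w. v a c d w))"

lemma IDR_universal:
  assumes P: "module C P"
  shows "universal C IDR IDR_index (\<lambda>(a, c, d, w). IDR_pure a c d w)
    (\<lambda>v. IDR_multilinear P (\<lambda>a c d w. v (a, c, d, w))) P"
proof -
  have "universal C CT (carrier C\<^sub>1 \<times> (carrier C\<^sub>2 \<times> W))
      (\<lambda>(c, j). tensor C C\<^sub>1 C\<^sub>2T c ((\<lambda>(d, w). tensor C C\<^sub>2 T d (pure w)) j))
      (\<lambda>v. (\<forall>j\<in>carrier C\<^sub>2 \<times> W. linear_map C C\<^sub>1 P (\<lambda>i. v (i, j))) \<and>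
        (\<forall>i\<in>carrier C\<^sub>1. TC_multilinear P (\<lambda>j. v (i, j)))) P"
    by (rule universal_tensor_product[OF C_cring C1_module C2T_module P universal_self[OF C1_module]
          C2T_universal[OF P] TC_condition[OF P]])
  note u = universal_tensor_product[OF C_cring R_alg_module CT_module P universal_self[OF R_alg_module] this
      linear_condition_prod[OF linear_condition_linear_map[OF P C1_module] TC_condition[OF P]]]
  have "(\<lambda>v. (\<forall>j\<in>carrier C\<^sub>1 \<times> carrier C\<^sub>2 \<times> W. linear_map C R_alg P (\<lambda>i. v (i, j))) \<and>
      (\<forall>i\<in>carrier R_alg. (\<forall>j\<in>carrier C\<^sub>2 \<times> W. linear_map C C\<^sub>1 P (\<lambda>k. v (i, k, j))) \<and>
        (\<forall>k\<in>carrier C\<^sub>1. TC_multilinear P (\<lambda>j. v (i, k, j))))) =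
      (\<lambda>v. IDR_multilinear P (\<lambda>a c d w. v (a, c, d, w)))"
    by (rule ext) (simp add: IDR_multilinear_def TC_multilinear_def, blast)
  then show ?thesis
    using u by (simp add: IDR_def IDR_pure_def split_def)
qed

lemma IDR_multilinearD:
  assumes "IDR_multilinear P v"
  shows "c \<in> carrier C\<^sub>1 \<Longrightarrow> d \<in> carrier C\<^sub>2 \<Longrightarrow> w \<in> W \<Longrightarrow> linear_map C R_alg P (\<lambda>a. v a c d w)"
    and "a \<in> carrier R \<Longrightarrow> d \<in> carrier C\<^sub>2 \<Longrightarrow> w \<in> W \<Longrightarrow> linear_map C C\<^sub>1 P (\<lambda>c. v a c d w)"
    and "a \<in> carrier R \<Longrightarrow> c \<in> carrier C\<^sub>1 \<Longrightarrow> w \<in> W \<Longrightarrow> linear_map C C\<^sub>2 P (\<lambda>d. v a c d w)"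
    and "a \<in> carrier R \<Longrightarrow> c \<in> carrier C\<^sub>1 \<Longrightarrow> d \<in> carrier C\<^sub>2 \<Longrightarrow> u \<in> W \<Longrightarrow> w \<in> W \<Longrightarrow>
      linear_map C R\<^sub>T P (\<lambda>x. v a c d (u @ x # w))"
  using assms by (simp_all add: IDR_multilinear_def word_multilinear_def)

lemma TC_pure_closed: "d \<in> carrier C\<^sub>2 \<Longrightarrow> w \<in> W \<Longrightarrow> tensor C C\<^sub>2 T d (pure w) \<in> carrier C\<^sub>2T"
  by (rule bilinear_map_closed[OF C2T_tensor _ T.pure_closed])

lemma IDR_pure_multilinear: "IDR_multilinear IDR IDR_pure"
  unfolding IDR_multilinear_def IDR_pure_triple
proof (intro conjI ballI)
  fix a c w assume a: "a \<in> carrier R" and c: "c \<in> carrier C\<^sub>1" and w: "w \<in> W"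
  show "linear_map C C\<^sub>2 IDR (\<lambda>d. triple a c (tensor C C\<^sub>2 T d (pure w)))"
    by (rule linear_map_comp[OF bilinear_mapD(2)[OF C2T_tensor T.pure_closed[OF w]] triple_linear(3)[OF a c]])
next
  fix a c d assume a: "a \<in> carrier R" and c: "c \<in> carrier C\<^sub>1" and d: "d \<in> carrier C\<^sub>2"
  show "word_multilinear C R\<^sub>T IDR (\<lambda>w. triple a c (tensor C C\<^sub>2 T d (pure w)))"
    by (rule T.word_multilinear_comp[OF T.pure_multilinear
          linear_map_comp[OF bilinear_mapD(1)[OF C2T_tensor d] triple_linear(3)[OF a c]]])
qed (intro triple_linear TC_pure_closed; assumption)+

lemmas IDR_pure_linear = IDR_multilinearD[OF IDR_pure_multilinear]

lemma IDR_pure_closed: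
  "a \<in> carrier R \<Longrightarrow> c \<in> carrier C\<^sub>1 \<Longrightarrow> d \<in> carrier C\<^sub>2 \<Longrightarrow> w \<in> W \<Longrightarrow> IDR_pure a c d w \<in> carrier IDR"
  using linear_mapD(1)[OF IDR_pure_linear(1), of c d w a] by simp

lemma R_mult_linear:
  "b \<in> carrier R \<Longrightarrow> linear_map C R_alg R_alg (\<lambda>a. a \<otimes> b)"
  "b \<in> carrier R \<Longrightarrow> linear_map C R_alg R_alg (\<lambda>a. b \<otimes> a)"
  using bilinear_mapD[OF algebra_mult_bilinear[OF R_alg_algebra]] by simp_all

lemma rest_linear: "linear_map C R_alg R\<^sub>T (\<lambda>x. x \<ominus> deriv (Q x))"
proof -
  have "linear_map C R_alg R_alg (\<lambda>x. x \<ominus>\<^bsub>R_alg\<^esub> deriv (Q x))"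
    by (intro linear_map_fun_minus R_alg_module linear_map_id linear_map_comp[OF Q_linear_map deriv_linear_map])
  then have "linear_map C R_alg R_alg (\<lambda>x. x \<ominus> deriv (Q x))"
    by (simp add: a_minus_def a_inv_R_alg)
  then show ?thesis
    unfolding R\<^sub>T_def by (rule linear_map_restrict_range) (use rest_RT in \<open>simp add: RT_carrier\<close>)
qed

lemma RT_R: "x \<in> carrier R\<^sub>T \<Longrightarrow> x \<in> carrier R"
  using RT_subset by auto


subsection \<open>The derivation and the integration\<close>

text \<open>The only letter with a special role is the first: in the second summand it leaves the
  word and multiplies the coefficient. Linearity in it there comes from the first tensor factor, for
  all other letters from the word.\<close>

lemma deriv_pure_multilinear: "IDR_multilinear IDR deriv_pure"
  unfolding IDR_multilinear_def
proof (intro conjI ballI)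
  fix c d w assume c: "c \<in> carrier C\<^sub>1" and d: "d \<in> carrier C\<^sub>2" and w: "w \<in> W"
  show "linear_map C R_alg IDR (\<lambda>a. deriv_pure a c d w)"
  proof (cases w)
    case Nil
    then show ?thesis
      using linear_map_comp[OF deriv_linear_map IDR_pure_linear(1)[OF c d w]] by simp
  next
    case (Cons x v)
    then have x: "x \<in> carrier R" "v \<in> W" using w RT_R by auto
    show ?thesis
      unfolding Cons deriv_pure.simps
      using linear_map_comp[OF deriv_linear_map IDR_pure_linear(1)[OF c d w]] Cons
      by (intro linear_map_fun_add[OF IDR_module]
          linear_map_comp[OF R_mult_linear(1)[OF x(1)] IDR_pure_linear(1)[OF c d x(2)]]) simp
  qed
next
  fix a d w assume a: "a \<in> carrier R" and d: "d \<in> carrier C\<^sub>2" and w: "w \<in> W"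
  then show "linear_map C C\<^sub>1 IDR (\<lambda>c. deriv_pure a c d w)"
    by (cases w) (auto intro!: linear_map_fun_add[OF IDR_module] IDR_pure_linear(2) deriv_closed dest: RT_R)
next
  fix a c w assume a: "a \<in> carrier R" and c: "c \<in> carrier C\<^sub>1" and w: "w \<in> W"
  then show "linear_map C C\<^sub>2 IDR (\<lambda>d. deriv_pure a c d w)"
    by (cases w) (auto intro!: linear_map_fun_add[OF IDR_module] IDR_pure_linear(3) deriv_closed dest: RT_R)
next
  fix a c d assume acd: "a \<in> carrier R" "c \<in> carrier C\<^sub>1" "d \<in> carrier C\<^sub>2"
  show "word_multilinear C R\<^sub>T IDR (\<lambda>w. deriv_pure a c d w)"
  proof (rule T.word_multilinearI)
    fix u v assume uv: "u \<in> W" "v \<in> W"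
    show "linear_map C R\<^sub>T IDR (\<lambda>x. deriv_pure a c d (u @ [x] @ v))"
    proof (cases u)
      case Nil
      have "linear_map C R\<^sub>T IDR (\<lambda>x. IDR_pure (deriv a) c d ([] @ x # v) \<oplus>\<^bsub>IDR\<^esub> IDR_pure (a \<otimes> x) c d v)"
        using acd uv
        by (intro linear_map_fun_add[OF IDR_module] IDR_pure_linear(4) deriv_closed
            linear_map_comp[OF linear_map_comp[OF RT_incl R_mult_linear(2)] IDR_pure_linear(1)]) auto
      then show ?thesis using Nil by simp
    next
      case (Cons y u')
      have "linear_map C R\<^sub>T IDR (\<lambda>x. IDR_pure (deriv a) c d ((y # u') @ x # v) \<oplus>\<^bsub>IDR\<^esub>
          IDR_pure (a \<otimes> y) c d (u' @ x # v))"
        using acd uv Cons RT_R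
        by (intro linear_map_fun_add[OF IDR_module] IDR_pure_linear(4) deriv_closed) auto
      then show ?thesis using Cons by simp
    qed
  qed
qed

lemma eps1_closed: "a \<in> carrier R \<Longrightarrow> w \<in> W \<Longrightarrow> \<epsilon>\<^sub>1 (Q a) (pure w) \<in> carrier C\<^sub>1"
  by (rule bilinear_map_closed[OF eps1_bilinear _ T.pure_closed]) (simp add: RJ_carrier)

lemma C1_mult_linear:
  "b \<in> carrier C\<^sub>1 \<Longrightarrow> linear_map C C\<^sub>1 C\<^sub>1 (\<lambda>a. a \<otimes>\<^bsub>C\<^sub>1\<^esub> b)"
  "b \<in> carrier C\<^sub>1 \<Longrightarrow> linear_map C C\<^sub>1 C\<^sub>1 (\<lambda>a. b \<otimes>\<^bsub>C\<^sub>1\<^esub> a)"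
  using bilinear_mapD[OF algebra_mult_bilinear[OF C1_algebra]] by simp_all

lemma eps1_Q_linear:
  assumes "c \<in> carrier C\<^sub>1" "w \<in> W"
  shows "linear_map C R_alg C\<^sub>1 (\<lambda>a. c \<otimes>\<^bsub>C\<^sub>1\<^esub> \<epsilon>\<^sub>1 (Q a) (pure w))"
  by (rule linear_map_comp[OF linear_map_comp[OF Q_linear_RJ bilinear_mapD(2)[OF eps1_bilinear
    T.pure_closed[OF assms(2)]]] C1_mult_linear(2)[OF assms(1)]])

text \<open>Linearity in the coefficient is isolated because linearity in the letters depends on it:
  the recursive call has the coefficient \<open>Q a \<otimes> f\<^sub>1\<close>, so a first letter
  reappears there.\<close>

lemma integ_pure_linear_base:
  assumes c: "c \<in> carrier C\<^sub>1" and d: "d \<in> carrier C\<^sub>2"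
  shows "w \<in> W \<Longrightarrow> linear_map C R_alg IDR (\<lambda>a. integ_pure a c d w)"
proof (induction w)
  case Nil
  have "linear_map C R_alg IDR (\<lambda>a. IDR_pure \<one> c d ([] @ (a \<ominus> deriv (Q a)) # []))"
    using c d by (intro linear_map_comp[OF rest_linear IDR_pure_linear(4)]) auto
  then show ?case
    using c d
    by (auto intro!: linear_map_fun_add[OF IDR_module] linear_map_fun_minus[OF IDR_module]
        linear_map_comp[OF Q_linear_map IDR_pure_linear(1)] linear_map_comp[OF eps1_Q_linear IDR_pure_linear(2)])
next
  case (Cons x v)
  then have x: "x \<in> carrier R" and v: "v \<in> W" using RT_R by auto
  have 1: "linear_map C R_alg IDR (\<lambda>a. IDR_pure \<one> c d ([] @ (a \<ominus> deriv (Q a)) # (x # v)))"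
    using c d Cons.prems by (intro linear_map_comp[OF rest_linear IDR_pure_linear(4)]) auto
  have 2: "linear_map C R_alg IDR (\<lambda>a. integ_pure (Q a \<otimes> x) c d v)"
    by (rule linear_map_comp[OF linear_map_comp[OF Q_linear_map R_mult_linear(1)[OF x]] Cons.IH[OF v]])
  show ?case
    using 1 2 c d Cons.prems
    by (auto intro!: linear_map_fun_add[OF IDR_module] linear_map_fun_minus[OF IDR_module]
        linear_map_comp[OF Q_linear_map IDR_pure_linear(1)] linear_map_comp[OF eps1_Q_linear IDR_pure_linear(2)])
qed

lemma integ_pure_multilinear: "IDR_multilinear IDR integ_pure"
  unfolding IDR_multilinear_def
proof (intro conjI ballI)
  fix c d w assume "c \<in> carrier C\<^sub>1" "d \<in> carrier C\<^sub>2" "w \<in> W"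
  then show "linear_map C R_alg IDR (\<lambda>a. integ_pure a c d w)" by (rule integ_pure_linear_base)
next
  fix a d w assume d: "d \<in> carrier C\<^sub>2"
  assume "a \<in> carrier R" "w \<in> W"
  then show "linear_map C C\<^sub>1 IDR (\<lambda>c. integ_pure a c d w)"
  proof (induction w arbitrary: a)
    case Nil
    then show ?case using d
      by (auto intro!: linear_map_fun_add[OF IDR_module] linear_map_fun_minus[OF IDR_module]
          IDR_pure_linear(2) linear_map_comp[OF C1_mult_linear(1) IDR_pure_linear(2)] eps1_closed Q_closed rest_RT)
  next
    case (Cons x v)
    then have x: "x \<in> carrier R" using RT_R by auto
    then have "linear_map C C\<^sub>1 IDR (\<lambda>c. integ_pure (Q a \<otimes> x) c d v)"
      using Cons by (intro Cons.IH) (auto simp: Q_closed)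
    then show ?case using d Cons.prems
      by (auto intro!: linear_map_fun_add[OF IDR_module] linear_map_fun_minus[OF IDR_module]
          IDR_pure_linear(2) linear_map_comp[OF C1_mult_linear(1) IDR_pure_linear(2)] eps1_closed Q_closed rest_RT)
  qed
next
  interpret C1: algebra C C\<^sub>1 by (rule C1_algebra)
  fix a c w assume c: "c \<in> carrier C\<^sub>1"
  assume "a \<in> carrier R" "w \<in> W"
  then show "linear_map C C\<^sub>2 IDR (\<lambda>d. integ_pure a c d w)"
  proof (induction w arbitrary: a)
    case Nil
    then show ?case using c
      by (auto intro!: linear_map_fun_add[OF IDR_module] linear_map_fun_minus[OF IDR_module]
          IDR_pure_linear(3) eps1_closed Q_closed rest_RT)
  next
    case (Cons x v)
    then have x: "x \<in> carrier R" using RT_R by auto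
    then have "linear_map C C\<^sub>2 IDR (\<lambda>d. integ_pure (Q a \<otimes> x) c d v)"
      using Cons by (intro Cons.IH) (auto simp: Q_closed)
    moreover have "c \<otimes>\<^bsub>C\<^sub>1\<^esub> \<epsilon>\<^sub>1 (Q a) (pure (x # v)) \<in> carrier C\<^sub>1"
      using Cons.prems by (intro C1.m_closed c eps1_closed)
    ultimately show ?case using c Cons.prems
      by (auto intro!: linear_map_fun_add[OF IDR_module] linear_map_fun_minus[OF IDR_module]
          IDR_pure_linear(3) eps1_closed Q_closed rest_RT)
  qed
next
  interpret C1: algebra C C\<^sub>1 by (rule C1_algebra)
  fix a c d assume a: "a \<in> carrier R" and c: "c \<in> carrier C\<^sub>1" and d: "d \<in> carrier C\<^sub>2"
  have eps: "linear_map C R\<^sub>T IDR (\<lambda>x. IDR_pure \<one> (c \<otimes>\<^bsub>C\<^sub>1\<^esub> \<epsilon>\<^sub>1 (Q a) (pure (u @ x # v))) d [])"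
    if "a \<in> carrier R" "u \<in> W" "v \<in> W" for a u v
  proof -
    have "Q a \<in> carrier R\<^sub>J" using that by (simp add: RJ_carrier)
    from linear_map_comp[OF linear_map_comp[OF linear_map_comp[OF T.pure_slot_linear[OF that(2,3)]
          bilinear_mapD(1)[OF eps1_bilinear this]] C1_mult_linear(2)[OF c]] IDR_pure_linear(2)[OF one_closed d]]
    show ?thesis by simp
  qed
  have "linear_map C R\<^sub>T IDR (\<lambda>x. integ_pure a c d (u @ x # v))" if "u \<in> W" "v \<in> W" for u v
    using a that
  proof (induction u arbitrary: a)
    case Nil
    \<comment> \<open>With an empty prefix the varied letter enters the recursive call through the
      coefficient, where \<open>integ_pure_linear_base\<close> applies. Writing
      \<open>[] @ x # v\<close> only exhibits the slot.\<close>
    have "linear_map C R\<^sub>T IDR (\<lambda>x. IDR_pure (Q a) c d ([] @ x # v)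
       \<ominus>\<^bsub>IDR\<^esub> IDR_pure \<one> (c \<otimes>\<^bsub>C\<^sub>1\<^esub> \<epsilon>\<^sub>1 (Q a) (pure ([] @ x # v))) d []
       \<ominus>\<^bsub>IDR\<^esub> integ_pure (Q a \<otimes> x) c d v
       \<oplus>\<^bsub>IDR\<^esub> IDR_pure \<one> c d ([a \<ominus> deriv (Q a)] @ x # v))"
      using Nil c d
      by (intro linear_map_fun_add[OF IDR_module] linear_map_fun_minus[OF IDR_module] IDR_pure_linear(4) eps
          linear_map_comp[OF linear_map_comp[OF RT_incl R_mult_linear(2)] integ_pure_linear_base])
        (auto simp: Q_closed rest_RT)
    then show ?case by simp
  next
    case (Cons y u)
    then have y: "y \<in> carrier R" using RT_R by auto
    have "linear_map C R\<^sub>T IDR (\<lambda>x. IDR_pure (Q a) c d ((y # u) @ x # v)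
       \<ominus>\<^bsub>IDR\<^esub> IDR_pure \<one> (c \<otimes>\<^bsub>C\<^sub>1\<^esub> \<epsilon>\<^sub>1 (Q a) (pure ((y # u) @ x # v))) d []
       \<ominus>\<^bsub>IDR\<^esub> integ_pure (Q a \<otimes> y) c d (u @ x # v)
       \<oplus>\<^bsub>IDR\<^esub> IDR_pure \<one> c d (((a \<ominus> deriv (Q a)) # y # u) @ x # v))"
      using Cons y c d
      by (intro linear_map_fun_add[OF IDR_module] linear_map_fun_minus[OF IDR_module] IDR_pure_linear(4) eps
          Cons.IH) (auto simp: Q_closed rest_RT)
    then show ?case by simp
  qed
  then show "word_multilinear C R\<^sub>T IDR (\<lambda>w. integ_pure a c d w)"
    by (intro T.word_multilinearI) simp
qed

lemma IDR_deriv_works: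
  "linear_map C IDR IDR IDR_deriv"
  "a \<in> carrier R \<Longrightarrow> c \<in> carrier C\<^sub>1 \<Longrightarrow> d \<in> carrier C\<^sub>2 \<Longrightarrow> w \<in> W \<Longrightarrow>
     IDR_deriv (IDR_pure a c d w) = deriv_pure a c d w"
proof -
  have cl: "(case i of (a, c, d, w) \<Rightarrow> deriv_pure a c d w) \<in> carrier IDR" if "i \<in> IDR_index" for i
    using that linear_mapD(1)[OF IDR_multilinearD(1)[OF deriv_pure_multilinear]] by auto
  note ext = linear_ext_works[OF IDR_universal[OF IDR_module], of "\<lambda>(a, c, d, w). deriv_pure a c d w"]
  show "linear_map C IDR IDR IDR_deriv"
    unfolding IDR_deriv_def by (rule ext(1)) (use cl deriv_pure_multilinear in simp_all)
  show "a \<in> carrier R \<Longrightarrow> c \<in> carrier C\<^sub>1 \<Longrightarrow> d \<in> carrier C\<^sub>2 \<Longrightarrow> w \<in> W \<Longrightarrow>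
     IDR_deriv (IDR_pure a c d w) = deriv_pure a c d w"
    unfolding IDR_deriv_def using ext(2)[of "(a, c, d, w)"] cl deriv_pure_multilinear by simp
qed

lemma IDR_integ_works:
  "linear_map C IDR IDR IDR_integ"
  "a \<in> carrier R \<Longrightarrow> c \<in> carrier C\<^sub>1 \<Longrightarrow> d \<in> carrier C\<^sub>2 \<Longrightarrow> w \<in> W \<Longrightarrow>
     IDR_integ (IDR_pure a c d w) = integ_pure a c d w"
proof -
  have cl: "(case i of (a, c, d, w) \<Rightarrow> integ_pure a c d w) \<in> carrier IDR" if "i \<in> IDR_index" for i
    using that linear_mapD(1)[OF IDR_multilinearD(1)[OF integ_pure_multilinear]] by auto
  note ext = linear_ext_works[OF IDR_universal[OF IDR_module], of "\<lambda>(a, c, d, w). integ_pure a c d w"]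
  show "linear_map C IDR IDR IDR_integ"
    unfolding IDR_integ_def by (rule ext(1)) (use cl integ_pure_multilinear in simp_all)
  show "a \<in> carrier R \<Longrightarrow> c \<in> carrier C\<^sub>1 \<Longrightarrow> d \<in> carrier C\<^sub>2 \<Longrightarrow> w \<in> W \<Longrightarrow>
     IDR_integ (IDR_pure a c d w) = integ_pure a c d w"
    unfolding IDR_integ_def using ext(2)[of "(a, c, d, w)"] cl integ_pure_multilinear by simp
qed

end


section \<open>Generation by the coefficient ring\<close>

lemma (in abelian_group) add_minus_cancel:
  "x \<in> carrier G \<Longrightarrow> y \<in> carrier G \<Longrightarrow> (x \<oplus> y) \<ominus> x = y"
  by (simp add: a_minus_def a_comm[of x y] a_assoc r_neg)

lemma submodule_finsum_closed:
  assumes "module C M" "submodule H C M" "finite A" "\<And>i. i \<in> A \<Longrightarrow> f i \<in> H"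
  shows "finsum M f A \<in> H"
  using assms(3,4)
proof (induction A)
  case empty
  interpret M: module C M by (rule assms(1))
  show ?case using submodule_zero_closed[OF assms(2)] by simp
next
  case (insert a A)
  interpret M: module C M by (rule assms(1))
  have "f i \<in> carrier M" if "i \<in> insert a A" for i
    using insert.prems that M.submoduleE(1)[OF assms(2)] by blast
  then have "finsum M f (insert a A) = f a \<oplus>\<^bsub>M\<^esub> finsum M f A"
    using insert.hyps by (intro M.M.finsum_insert) auto
  then show ?case using insert M.submoduleE(5)[OF assms(2)] by simp
qed

text \<open>A distinguished summand is the sum minus all the others. It is used twice in a row to
  reach the entry \<open>i = j = 0\<close> of a double sum: for the row and then for the entry in
  it.\<close>

lemma submodule_finsum_cancel:
  assumes M: "module C M" and H: "submodule H C M" and A: "finite A" "a \<in> A"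
    and f: "\<And>i. i \<in> A \<Longrightarrow> f i \<in> carrier M" and sum: "finsum M f A \<in> H"
    and rest: "\<And>i. i \<in> A \<Longrightarrow> i \<noteq> a \<Longrightarrow> f i \<in> H"
  shows "f a \<in> H"
proof -
  interpret M: module C M by (rule M)
  have r: "finsum M f (A - {a}) \<in> H"
    by (rule submodule_finsum_closed[OF M H]) (use A rest in auto)
  then have rc: "finsum M f (A - {a}) \<in> carrier M" using M.submoduleE(1)[OF H] by blast
  have "finsum M f A = finsum M f (insert a (A - {a}))" using A by (simp add: insert_absorb)
  also have "\<dots> = f a \<oplus>\<^bsub>M\<^esub> finsum M f (A - {a})"
    using A f by (intro M.M.finsum_insert) auto
  finally have "f a = finsum M f A \<oplus>\<^bsub>M\<^esub> \<ominus>\<^bsub>M\<^esub> finsum M f (A - {a})"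
    using f[OF A(2)] rc by (simp add: M.M.a_assoc M.M.r_neg)
  then show ?thesis
    using M.submoduleE(5)[OF H sum M.submoduleE(3)[OF H r]] by simp
qed

lemma submodule_minus_closed:
  assumes "module C M" "submodule H C M" "x \<in> H" "y \<in> H"
  shows "x \<ominus>\<^bsub>M\<^esub> y \<in> H"
proof -
  interpret M: module C M by (rule assms(1))
  show ?thesis unfolding a_minus_def
    using M.submoduleE(5)[OF assms(2,3) M.submoduleE(3)[OF assms(2,4)]] .
qed

context comm_differential_ring_quasi
begin

lemma RT_Q: "x \<in> carrier R\<^sub>T \<Longrightarrow> Q x = \<zero>"
  by (simp add: RT_carrier)

lemma W_Nil: "[] \<in> W" by simp

text \<open>With an empty word on the left the double sum has no terms, so elements of the constants
  multiply without correction.\<close>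

lemma TC_product_Nil:
  assumes "c \<in> carrier C\<^sub>2" "d \<in> carrier C\<^sub>2" "w \<in> W"
  shows "tensor C C\<^sub>2 T c (pure []) \<otimes>\<^bsub>C\<^sub>2T\<^esub> tensor C C\<^sub>2 T d (pure w) = tensor C C\<^sub>2 T (c \<otimes>\<^bsub>C\<^sub>2\<^esub> d) (pure w)"
proof -
  interpret TC: module C TC by (rule TC_module)
  interpret C2: algebra C C\<^sub>2 by (rule C2_algebra)
  have "tensor C C\<^sub>2 T (c \<otimes>\<^bsub>C\<^sub>2\<^esub> d) (pure w) \<in> carrier TC"
    using assms by (intro bilinear_map_closed[OF TC_tensor] T.pure_closed C2.m_closed)
  then show ?thesis
    using C2T_mult_works(2)[OF assms(1,2) W_Nil assms(3)]
    by (simp add: C2T_simps TC_product_def)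
qed

lemma one_C1: "\<one>\<^bsub>C\<^sub>1\<^esub> \<in> carrier C\<^sub>1" and one_C2: "\<one>\<^bsub>C\<^sub>2\<^esub> \<in> carrier C\<^sub>2"
proof -
  interpret C1: algebra C C\<^sub>1 by (rule C1_algebra)
  interpret C2: algebra C C\<^sub>2 by (rule C2_algebra)
  show "\<one>\<^bsub>C\<^sub>1\<^esub> \<in> carrier C\<^sub>1" "\<one>\<^bsub>C\<^sub>2\<^esub> \<in> carrier C\<^sub>2" by simp_all
qed

lemma IDR_pure_Nil_mult:
  assumes "a \<in> carrier R" "a' \<in> carrier R" "c \<in> carrier C\<^sub>1" "c' \<in> carrier C\<^sub>1"
    "d \<in> carrier C\<^sub>2" "d' \<in> carrier C\<^sub>2" "w \<in> W"
  shows "IDR_pure a c d [] \<otimes>\<^bsub>IDR\<^esub> IDR_pure a' c' d' w =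
    IDR_pure (a \<otimes> a') (c \<otimes>\<^bsub>C\<^sub>1\<^esub> c') (d \<otimes>\<^bsub>C\<^sub>2\<^esub> d') w"
  unfolding IDR_pure_triple
  using triple_mult[OF assms(1-4) TC_pure_closed[OF assms(5) W_Nil] TC_pure_closed[OF assms(6,7)]]
    TC_product_Nil[OF assms(5-7)] by simp

lemma IDR_span: "submodule_span C IDR ((\<lambda>(a, c, d, w). IDR_pure a c d w) ` IDR_index) = carrier IDR"
  by (rule universalD(2)[OF IDR_universal[OF IDR_module]])

lemma IDR_incl_closed: "a \<in> carrier R \<Longrightarrow> IDR_incl a \<in> carrier IDR"
  unfolding IDR_incl_def by (intro IDR_pure_closed one_C1 one_C2 W_Nil)

lemma IDR_incl_mult_pure:
  assumes "a \<in> carrier R" "a' \<in> carrier R" "c \<in> carrier C\<^sub>1" "d \<in> carrier C\<^sub>2" "w \<in> W"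
  shows "IDR_incl a \<otimes>\<^bsub>IDR\<^esub> IDR_pure a' c d w = IDR_pure (a \<otimes> a') c d w"
proof -
  interpret C1: algebra C C\<^sub>1 by (rule C1_algebra)
  interpret C2: algebra C C\<^sub>2 by (rule C2_algebra)
  show ?thesis unfolding IDR_incl_def using assms by (simp add: IDR_pure_Nil_mult)
qed

lemma IDR_one: "\<one>\<^bsub>IDR\<^esub> = IDR_incl \<one>"
  by (simp add: IDR_def tensor_algebra_product_simps IDR_incl_def IDR_pure_def C2T_simps)

text \<open>A set that contains the image of \<open>R\<close> and is closed under products is
  thereby closed under scalars; this makes the sets considered in \<open>IDR_generated\<close>
  submodules.\<close>

lemma IDR_smult_eq:
  assumes k: "k \<in> carrier C" and x: "x \<in> carrier IDR"
  shows "k \<odot>\<^bsub>IDR\<^esub> x = IDR_incl k \<otimes>\<^bsub>IDR\<^esub> x"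
proof (rule linear_map_eqI[OF IDR_module IDR_module linear_map_fun_smult[OF IDR_module linear_map_id k]
      bilinear_mapD(1)[OF IDR_mult] IDR_span _ x])
  have kR: "k \<in> carrier R" using k constants_subset by auto
  then show "IDR_incl k \<in> carrier IDR" by (rule IDR_incl_closed)
  fix i assume i: "i \<in> IDR_index"
  then obtain a c d w where "i = (a, c, d, w)" "a \<in> carrier R" "c \<in> carrier C\<^sub>1" "d \<in> carrier C\<^sub>2" "w \<in> W"
    by auto
  then show "k \<odot>\<^bsub>IDR\<^esub> (case i of (a, c, d, w) \<Rightarrow> IDR_pure a c d w) =
      IDR_incl k \<otimes>\<^bsub>IDR\<^esub> (case i of (a, c, d, w) \<Rightarrow> IDR_pure a c d w)"
    using linear_mapD(3)[OF IDR_pure_linear(1), of c d w k a] k kR by (simp add: IDR_incl_mult_pure)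
qed

lemma IDR_pure_zero:
  "c \<in> carrier C\<^sub>1 \<Longrightarrow> d \<in> carrier C\<^sub>2 \<Longrightarrow> w \<in> W \<Longrightarrow> IDR_pure \<zero> c d w = \<zero>\<^bsub>IDR\<^esub>"
  "a \<in> carrier R \<Longrightarrow> d \<in> carrier C\<^sub>2 \<Longrightarrow> w \<in> W \<Longrightarrow> IDR_pure a \<zero>\<^bsub>C\<^sub>1\<^esub> d w = \<zero>\<^bsub>IDR\<^esub>"
  "a \<in> carrier R \<Longrightarrow> c \<in> carrier C\<^sub>1 \<Longrightarrow> d \<in> carrier C\<^sub>2 \<Longrightarrow> w \<in> W \<Longrightarrow> IDR_pure a c d (\<zero> # w) = \<zero>\<^bsub>IDR\<^esub>"
proof -
  show "c \<in> carrier C\<^sub>1 \<Longrightarrow> d \<in> carrier C\<^sub>2 \<Longrightarrow> w \<in> W \<Longrightarrow> IDR_pure \<zero> c d w = \<zero>\<^bsub>IDR\<^esub>"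
    using linear_map_zero[OF R_alg_module IDR_module IDR_pure_linear(1)] by simp
  show "a \<in> carrier R \<Longrightarrow> d \<in> carrier C\<^sub>2 \<Longrightarrow> w \<in> W \<Longrightarrow> IDR_pure a \<zero>\<^bsub>C\<^sub>1\<^esub> d w = \<zero>\<^bsub>IDR\<^esub>"
    using linear_map_zero[OF C1_module IDR_module IDR_pure_linear(2)] by simp
  show "a \<in> carrier R \<Longrightarrow> c \<in> carrier C\<^sub>1 \<Longrightarrow> d \<in> carrier C\<^sub>2 \<Longrightarrow> w \<in> W \<Longrightarrow> IDR_pure a c d (\<zero> # w) = \<zero>\<^bsub>IDR\<^esub>"
    using linear_map_zero[OF RT_module IDR_module IDR_pure_linear(4)[of a c d "[]" w]] by (simp add: R\<^sub>T_def)
qed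

lemma integ_pure_zero:
  "c \<in> carrier C\<^sub>1 \<Longrightarrow> d \<in> carrier C\<^sub>2 \<Longrightarrow> w \<in> W \<Longrightarrow> integ_pure \<zero> c d w = \<zero>\<^bsub>IDR\<^esub>"
  using linear_map_zero[OF R_alg_module IDR_module integ_pure_linear_base] by simp

lemma integ_pure_closed:
  "a \<in> carrier R \<Longrightarrow> c \<in> carrier C\<^sub>1 \<Longrightarrow> d \<in> carrier C\<^sub>2 \<Longrightarrow> w \<in> W \<Longrightarrow> integ_pure a c d w \<in> carrier IDR"
  using linear_mapD(1)[OF integ_pure_linear_base] by simp

text \<open>Since \<open>Q x = \<zero>\<close>, every summand containing \<open>Q x\<close> vanishes
  and \<open>x \<ominus> deriv (Q x)\<close> is \<open>x\<close>. So prepending a letter is an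
  integration.\<close>

lemma integ_pure_RT:
  assumes x: "x \<in> carrier R\<^sub>T" and c: "c \<in> carrier C\<^sub>1" and d: "d \<in> carrier C\<^sub>2" and w: "w \<in> W"
  shows "integ_pure x c d w = IDR_pure \<one> c d (x # w)"
proof -
  interpret C1: algebra C C\<^sub>1 by (rule C1_algebra)
  interpret I: module C IDR by (rule IDR_module)
  have Q: "Q x = \<zero>" and xR: "x \<in> carrier R" using x RT_Q RT_R by auto
  have mz: "\<ominus>\<^bsub>IDR\<^esub> \<zero>\<^bsub>IDR\<^esub> = \<zero>\<^bsub>IDR\<^esub>"
    using I.M.minus_equality[of "\<zero>\<^bsub>IDR\<^esub>" "\<zero>\<^bsub>IDR\<^esub>"] by simp
  have e: "\<epsilon>\<^sub>1 \<zero> (pure v) = \<zero>\<^bsub>C\<^sub>1\<^esub>" if "v \<in> W" for v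
    using linear_map_zero[OF RJ_module C1_module bilinear_mapD(2)[OF eps1_bilinear T.pure_closed[OF that]]]
    by (simp add: R\<^sub>J_def)
  have cl: "IDR_pure \<one> c d (x # w) \<in> carrier IDR"
    using x c d w by (intro IDR_pure_closed) auto
  show ?thesis
  proof (cases w)
    case Nil
    then show ?thesis using c d xR cl
      by (simp add: mz Q e IDR_pure_zero deriv_zero a_minus_def)
  next
    case (Cons y v)
    then have y: "y \<in> carrier R" "v \<in> W" "y # v \<in> W" using w RT_R by auto
    show ?thesis using c d xR cl y
      by (simp add: mz Q e IDR_pure_zero deriv_zero a_minus_def Cons integ_pure_zero del: in_lists_conv_set)
  qed
qed

text \<open>The integration formula is applied to the coefficient \<open>deriv r\<close>. As
  \<open>r\<close> lies in the image of \<open>Q\<close>, one has \<open>Q (deriv r) = r\<close>, so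
  the last summand of the formula vanishes and the second contains the constant of \<open>r\<close>
  and \<open>w\<close>. All remaining terms carry the units of \<open>C\<^sub>1\<close> and
  \<open>C\<^sub>2\<close>, hence lie in \<open>H\<close> by assumption.\<close>

lemma eps1_via_integ:
  assumes r: "r \<in> carrier R\<^sub>J" and H: "submodule H C IDR" and w: "w \<in> W"
    and h: "\<And>a v. a \<in> carrier R \<Longrightarrow> v \<in> W \<Longrightarrow> IDR_pure a \<one>\<^bsub>C\<^sub>1\<^esub> \<one>\<^bsub>C\<^sub>2\<^esub> v \<in> H"
      "\<And>a v. a \<in> carrier R \<Longrightarrow> v \<in> W \<Longrightarrow> integ_pure a \<one>\<^bsub>C\<^sub>1\<^esub> \<one>\<^bsub>C\<^sub>2\<^esub> v \<in> H"
  shows "IDR_pure \<one> (\<epsilon>\<^sub>1 r (pure w)) \<one>\<^bsub>C\<^sub>2\<^esub> [] \<in> H"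
proof -
  interpret C1: algebra C C\<^sub>1 by (rule C1_algebra)
  interpret I: module C IDR by (rule IDR_module)
  from r obtain b where b: "b \<in> carrier R" "r = Q b" by (auto simp: RJ_carrier)
  then have rR: "r \<in> carrier R" and drR: "deriv r \<in> carrier R" by (simp_all add: Q_closed deriv_closed)
  have Q: "Q (deriv r) = r" using b by (simp add: Q_deriv_Q)
  have rest: "deriv r \<ominus> deriv r = \<zero>" using drR by (simp add: a_minus_def r_neg)
  have ecl: "\<epsilon>\<^sub>1 r (pure w) \<in> carrier C\<^sub>1" using eps1_closed[OF b(1) w] b(2) by simp
  define e where "e = IDR_pure \<one> (\<epsilon>\<^sub>1 r (pure w)) \<one>\<^bsub>C\<^sub>2\<^esub> []"
  have e: "e \<in> carrier IDR" unfolding e_def by (intro IDR_pure_closed one_closed ecl one_C2 W_Nil)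
  have solve: "e \<in> H" if "p \<in> H" "z \<in> H" "z = p \<ominus>\<^bsub>IDR\<^esub> e" for p z
  proof -
    have pz: "p \<in> carrier IDR" "z \<in> carrier IDR" using that I.submoduleE(1)[OF H] by auto
    have "p \<ominus>\<^bsub>IDR\<^esub> z = e"
      unfolding that(3) using pz(1) e
      by (simp add: a_minus_def I.M.minus_add I.M.a_assoc[symmetric] I.M.r_neg)
    then show ?thesis using submodule_minus_closed[OF IDR_module H that(1,2)] by simp
  qed
  have pcl: "IDR_pure r \<one>\<^bsub>C\<^sub>1\<^esub> \<one>\<^bsub>C\<^sub>2\<^esub> w \<in> carrier IDR"
    by (intro IDR_pure_closed rR one_C1 one_C2 w)
  have "e \<in> H"
  proof (cases w)
    case Nil
    have "integ_pure (deriv r) \<one>\<^bsub>C\<^sub>1\<^esub> \<one>\<^bsub>C\<^sub>2\<^esub> [] = IDR_pure r \<one>\<^bsub>C\<^sub>1\<^esub> \<one>\<^bsub>C\<^sub>2\<^esub> [] \<ominus>\<^bsub>IDR\<^esub> e"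
      using ecl pcl e one_C2 Nil by (simp add: Q rest IDR_pure_zero e_def)
    then show ?thesis using solve[OF h(1)[OF rR W_Nil] h(2)[OF drR W_Nil]] by simp
  next
    case (Cons y v)
    then have y: "y \<in> carrier R" "v \<in> W" "y # v \<in> W" using w RT_R by auto
    have ry: "r \<otimes> y \<in> carrier R" using rR y by simp
    let ?p = "IDR_pure r \<one>\<^bsub>C\<^sub>1\<^esub> \<one>\<^bsub>C\<^sub>2\<^esub> (y # v)" and ?q = "integ_pure (r \<otimes> y) \<one>\<^bsub>C\<^sub>1\<^esub> \<one>\<^bsub>C\<^sub>2\<^esub> v"
    have qcl: "?q \<in> carrier IDR" by (intro integ_pure_closed ry one_C1 one_C2 y)
    have "integ_pure (deriv r) \<one>\<^bsub>C\<^sub>1\<^esub> \<one>\<^bsub>C\<^sub>2\<^esub> (y # v) = (?p \<ominus>\<^bsub>IDR\<^esub> e) \<ominus>\<^bsub>IDR\<^esub> ?q"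
      using ecl pcl e qcl one_C2 Cons y by (simp add: Q rest IDR_pure_zero e_def del: in_lists_conv_set)
    also have "\<dots> = (?p \<ominus>\<^bsub>IDR\<^esub> ?q) \<ominus>\<^bsub>IDR\<^esub> e"
      using pcl e qcl Cons by (simp add: a_minus_def I.M.a_ac)
    finally show ?thesis
      using solve[OF submodule_minus_closed[OF IDR_module H h(1)[OF rR y(3)] h(2)[OF ry y(2)]]
          h(2)[OF drR y(3)]] by simp
  qed
  then show ?thesis by (simp add: e_def)
qed

text \<open>Meant for the set on which two homomorphisms agree, so \<open>H\<close> is only assumed
  to be closed under the operations such maps preserve. That \<open>H\<close> is a submodule is
  derived: scalars act as elements of the image of \<open>R\<close>, and negatives are multiples by
  minus one.\<close>

lemma IDR_generated:
  assumes HI: "H \<subseteq> carrier IDR" and incl: "\<And>a. a \<in> carrier R \<Longrightarrow> IDR_incl a \<in> H"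
    and add: "\<And>x y. x \<in> H \<Longrightarrow> y \<in> H \<Longrightarrow> x \<oplus>\<^bsub>IDR\<^esub> y \<in> H"
    and mult: "\<And>x y. x \<in> H \<Longrightarrow> y \<in> H \<Longrightarrow> x \<otimes>\<^bsub>IDR\<^esub> y \<in> H"
    and integ: "\<And>x. x \<in> H \<Longrightarrow> IDR_integ x \<in> H"
    and x: "x \<in> carrier IDR"
  shows "x \<in> H"
proof -
  interpret Cc: cring C by (rule C_cring)
  interpret C1: algebra C C\<^sub>1 by (rule C1_algebra)
  interpret C2: algebra C C\<^sub>2 by (rule C2_algebra)
  interpret Sy: algebra C Sym\<^sub>2 by (rule Sym2_algebra)
  interpret I: module C IDR by (rule IDR_module)
  interpret TT: module C T by (rule T.tensors_module)
  interpret TC: module C TC by (rule TC_module)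
  let ?u1 = "\<one>\<^bsub>C\<^sub>1\<^esub>" and ?u2 = "\<one>\<^bsub>C\<^sub>2\<^esub>"
  have smult: "k \<odot>\<^bsub>IDR\<^esub> x \<in> H" if k: "k \<in> carrier C" and x: "x \<in> H" for k x
  proof -
    have "x \<in> carrier IDR" using x HI by auto
    moreover have "k \<in> carrier R" using k constants_subset by auto
    ultimately show ?thesis using IDR_smult_eq[OF k] mult[OF incl x] by metis
  qed
  have H: "submodule H C IDR"
  proof (rule I.submoduleI[OF HI _ _ add smult])
    show "\<zero>\<^bsub>IDR\<^esub> \<in> H" using incl[of \<zero>] IDR_pure_zero(1)[OF one_C1 one_C2 W_Nil] by (simp add: IDR_incl_def)
    fix a assume a: "a \<in> H"
    have "\<ominus>\<^bsub>IDR\<^esub> a = (\<ominus>\<^bsub>C\<^esub> \<one>\<^bsub>C\<^esub>) \<odot>\<^bsub>IDR\<^esub> a"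
      using I.smult_l_minus[OF Cc.one_closed subsetD[OF HI a]] I.smult_one[OF subsetD[OF HI a]] by simp
    then show "\<ominus>\<^bsub>IDR\<^esub> a \<in> H"
      using smult[OF _ a, of "\<ominus>\<^bsub>C\<^esub> \<one>\<^bsub>C\<^esub>"] Cc.a_inv_closed[OF Cc.one_closed] by simp
  qed
  have scale: "IDR_pure a c d w \<in> H"
    if "IDR_pure \<one> c d w \<in> H" "a \<in> carrier R" "c \<in> carrier C\<^sub>1" "d \<in> carrier C\<^sub>2" "w \<in> W" for a c d w
    using mult[OF incl[OF that(2)] that(1)] IDR_incl_mult_pure[of a \<one> c d w] that by simp
  have word: "IDR_pure \<one> ?u1 ?u2 w \<in> H" if "w \<in> W" for w
    using that
  proof (induction w)
    case Nil
    then show ?case using incl[of \<one>] by (simp add: IDR_incl_def)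
  next
    case (Cons z w)
    then have z: "z \<in> carrier R\<^sub>T" and w: "w \<in> W" by auto
    have "IDR_integ (IDR_pure z ?u1 ?u2 w) \<in> H"
      by (rule integ[OF scale[OF Cons.IH RT_R[OF z] one_C1 one_C2 w]])
    then show ?case
      using IDR_integ_works(2)[OF RT_R[OF z] one_C1 one_C2 w] integ_pure_RT[OF z one_C1 one_C2 w] by simp
  qed
  have pure: "IDR_pure a ?u1 ?u2 w \<in> H" if "a \<in> carrier R" "w \<in> W" for a w
    by (rule scale[OF word[OF that(2)] that(1) one_C1 one_C2 that(2)])
  have ip: "integ_pure a ?u1 ?u2 w \<in> H" if "a \<in> carrier R" "w \<in> W" for a w
    using integ[OF pure[OF that]] IDR_integ_works(2)[OF that(1) one_C1 one_C2 that(2)] by simp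
  \<comment> \<open>The elements of \<open>C\<^sub>1\<close> whose tensor with units lies in
    \<open>H\<close> form a subalgebra, because products with empty words have no correction terms;
    \<open>eps1_via_integ\<close> provides its generators.\<close>
  have c1: "IDR_pure \<one> c ?u2 [] \<in> H" if "c \<in> carrier C\<^sub>1" for c
  proof -
    let ?G = "{c \<in> carrier C\<^sub>1. IDR_pure \<one> c ?u2 [] \<in> H}"
    have G: "submodule ?G C C\<^sub>1"
      by (rule linear_map_vimage_submodule[OF C1_module IDR_module IDR_pure_linear(2)[OF one_closed one_C2 W_Nil] H])
    have span: "submodule_span C M\<^sub>1 ((\<lambda>(r, w). tensor C R\<^sub>J T r (pure w)) ` (carrier R\<^sub>J \<times> W)) = carrier M\<^sub>1"
      unfolding M\<^sub>1_def
      by (rule tensor_span[OF C_cring RJ_module T.tensors_module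
            universalD(2)[OF universal_self[OF RJ_module, where P = R\<^sub>J]] T.pure_span])
    have one: "\<one>\<^bsub>C\<^sub>1\<^esub> \<in> ?G"
      using word[OF W_Nil] by simp
    have mul: "x \<otimes>\<^bsub>C\<^sub>1\<^esub> y \<in> ?G" if "x \<in> ?G" "y \<in> ?G" for x y
      using that mult[of "IDR_pure \<one> x ?u2 []" "IDR_pure \<one> y ?u2 []"] by (simp add: IDR_pure_Nil_mult)
    have gen: "sym_monomial C M\<^sub>1 {#m#} \<in> ?G"
      if m: "m \<in> (\<lambda>(r, w). tensor C R\<^sub>J T r (pure w)) ` (carrier R\<^sub>J \<times> W)" for m
    proof -
      from m obtain r w where m: "m = tensor C R\<^sub>J T r (pure w)" "r \<in> carrier R\<^sub>J" "w \<in> W" by auto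
      have eq: "sym_monomial C M\<^sub>1 {#m#} = \<epsilon>\<^sub>1 r (pure w)" by (simp add: \<epsilon>\<^sub>1_def m)
      show ?thesis
        unfolding eq
        using eps1_via_integ[OF m(2) H m(3) pure ip] bilinear_map_closed[OF eps1_bilinear m(2) T.pure_closed[OF m(3)]]
        by simp
    qed
    have "c \<in> ?G"
      by (rule S1.sym_algebra_induct[folded C\<^sub>1_def, OF G one mul span gen that])
    then show ?thesis by simp
  qed
  have tl: "linear_map C T IDR (\<lambda>t. triple \<one> ?u1 (tensor C C\<^sub>2 T d t))" if "d \<in> carrier C\<^sub>2" for d
    by (rule linear_map_comp[OF bilinear_mapD(1)[OF C2T_tensor that] triple_linear(3)[OF one_closed one_C1]])
  \<comment> \<open>Multiplying by a word whose constants are units places any word behind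
    \<open>d\<close>, and linearity then any tensor. It is needed for arbitrary \<open>t\<close>
    since the summands of the product formula contain shuffles.\<close>
  have tens: "triple \<one> ?u1 (tensor C C\<^sub>2 T d t) \<in> H"
    if "IDR_pure \<one> ?u1 d [] \<in> H" "d \<in> carrier C\<^sub>2" "t \<in> carrier T" for d t
  proof (rule linear_map_span_image[OF T.tensors_module IDR_module tl[OF that(2)] T.pure_span H _ that(3)])
    have "IDR_pure \<one> ?u1 d w \<in> H" if w: "w \<in> W" for w
      using mult[OF \<open>IDR_pure \<one> ?u1 d [] \<in> H\<close> word[OF w]] \<open>d \<in> carrier C\<^sub>2\<close> w one_C1 one_C2
        IDR_pure_Nil_mult[of \<one> \<one> ?u1 ?u1 d ?u2 w] by simp
    then show "(\<lambda>t. triple \<one> ?u1 (tensor C C\<^sub>2 T d t)) ` (pure ` W) \<subseteq> H"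
      unfolding IDR_pure_triple by blast
  qed
  have tr: "linear_map C TC IDR (triple \<one> ?u1)"
    using triple_linear(3)[OF one_closed one_C1] by (simp add: C2T_linear)
  have eps_cl: "\<epsilon>\<^sub>2 s t \<in> carrier C\<^sub>2" if "s \<in> carrier T_pos" "t \<in> carrier T_pos" for s t
    by (rule bilinear_map_closed[OF eps2_bilinear that])
  \<comment> \<open>Strong induction on the total length: in the product of the words
    \<open>f\<close> and \<open>g\<close>, each summand other than \<open>i = j = 0\<close> has a
    strictly shorter pair of suffixes in its constant, while the leading shuffle term needs no
    constant at all.\<close>
  have eps: "IDR_pure \<one> ?u1 (\<epsilon>\<^sub>2 (pure f) (pure g)) [] \<in> H"
    if "f \<in> W" "f \<noteq> []" "g \<in> W" "g \<noteq> []" for f g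
    using that
  proof (induction "length f + length g" arbitrary: f g rule: less_induct)
    case less
    note f = less.prems(1,2) and g = less.prems(3,4)
    let ?c = "\<lambda>i j. cross ?u2 ?u2 (take i f) (drop i f) (take j g) (drop j g)"
    let ?t = "\<lambda>i j. triple \<one> ?u1 (?c i j)"
    let ?S = "\<lambda>i. \<Oplus>\<^bsub>IDR\<^esub>j\<in>{0..<length g}. ?t i j"
    have ccl: "?c i j \<in> carrier TC" if "i < length f" "j < length g" for i j
      using that f g by (intro cross_closed one_C2 W_take_drop) auto
    have tcl: "?t i j \<in> carrier IDR" if "i < length f" "j < length g" for i j
      by (rule linear_mapD(1)[OF tr ccl[OF that]])
    have Scl: "?S i \<in> carrier IDR" if "i < length f" for i
      using tcl[OF that] by (intro I.M.finsum_closed) auto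
    have eps_d: "\<epsilon>\<^sub>2 (pure (drop i f)) (pure (drop j g)) \<in> carrier C\<^sub>2" if "i < length f" "j < length g" for i j
      using that f g by (intro eps_cl pure_drop_pos) auto
    have tH: "?t i j \<in> H" if ij: "i < length f" "j < length g" "i \<noteq> 0 \<or> j \<noteq> 0" for i j
    proof -
      have "IDR_pure \<one> ?u1 (\<epsilon>\<^sub>2 (pure (drop i f)) (pure (drop j g))) [] \<in> H"
        using ij f g by (intro less.hyps W_take_drop) auto
      from tens[OF this eps_d[OF ij(1,2)]] show ?thesis
        using f g eps_d[OF ij(1,2)] T.shuffle_closed[of "take i f" "take j g"] W_take_drop
        by (simp add: cross_def one_C2)
    qed
    have fT: "tensor C C\<^sub>2 T ?u2 (sh f g) \<in> carrier TC"
      using f g by (intro bilinear_map_closed[OF TC_tensor] one_C2 T.shuffle_closed)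
    have sumT: "(\<Oplus>\<^bsub>TC\<^esub>i\<in>{0..<length f}. \<Oplus>\<^bsub>TC\<^esub>j\<in>{0..<length g}. ?c i j) \<in> carrier TC"
      using ccl by (intro TC.M.finsum_closed Pi_I) auto
    have prod: "IDR_pure \<one> ?u1 ?u2 f \<otimes>\<^bsub>IDR\<^esub> IDR_pure \<one> ?u1 ?u2 g = triple \<one> ?u1 (TC_product ?u2 f ?u2 g)"
      unfolding IDR_pure_triple
      using triple_mult[OF one_closed one_closed one_C1 one_C1 TC_pure_closed[OF one_C2 f(1)]
          TC_pure_closed[OF one_C2 g(1)]] C2T_mult_works(2)[OF one_C2 one_C2 f(1) g(1)] one_C1
      by (simp add: C2T_simps)
    have "triple \<one> ?u1 (TC_product ?u2 f ?u2 g) =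
        triple \<one> ?u1 (tensor C C\<^sub>2 T ?u2 (sh f g)) \<oplus>\<^bsub>IDR\<^esub>
        triple \<one> ?u1 (\<Oplus>\<^bsub>TC\<^esub>i\<in>{0..<length f}. \<Oplus>\<^bsub>TC\<^esub>j\<in>{0..<length g}. ?c i j)"
      unfolding TC_product_def using linear_mapD(2)[OF tr fT sumT] one_C2 by simp
    also have "triple \<one> ?u1 (\<Oplus>\<^bsub>TC\<^esub>i\<in>{0..<length f}. \<Oplus>\<^bsub>TC\<^esub>j\<in>{0..<length g}. ?c i j) =
        (\<Oplus>\<^bsub>IDR\<^esub>i\<in>{0..<length f}. triple \<one> ?u1 (\<Oplus>\<^bsub>TC\<^esub>j\<in>{0..<length g}. ?c i j))"
      by (rule linear_map_finsum[OF TC_module IDR_module tr]) (use ccl in \<open>auto intro!: TC.M.finsum_closed\<close>)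
    also have "\<dots> = (\<Oplus>\<^bsub>IDR\<^esub>i\<in>{0..<length f}. ?S i)"
      by (rule I.M.finsum_cong')
        (use Scl in \<open>auto intro!: linear_map_finsum[OF TC_module IDR_module tr] ccl\<close>)
    finally have eq: "IDR_pure \<one> ?u1 ?u2 f \<otimes>\<^bsub>IDR\<^esub> IDR_pure \<one> ?u1 ?u2 g =
        triple \<one> ?u1 (tensor C C\<^sub>2 T ?u2 (sh f g)) \<oplus>\<^bsub>IDR\<^esub> (\<Oplus>\<^bsub>IDR\<^esub>i\<in>{0..<length f}. ?S i)"
      using prod by simp
    have p: "triple \<one> ?u1 (tensor C C\<^sub>2 T ?u2 (sh f g)) \<in> H"
      by (rule tens[OF word[OF W_Nil] one_C2 T.shuffle_closed[OF f(1) g(1)]])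
    have tot: "(\<Oplus>\<^bsub>IDR\<^esub>i\<in>{0..<length f}. ?S i) \<in> carrier IDR"
      using Scl by (intro I.M.finsum_closed) auto
    have pc: "triple \<one> ?u1 (tensor C C\<^sub>2 T ?u2 (sh f g)) \<in> carrier IDR" using p HI by auto
    have "(\<Oplus>\<^bsub>IDR\<^esub>i\<in>{0..<length f}. ?S i) = IDR_pure \<one> ?u1 ?u2 f \<otimes>\<^bsub>IDR\<^esub> IDR_pure \<one> ?u1 ?u2 g
        \<ominus>\<^bsub>IDR\<^esub> triple \<one> ?u1 (tensor C C\<^sub>2 T ?u2 (sh f g))"
      unfolding eq by (rule I.M.add_minus_cancel[symmetric, OF pc tot])
    then have "(\<Oplus>\<^bsub>IDR\<^esub>i\<in>{0..<length f}. ?S i) \<in> H"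
      using submodule_minus_closed[OF IDR_module H mult[OF word[OF f(1)] word[OF g(1)]] p] by simp
    \<comment> \<open>All rows but the first consist of entries in \<open>H\<close>, so the first
      row lies in \<open>H\<close>; repeating this inside the row leaves the corner. Both words are
      nonempty, so the corner exists.\<close>
    then have "?S 0 \<in> H"
    proof (rule submodule_finsum_cancel[OF IDR_module H _ _ _ , rotated 3])
      show "?S i \<in> H" if "i \<in> {0..<length f}" "i \<noteq> 0" for i
        using that tH by (intro submodule_finsum_closed[OF IDR_module H]) auto
    qed (use f Scl in auto)
    moreover have f0: "0 < length f" and g0: "0 \<in> {0..<length g}" using f g by auto
    ultimately have "?t 0 0 \<in> H"
      using submodule_finsum_cancel[OF IDR_module H finite_atLeastLessThan g0, of "?t 0"] tcl[OF f0] tH[OF f0]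
      by auto
    \<comment> \<open>At the corner the prefixes are empty and their shuffle is the empty word, so
      the entry is the constant of \<open>f\<close> and \<open>g\<close> itself.\<close>
    then show ?case
      using f g eps_d[of 0 0] by (simp add: IDR_pure_triple cross_def one_C2)
  qed
  have eps': "IDR_pure \<one> ?u1 (\<epsilon>\<^sub>2 s t) [] \<in> H" if s: "s \<in> carrier T_pos" and t: "t \<in> carrier T_pos" for s t
  proof -
    note l = IDR_pure_linear(3)[OF one_closed one_C1 W_Nil]
    have "IDR_pure \<one> ?u1 (\<epsilon>\<^sub>2 (pure f) t) [] \<in> H" if f: "f \<in> W" "f \<noteq> []" for f
      by (rule linear_map_span_image[OF T.tensors_pos_module IDR_module
            linear_map_comp[OF bilinear_mapD(1)[OF eps2_bilinear T.pure_pos_closed[OF f]] l] T.pure_pos_span H _ t])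
        (use eps[OF f] in blast)
    then show ?thesis
      by (intro linear_map_span_image[OF T.tensors_pos_module IDR_module
            linear_map_comp[OF bilinear_mapD(2)[OF eps2_bilinear t] l] T.pure_pos_span H _ s]) blast
  qed
  \<comment> \<open>The induction takes place in \<open>Sym\<^sub>2\<close>, on the preimage of
    \<open>H\<close> under the projection to \<open>C\<^sub>2\<close>, because generators and
    monomials are available there; every element of \<open>C\<^sub>2\<close> is a class.\<close>
  have c2: "IDR_pure \<one> ?u1 d [] \<in> H" if d: "d \<in> carrier C\<^sub>2" for d
  proof -
    note pl = linear_map_comp[OF C2_proj_linear IDR_pure_linear(3)[OF one_closed one_C1 W_Nil]]
    let ?p = "\<lambda>x. J\<^sub>2 +>\<^bsub>Sym\<^sub>2\<^esub> x"
    let ?G = "{x \<in> carrier Sym\<^sub>2. IDR_pure \<one> ?u1 (?p x) [] \<in> H}"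
    have pcl: "?p x \<in> carrier C\<^sub>2" if "x \<in> carrier Sym\<^sub>2" for x
      by (rule linear_mapD(1)[OF C2_proj_linear that])
    have G: "submodule ?G C Sym\<^sub>2"
      by (rule linear_map_vimage_submodule[OF Sy.module_axioms IDR_module pl H])
    have one: "\<one>\<^bsub>Sym\<^sub>2\<^esub> \<in> ?G"
      using word[OF W_Nil] by (simp add: C\<^sub>2_def quotient_module_simps)
    have mul: "x \<otimes>\<^bsub>Sym\<^sub>2\<^esub> y \<in> ?G" if "x \<in> ?G" "y \<in> ?G" for x y
    proof -
      have "?p (x \<otimes>\<^bsub>Sym\<^sub>2\<^esub> y) = ?p x \<otimes>\<^bsub>C\<^sub>2\<^esub> ?p y"
        unfolding C\<^sub>2_def using quotient_algebra_mult[OF Sym2_algebra J2_ideal] that by simp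
      moreover have "IDR_pure \<one> ?u1 (?p x \<otimes>\<^bsub>C\<^sub>2\<^esub> ?p y) [] \<in> H"
        using mult[of "IDR_pure \<one> ?u1 (?p x) []" "IDR_pure \<one> ?u1 (?p y) []"] that pcl one_C1
          IDR_pure_Nil_mult[of \<one> \<one> ?u1 ?u1 "?p x" "?p y" "[]"] by simp
      ultimately show ?thesis using that by simp
    qed
    have span: "submodule_span C M\<^sub>2 (sym_prod C T_pos ` multiwords T_pos 2) = carrier M\<^sub>2"
      unfolding M\<^sub>2_def by (rule universalD(2)[OF Tp.universal_sym_prod[OF T.tensors_pos_module]])
    have gen: "sym_monomial C M\<^sub>2 {#m#} \<in> ?G" if m: "m \<in> sym_prod C T_pos ` multiwords T_pos 2" for m
    proof -
      obtain u where u: "u \<in> multiwords T_pos 2" "m = sym_prod C T_pos u" using m by auto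
      then have "size u = Suc (Suc 0)" by (simp add: multiwords_def)
      then obtain s v where v: "u = add_mset s v" "size v = Suc 0"
        using size_eq_Suc_imp_eq_union[of u "Suc 0"] by auto
      then obtain t where st: "u = {#s, t#}"
        using size_eq_Suc_imp_eq_union[of v 0] by auto
      have sT: "s \<in> carrier T_pos" "t \<in> carrier T_pos" using u(1) by (auto simp: st multiwords_def)
      have eq: "sym_monomial C M\<^sub>2 {#m#} = \<epsilon>' s t" by (simp add: \<epsilon>'_def u(2) st)
      show ?thesis
        unfolding eq using eps'[OF sT] bilinear_map_closed[OF eps'_bilinear sT] by (simp add: \<epsilon>\<^sub>2_def)
    qed
    have "x \<in> ?G" if "x \<in> carrier Sym\<^sub>2" for x
      by (rule S2.sym_algebra_induct[folded Sym\<^sub>2_def, OF G one mul span gen that])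
    moreover have "d \<in> ?p ` carrier Sym\<^sub>2"
      using d quotient_carrier[OF Sy.module_axioms algebra_ideal_submodule[OF Sym2_algebra J2_ideal]]
      by (simp add: C\<^sub>2_def)
    ultimately show ?thesis by auto
  qed
  have gen: "IDR_pure a c d w \<in> H" if "a \<in> carrier R" "c \<in> carrier C\<^sub>1" "d \<in> carrier C\<^sub>2" "w \<in> W" for a c d w
  proof -
    have "IDR_pure \<one> ?u1 d [] \<otimes>\<^bsub>IDR\<^esub> IDR_pure \<one> ?u1 ?u2 w = IDR_pure \<one> ?u1 d w"
      using that one_C1 one_C2 by (simp add: IDR_pure_Nil_mult)
    then have "IDR_pure \<one> ?u1 d w \<in> H" using mult[OF c2[OF that(3)] word[OF that(4)]] by simp
    moreover have "IDR_pure \<one> c ?u2 [] \<otimes>\<^bsub>IDR\<^esub> IDR_pure \<one> ?u1 d w = IDR_pure \<one> c d w"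
      using that one_C1 one_C2 by (simp add: IDR_pure_Nil_mult)
    ultimately have "IDR_pure \<one> c d w \<in> H" using mult[OF c1[OF that(2)]] by metis
    from scale[OF this that] show ?thesis .
  qed
  show ?thesis
    by (rule span_carrier_induct[OF IDR_span H _ x]) (use gen in auto)
qed

end


section \<open>Evaluation of iterated integrals\<close>

context abelian_monoid
begin

lemma finsum_Suc_shift:
  fixes n :: nat
  assumes "\<And>i. i < Suc n \<Longrightarrow> f i \<in> carrier G"
  shows "(\<Oplus>i\<in>{0..<Suc n}. f i) = f 0 \<oplus> (\<Oplus>i\<in>{0..<n}. f (Suc i))"
proof -
  have "{0..<Suc n} = insert 0 (Suc ` {0..<n})" by (auto simp: image_iff less_Suc_eq_0_disj)
  moreover have "(\<Oplus>i\<in>insert 0 (Suc ` {0..<n}). f i) = f 0 \<oplus> (\<Oplus>i\<in>Suc ` {0..<n}. f i)"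
    using assms by (intro finsum_insert) auto
  moreover have "(\<Oplus>i\<in>Suc ` {0..<n}. f i) = (\<Oplus>i\<in>{0..<n}. f (Suc i))"
    using assms by (intro finsum_reindex) auto
  ultimately show ?thesis by simp
qed

lemma finsum_swap:
  assumes "finite A" "finite B" "\<And>i j. i \<in> A \<Longrightarrow> j \<in> B \<Longrightarrow> f i j \<in> carrier G"
  shows "(\<Oplus>i\<in>A. \<Oplus>j\<in>B. f i j) = (\<Oplus>j\<in>B. \<Oplus>i\<in>A. f i j)"
  using assms(1,3)
proof (induction A)
  case empty
  have "(\<Oplus>j\<in>B. \<zero>) = \<zero>" by (rule finsum_zero)
  then show ?case by simp
next
  case (insert a A)
  have "(\<Oplus>i\<in>insert a A. \<Oplus>j\<in>B. f i j) = (\<Oplus>j\<in>B. f a j) \<oplus> (\<Oplus>i\<in>A. \<Oplus>j\<in>B. f i j)"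
    using insert by (intro finsum_insert) auto
  also have "\<dots> = (\<Oplus>j\<in>B. f a j) \<oplus> (\<Oplus>j\<in>B. \<Oplus>i\<in>A. f i j)"
    using insert by simp
  also have "\<dots> = (\<Oplus>j\<in>B. f a j \<oplus> (\<Oplus>i\<in>A. f i j))"
    using insert by (intro finsum_addf[symmetric]) auto
  also have "\<dots> = (\<Oplus>j\<in>B. \<Oplus>i\<in>insert a A. f i j)"
    using insert by (intro finsum_cong') auto
  finally show ?case .
qed

text \<open>
  The grid \<open>{0..n} \<times> {0..m}\<close> is split into its corner and the two shifted grids along
  which the recursion of the shuffle product runs.
\<close>

lemma finsum_grid_split:
  fixes n m :: nat
  assumes A: "\<And>i j. i < n \<Longrightarrow> j < Suc m \<Longrightarrow> A i j \<in> carrier G"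
    and B: "\<And>i j. i < Suc n \<Longrightarrow> j < m \<Longrightarrow> B i j \<in> carrier G" and e: "e \<in> carrier G"
    and c: "c 0 0 = e" "\<And>i. i < n \<Longrightarrow> c (Suc i) 0 = A i 0" "\<And>j. j < m \<Longrightarrow> c 0 (Suc j) = B 0 j"
      "\<And>i j. i < n \<Longrightarrow> j < m \<Longrightarrow> c (Suc i) (Suc j) = A i (Suc j) \<oplus> B (Suc i) j"
  shows "(\<Oplus>i\<in>{0..<Suc n}. \<Oplus>j\<in>{0..<Suc m}. c i j) =
    e \<oplus> (\<Oplus>i\<in>{0..<n}. \<Oplus>j\<in>{0..<Suc m}. A i j) \<oplus> (\<Oplus>i\<in>{0..<Suc n}. \<Oplus>j\<in>{0..<m}. B i j)"
proof -
  have cc: "c i j \<in> carrier G" if "i < Suc n" "j < Suc m" for i j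
    using that A B e c by (cases i; cases j) auto
  have sA: "(\<Oplus>j\<in>{0..<Suc m}. A i j) \<in> carrier G" if "i < n" for i
    using A[OF that] by (intro finsum_closed) auto
  have sB: "(\<Oplus>j\<in>{0..<m}. B i j) \<in> carrier G" if "i < Suc n" for i
    using B[OF that] by (intro finsum_closed) auto
  have row0: "(\<Oplus>j\<in>{0..<Suc m}. c 0 j) = e \<oplus> (\<Oplus>j\<in>{0..<m}. B 0 j)"
  proof -
    have "(\<Oplus>j\<in>{0..<Suc m}. c 0 j) = c 0 0 \<oplus> (\<Oplus>j\<in>{0..<m}. c 0 (Suc j))"
      using cc by (intro finsum_Suc_shift) auto
    also have "(\<Oplus>j\<in>{0..<m}. c 0 (Suc j)) = (\<Oplus>j\<in>{0..<m}. B 0 j)"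
      using B c by (intro finsum_cong') auto
    finally show ?thesis by (simp add: c)
  qed
  have row: "(\<Oplus>j\<in>{0..<Suc m}. c (Suc i) j) = (\<Oplus>j\<in>{0..<Suc m}. A i j) \<oplus> (\<Oplus>j\<in>{0..<m}. B (Suc i) j)"
    if i: "i < n" for i
  proof -
    have AS: "(\<Oplus>j\<in>{0..<m}. A i (Suc j)) \<in> carrier G" using A[OF i] by (intro finsum_closed) auto
    have "(\<Oplus>j\<in>{0..<Suc m}. c (Suc i) j) = c (Suc i) 0 \<oplus> (\<Oplus>j\<in>{0..<m}. c (Suc i) (Suc j))"
      using cc i by (intro finsum_Suc_shift) auto
    also have "(\<Oplus>j\<in>{0..<m}. c (Suc i) (Suc j)) = (\<Oplus>j\<in>{0..<m}. A i (Suc j) \<oplus> B (Suc i) j)"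
      using A B c i by (intro finsum_cong') auto
    also have "\<dots> = (\<Oplus>j\<in>{0..<m}. A i (Suc j)) \<oplus> (\<Oplus>j\<in>{0..<m}. B (Suc i) j)"
      using A B i by (intro finsum_addf) auto
    also have "c (Suc i) 0 \<oplus> ((\<Oplus>j\<in>{0..<m}. A i (Suc j)) \<oplus> (\<Oplus>j\<in>{0..<m}. B (Suc i) j)) =
        (A i 0 \<oplus> (\<Oplus>j\<in>{0..<m}. A i (Suc j))) \<oplus> (\<Oplus>j\<in>{0..<m}. B (Suc i) j)"
      using A[OF i] AS sB[of "Suc i"] i by (simp add: c a_assoc)
    also have "A i 0 \<oplus> (\<Oplus>j\<in>{0..<m}. A i (Suc j)) = (\<Oplus>j\<in>{0..<Suc m}. A i j)"
      using A[OF i] by (intro finsum_Suc_shift[symmetric]) auto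
    finally show ?thesis .
  qed
  have SA: "(\<Oplus>i\<in>{0..<n}. \<Oplus>j\<in>{0..<Suc m}. A i j) \<in> carrier G"
    using sA by (intro finsum_closed) auto
  have SB: "(\<Oplus>i\<in>{0..<n}. \<Oplus>j\<in>{0..<m}. B (Suc i) j) \<in> carrier G"
    using sB by (intro finsum_closed) auto
  have "(\<Oplus>i\<in>{0..<Suc n}. \<Oplus>j\<in>{0..<Suc m}. c i j) =
      (\<Oplus>j\<in>{0..<Suc m}. c 0 j) \<oplus> (\<Oplus>i\<in>{0..<n}. \<Oplus>j\<in>{0..<Suc m}. c (Suc i) j)"
    using cc by (intro finsum_Suc_shift finsum_closed) auto
  also have "(\<Oplus>i\<in>{0..<n}. \<Oplus>j\<in>{0..<Suc m}. c (Suc i) j) =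
      (\<Oplus>i\<in>{0..<n}. (\<Oplus>j\<in>{0..<Suc m}. A i j) \<oplus> (\<Oplus>j\<in>{0..<m}. B (Suc i) j))"
    using row sA sB by (intro finsum_cong') auto
  also have "\<dots> = (\<Oplus>i\<in>{0..<n}. \<Oplus>j\<in>{0..<Suc m}. A i j) \<oplus> (\<Oplus>i\<in>{0..<n}. \<Oplus>j\<in>{0..<m}. B (Suc i) j)"
    using sA sB by (intro finsum_addf) auto
  also have "(\<Oplus>j\<in>{0..<Suc m}. c 0 j) \<oplus> \<dots> = e \<oplus> (\<Oplus>i\<in>{0..<n}. \<Oplus>j\<in>{0..<Suc m}. A i j) \<oplus>
      ((\<Oplus>j\<in>{0..<m}. B 0 j) \<oplus> (\<Oplus>i\<in>{0..<n}. \<Oplus>j\<in>{0..<m}. B (Suc i) j))"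
    using e SA SB sB[of 0] unfolding row0 by (simp only: a_ac a_closed zero_less_Suc)
  also have "(\<Oplus>j\<in>{0..<m}. B 0 j) \<oplus> (\<Oplus>i\<in>{0..<n}. \<Oplus>j\<in>{0..<m}. B (Suc i) j) =
      (\<Oplus>i\<in>{0..<Suc n}. \<Oplus>j\<in>{0..<m}. B i j)"
    using sB by (intro finsum_Suc_shift[symmetric]) auto
  finally show ?thesis .
qed

end

context abelian_group
begin

lemma finsum_minus_distrib:
  assumes "finite A" "\<And>i. i \<in> A \<Longrightarrow> f i \<in> carrier G" "\<And>i. i \<in> A \<Longrightarrow> g i \<in> carrier G"
  shows "(\<Oplus>i\<in>A. f i \<ominus> g i) = (\<Oplus>i\<in>A. f i) \<ominus> (\<Oplus>i\<in>A. g i)"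
  using assms
proof (induction A)
  case empty
  then show ?case by (simp add: a_minus_def r_neg)
next
  case (insert a A)
  have cl: "(\<Oplus>i\<in>A. f i) \<in> carrier G" "(\<Oplus>i\<in>A. g i) \<in> carrier G" "f a \<in> carrier G" "g a \<in> carrier G"
    using insert by (auto intro!: finsum_closed)
  have "(\<Oplus>i\<in>insert a A. f i \<ominus> g i) = (f a \<ominus> g a) \<oplus> (\<Oplus>i\<in>A. f i \<ominus> g i)"
    using insert by (intro finsum_insert) auto
  also have "(\<Oplus>i\<in>A. f i \<ominus> g i) = (\<Oplus>i\<in>A. f i) \<ominus> (\<Oplus>i\<in>A. g i)"
    using insert by simp
  also have "(f a \<ominus> g a) \<oplus> ((\<Oplus>i\<in>A. f i) \<ominus> (\<Oplus>i\<in>A. g i)) =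
      (f a \<oplus> (\<Oplus>i\<in>A. f i)) \<ominus> (g a \<oplus> (\<Oplus>i\<in>A. g i))"
    using cl by (simp add: a_minus_def minus_add a_ac)
  finally show ?case using insert by (simp add: Pi_def)
qed

text \<open>The shape of a generator of \<open>J\<^sub>2\<close>: two leading terms are subtracted,
  and the two sums of corrections are collected in a second difference.\<close>

lemma minus_add_minus_zero:
  assumes "x \<in> carrier G" "y \<in> carrier G" "p \<in> carrier G" "q \<in> carrier G" "x \<oplus> p = y \<oplus> q"
  shows "(x \<ominus> y) \<oplus> (p \<ominus> q) = \<zero>"
proof -
  have "(x \<ominus> y) \<oplus> (p \<ominus> q) = (x \<oplus> p) \<ominus> (y \<oplus> q)"
    using assms(1-4) by (simp add: a_minus_def minus_add a_ac)
  then show ?thesis using assms by (simp add: minus_eq_zero_iff)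
qed

end

lemma linear_map_finsum2:
  assumes "module C M" "module C N" "linear_map C M N h" "finite A" "finite B"
    and "\<And>i j. i \<in> A \<Longrightarrow> j \<in> B \<Longrightarrow> f i j \<in> carrier M"
  shows "h (\<Oplus>\<^bsub>M\<^esub>i\<in>A. \<Oplus>\<^bsub>M\<^esub>j\<in>B. f i j) = (\<Oplus>\<^bsub>N\<^esub>i\<in>A. \<Oplus>\<^bsub>N\<^esub>j\<in>B. h (f i j))"
proof -
  interpret M: module C M by fact
  interpret N: module C N by fact
  have "h (\<Oplus>\<^bsub>M\<^esub>i\<in>A. \<Oplus>\<^bsub>M\<^esub>j\<in>B. f i j) = (\<Oplus>\<^bsub>N\<^esub>i\<in>A. h (\<Oplus>\<^bsub>M\<^esub>j\<in>B. f i j))"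
    using assms(6) by (intro linear_map_finsum[OF assms(1-4)] M.M.finsum_closed) auto
  also have "\<dots> = (\<Oplus>\<^bsub>N\<^esub>i\<in>A. \<Oplus>\<^bsub>N\<^esub>j\<in>B. h (f i j))"
    using assms(6) linear_mapD(1)[OF assms(3)]
    by (intro N.M.finsum_cong') (auto intro!: linear_map_finsum[OF assms(1-3,5)] N.M.finsum_closed)
  finally show ?thesis .
qed

section \<open>The target ring as an algebra over the constants of \<open>R\<close>\<close>

locale differential_hom = comm_differential_ring_quasi R deriv Q +
  S: comm_integro_differential_ring S dS iS
  for R :: "('r, 'm) ring_scheme" (structure) and deriv Q
    and S :: "('s, 'n) ring_scheme" (structure) and dS iS +
  fixes \<phi> :: "'r \<Rightarrow> 's"
  assumes phi: "\<phi> \<in> differential_ring_hom R deriv S dS"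
begin

lemma phi_ring_hom: "\<phi> \<in> ring_hom R S"
  using phi by (simp add: differential_ring_hom_def)

sublocale phi: ring_hom_cring R S \<phi>
  by (intro ring_hom_cring.intro ring_hom_cring_axioms.intro is_cring S.is_cring phi_ring_hom)

lemma phi_deriv: "x \<in> carrier R \<Longrightarrow> \<phi> (deriv x) = dS (\<phi> x)"
  using phi by (simp add: differential_ring_hom_def)

lemma phi_const: "c \<in> constants \<Longrightarrow> \<phi> c \<in> S.constants"
  using phi_deriv[of c] by (auto simp: constants_def S.constants_def)

text \<open>Restriction of scalars along \<open>\<phi>\<close>. Since \<open>\<phi>\<close> commutes
  with the derivations it maps constants to constants, so the constants of \<open>S\<close> form a
  subalgebra \<open>K\<close>, which is where the values on \<open>C\<^sub>1\<close> and
  \<open>C\<^sub>2\<close> have to lie.\<close>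

definition SM :: "('r, 's) module" where
  "SM = \<lparr>carrier = carrier S, monoid.mult = monoid.mult S, monoid.one = monoid.one S,
     ring.zero = ring.zero S, ring.add = ring.add S, module.smult = \<lambda>c x. \<phi> c \<otimes>\<^bsub>S\<^esub> x\<rparr>"

definition K :: "('r, 's) module" where "K = SM\<lparr>carrier := S.constants\<rparr>"

lemma SM_simps:
  "carrier SM = carrier S" "monoid.mult SM = monoid.mult S" "monoid.one SM = monoid.one S"
  "ring.zero SM = ring.zero S" "ring.add SM = ring.add S" "c \<odot>\<^bsub>SM\<^esub> x = \<phi> c \<otimes>\<^bsub>S\<^esub> x"
  by (simp_all add: SM_def)

lemma K_simps:
  "carrier K = S.constants" "monoid.mult K = monoid.mult SM" "monoid.one K = monoid.one SM"
  "ring.zero K = ring.zero SM" "ring.add K = ring.add SM" "module.smult K = module.smult SM"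
  by (simp_all add: K_def)

lemma SM_algebra: "algebra C SM"
  using constants_subset
  by (intro algebraI C_cring cringI abelian_groupI comm_monoidI)
    (auto simp: SM_simps S.a_ac S.m_ac S.l_distr S.r_distr S.r_neg subset_iff
      intro!: bexI[where x = "\<ominus>\<^bsub>S\<^esub> _"])

lemma SM_module: "module C SM"
  using SM_algebra by (simp add: algebra_def)

lemma K_subset: "carrier K \<subseteq> carrier SM"
  using S.constants_subset by (simp add: K_simps SM_simps)

lemma K_algebra: "algebra C K"
proof -
  have d: "dS (x \<otimes>\<^bsub>S\<^esub> y) = \<zero>\<^bsub>S\<^esub>" if "x \<in> S.constants" "y \<in> S.constants" for x y
    using that by (simp add: S.constants_def S.deriv_mult)
  show ?thesis
    using constants_subset S.constants_subset phi_const
    by (intro algebraI C_cring cringI abelian_groupI comm_monoidI)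
      (auto simp: K_simps SM_simps S.a_ac S.m_ac S.l_distr S.r_distr S.r_neg subset_iff d
        S.constants_def S.deriv_add S.deriv_zero S.deriv_one S.deriv_a_inv S.deriv_mult
        intro!: exI[where x = "\<ominus>\<^bsub>S\<^esub> _"])
qed

lemma K_module: "module C K"
  using K_algebra by (simp add: algebra_def)

interpretation SM: algebra C SM by (rule SM_algebra)

interpretation K: algebra C K by (rule K_algebra)

lemma K_incl: "linear_map C K SM (\<lambda>x. x)"
  by (rule linear_mapI) (use K_subset in \<open>auto simp: K_simps\<close>)

lemma S_linear_map:
  assumes "S.const_linear h"
  shows "linear_map C SM SM h"
  using assms phi_const constants_subset
  by (auto simp: linear_map_def S.const_linear_def SM_simps)

lemma iS_linear: "linear_map C SM SM iS"
  by (rule S_linear_map[OF S.integ_linear])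

lemma iS_const: "k \<in> carrier K \<Longrightarrow> x \<in> carrier SM \<Longrightarrow> iS (k \<otimes>\<^bsub>SM\<^esub> x) = k \<otimes>\<^bsub>SM\<^esub> iS x"
  using S.integ_linear by (simp add: S.const_linear_def SM_simps K_simps)

lemma dS_linear: "linear_map C SM SM dS"
  using phi_const
  by (intro linear_mapI) (auto simp: SM_simps S.deriv_closed S.deriv_add S.deriv_mult S.constants_def)

lemma dS_mult: "x \<in> carrier SM \<Longrightarrow> y \<in> carrier SM \<Longrightarrow>
    dS (x \<otimes>\<^bsub>SM\<^esub> y) = dS x \<otimes>\<^bsub>SM\<^esub> y \<oplus>\<^bsub>SM\<^esub> x \<otimes>\<^bsub>SM\<^esub> dS y"
  by (simp add: SM_simps S.deriv_mult)

lemma dS_iS: "x \<in> carrier SM \<Longrightarrow> dS (iS x) = x"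
  by (simp add: SM_simps S.deriv_integ)

lemma K_dS: "k \<in> carrier K \<longleftrightarrow> k \<in> carrier SM \<and> dS k = \<zero>\<^bsub>SM\<^esub>"
  by (simp add: K_simps SM_simps S.constants_def)

lemmas iS_closed = linear_mapD(1)[OF iS_linear]

lemmas dS_closed = linear_mapD(1)[OF dS_linear]

lemma K_SM: "k \<in> carrier K \<Longrightarrow> k \<in> carrier SM"
  using K_subset by auto

lemma phi_linear: "linear_map C R_alg SM \<phi>"
  using constants_subset by (intro linear_mapI) (auto simp: SM_simps)

lemma phi_closed: "x \<in> carrier R \<Longrightarrow> \<phi> x \<in> carrier SM"
  by (simp add: SM_simps)

lemma phi_mult: "x \<in> carrier R \<Longrightarrow> y \<in> carrier R \<Longrightarrow> \<phi> (x \<otimes> y) = \<phi> x \<otimes>\<^bsub>SM\<^esub> \<phi> y"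
  by (simp add: SM_simps)


subsection \<open>The evaluation\<close>

text \<open>If the integration is taken from a base point, this is evaluation at that point, by the
  fundamental theorem of calculus.\<close>

definition E where "E x = x \<ominus>\<^bsub>SM\<^esub> iS (dS x)"

text \<open>The values are constants because the derivation undoes the integration, so the
  derivatives of the two terms cancel.\<close>

lemma E_linear: "linear_map C SM K E"
proof -
  have "linear_map C SM SM E"
    unfolding E_def by (intro linear_map_fun_minus SM_module linear_map_id linear_map_comp[OF dS_linear iS_linear])
  moreover have "E x \<in> carrier K" if "x \<in> carrier SM" for x
    using that linear_map_minus[OF SM_module SM_module dS_linear that iS_closed[OF dS_closed[OF that]]]
    by (simp add: K_dS E_def iS_closed dS_closed dS_iS a_minus_def SM.M.r_neg)
  ultimately have "linear_map C SM (SM\<lparr>carrier := carrier K\<rparr>) E"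
    by (rule linear_map_restrict_range)
  then show ?thesis by (simp add: K_def)
qed

lemmas E_closed = linear_mapD(1)[OF E_linear]

lemma E_decomp: "x \<in> carrier SM \<Longrightarrow> x = E x \<oplus>\<^bsub>SM\<^esub> iS (dS x)"
  by (simp add: E_def a_minus_def SM.M.a_assoc iS_closed dS_closed SM.M.l_neg)

lemma E_iS: "x \<in> carrier SM \<Longrightarrow> E (iS x) = \<zero>\<^bsub>K\<^esub>"
  by (simp add: E_def dS_iS iS_closed a_minus_def SM.M.r_neg K_simps)

lemma E_const:
  assumes k: "k \<in> carrier K" and x: "x \<in> carrier SM"
  shows "E (k \<otimes>\<^bsub>SM\<^esub> x) = k \<otimes>\<^bsub>K\<^esub> E x"
proof -
  have kS: "k \<in> carrier SM" "dS k = \<zero>\<^bsub>SM\<^esub>" using k by (simp_all add: K_dS)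
  have "dS (k \<otimes>\<^bsub>SM\<^esub> x) = k \<otimes>\<^bsub>SM\<^esub> dS x"
    using kS x by (simp add: dS_mult dS_closed)
  then show ?thesis
    using kS x k by (simp add: E_def iS_const dS_closed K_simps(2) a_minus_def SM.r_distr iS_closed SM.r_minus)
qed

primrec Iw where
  "Iw [] = \<one>\<^bsub>SM\<^esub>"
| "Iw (x # w) = iS (\<phi> x \<otimes>\<^bsub>SM\<^esub> Iw w)"

lemma Iw_closed: "w \<in> W \<Longrightarrow> Iw w \<in> carrier SM"
  by (induction w) (auto intro!: iS_closed phi_closed RT_R)

text \<open>One step of an iterated integral as an operator on \<open>S\<close>. Under
  \<open>I\<close> it corresponds to \<open>tensor_cons\<close>, which transports the recursion of
  the shuffle product to \<open>S\<close>.\<close>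

definition L where "L x z = iS (\<phi> x \<otimes>\<^bsub>SM\<^esub> z)"

lemma L_linear: "x \<in> carrier R \<Longrightarrow> linear_map C SM SM (L x)"
  unfolding L_def
  by (rule linear_map_comp[OF bilinear_mapD(1)[OF algebra_mult_bilinear[OF SM_algebra] phi_closed] iS_linear])

lemma L_linear_left: "z \<in> carrier SM \<Longrightarrow> linear_map C R\<^sub>T SM (\<lambda>x. L x z)"
  unfolding L_def
  by (rule linear_map_comp[OF linear_map_comp[OF linear_map_comp[OF RT_incl phi_linear]
    bilinear_mapD(2)[OF algebra_mult_bilinear[OF SM_algebra]]] iS_linear])

lemma L_const:
  assumes "k \<in> carrier K" "x \<in> carrier R" "z \<in> carrier SM"
  shows "L x (k \<otimes>\<^bsub>SM\<^esub> z) = k \<otimes>\<^bsub>SM\<^esub> L x z"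
proof -
  have "\<phi> x \<otimes>\<^bsub>SM\<^esub> (k \<otimes>\<^bsub>SM\<^esub> z) = k \<otimes>\<^bsub>SM\<^esub> (\<phi> x \<otimes>\<^bsub>SM\<^esub> z)"
    using assms phi_closed K_SM by (intro SM.m_lcomm) auto
  then show ?thesis using assms phi_closed by (simp add: L_def iS_const)
qed

lemma Iw_Cons: "Iw (x # w) = L x (Iw w)"
  by (simp add: L_def)

lemma Iw_multilinear: "word_multilinear C R\<^sub>T SM Iw"
proof (rule T.word_multilinearI)
  fix u v assume u: "u \<in> W" and v: "v \<in> W"
  from u show "linear_map C R\<^sub>T SM (\<lambda>x. Iw (u @ [x] @ v))"
  proof (induction u)
    case Nil
    show ?case using L_linear_left[OF Iw_closed[OF v]] by (simp add: L_def)
  next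
    case (Cons y u)
    then have "linear_map C R\<^sub>T SM (\<lambda>x. L y (Iw (u @ [x] @ v)))"
      by (intro linear_map_comp[OF _ L_linear]) (auto intro: RT_R)
    then show ?case by (simp add: L_def)
  qed
qed

text \<open>\<open>Iw\<close> is recursive on words; shuffles are sums of words and need the linear
  extension.\<close>

definition I where "I = linear_ext C T SM W pure Iw"

lemma I_linear: "linear_map C T SM I"
  unfolding I_def
  by (rule linear_ext_works(1)[OF T.universal_pure[OF SM_module]]) (simp_all add: Iw_closed Iw_multilinear)

lemma I_pure: "w \<in> W \<Longrightarrow> I (pure w) = Iw w"
  unfolding I_def
  by (rule linear_ext_works(2)[OF T.universal_pure[OF SM_module]]) (simp_all add: Iw_closed Iw_multilinear)

lemmas I_closed = linear_mapD(1)[OF I_linear]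

lemma I_cons:
  assumes "x \<in> carrier R\<^sub>T" "t \<in> carrier T"
  shows "I (tensor_cons C R\<^sub>T x t) = L x (I t)"
  by (rule linear_map_eqI[OF T.tensors_module SM_module linear_map_comp[OF T.cons_linear[OF assms(1)] I_linear]
        linear_map_comp[OF I_linear L_linear[OF RT_R[OF assms(1)]]] T.pure_span _ assms(2)])
    (use assms(1) in \<open>simp add: T.cons_pure I_pure Iw_Cons del: Iw.simps in_lists_conv_set\<close>)

lemma I_linear_pos: "linear_map C T_pos SM I"
  using linear_map_restrict_domain[OF I_linear T.tensors_pos_subset] by (simp add: tensors_pos_def)

text \<open>A nonempty word is sent to an integral, and \<open>E\<close> vanishes on integrals. This
  is the identity responsible for the summand missing in the generators of
  \<open>J\<^sub>2\<close>.\<close>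

lemma E_I_pos:
  assumes "t \<in> carrier T_pos"
  shows "E (I t) = \<zero>\<^bsub>K\<^esub>"
proof (rule linear_map_eqI[OF T.tensors_pos_module K_module linear_map_comp[OF I_linear_pos E_linear]
      linear_map_fun_zero[OF K_module] T.pure_pos_span _ assms])
  fix w assume "w \<in> W - {[]}"
  then obtain x v where w: "w = x # v" "x \<in> carrier R\<^sub>T" "v \<in> W" by (cases w) auto
  then have "\<phi> x \<otimes>\<^bsub>SM\<^esub> Iw v \<in> carrier SM" using phi_closed RT_R Iw_closed by simp
  from E_iS[OF this] show "E (I (pure w)) = \<zero>\<^bsub>K\<^esub>" using w by (simp add: I_pure)
qed

definition cf where "cf s t = E (Iw s \<otimes>\<^bsub>SM\<^esub> Iw t)"

lemma cf_closed: "s \<in> W \<Longrightarrow> t \<in> W \<Longrightarrow> cf s t \<in> carrier K"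
  unfolding cf_def by (intro E_closed SM.m_closed Iw_closed)

text \<open>The coefficients are constants of \<open>S\<close> and pass through the integral in
  \<open>L\<close>. In this form the induction hypotheses of the product formula are integrated once
  more.\<close>

lemma L_expansion:
  fixes n m :: nat
  assumes x: "x \<in> carrier R" and s: "s \<in> carrier T"
    and k: "\<And>i j. i < n \<Longrightarrow> j < m \<Longrightarrow> k i j \<in> carrier K" and t: "\<And>i j. i < n \<Longrightarrow> j < m \<Longrightarrow> t i j \<in> carrier T"
  shows "L x (I s \<oplus>\<^bsub>SM\<^esub> (\<Oplus>\<^bsub>SM\<^esub>i\<in>{0..<n}. \<Oplus>\<^bsub>SM\<^esub>j\<in>{0..<m}. k i j \<otimes>\<^bsub>SM\<^esub> I (t i j))) =
    L x (I s) \<oplus>\<^bsub>SM\<^esub> (\<Oplus>\<^bsub>SM\<^esub>i\<in>{0..<n}. \<Oplus>\<^bsub>SM\<^esub>j\<in>{0..<m}. k i j \<otimes>\<^bsub>SM\<^esub> L x (I (t i j)))"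
proof -
  note l = L_linear[OF x]
  have cl: "k i j \<otimes>\<^bsub>SM\<^esub> I (t i j) \<in> carrier SM" if "i < n" "j < m" for i j
    using k[OF that] t[OF that] by (simp add: K_SM I_closed)
  have "L x (\<Oplus>\<^bsub>SM\<^esub>i\<in>{0..<n}. \<Oplus>\<^bsub>SM\<^esub>j\<in>{0..<m}. k i j \<otimes>\<^bsub>SM\<^esub> I (t i j)) =
      (\<Oplus>\<^bsub>SM\<^esub>i\<in>{0..<n}. \<Oplus>\<^bsub>SM\<^esub>j\<in>{0..<m}. L x (k i j \<otimes>\<^bsub>SM\<^esub> I (t i j)))"
    by (rule linear_map_finsum2[OF SM_module SM_module l]) (use cl in auto)
  also have "\<dots> = (\<Oplus>\<^bsub>SM\<^esub>i\<in>{0..<n}. \<Oplus>\<^bsub>SM\<^esub>j\<in>{0..<m}. k i j \<otimes>\<^bsub>SM\<^esub> L x (I (t i j)))"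
    by (intro SM.M.finsum_cong' refl)
      (use k t x in \<open>auto intro!: L_const SM.M.finsum_closed SM.M.finsum_cong' simp: I_closed K_SM linear_mapD(1)[OF l]\<close>)
  finally have eq: "L x (\<Oplus>\<^bsub>SM\<^esub>i\<in>{0..<n}. \<Oplus>\<^bsub>SM\<^esub>j\<in>{0..<m}. k i j \<otimes>\<^bsub>SM\<^esub> I (t i j)) =
      (\<Oplus>\<^bsub>SM\<^esub>i\<in>{0..<n}. \<Oplus>\<^bsub>SM\<^esub>j\<in>{0..<m}. k i j \<otimes>\<^bsub>SM\<^esub> L x (I (t i j)))" .
  have "(\<Oplus>\<^bsub>SM\<^esub>i\<in>{0..<n}. \<Oplus>\<^bsub>SM\<^esub>j\<in>{0..<m}. k i j \<otimes>\<^bsub>SM\<^esub> I (t i j)) \<in> carrier SM"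
    using cl by (intro SM.M.finsum_closed Pi_I) auto
  from linear_mapD(2)[OF l I_closed[OF s] this] show ?thesis unfolding eq .
qed

text \<open>
  Both sides have the same derivative by induction on the lengths, and the summand for
  \<open>i = j = 0\<close> is the evaluation of the left-hand side.
\<close>

lemma I_product:
  "f \<in> W \<Longrightarrow> g \<in> W \<Longrightarrow> Iw f \<otimes>\<^bsub>SM\<^esub> Iw g = I (sh f g) \<oplus>\<^bsub>SM\<^esub>
    (\<Oplus>\<^bsub>SM\<^esub>i\<in>{0..<length f}. \<Oplus>\<^bsub>SM\<^esub>j\<in>{0..<length g}.
      cf (drop i f) (drop j g) \<otimes>\<^bsub>SM\<^esub> I (sh (take i f) (take j g)))"
proof (induction f g rule: shuffle_words_induct)
  case (Nil1 g)
  then show ?case by (simp add: I_pure Iw_closed)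
next
  case (Nil2 x f)
  have "(\<Oplus>\<^bsub>SM\<^esub>i\<in>{0..<length (x # f)}. \<zero>\<^bsub>SM\<^esub>) = \<zero>\<^bsub>SM\<^esub>" by (rule SM.M.finsum_zero)
  then show ?case using Nil2 Iw_closed[OF Nil2(1)] I_pure[OF Nil2(1)] by simp
next
  case (Cons x f y g)
  let ?F = "x # f" and ?G = "y # g"
  have x: "x \<in> carrier R\<^sub>T" and f: "f \<in> W" and y: "y \<in> carrier R\<^sub>T" and g: "g \<in> W"
    using Cons.prems by auto
  note F = Cons.prems(1) and G = Cons.prems(2)
  note xR = RT_R[OF x] and yR = RT_R[OF y]
  let ?p = "Iw ?F \<otimes>\<^bsub>SM\<^esub> Iw ?G"
  let ?a = "\<lambda>i j. cf (drop i ?F) (drop j ?G)"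
  let ?c = "\<lambda>i j. ?a i j \<otimes>\<^bsub>SM\<^esub> I (sh (take i ?F) (take j ?G))"
  let ?A = "\<lambda>i j. ?a (Suc i) j \<otimes>\<^bsub>SM\<^esub> L x (I (sh (take i f) (take j ?G)))"
  let ?B = "\<lambda>i j. ?a i (Suc j) \<otimes>\<^bsub>SM\<^esub> L y (I (sh (take i ?F) (take j g)))"
  let ?n = "length f" and ?m = "length g"
  note cl = Iw_closed[OF f] Iw_closed[OF g] Iw_closed[OF F] Iw_closed[OF G]
  have shc: "sh (take i u) (take j v) \<in> carrier T" if "u \<in> W" "v \<in> W" for i j u v
    using that by (intro T.shuffle_closed W_take_drop)
  have acl: "cf (drop i u) (drop j v) \<in> carrier K" if "u \<in> W" "v \<in> W" for i j u v
    using that by (intro cf_closed W_take_drop)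
  have Lc: "L z t \<in> carrier SM" if "z \<in> carrier R" "t \<in> carrier SM" for z t
    using linear_mapD(1)[OF L_linear] that by blast
  have Acl: "?A i j \<in> carrier SM" for i j
    by (intro SM.m_closed K_SM acl[OF F G] Lc xR I_closed shc f G)
  have Bcl: "?B i j \<in> carrier SM" for i j
    by (intro SM.m_closed K_SM acl[OF F G] Lc yR I_closed shc F g)
  have pcl: "?p \<in> carrier SM" by (intro SM.m_closed cl)
  have IHx: "L x (Iw f \<otimes>\<^bsub>SM\<^esub> Iw ?G) = L x (I (sh f ?G)) \<oplus>\<^bsub>SM\<^esub>
      (\<Oplus>\<^bsub>SM\<^esub>i\<in>{0..<?n}. \<Oplus>\<^bsub>SM\<^esub>j\<in>{0..<Suc ?m}. ?A i j)"
    using L_expansion[OF xR T.shuffle_closed[OF f G], of ?n "Suc ?m" "\<lambda>i j. cf (drop i f) (drop j ?G)"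
        "\<lambda>i j. sh (take i f) (take j ?G)"] Cons.IH(1)[OF f G] acl[OF f G] shc[OF f G]
    by simp
  have IHy: "L y (Iw ?F \<otimes>\<^bsub>SM\<^esub> Iw g) = L y (I (sh ?F g)) \<oplus>\<^bsub>SM\<^esub>
      (\<Oplus>\<^bsub>SM\<^esub>i\<in>{0..<Suc ?n}. \<Oplus>\<^bsub>SM\<^esub>j\<in>{0..<?m}. ?B i j)"
    using L_expansion[OF yR T.shuffle_closed[OF F g], of "Suc ?n" ?m "\<lambda>i j. cf (drop i ?F) (drop j g)"
        "\<lambda>i j. sh (take i ?F) (take j g)"] Cons.IH(2)[OF F g] acl[OF F g] shc[OF F g]
    by simp
  have dI: "dS (Iw (z # w)) = \<phi> z \<otimes>\<^bsub>SM\<^esub> Iw w" if "z \<in> carrier R" "w \<in> W" for z w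
    using that by (simp add: dS_iS phi_closed Iw_closed)
  \<comment> \<open>The Leibniz rule strips the first letter from one factor at a time. After
    integration the two terms are \<open>L x\<close> and \<open>L y\<close> of products to which the
    induction hypotheses apply, and only the evaluation of the product remains.\<close>
  have "dS ?p = \<phi> x \<otimes>\<^bsub>SM\<^esub> (Iw f \<otimes>\<^bsub>SM\<^esub> Iw ?G) \<oplus>\<^bsub>SM\<^esub> \<phi> y \<otimes>\<^bsub>SM\<^esub> (Iw ?F \<otimes>\<^bsub>SM\<^esub> Iw g)"
    unfolding dS_mult[OF cl(3,4)] dI[OF xR f] dI[OF yR g]
    using cl phi_closed[OF xR] phi_closed[OF yR] by (simp only: SM.m_assoc SM.m_lcomm SM.m_closed)
  then have "iS (dS ?p) = L x (Iw f \<otimes>\<^bsub>SM\<^esub> Iw ?G) \<oplus>\<^bsub>SM\<^esub> L y (Iw ?F \<otimes>\<^bsub>SM\<^esub> Iw g)"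
    using linear_mapD(2)[OF iS_linear, of "\<phi> x \<otimes>\<^bsub>SM\<^esub> (Iw f \<otimes>\<^bsub>SM\<^esub> Iw ?G)" "\<phi> y \<otimes>\<^bsub>SM\<^esub> (Iw ?F \<otimes>\<^bsub>SM\<^esub> Iw g)"]
      cl phi_closed[OF xR] phi_closed[OF yR] by (simp add: L_def del: Iw.simps)
  with E_decomp[OF pcl] have p: "?p = E ?p \<oplus>\<^bsub>SM\<^esub>
      (L x (Iw f \<otimes>\<^bsub>SM\<^esub> Iw ?G) \<oplus>\<^bsub>SM\<^esub> L y (Iw ?F \<otimes>\<^bsub>SM\<^esub> Iw g))" by simp
  \<comment> \<open>Prepending \<open>x\<close> moves the cut of the first word by one and leaves
    the suffix unchanged, so the entries \<open>?A i j\<close> belong to row \<open>i + 1\<close>;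
    likewise \<open>?B i j\<close> belongs to column \<open>j + 1\<close>. Inside the grid the
    shuffle recursion splits an entry into one of each kind, on the two edges only one kind occurs,
    and the corner is \<open>E ?p\<close>.\<close>
  have sum: "(\<Oplus>\<^bsub>SM\<^esub>i\<in>{0..<Suc ?n}. \<Oplus>\<^bsub>SM\<^esub>j\<in>{0..<Suc ?m}. ?c i j) = E ?p \<oplus>\<^bsub>SM\<^esub>
      (\<Oplus>\<^bsub>SM\<^esub>i\<in>{0..<?n}. \<Oplus>\<^bsub>SM\<^esub>j\<in>{0..<Suc ?m}. ?A i j) \<oplus>\<^bsub>SM\<^esub>
      (\<Oplus>\<^bsub>SM\<^esub>i\<in>{0..<Suc ?n}. \<Oplus>\<^bsub>SM\<^esub>j\<in>{0..<?m}. ?B i j)"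
  proof (rule SM.M.finsum_grid_split)
    show "?c 0 0 = E ?p"
      using K_SM[OF E_closed[OF pcl]] by (simp add: cf_def I_pure del: Iw.simps(2))
    show "?c (Suc i) 0 = ?A i 0" if "i < ?n" for i
      using I_cons[OF x, of "pure (take i f)"] T.pure_closed[OF W_take_drop(1)[OF f], of i]
        T.cons_pure[OF x W_take_drop(1)[OF f], of i] by simp
    show "?c 0 (Suc j) = ?B 0 j" if "j < ?m" for j
      using I_cons[OF y, of "pure (take j g)"] T.pure_closed[OF W_take_drop(1)[OF g], of j]
        T.cons_pure[OF y W_take_drop(1)[OF g], of j] by simp
    fix i j
    have 1: "sh (take i f) (y # take j g) \<in> carrier T" "sh (x # take i f) (take j g) \<in> carrier T"
      using shc[OF f G, of i "Suc j"] shc[OF F g, of "Suc i" j] by simp_all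
    have "I (sh (take (Suc i) ?F) (take (Suc j) ?G)) =
        L x (I (sh (take i f) (take (Suc j) ?G))) \<oplus>\<^bsub>SM\<^esub> L y (I (sh (take (Suc i) ?F) (take j g)))"
      using linear_mapD(2)[OF I_linear linear_mapD(1)[OF T.cons_linear[OF x] 1(1)]
          linear_mapD(1)[OF T.cons_linear[OF y] 1(2)]] I_cons[OF x 1(1)] I_cons[OF y 1(2)] by simp
    then show "?c (Suc i) (Suc j) = ?A i (Suc j) \<oplus>\<^bsub>SM\<^esub> ?B (Suc i) j"
      using SM.r_distr[OF Lc[OF xR I_closed[OF shc[OF f G, of i "Suc j"]]]
          Lc[OF yR I_closed[OF shc[OF F g, of "Suc i" j]]] K_SM[OF acl[OF F G, of "Suc i" "Suc j"]]]
      by simp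
  qed (use Acl Bcl K_SM[OF E_closed[OF pcl]] in auto)
  have "I (sh ?F ?G) = L x (I (sh f ?G)) \<oplus>\<^bsub>SM\<^esub> L y (I (sh ?F g))"
    using linear_mapD(2)[OF I_linear linear_mapD(1)[OF T.cons_linear[OF x] T.shuffle_closed[OF f G]]
        linear_mapD(1)[OF T.cons_linear[OF y] T.shuffle_closed[OF F g]]]
      I_cons[OF x T.shuffle_closed[OF f G]] I_cons[OF y T.shuffle_closed[OF F g]] by simp
  moreover have "L x (I (sh f ?G)) \<in> carrier SM" "L y (I (sh ?F g)) \<in> carrier SM"
    by (intro Lc xR yR I_closed T.shuffle_closed f F g G)+
  moreover have "(\<Oplus>\<^bsub>SM\<^esub>i\<in>{0..<?n}. \<Oplus>\<^bsub>SM\<^esub>j\<in>{0..<Suc ?m}. ?A i j) \<in> carrier SM"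
    "(\<Oplus>\<^bsub>SM\<^esub>i\<in>{0..<Suc ?n}. \<Oplus>\<^bsub>SM\<^esub>j\<in>{0..<?m}. ?B i j) \<in> carrier SM"
    by (intro SM.M.finsum_closed Pi_I Acl Bcl)+
  moreover note K_SM[OF E_closed[OF pcl]]
  ultimately show ?case
    using p sum unfolding IHx IHy length_Cons
    by (simp only: SM.M.a_ac SM.M.a_closed)
qed

end


subsection \<open>The homomorphisms on the constants\<close>

context differential_hom
begin

interpretation SM: algebra C SM by (rule SM_algebra)

interpretation K: algebra C K by (rule K_algebra)

lemma SM_mult_linear:
  "b \<in> carrier SM \<Longrightarrow> linear_map C SM SM (\<lambda>a. a \<otimes>\<^bsub>SM\<^esub> b)"
  "b \<in> carrier SM \<Longrightarrow> linear_map C SM SM (\<lambda>a. b \<otimes>\<^bsub>SM\<^esub> a)"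
  using bilinear_mapD[OF algebra_mult_bilinear[OF SM_algebra]] by simp_all

lemma eta1_exists:
  obtains \<eta> where "linear_map C C\<^sub>1 K \<eta>" "\<eta> \<one>\<^bsub>C\<^sub>1\<^esub> = \<one>\<^bsub>K\<^esub>"
    "\<And>x y. x \<in> carrier C\<^sub>1 \<Longrightarrow> y \<in> carrier C\<^sub>1 \<Longrightarrow> \<eta> (x \<otimes>\<^bsub>C\<^sub>1\<^esub> y) = \<eta> x \<otimes>\<^bsub>K\<^esub> \<eta> y"
    "\<And>r t. r \<in> carrier R\<^sub>J \<Longrightarrow> t \<in> carrier T \<Longrightarrow> \<eta> (\<epsilon>\<^sub>1 r t) = E (\<phi> r \<otimes>\<^bsub>SM\<^esub> I t)"
proof -
  have b: "bilinear_map C R\<^sub>J T K (\<lambda>r t. E (\<phi> r \<otimes>\<^bsub>SM\<^esub> I t))"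
  proof (rule bilinear_mapI)
    fix r assume "r \<in> carrier R\<^sub>J"
    then have "\<phi> r \<in> carrier SM" using RJ_subset phi_closed by auto
    then show "linear_map C T K (\<lambda>t. E (\<phi> r \<otimes>\<^bsub>SM\<^esub> I t))"
      by (rule linear_map_comp[OF linear_map_comp[OF I_linear SM_mult_linear(2)] E_linear])
  next
    fix t assume t: "t \<in> carrier T"
    show "linear_map C R\<^sub>J K (\<lambda>r. E (\<phi> r \<otimes>\<^bsub>SM\<^esub> I t))"
      by (rule linear_map_comp[OF linear_map_comp[OF linear_map_comp[OF RJ_incl phi_linear]
            SM_mult_linear(1)[OF I_closed[OF t]]] E_linear])
  qed
  obtain e where e: "linear_map C M\<^sub>1 K e"
    "\<And>r t. r \<in> carrier R\<^sub>J \<Longrightarrow> t \<in> carrier T \<Longrightarrow> e (tensor C R\<^sub>J T r t) = E (\<phi> r \<otimes>\<^bsub>SM\<^esub> I t)"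
    using tensor_extend[OF C_cring RJ_module T.tensors_module K_module b] unfolding M\<^sub>1_def by blast
  obtain h where h: "linear_map C C\<^sub>1 K h" "h \<one>\<^bsub>C\<^sub>1\<^esub> = \<one>\<^bsub>K\<^esub>"
    "\<And>x y. x \<in> carrier C\<^sub>1 \<Longrightarrow> y \<in> carrier C\<^sub>1 \<Longrightarrow> h (x \<otimes>\<^bsub>C\<^sub>1\<^esub> y) = h x \<otimes>\<^bsub>K\<^esub> h y"
    "\<And>m. m \<in> carrier M\<^sub>1 \<Longrightarrow> h (sym_monomial C M\<^sub>1 {#m#}) = e m"
    using S1.sym_algebra_extend[OF K_algebra e(1)] unfolding C\<^sub>1_def by blast
  show thesis
  proof (rule that[OF h(1-3)])
    fix r t assume "r \<in> carrier R\<^sub>J" "t \<in> carrier T"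
    then show "h (\<epsilon>\<^sub>1 r t) = E (\<phi> r \<otimes>\<^bsub>SM\<^esub> I t)"
      using h(4) e(2) tensor_closed[OF C_cring RJ_module T.tensors_module] by (simp add: \<epsilon>\<^sub>1_def M\<^sub>1_def)
  qed
qed

definition ev where "ev s t = E (I s \<otimes>\<^bsub>SM\<^esub> I t)"

lemma ev_pure: "f \<in> W \<Longrightarrow> g \<in> W \<Longrightarrow> ev (pure f) (pure g) = cf f g"
  by (simp add: ev_def cf_def I_pure)

lemma T_pos_T: "t \<in> carrier T_pos \<Longrightarrow> t \<in> carrier T"
  using T.tensors_pos_subset by blast

text \<open>The value on a symmetric product is defined through \<open>mset_prod\<close>, a function
  of the multiset, so that symmetry in the two factors needs no separate argument.\<close>

lemma sym2_hom_exists: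
  obtains h where "linear_map C Sym\<^sub>2 K h" "h \<one>\<^bsub>Sym\<^sub>2\<^esub> = \<one>\<^bsub>K\<^esub>"
    "\<And>x y. x \<in> carrier Sym\<^sub>2 \<Longrightarrow> y \<in> carrier Sym\<^sub>2 \<Longrightarrow> h (x \<otimes>\<^bsub>Sym\<^sub>2\<^esub> y) = h x \<otimes>\<^bsub>K\<^esub> h y"
    "\<And>s t. s \<in> carrier T_pos \<Longrightarrow> t \<in> carrier T_pos \<Longrightarrow> h (\<epsilon>' s t) = ev s t"
proof -
  have cl: "mset_prod SM I u \<in> carrier SM" if "set_mset u \<subseteq> carrier T_pos" for u
    using that I_closed T_pos_T by (intro SM.mset_prod_closed_add(1)) auto
  have ml: "mset_multilinear C T_pos K {2} (\<lambda>u. E (mset_prod SM I u))"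
    unfolding mset_multilinear_def
  proof (intro allI impI)
    fix u assume "set_mset u \<subseteq> carrier T_pos \<and> size u + 1 \<in> {2}"
    then have "linear_map C T_pos SM (\<lambda>x. mset_prod SM I (add_mset x u))"
      using mset_prod_multilinear[OF SM_algebra I_linear_pos T.tensors_pos_module]
      by (simp add: mset_multilinear_def)
    from linear_map_comp[OF this E_linear]
    show "linear_map C T_pos K (\<lambda>x. E (mset_prod SM I (add_mset x u)))" .
  qed
  have "(\<lambda>u. E (mset_prod SM I u)) \<in> multiwords T_pos 2 \<rightarrow> carrier K"
    by (intro Pi_I E_closed cl) (simp add: multiwords_def)
  from universal_ex[OF Tp.universal_sym_prod[OF K_module, where n = 2],
      where f = "\<lambda>u. E (mset_prod SM I u)", OF this ml]
  obtain e where e: "linear_map C M\<^sub>2 K e"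
    "\<And>u. u \<in> multiwords T_pos 2 \<Longrightarrow> e (sym_prod C T_pos u) = E (mset_prod SM I u)"
    unfolding M\<^sub>2_def by blast
  obtain h where h: "linear_map C Sym\<^sub>2 K h" "h \<one>\<^bsub>Sym\<^sub>2\<^esub> = \<one>\<^bsub>K\<^esub>"
    "\<And>x y. x \<in> carrier Sym\<^sub>2 \<Longrightarrow> y \<in> carrier Sym\<^sub>2 \<Longrightarrow> h (x \<otimes>\<^bsub>Sym\<^sub>2\<^esub> y) = h x \<otimes>\<^bsub>K\<^esub> h y"
    "\<And>m. m \<in> carrier M\<^sub>2 \<Longrightarrow> h (sym_monomial C M\<^sub>2 {#m#}) = e m"
    using S2.sym_algebra_extend[OF K_algebra e(1)] unfolding Sym\<^sub>2_def by blast
  show thesis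
  proof (rule that[OF h(1-3)])
    fix s t assume st: "s \<in> carrier T_pos" "t \<in> carrier T_pos"
    then have u: "{#s, t#} \<in> multiwords T_pos 2" by (simp add: multiwords_def)
    have "sym_prod C T_pos {#s, t#} \<in> carrier M\<^sub>2"
      unfolding M\<^sub>2_def by (rule universalD(1)[OF Tp.universal_sym_prod[OF K_module] u])
    moreover have "mset_prod SM I {#s, t#} = I s \<otimes>\<^bsub>SM\<^esub> I t"
      using st SM.mset_prod_closed_add(2)[of "{#t#}" I s] SM.mset_prod_closed_add(2)[of "{#}" I t]
        I_closed T_pos_T by simp
    ultimately show "h (\<epsilon>' s t) = ev s t"
      using h(4) e(2)[OF u] by (simp add: \<epsilon>'_def ev_def)
  qed
qed

text \<open>The product formula sums over the full grid, whereas a generator of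
  \<open>J\<^sub>2\<close> starts at \<open>1 - j\<close>. By truncated subtraction this omits only
  the entry \<open>i = j = 0\<close>, which is assumed to vanish.\<close>

lemma J2_index_sum:
  fixes n m :: nat
  assumes F: "\<And>i j. i < n \<Longrightarrow> j < m \<Longrightarrow> F i j \<in> carrier K" and z: "F 0 0 = \<zero>\<^bsub>K\<^esub>"
  shows "(\<Oplus>\<^bsub>K\<^esub>i\<in>{0..<n}. \<Oplus>\<^bsub>K\<^esub>j\<in>{0..<m}. F i j) = (\<Oplus>\<^bsub>K\<^esub>j\<in>{0..<m}. \<Oplus>\<^bsub>K\<^esub>i\<in>{1 - j..<n}. F i j)"
proof -
  have "(\<Oplus>\<^bsub>K\<^esub>i\<in>{0..<n}. \<Oplus>\<^bsub>K\<^esub>j\<in>{0..<m}. F i j) = (\<Oplus>\<^bsub>K\<^esub>j\<in>{0..<m}. \<Oplus>\<^bsub>K\<^esub>i\<in>{0..<n}. F i j)"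
    using F by (intro K.M.finsum_swap) auto
  also have "\<dots> = (\<Oplus>\<^bsub>K\<^esub>j\<in>{0..<m}. \<Oplus>\<^bsub>K\<^esub>i\<in>{1 - j..<n}. F i j)"
  proof (rule K.M.finsum_cong'[OF refl])
    show "(\<lambda>j. \<Oplus>\<^bsub>K\<^esub>i\<in>{1 - j..<n}. F i j) \<in> {0..<m} \<rightarrow> carrier K"
      using F by (intro Pi_I K.M.finsum_closed) auto
    fix j assume j: "j \<in> {0..<m}"
    have "F i j = \<zero>\<^bsub>K\<^esub>" if "i \<in> {0..<n} - {1 - j..<n}" for i
    proof -
      have "i = 0" "j = 0" using that by auto
      then show ?thesis using z by simp
    qed
    then show "(\<Oplus>\<^bsub>K\<^esub>i\<in>{0..<n}. F i j) = (\<Oplus>\<^bsub>K\<^esub>i\<in>{1 - j..<n}. F i j)"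
      using F j by (intro K.M.add.finprod_mono_neutral_cong_right) auto
  qed
  finally show ?thesis .
qed

text \<open>The image of the generator has the form \<open>(X - Y) + (P - Q)\<close>. Here
  \<open>X + P\<close> and \<open>Y + Q\<close> are \<open>E\<close> of the two bracketings of the
  product of three iterated integrals, with the product formula applied to the inner pair.\<close>

lemma J2_gen_vanish:
  assumes h: "linear_map C Sym\<^sub>2 K h"
    and hm: "\<And>x y. x \<in> carrier Sym\<^sub>2 \<Longrightarrow> y \<in> carrier Sym\<^sub>2 \<Longrightarrow> h (x \<otimes>\<^bsub>Sym\<^sub>2\<^esub> y) = h x \<otimes>\<^bsub>K\<^esub> h y"
    and he: "\<And>s t. s \<in> carrier T_pos \<Longrightarrow> t \<in> carrier T_pos \<Longrightarrow> h (\<epsilon>' s t) = ev s t"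
    and f: "f \<in> W" "f \<noteq> []" and g: "g \<in> W" "g \<noteq> []" and w: "w \<in> W" "w \<noteq> []"
  shows "h (J\<^sub>2_gen f g w) = \<zero>\<^bsub>K\<^esub>"
proof -
  interpret Sy: algebra C Sym\<^sub>2 by (rule Sym2_algebra)
  note e = bilinear_map_closed[OF eps'_bilinear]
  note hc = linear_mapD(1)[OF h]
  let ?n = "length f" and ?m = "length g" and ?l = "length w"
  have pos: "sh (take i u) (take j v) \<in> carrier T_pos"
    if "u \<in> W" "v \<in> W" "i \<in> {1 - j..<length u}" "j < length v" for i j u v
    using that by (intro T.shuffle_pos_closed W_take_drop) auto
  have pos': "sh (take j v) (take i u) \<in> carrier T_pos"
    if "u \<in> W" "v \<in> W" "i \<in> {1 - j..<length u}" "j < length v" for i j u v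
    using that by (intro T.shuffle_pos_closed W_take_drop) auto
  have shT: "sh (take i u) (take j v) \<in> carrier T" if "u \<in> W" "v \<in> W" for i j u v
    using that by (intro T.shuffle_closed W_take_drop)
  have cfc: "cf (drop i u) (drop j v) \<in> carrier K" if "u \<in> W" "v \<in> W" for i j u v
    using that by (intro cf_closed W_take_drop)
  let ?A = "\<lambda>i j. cf (drop i f) (drop j g) \<otimes>\<^bsub>K\<^esub> E (I (sh (take i f) (take j g)) \<otimes>\<^bsub>SM\<^esub> Iw w)"
  let ?B = "\<lambda>k j. cf (drop j g) (drop k w) \<otimes>\<^bsub>K\<^esub> E (Iw f \<otimes>\<^bsub>SM\<^esub> I (sh (take j g) (take k w)))"
  let ?X = "E (I (sh f g) \<otimes>\<^bsub>SM\<^esub> Iw w)" and ?Y = "E (Iw f \<otimes>\<^bsub>SM\<^esub> I (sh g w))"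
  note Ic = Iw_closed[OF f(1)] Iw_closed[OF g(1)] Iw_closed[OF w(1)]
  have Ac: "?A i j \<in> carrier K" for i j
    by (intro K.m_closed cfc f g E_closed SM.m_closed I_closed shT Ic)
  have Bc: "?B i j \<in> carrier K" for i j
    by (intro K.m_closed cfc g w E_closed SM.m_closed I_closed shT Ic)
  have Xc: "?X \<in> carrier K" and Yc: "?Y \<in> carrier K"
    by (intro E_closed SM.m_closed I_closed T.shuffle_closed Ic f g w)+
  have E1: "E ((Iw f \<otimes>\<^bsub>SM\<^esub> Iw g) \<otimes>\<^bsub>SM\<^esub> Iw w) = ?X \<oplus>\<^bsub>K\<^esub> (\<Oplus>\<^bsub>K\<^esub>i\<in>{0..<?n}. \<Oplus>\<^bsub>K\<^esub>j\<in>{0..<?m}. ?A i j)"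
  proof -
    have l: "linear_map C SM K (\<lambda>z. E (z \<otimes>\<^bsub>SM\<^esub> Iw w))"
      by (rule linear_map_comp[OF SM_mult_linear(1)[OF Ic(3)] E_linear])
    let ?c = "\<lambda>i j. cf (drop i f) (drop j g) \<otimes>\<^bsub>SM\<^esub> I (sh (take i f) (take j g))"
    have cc: "?c i j \<in> carrier SM" for i j
      by (intro SM.m_closed K_SM cfc I_closed shT f g)
    have sc: "(\<Oplus>\<^bsub>SM\<^esub>i\<in>{0..<?n}. \<Oplus>\<^bsub>SM\<^esub>j\<in>{0..<?m}. ?c i j) \<in> carrier SM"
      by (intro SM.M.finsum_closed Pi_I cc)
    have ck: "E (?c i j \<otimes>\<^bsub>SM\<^esub> Iw w) = ?A i j" for i j
      using E_const[OF cfc[OF f(1) g(1), of i j] SM.m_closed[OF I_closed[OF shT[OF f(1) g(1), of i j]] Ic(3)]]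
        SM.m_assoc[OF K_SM[OF cfc[OF f(1) g(1), of i j]] I_closed[OF shT[OF f(1) g(1), of i j]] Ic(3)] by simp
    show ?thesis
      unfolding I_product[OF f(1) g(1)]
      using linear_mapD(2)[OF l I_closed[OF T.shuffle_closed[OF f(1) g(1)]] sc]
        linear_map_finsum2[OF SM_module K_module l, where A = "{0..<?n}" and B = "{0..<?m}" and f = ?c,
          OF finite_atLeastLessThan finite_atLeastLessThan cc]
      unfolding ck by simp
  qed
  have E2: "E (Iw f \<otimes>\<^bsub>SM\<^esub> (Iw g \<otimes>\<^bsub>SM\<^esub> Iw w)) = ?Y \<oplus>\<^bsub>K\<^esub> (\<Oplus>\<^bsub>K\<^esub>j\<in>{0..<?m}. \<Oplus>\<^bsub>K\<^esub>k\<in>{0..<?l}. ?B k j)"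
  proof -
    have l: "linear_map C SM K (\<lambda>z. E (Iw f \<otimes>\<^bsub>SM\<^esub> z))"
      by (rule linear_map_comp[OF SM_mult_linear(2)[OF Ic(1)] E_linear])
    let ?c = "\<lambda>j k. cf (drop j g) (drop k w) \<otimes>\<^bsub>SM\<^esub> I (sh (take j g) (take k w))"
    have cc: "?c i j \<in> carrier SM" for i j
      by (intro SM.m_closed K_SM cfc I_closed shT g w)
    have sc: "(\<Oplus>\<^bsub>SM\<^esub>i\<in>{0..<?m}. \<Oplus>\<^bsub>SM\<^esub>j\<in>{0..<?l}. ?c i j) \<in> carrier SM"
      by (intro SM.M.finsum_closed Pi_I cc)
    have ck: "E (Iw f \<otimes>\<^bsub>SM\<^esub> ?c j k) = ?B k j" for j k
      using E_const[OF cfc[OF g(1) w(1), of j k] SM.m_closed[OF Ic(1) I_closed[OF shT[OF g(1) w(1), of j k]]]]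
        SM.m_lcomm[OF Ic(1) K_SM[OF cfc[OF g(1) w(1), of j k]] I_closed[OF shT[OF g(1) w(1), of j k]]] by simp
    show ?thesis
      unfolding I_product[OF g(1) w(1)]
      using linear_mapD(2)[OF l I_closed[OF T.shuffle_closed[OF g(1) w(1)]] sc]
        linear_map_finsum2[OF SM_module K_module l, where A = "{0..<?m}" and B = "{0..<?l}" and f = ?c,
          OF finite_atLeastLessThan finite_atLeastLessThan cc]
      unfolding ck by simp
  qed
  have Ew: "E (Iw w) = \<zero>\<^bsub>K\<^esub>" "E (Iw f) = \<zero>\<^bsub>K\<^esub>"
    using E_I_pos[OF T.pure_pos_closed[OF w]] E_I_pos[OF T.pure_pos_closed[OF f]] f w by (simp_all add: I_pure)
  \<comment> \<open>At \<open>i = j = 0\<close> the shuffle of the prefixes is the empty word, whose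
    integral is one, so the second factor is \<open>E\<close> of the integral of the remaining
    nonempty word.\<close>
  have A0: "?A 0 0 = \<zero>\<^bsub>K\<^esub>"
    using Ew cfc[OF f(1) g(1), of 0 0] Ic by (simp add: I_pure)
  have B0: "?B 0 0 = \<zero>\<^bsub>K\<^esub>"
    using Ew cfc[OF g(1) w(1), of 0 0] Ic by (simp add: I_pure)
  let ?P = "\<lambda>j. \<Oplus>\<^bsub>K\<^esub>i\<in>{1 - j..<?n}. ?A i j" and ?Q = "\<lambda>j. \<Oplus>\<^bsub>K\<^esub>k\<in>{1 - j..<?l}. ?B k j"
  have Pc: "?P j \<in> carrier K" and Qc: "?Q j \<in> carrier K" for j
    by (intro K.M.finsum_closed Pi_I Ac Bc)+
  have PQ: "(\<Oplus>\<^bsub>K\<^esub>j\<in>{0..<?m}. ?P j) \<in> carrier K" "(\<Oplus>\<^bsub>K\<^esub>j\<in>{0..<?m}. ?Q j) \<in> carrier K"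
    by (intro K.M.finsum_closed Pi_I Pc Qc)+
  have "E ((Iw f \<otimes>\<^bsub>SM\<^esub> Iw g) \<otimes>\<^bsub>SM\<^esub> Iw w) = ?X \<oplus>\<^bsub>K\<^esub> (\<Oplus>\<^bsub>K\<^esub>j\<in>{0..<?m}. ?P j)"
    unfolding E1 using J2_index_sum[where F = ?A and n = ?n and m = ?m, OF Ac A0] by simp
  moreover have "E (Iw f \<otimes>\<^bsub>SM\<^esub> (Iw g \<otimes>\<^bsub>SM\<^esub> Iw w)) = ?Y \<oplus>\<^bsub>K\<^esub> (\<Oplus>\<^bsub>K\<^esub>j\<in>{0..<?m}. ?Q j)"
  proof -
    have "(\<Oplus>\<^bsub>K\<^esub>j\<in>{0..<?m}. \<Oplus>\<^bsub>K\<^esub>k\<in>{0..<?l}. ?B k j) = (\<Oplus>\<^bsub>K\<^esub>k\<in>{0..<?l}. \<Oplus>\<^bsub>K\<^esub>j\<in>{0..<?m}. ?B k j)"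
      by (rule K.M.finsum_swap) (use Bc in auto)
    then show ?thesis
      unfolding E2 using J2_index_sum[where F = ?B and n = ?l and m = ?m, OF Bc B0] by simp
  qed
  ultimately have XY: "?X \<oplus>\<^bsub>K\<^esub> (\<Oplus>\<^bsub>K\<^esub>j\<in>{0..<?m}. ?P j) = ?Y \<oplus>\<^bsub>K\<^esub> (\<Oplus>\<^bsub>K\<^esub>j\<in>{0..<?m}. ?Q j)"
    using SM.m_assoc[OF Ic] by simp
  let ?sA = "\<lambda>j i. \<epsilon>' (pure (drop i f)) (pure (drop j g)) \<otimes>\<^bsub>Sym\<^sub>2\<^esub> \<epsilon>' (sh (take i f) (take j g)) (pure w)"
  let ?sB = "\<lambda>j k. \<epsilon>' (pure f) (sh (take j g) (take k w)) \<otimes>\<^bsub>Sym\<^sub>2\<^esub> \<epsilon>' (pure (drop j g)) (pure (drop k w))"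
  let ?sP = "\<lambda>j. \<Oplus>\<^bsub>Sym\<^sub>2\<^esub> i \<in> {1 - j..<?n}. ?sA j i" and ?sQ = "\<lambda>j. \<Oplus>\<^bsub>Sym\<^sub>2\<^esub> k \<in> {1 - j..<?l}. ?sB j k"
  have sA: "?sA j i \<in> carrier Sym\<^sub>2 \<and> h (?sA j i) = ?A i j" if "j < ?m" "i \<in> {1 - j..<?n}" for i j
  proof -
    have i: "i < ?n" using that by simp
    have m: "pure (drop i f) \<in> carrier T_pos" "pure (drop j g) \<in> carrier T_pos"
      "sh (take i f) (take j g) \<in> carrier T_pos" "pure w \<in> carrier T_pos"
      using pure_drop_pos[OF f(1) i] pure_drop_pos[OF g(1) that(1)] pos[OF f(1) g(1) that(2,1)] T.pure_pos_closed[OF w]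
      by simp_all
    show ?thesis
      using hm[OF e[OF m(1,2)] e[OF m(3,4)]] e[OF m(1,2)] e[OF m(3,4)] he[OF m(1,2)] he[OF m(3,4)]
        ev_pure[OF W_take_drop(2)[OF f(1)] W_take_drop(2)[OF g(1)]] w
      by (simp add: ev_def I_pure)
  qed
  have sB: "?sB j k \<in> carrier Sym\<^sub>2 \<and> h (?sB j k) = ?B k j" if "j < ?m" "k \<in> {1 - j..<?l}" for k j
  proof -
    have k: "k < ?l" using that by simp
    have m: "pure (drop j g) \<in> carrier T_pos" "pure (drop k w) \<in> carrier T_pos"
      "pure f \<in> carrier T_pos" "sh (take j g) (take k w) \<in> carrier T_pos"
      using pure_drop_pos[OF g(1) that(1)] pure_drop_pos[OF w(1) k] pos'[OF w(1) g(1) that(2,1)] T.pure_pos_closed[OF f]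
      by simp_all
    have "h (?sB j k) = E (Iw f \<otimes>\<^bsub>SM\<^esub> I (sh (take j g) (take k w))) \<otimes>\<^bsub>K\<^esub> cf (drop j g) (drop k w)"
      using hm[OF e[OF m(3,4)] e[OF m(1,2)]] he[OF m(1,2)] he[OF m(3,4)]
        ev_pure[OF W_take_drop(2)[OF g(1)] W_take_drop(2)[OF w(1)]] f
      by (simp add: ev_def I_pure)
    \<comment> \<open>The generator of \<open>J\<^sub>2\<close> lists the two constants in the
      opposite order from the product formula.\<close>
    also have "\<dots> = ?B k j"
      by (intro K.m_comm E_closed SM.m_closed Ic I_closed shT cfc g w)
    finally show ?thesis using e[OF m(1,2)] e[OF m(3,4)] by simp
  qed
  have sP: "?sP j \<in> carrier Sym\<^sub>2 \<and> h (?sP j) = ?P j" if "j < ?m" for j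
  proof
    show "?sP j \<in> carrier Sym\<^sub>2" using sA[OF that] by (intro Sy.M.finsum_closed) auto
    have "h (?sP j) = (\<Oplus>\<^bsub>K\<^esub>i\<in>{1 - j..<?n}. h (?sA j i))"
      by (rule linear_map_finsum[OF Sy.module_axioms K_module h]) (use sA[OF that] in auto)
    also have "\<dots> = ?P j" using sA[OF that] Ac by (intro K.M.finsum_cong') auto
    finally show "h (?sP j) = ?P j" .
  qed
  have sQ: "?sQ j \<in> carrier Sym\<^sub>2 \<and> h (?sQ j) = ?Q j" if "j < ?m" for j
  proof
    show "?sQ j \<in> carrier Sym\<^sub>2" using sB[OF that] by (intro Sy.M.finsum_closed) auto
    have "h (?sQ j) = (\<Oplus>\<^bsub>K\<^esub>k\<in>{1 - j..<?l}. h (?sB j k))"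
      by (rule linear_map_finsum[OF Sy.module_axioms K_module h]) (use sB[OF that] in auto)
    also have "\<dots> = ?Q j" using sB[OF that] Bc by (intro K.M.finsum_cong') auto
    finally show "h (?sQ j) = ?Q j" .
  qed
  have sPQ: "?sP j \<ominus>\<^bsub>Sym\<^sub>2\<^esub> ?sQ j \<in> carrier Sym\<^sub>2 \<and> h (?sP j \<ominus>\<^bsub>Sym\<^sub>2\<^esub> ?sQ j) = ?P j \<ominus>\<^bsub>K\<^esub> ?Q j" if "j < ?m" for j
    using sP[OF that] sQ[OF that] linear_map_minus[OF Sy.module_axioms K_module h] by (simp del: One_nat_def)
  have hsum: "h (\<Oplus>\<^bsub>Sym\<^sub>2\<^esub>j\<in>{0..<?m}. ?sP j \<ominus>\<^bsub>Sym\<^sub>2\<^esub> ?sQ j) =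
      (\<Oplus>\<^bsub>K\<^esub>j\<in>{0..<?m}. ?P j) \<ominus>\<^bsub>K\<^esub> (\<Oplus>\<^bsub>K\<^esub>j\<in>{0..<?m}. ?Q j)"
  proof -
    have "h (\<Oplus>\<^bsub>Sym\<^sub>2\<^esub>j\<in>{0..<?m}. ?sP j \<ominus>\<^bsub>Sym\<^sub>2\<^esub> ?sQ j) =
        (\<Oplus>\<^bsub>K\<^esub>j\<in>{0..<?m}. h (?sP j \<ominus>\<^bsub>Sym\<^sub>2\<^esub> ?sQ j))"
      by (rule linear_map_finsum[OF Sy.module_axioms K_module h]) (use sPQ in auto)
    also have "\<dots> = (\<Oplus>\<^bsub>K\<^esub>j\<in>{0..<?m}. ?P j \<ominus>\<^bsub>K\<^esub> ?Q j)"
      using sPQ Pc Qc by (intro K.M.finsum_cong') auto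
    also have "\<dots> = (\<Oplus>\<^bsub>K\<^esub>j\<in>{0..<?m}. ?P j) \<ominus>\<^bsub>K\<^esub> (\<Oplus>\<^bsub>K\<^esub>j\<in>{0..<?m}. ?Q j)"
      by (rule K.M.finsum_minus_distrib) (use Pc Qc in auto)
    finally show ?thesis .
  qed
  have sX: "\<epsilon>' (sh f g) (pure w) \<in> carrier Sym\<^sub>2" "h (\<epsilon>' (sh f g) (pure w)) = ?X"
    using T.shuffle_pos_closed[OF f(1) g(1)] T.pure_pos_closed[OF w] e he f w
    by (simp_all add: ev_def I_pure)
  have sY: "\<epsilon>' (pure f) (sh g w) \<in> carrier Sym\<^sub>2" "h (\<epsilon>' (pure f) (sh g w)) = ?Y"
    using T.shuffle_pos_closed[OF g(1) w(1)] T.pure_pos_closed[OF f] e he f w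
    by (simp_all add: ev_def I_pure)
  have sc: "(\<Oplus>\<^bsub>Sym\<^sub>2\<^esub>j\<in>{0..<?m}. ?sP j \<ominus>\<^bsub>Sym\<^sub>2\<^esub> ?sQ j) \<in> carrier Sym\<^sub>2"
    using sPQ by (intro Sy.M.finsum_closed) auto
  have "h (J\<^sub>2_gen f g w) = (?X \<ominus>\<^bsub>K\<^esub> ?Y) \<oplus>\<^bsub>K\<^esub>
      ((\<Oplus>\<^bsub>K\<^esub>j\<in>{0..<?m}. ?P j) \<ominus>\<^bsub>K\<^esub> (\<Oplus>\<^bsub>K\<^esub>j\<in>{0..<?m}. ?Q j))"
    unfolding J\<^sub>2_gen_def
    using linear_mapD(2)[OF h Sy.M.minus_closed[OF sX(1) sY(1)] sc]
      linear_map_minus[OF Sy.module_axioms K_module h sX(1) sY(1)]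
    unfolding hsum sX(2) sY(2) by simp
  also have "\<dots> = \<zero>\<^bsub>K\<^esub>"
    by (rule K.M.minus_add_minus_zero[OF Xc Yc PQ XY])
  finally show ?thesis .
qed

text \<open>The kernel of the homomorphism on \<open>Sym\<^sub>2\<close> is an ideal, so it is
  enough that it contains the generators of \<open>J\<^sub>2\<close>.\<close>

lemma eta2_exists:
  obtains \<eta> where "linear_map C C\<^sub>2 K \<eta>" "\<eta> \<one>\<^bsub>C\<^sub>2\<^esub> = \<one>\<^bsub>K\<^esub>"
    "\<And>x y. x \<in> carrier C\<^sub>2 \<Longrightarrow> y \<in> carrier C\<^sub>2 \<Longrightarrow> \<eta> (x \<otimes>\<^bsub>C\<^sub>2\<^esub> y) = \<eta> x \<otimes>\<^bsub>K\<^esub> \<eta> y"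
    "\<And>s t. s \<in> carrier T_pos \<Longrightarrow> t \<in> carrier T_pos \<Longrightarrow> \<eta> (\<epsilon>\<^sub>2 s t) = ev s t"
proof -
  interpret Sy: algebra C Sym\<^sub>2 by (rule Sym2_algebra)
  obtain h where h: "linear_map C Sym\<^sub>2 K h" "h \<one>\<^bsub>Sym\<^sub>2\<^esub> = \<one>\<^bsub>K\<^esub>"
    "\<And>x y. x \<in> carrier Sym\<^sub>2 \<Longrightarrow> y \<in> carrier Sym\<^sub>2 \<Longrightarrow> h (x \<otimes>\<^bsub>Sym\<^sub>2\<^esub> y) = h x \<otimes>\<^bsub>K\<^esub> h y"
    "\<And>s t. s \<in> carrier T_pos \<Longrightarrow> t \<in> carrier T_pos \<Longrightarrow> h (\<epsilon>' s t) = ev s t"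
    using sym2_hom_exists by blast
  have gens: "J\<^sub>2_gen f g w \<in> {x \<in> carrier Sym\<^sub>2. h x = \<zero>\<^bsub>K\<^esub>}" if "{f, g, w} \<subseteq> W - {[]}" for f g w
  proof -
    have "f \<in> W" "f \<noteq> []" "g \<in> W" "g \<noteq> []" "w \<in> W" "w \<noteq> []" using that by auto
    then show ?thesis
      using J2_gen_closed[of f g w] J2_gen_vanish[where h = h, OF h(1,3,4), of f g w]
      by (simp del: in_lists_conv_set)
  qed
  have "ideal {x \<in> carrier Sym\<^sub>2. h x = \<zero>\<^bsub>K\<^esub>} Sym\<^sub>2"
    by (rule ideal_kernel[OF Sym2_algebra K_algebra h(1)]) (rule h(3))
  then have "J\<^sub>2 \<subseteq> {x \<in> carrier Sym\<^sub>2. h x = \<zero>\<^bsub>K\<^esub>}"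
    unfolding J\<^sub>2_def by (rule Sy.genideal_minimal) (use gens in blast)
  then have z: "x \<in> J\<^sub>2 \<Longrightarrow> h x = \<zero>\<^bsub>K\<^esub>" for x by blast
  obtain k where k: "linear_map C C\<^sub>2 K k" "k \<one>\<^bsub>C\<^sub>2\<^esub> = \<one>\<^bsub>K\<^esub>"
    "\<And>x y. x \<in> carrier C\<^sub>2 \<Longrightarrow> y \<in> carrier C\<^sub>2 \<Longrightarrow> k (x \<otimes>\<^bsub>C\<^sub>2\<^esub> y) = k x \<otimes>\<^bsub>K\<^esub> k y"
    "\<And>x. x \<in> carrier Sym\<^sub>2 \<Longrightarrow> k (J\<^sub>2 +>\<^bsub>Sym\<^sub>2\<^esub> x) = h x"
    unfolding C\<^sub>2_def
    by (rule quotient_algebra_extend[OF Sym2_algebra J2_ideal K_algebra, where h = h, OF h(1,2)])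
      (rule h(3) z, assumption+ | blast)+
  show thesis
  proof (rule that[OF k(1-3)])
    fix s t assume st: "s \<in> carrier T_pos" "t \<in> carrier T_pos"
    show "k (\<epsilon>\<^sub>2 s t) = ev s t"
      unfolding \<epsilon>\<^sub>2_def k(4)[OF bilinear_map_closed[OF eps'_bilinear st]] by (rule h(4)[OF st])
  qed
qed

subsection \<open>The universal property\<close>

lemma K_mult: "x \<otimes>\<^bsub>K\<^esub> y = x \<otimes>\<^bsub>SM\<^esub> y"
  by (simp add: K_simps)

lemma L_linear_R: "z \<in> carrier SM \<Longrightarrow> linear_map C R_alg SM (\<lambda>x. L x z)"
  unfolding L_def by (rule linear_map_comp[OF linear_map_comp[OF phi_linear SM_mult_linear(1)] iS_linear])

lemma L_rest:
  assumes a: "a \<in> carrier R" and z: "z \<in> carrier SM"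
  shows "L (deriv (Q a)) z \<oplus>\<^bsub>SM\<^esub> L (a \<ominus> deriv (Q a)) z = L a z"
proof -
  have "deriv (Q a) \<in> carrier R" using a by (intro deriv_closed Q_closed)
  moreover from this have "deriv (Q a) \<oplus> (a \<ominus> deriv (Q a)) = a"
    using a by (simp add: a_minus_def a_lcomm r_neg)
  ultimately show ?thesis
    using linear_mapD(2)[OF L_linear_R[OF z], of "deriv (Q a)" "a \<ominus> deriv (Q a)"] a by simp
qed

text \<open>Integration by parts: \<open>u - E u\<close> is the integral of the derivative of
  \<open>u\<close>, and the Leibniz rule splits that derivative. \<open>E u\<close> plays the part
  of the boundary term.\<close>

lemma minus_E_parts:
  assumes a: "a \<in> carrier R" and w: "w \<in> W"
  shows "\<phi> (Q a) \<otimes>\<^bsub>SM\<^esub> Iw w \<ominus>\<^bsub>SM\<^esub> E (\<phi> (Q a) \<otimes>\<^bsub>SM\<^esub> Iw w) =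
    L (deriv (Q a)) (Iw w) \<oplus>\<^bsub>SM\<^esub> iS (\<phi> (Q a) \<otimes>\<^bsub>SM\<^esub> dS (Iw w))"
proof -
  let ?u = "\<phi> (Q a) \<otimes>\<^bsub>SM\<^esub> Iw w"
  have q: "\<phi> (Q a) \<in> carrier SM" "\<phi> (deriv (Q a)) \<in> carrier SM"
    using a by (auto intro!: phi_closed deriv_closed Q_closed)
  note wc = Iw_closed[OF w]
  have u: "?u \<in> carrier SM" using q wc by simp
  have "?u \<ominus>\<^bsub>SM\<^esub> E ?u = iS (dS ?u)"
    using E_decomp[OF u] SM.M.add_minus_cancel[OF K_SM[OF E_closed[OF u]] iS_closed[OF dS_closed[OF u]]]
    by simp
  also have "dS ?u = \<phi> (deriv (Q a)) \<otimes>\<^bsub>SM\<^esub> Iw w \<oplus>\<^bsub>SM\<^esub> \<phi> (Q a) \<otimes>\<^bsub>SM\<^esub> dS (Iw w)"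
    using dS_mult[OF q(1) wc] phi_deriv[OF Q_closed[OF a]] by simp
  also have "iS \<dots> = L (deriv (Q a)) (Iw w) \<oplus>\<^bsub>SM\<^esub> iS (\<phi> (Q a) \<otimes>\<^bsub>SM\<^esub> dS (Iw w))"
    unfolding L_def using q wc dS_closed by (intro linear_mapD(2)[OF iS_linear]) simp_all
  finally show ?thesis .
qed

lemma dS_one: "dS \<one>\<^bsub>SM\<^esub> = \<zero>\<^bsub>SM\<^esub>"
  by (simp add: SM_simps S.deriv_one)

lemma dS_Iw_Cons: "x \<in> carrier R \<Longrightarrow> w \<in> W \<Longrightarrow> dS (Iw (x # w)) = \<phi> x \<otimes>\<^bsub>SM\<^esub> Iw w"
  by (simp add: dS_iS phi_closed Iw_closed)

lemma dS_const: "k \<in> carrier K \<Longrightarrow> z \<in> carrier SM \<Longrightarrow> dS (k \<otimes>\<^bsub>SM\<^esub> z) = k \<otimes>\<^bsub>SM\<^esub> dS z"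
  using K_SM dS_closed by (simp add: dS_mult K_dS)

text \<open>The recursion of \<open>integ_pure\<close> read in \<open>S\<close>. Integration by
  parts with respect to \<open>Q a\<close> accounts for the part \<open>deriv (Q a)\<close> of the
  coefficient, and the remaining part, which lies in \<open>R\<^sub>T\<close>, is integrated by
  lengthening the word.\<close>

lemma iS_parts:
  assumes a: "a \<in> carrier R" and w: "w \<in> W"
  defines "u \<equiv> \<phi> (Q a) \<otimes>\<^bsub>SM\<^esub> Iw w"
  shows "u \<ominus>\<^bsub>SM\<^esub> E u \<ominus>\<^bsub>SM\<^esub> iS (\<phi> (Q a) \<otimes>\<^bsub>SM\<^esub> dS (Iw w)) \<oplus>\<^bsub>SM\<^esub> L (a \<ominus> deriv (Q a)) (Iw w) =
    iS (\<phi> a \<otimes>\<^bsub>SM\<^esub> Iw w)"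
proof -
  let ?A = "L (deriv (Q a)) (Iw w)" and ?X = "iS (\<phi> (Q a) \<otimes>\<^bsub>SM\<^esub> dS (Iw w))"
  note wc = Iw_closed[OF w]
  have A: "?A \<in> carrier SM" unfolding L_def
    by (intro iS_closed SM.m_closed phi_closed deriv_closed Q_closed a wc)
  have X: "?X \<in> carrier SM"
    by (intro iS_closed SM.m_closed phi_closed dS_closed Q_closed a wc)
  have "u \<ominus>\<^bsub>SM\<^esub> E u = ?X \<oplus>\<^bsub>SM\<^esub> ?A"
    unfolding u_def minus_E_parts[OF a w] by (rule SM.M.a_comm[OF A X])
  then have "u \<ominus>\<^bsub>SM\<^esub> E u \<ominus>\<^bsub>SM\<^esub> ?X = ?A"
    using SM.M.add_minus_cancel[OF X A] by simp
  then show ?thesis using L_rest[OF a wc] by (simp add: L_def)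
qed

lemma iS_zero: "iS \<zero>\<^bsub>SM\<^esub> = \<zero>\<^bsub>SM\<^esub>"
  by (rule linear_map_zero[OF SM_module SM_module iS_linear])

lemma IDR_hom_exists:
  obtains \<eta> where "linear_map C IDR SM \<eta>"
    "\<And>x y. x \<in> carrier IDR \<Longrightarrow> y \<in> carrier IDR \<Longrightarrow> \<eta> (x \<otimes>\<^bsub>IDR\<^esub> y) = \<eta> x \<otimes>\<^bsub>SM\<^esub> \<eta> y"
    "\<And>x. x \<in> carrier IDR \<Longrightarrow> \<eta> (IDR_deriv x) = dS (\<eta> x)"
    "\<And>x. x \<in> carrier IDR \<Longrightarrow> \<eta> (IDR_integ x) = iS (\<eta> x)"
    "\<And>a. a \<in> carrier R \<Longrightarrow> \<eta> (IDR_incl a) = \<phi> a"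
proof -
  interpret C1: algebra C C\<^sub>1 by (rule C1_algebra)
  interpret C2: algebra C C\<^sub>2 by (rule C2_algebra)
  interpret TC: module C TC by (rule TC_module)
  interpret ID: module C IDR by (rule IDR_module)
  obtain \<eta>1 where e1: "linear_map C C\<^sub>1 K \<eta>1" "\<eta>1 \<one>\<^bsub>C\<^sub>1\<^esub> = \<one>\<^bsub>K\<^esub>"
    "\<And>x y. x \<in> carrier C\<^sub>1 \<Longrightarrow> y \<in> carrier C\<^sub>1 \<Longrightarrow> \<eta>1 (x \<otimes>\<^bsub>C\<^sub>1\<^esub> y) = \<eta>1 x \<otimes>\<^bsub>K\<^esub> \<eta>1 y"
    "\<And>r t. r \<in> carrier R\<^sub>J \<Longrightarrow> t \<in> carrier T \<Longrightarrow> \<eta>1 (\<epsilon>\<^sub>1 r t) = E (\<phi> r \<otimes>\<^bsub>SM\<^esub> I t)"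
    using eta1_exists by blast
  obtain \<eta>2 where e2: "linear_map C C\<^sub>2 K \<eta>2" "\<eta>2 \<one>\<^bsub>C\<^sub>2\<^esub> = \<one>\<^bsub>K\<^esub>"
    "\<And>x y. x \<in> carrier C\<^sub>2 \<Longrightarrow> y \<in> carrier C\<^sub>2 \<Longrightarrow> \<eta>2 (x \<otimes>\<^bsub>C\<^sub>2\<^esub> y) = \<eta>2 x \<otimes>\<^bsub>K\<^esub> \<eta>2 y"
    "\<And>s t. s \<in> carrier T_pos \<Longrightarrow> t \<in> carrier T_pos \<Longrightarrow> \<eta>2 (\<epsilon>\<^sub>2 s t) = ev s t"
    using eta2_exists by blast
  have l1: "linear_map C C\<^sub>1 SM \<eta>1" and l2: "linear_map C C\<^sub>2 SM \<eta>2"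
    by (rule linear_map_comp[OF e1(1) K_incl], rule linear_map_comp[OF e2(1) K_incl])
  have c1: "\<eta>1 x \<in> carrier K" "\<eta>1 x \<in> carrier SM" if "x \<in> carrier C\<^sub>1" for x
    using linear_mapD(1)[OF e1(1) that] K_SM by auto
  have c2: "\<eta>2 x \<in> carrier K" "\<eta>2 x \<in> carrier SM" if "x \<in> carrier C\<^sub>2" for x
    using linear_mapD(1)[OF e2(1) that] K_SM by auto
  have one: "\<eta>1 \<one>\<^bsub>C\<^sub>1\<^esub> = \<one>\<^bsub>SM\<^esub>" "\<eta>2 \<one>\<^bsub>C\<^sub>2\<^esub> = \<one>\<^bsub>SM\<^esub>" using e1(2) e2(2) by (simp_all add: K_simps)
  let ?vT = "\<lambda>(d, w). \<eta>2 d \<otimes>\<^bsub>SM\<^esub> Iw w"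
  have "TC_multilinear SM ?vT"
    unfolding TC_multilinear_def case_prod_conv
    by (intro conjI ballI linear_map_comp[OF l2 SM_mult_linear(1)] Iw_closed
        T.word_multilinear_comp[OF Iw_multilinear SM_mult_linear(2)] c2)
  from universal_ex[OF TC_universal[OF SM_module], where f = ?vT, OF _ this]
  obtain \<eta>T where eT: "linear_map C TC SM \<eta>T"
    "\<And>d w. d \<in> carrier C\<^sub>2 \<Longrightarrow> w \<in> W \<Longrightarrow> \<eta>T (tensor C C\<^sub>2 T d (pure w)) = \<eta>2 d \<otimes>\<^bsub>SM\<^esub> Iw w"
    using c2 Iw_closed by fastforce
  \<comment> \<open>The second factor has to be an arbitrary tensor because the product formula
    contains shuffles.\<close>
  have eTt: "\<eta>T (tensor C C\<^sub>2 T d t) = \<eta>2 d \<otimes>\<^bsub>SM\<^esub> I t" if d: "d \<in> carrier C\<^sub>2" and t: "t \<in> carrier T" for d t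
    by (rule linear_map_eqI[OF T.tensors_module SM_module linear_map_comp[OF bilinear_mapD(1)[OF TC_tensor d] eT(1)]
          linear_map_comp[OF I_linear SM_mult_linear(2)[OF c2(2)[OF d]]] T.pure_span _ t])
      (simp add: eT(2) d I_pure del: in_lists_conv_set)
  \<comment> \<open>Up to the common factor from the two constants this is \<open>I_product\<close>:
    \<open>\<eta>2\<close> turns the constants in the double sum into the coefficients
    \<open>cf\<close>.\<close>
  have eT_prod: "\<eta>T (TC_product c f d g) = (\<eta>2 c \<otimes>\<^bsub>SM\<^esub> Iw f) \<otimes>\<^bsub>SM\<^esub> (\<eta>2 d \<otimes>\<^bsub>SM\<^esub> Iw g)"
    if c: "c \<in> carrier C\<^sub>2" and d: "d \<in> carrier C\<^sub>2" and f: "f \<in> W" and g: "g \<in> W" for c d f g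
  proof -
    let ?k = "\<eta>2 c \<otimes>\<^bsub>SM\<^esub> \<eta>2 d"
    let ?c = "\<lambda>i j. cross c d (take i f) (drop i f) (take j g) (drop j g)"
    let ?s = "\<lambda>i j. cf (drop i f) (drop j g) \<otimes>\<^bsub>SM\<^esub> I (sh (take i f) (take j g))"
    let ?Sc = "\<Oplus>\<^bsub>TC\<^esub>i\<in>{0..<length f}. \<Oplus>\<^bsub>TC\<^esub>j\<in>{0..<length g}. ?c i j"
    let ?Ss = "\<Oplus>\<^bsub>SM\<^esub>i\<in>{0..<length f}. \<Oplus>\<^bsub>SM\<^esub>j\<in>{0..<length g}. ?s i j"
    have k: "?k \<in> carrier SM" using c2 c d by simp
    have cd: "c \<otimes>\<^bsub>C\<^sub>2\<^esub> d \<in> carrier C\<^sub>2" "\<eta>2 (c \<otimes>\<^bsub>C\<^sub>2\<^esub> d) = ?k" using c d by (simp_all add: e2(3) K_mult)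
    have shT: "sh (take i f) (take j g) \<in> carrier T" for i j
      using f g by (intro T.shuffle_closed W_take_drop)
    have cc: "?c i j \<in> carrier TC" if "i < length f" "j < length g" for i j
      using that c d f g by (intro cross_closed W_take_drop) auto
    have sc: "?s i j \<in> carrier SM" for i j
      using f g by (intro SM.m_closed K_SM cf_closed W_take_drop I_closed shT)
    have cs: "\<eta>T (?c i j) = ?k \<otimes>\<^bsub>SM\<^esub> ?s i j" if i: "i < length f" and j: "j < length g" for i j
    proof -
      note pp = pure_drop_pos[OF f i] pure_drop_pos[OF g j]
      have "\<epsilon>\<^sub>2 (pure (drop i f)) (pure (drop j g)) \<in> carrier C\<^sub>2"
        by (rule bilinear_map_closed[OF eps2_bilinear pp])
      moreover have "\<eta>2 (\<epsilon>\<^sub>2 (pure (drop i f)) (pure (drop j g))) = cf (drop i f) (drop j g)"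
        using e2(4)[OF pp] ev_pure[OF W_take_drop(2)[OF f] W_take_drop(2)[OF g]] by simp
      ultimately have "\<eta>T (?c i j) = (?k \<otimes>\<^bsub>SM\<^esub> cf (drop i f) (drop j g)) \<otimes>\<^bsub>SM\<^esub> I (sh (take i f) (take j g))"
        unfolding cross_def using cd by (simp add: eTt shT e2(3) K_mult)
      also have "\<dots> = ?k \<otimes>\<^bsub>SM\<^esub> ?s i j"
        by (intro SM.m_assoc k K_SM cf_closed W_take_drop f g I_closed shT)
      finally show ?thesis .
    qed
    have Scc: "?Sc \<in> carrier TC" using cc by (intro TC.M.finsum_closed Pi_I) auto
    have Ssc: "?Ss \<in> carrier SM" by (intro SM.M.finsum_closed Pi_I sc)
    have shc: "sh f g \<in> carrier T" using f g by (rule T.shuffle_closed)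
    have "\<eta>T ?Sc = (\<Oplus>\<^bsub>SM\<^esub>i\<in>{0..<length f}. \<Oplus>\<^bsub>SM\<^esub>j\<in>{0..<length g}. \<eta>T (?c i j))"
      by (rule linear_map_finsum2[OF TC_module SM_module eT(1)]) (use cc in auto)
    also have "\<dots> = (\<Oplus>\<^bsub>SM\<^esub>i\<in>{0..<length f}. \<Oplus>\<^bsub>SM\<^esub>j\<in>{0..<length g}. ?k \<otimes>\<^bsub>SM\<^esub> ?s i j)"
    proof (rule SM.M.finsum_cong'[OF refl])
      show "(\<lambda>i. \<Oplus>\<^bsub>SM\<^esub>j\<in>{0..<length g}. ?k \<otimes>\<^bsub>SM\<^esub> ?s i j) \<in> {0..<length f} \<rightarrow> carrier SM"
        by (intro SM.M.finsum_closed Pi_I SM.m_closed[OF k sc])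
      fix i assume i: "i \<in> {0..<length f}"
      show "(\<Oplus>\<^bsub>SM\<^esub>j\<in>{0..<length g}. \<eta>T (?c i j)) = (\<Oplus>\<^bsub>SM\<^esub>j\<in>{0..<length g}. ?k \<otimes>\<^bsub>SM\<^esub> ?s i j)"
        by (intro SM.M.finsum_cong' refl Pi_I SM.m_closed[OF k sc] cs) (use i in auto)
    qed
    also have "\<dots> = ?k \<otimes>\<^bsub>SM\<^esub> ?Ss"
      by (rule linear_map_finsum2[OF SM_module SM_module SM_mult_linear(2)[OF k], symmetric]) (use sc in auto)
    finally have 1: "\<eta>T ?Sc = ?k \<otimes>\<^bsub>SM\<^esub> ?Ss" .
    have "\<eta>T (TC_product c f d g) = \<eta>T (tensor C C\<^sub>2 T (c \<otimes>\<^bsub>C\<^sub>2\<^esub> d) (sh f g)) \<oplus>\<^bsub>SM\<^esub> \<eta>T ?Sc"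
      unfolding TC_product_def
      by (rule linear_mapD(2)[OF eT(1) bilinear_map_closed[OF TC_tensor cd(1) shc] Scc])
    also have "\<dots> = ?k \<otimes>\<^bsub>SM\<^esub> (I (sh f g) \<oplus>\<^bsub>SM\<^esub> ?Ss)"
      unfolding 1 eTt[OF cd(1) shc] cd(2) by (rule SM.r_distr[symmetric, OF I_closed[OF shc] Ssc k])
    also have "\<dots> = ?k \<otimes>\<^bsub>SM\<^esub> (Iw f \<otimes>\<^bsub>SM\<^esub> Iw g)"
      using I_product[OF f g] by simp
    also have "\<dots> = (\<eta>2 c \<otimes>\<^bsub>SM\<^esub> Iw f) \<otimes>\<^bsub>SM\<^esub> (\<eta>2 d \<otimes>\<^bsub>SM\<^esub> Iw g)"
      using c2(2)[OF c] c2(2)[OF d] Iw_closed[OF f] Iw_closed[OF g] by (simp only: SM.m_ac SM.m_closed)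
    finally show ?thesis .
  qed
  have eT_mult: "\<eta>T (x \<otimes>\<^bsub>C\<^sub>2T\<^esub> y) = \<eta>T x \<otimes>\<^bsub>SM\<^esub> \<eta>T y" if "x \<in> carrier C\<^sub>2T" "y \<in> carrier C\<^sub>2T" for x y
    unfolding C2T_simps
  proof (rule bilinear_map_eqI[OF TC_module TC_module SM_module _ _ universalD(2)[OF TC_universal[OF SM_module]]
        universalD(2)[OF TC_universal[OF SM_module]] _ that[unfolded C2T_simps]])
    show "bilinear_map C TC TC SM (\<lambda>x y. \<eta>T (C\<^sub>2T_mult x y))"
      by (intro bilinear_mapI linear_map_comp[OF _ eT(1)] bilinear_mapD[OF C2T_mult_works(1)])
    show "bilinear_map C TC TC SM (\<lambda>x y. \<eta>T x \<otimes>\<^bsub>SM\<^esub> \<eta>T y)"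
      by (rule bilinear_map_comp[OF algebra_mult_bilinear[OF SM_algebra] eT(1) eT(1)])
    fix p q assume "p \<in> carrier C\<^sub>2 \<times> W" "q \<in> carrier C\<^sub>2 \<times> W"
    then obtain c f d g where pq: "p = (c, f)" "q = (d, g)" "c \<in> carrier C\<^sub>2" "f \<in> W" "d \<in> carrier C\<^sub>2" "g \<in> W"
      by auto
    then show "\<eta>T (C\<^sub>2T_mult (case p of (c, f) \<Rightarrow> tensor C C\<^sub>2 T c (pure f)) (case q of (c, f) \<Rightarrow> tensor C C\<^sub>2 T c (pure f)))
        = \<eta>T (case p of (c, f) \<Rightarrow> tensor C C\<^sub>2 T c (pure f)) \<otimes>\<^bsub>SM\<^esub> \<eta>T (case q of (c, f) \<Rightarrow> tensor C C\<^sub>2 T c (pure f))"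
      by (simp add: C2T_mult_works(2) eT_prod eT(2) del: in_lists_conv_set)
  qed
  let ?v = "\<lambda>a c d w. (\<phi> a \<otimes>\<^bsub>SM\<^esub> \<eta>1 c) \<otimes>\<^bsub>SM\<^esub> (\<eta>2 d \<otimes>\<^bsub>SM\<^esub> Iw w)"
  have v_ml: "IDR_multilinear SM ?v"
    unfolding IDR_multilinear_def
  proof (intro conjI ballI)
    fix c d w assume "c \<in> carrier C\<^sub>1" "d \<in> carrier C\<^sub>2" "w \<in> W"
    then show "linear_map C R_alg SM (\<lambda>a. ?v a c d w)"
      by (intro linear_map_comp[OF linear_map_comp[OF phi_linear SM_mult_linear(1)] SM_mult_linear(1)]
          SM.m_closed c1 c2 Iw_closed)
  next
    fix a d w assume "a \<in> carrier R" "d \<in> carrier C\<^sub>2" "w \<in> W"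
    then show "linear_map C C\<^sub>1 SM (\<lambda>c. ?v a c d w)"
      by (intro linear_map_comp[OF linear_map_comp[OF l1 SM_mult_linear(2)] SM_mult_linear(1)]
          SM.m_closed phi_closed c2 Iw_closed)
  next
    fix a c w assume "a \<in> carrier R" "c \<in> carrier C\<^sub>1" "w \<in> W"
    then show "linear_map C C\<^sub>2 SM (\<lambda>d. ?v a c d w)"
      by (intro linear_map_comp[OF linear_map_comp[OF l2 SM_mult_linear(1)] SM_mult_linear(2)]
          SM.m_closed phi_closed c1 Iw_closed)
  next
    fix a c d assume "a \<in> carrier R" "c \<in> carrier C\<^sub>1" "d \<in> carrier C\<^sub>2"
    then show "word_multilinear C R\<^sub>T SM (\<lambda>w. ?v a c d w)"
      by (intro T.word_multilinear_comp[OF Iw_multilinear linear_map_comp[OF SM_mult_linear(2) SM_mult_linear(2)]]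
          SM.m_closed phi_closed c1 c2)
  qed
  have vcl: "?v a c d w \<in> carrier SM" if "a \<in> carrier R" "c \<in> carrier C\<^sub>1" "d \<in> carrier C\<^sub>2" "w \<in> W" for a c d w
    using that by (intro SM.m_closed phi_closed c1 c2 Iw_closed)
  have "(\<lambda>(a, c, d, w). ?v a c d w) \<in> IDR_index \<rightarrow> carrier SM"
    using vcl by (simp add: Pi_iff del: in_lists_conv_set)
  from universal_ex[OF IDR_universal[OF SM_module], where f = "\<lambda>(a, c, d, w). ?v a c d w", OF this]
  obtain \<eta> where \<eta>: "linear_map C IDR SM \<eta>"
    and "\<forall>i\<in>IDR_index. \<eta> (case i of (a, c, d, w) \<Rightarrow> IDR_pure a c d w) = (case i of (a, c, d, w) \<Rightarrow> ?v a c d w)"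
    using v_ml by auto
  then have \<eta>p: "\<eta> (IDR_pure a c d w) = ?v a c d w"
    if "a \<in> carrier R" "c \<in> carrier C\<^sub>1" "d \<in> carrier C\<^sub>2" "w \<in> W" for a c d w
    using that by force
  \<comment> \<open>The product of two pure tensors has a sum of pure tensors in its last factor, so
    multiplicativity requires the value of \<open>\<eta>\<close> on a general
    \<open>triple\<close>.\<close>
  have \<eta>t: "\<eta> (triple a c y) = (\<phi> a \<otimes>\<^bsub>SM\<^esub> \<eta>1 c) \<otimes>\<^bsub>SM\<^esub> \<eta>T y"
    if a: "a \<in> carrier R" and c: "c \<in> carrier C\<^sub>1" and y: "y \<in> carrier C\<^sub>2T" for a c y
  proof (rule linear_map_eqI[OF TC_module SM_module _ _ universalD(2)[OF TC_universal[OF SM_module]] _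
        y[unfolded C2T_simps]])
    show "linear_map C TC SM (\<lambda>y. \<eta> (triple a c y))"
      by (rule linear_map_comp[OF triple_linear(3)[OF a c, unfolded C2T_linear] \<eta>])
    show "linear_map C TC SM (\<lambda>y. (\<phi> a \<otimes>\<^bsub>SM\<^esub> \<eta>1 c) \<otimes>\<^bsub>SM\<^esub> \<eta>T y)"
      by (rule linear_map_comp[OF eT(1) SM_mult_linear(2)[OF SM.m_closed[OF phi_closed[OF a] c1(2)[OF c]]]])
    fix p assume "p \<in> carrier C\<^sub>2 \<times> W"
    then obtain d w where p: "p = (d, w)" "d \<in> carrier C\<^sub>2" "w \<in> W" by auto
    then show "\<eta> (triple a c (case p of (c, f) \<Rightarrow> tensor C C\<^sub>2 T c (pure f))) =
        (\<phi> a \<otimes>\<^bsub>SM\<^esub> \<eta>1 c) \<otimes>\<^bsub>SM\<^esub> \<eta>T (case p of (c, f) \<Rightarrow> tensor C C\<^sub>2 T c (pure f))"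
      using \<eta>p[OF a c p(2,3)] by (simp add: IDR_pure_triple eT(2) del: in_lists_conv_set)
  qed
  have mult: "\<eta> (x \<otimes>\<^bsub>IDR\<^esub> y) = \<eta> x \<otimes>\<^bsub>SM\<^esub> \<eta> y" if "x \<in> carrier IDR" "y \<in> carrier IDR" for x y
  proof (rule bilinear_map_eqI[OF IDR_module IDR_module SM_module _ _ IDR_span IDR_span _ that])
    show "bilinear_map C IDR IDR SM (\<lambda>x y. \<eta> (x \<otimes>\<^bsub>IDR\<^esub> y))"
      by (intro bilinear_mapI linear_map_comp[OF _ \<eta>] bilinear_mapD[OF IDR_mult])
    show "bilinear_map C IDR IDR SM (\<lambda>x y. \<eta> x \<otimes>\<^bsub>SM\<^esub> \<eta> y)"
      by (rule bilinear_map_comp[OF algebra_mult_bilinear[OF SM_algebra] \<eta> \<eta>])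
    fix p q assume "p \<in> IDR_index" "q \<in> IDR_index"
    from \<open>p \<in> IDR_index\<close> obtain a c d w where pp: "p = (a, c, d, w)"
      and p: "a \<in> carrier R" "c \<in> carrier C\<^sub>1" "d \<in> carrier C\<^sub>2" "w \<in> W" by auto
    from \<open>q \<in> IDR_index\<close> obtain a' c' d' w' where qq: "q = (a', c', d', w')"
      and q: "a' \<in> carrier R" "c' \<in> carrier C\<^sub>1" "d' \<in> carrier C\<^sub>2" "w' \<in> W" by auto
    let ?y = "tensor C C\<^sub>2 T d (pure w)" and ?y' = "tensor C C\<^sub>2 T d' (pure w')"
    note y = TC_pure_closed[OF p(3,4)] and y' = TC_pure_closed[OF q(3,4)]
    have yy: "?y \<otimes>\<^bsub>C\<^sub>2T\<^esub> ?y' \<in> carrier C\<^sub>2T"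
      by (rule bilinear_map_closed[OF C2T_mult y y'])
    have eTc: "\<eta>T ?y \<in> carrier SM" "\<eta>T ?y' \<in> carrier SM"
      using linear_mapD(1)[OF eT(1)] y y' by (simp_all add: C2T_simps)
    have "\<eta> (triple a c ?y \<otimes>\<^bsub>IDR\<^esub> triple a' c' ?y') =
        (\<phi> (a \<otimes> a') \<otimes>\<^bsub>SM\<^esub> \<eta>1 (c \<otimes>\<^bsub>C\<^sub>1\<^esub> c')) \<otimes>\<^bsub>SM\<^esub> \<eta>T (?y \<otimes>\<^bsub>C\<^sub>2T\<^esub> ?y')"
      unfolding triple_mult[OF p(1) q(1) p(2) q(2) y y']
      by (rule \<eta>t[OF m_closed[OF p(1) q(1)] C1.m_closed[OF p(2) q(2)] yy])
    also have "\<dots> = ((\<phi> a \<otimes>\<^bsub>SM\<^esub> \<phi> a') \<otimes>\<^bsub>SM\<^esub> (\<eta>1 c \<otimes>\<^bsub>SM\<^esub> \<eta>1 c')) \<otimes>\<^bsub>SM\<^esub> (\<eta>T ?y \<otimes>\<^bsub>SM\<^esub> \<eta>T ?y')"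
      unfolding eT_mult[OF y y'] phi_mult[OF p(1) q(1)] e1(3)[OF p(2) q(2)] K_mult ..
    also have "\<dots> = ((\<phi> a \<otimes>\<^bsub>SM\<^esub> \<eta>1 c) \<otimes>\<^bsub>SM\<^esub> \<eta>T ?y) \<otimes>\<^bsub>SM\<^esub> ((\<phi> a' \<otimes>\<^bsub>SM\<^esub> \<eta>1 c') \<otimes>\<^bsub>SM\<^esub> \<eta>T ?y')"
      using phi_closed[OF p(1)] phi_closed[OF q(1)] c1(2)[OF p(2)] c1(2)[OF q(2)] eTc
      by (simp only: SM.m_ac SM.m_closed)
    finally show "\<eta> ((case p of (a, c, d, w) \<Rightarrow> IDR_pure a c d w) \<otimes>\<^bsub>IDR\<^esub> (case q of (a, c, d, w) \<Rightarrow> IDR_pure a c d w)) =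
        \<eta> (case p of (a, c, d, w) \<Rightarrow> IDR_pure a c d w) \<otimes>\<^bsub>SM\<^esub> \<eta> (case q of (a, c, d, w) \<Rightarrow> IDR_pure a c d w)"
      using \<eta>t[OF p(1,2) y] \<eta>t[OF q(1,2) y'] by (simp add: pp qq IDR_pure_triple)
  qed
  \<comment> \<open>The two factors coming from \<open>C\<^sub>1\<close> and
    \<open>C\<^sub>2\<close> are constants of \<open>S\<close>. Collected in front they pass through
    both the derivation and the integration, which leaves statements about a coefficient and a word
    only.\<close>
  let ?k = "\<lambda>c d. \<eta>1 c \<otimes>\<^bsub>SM\<^esub> \<eta>2 d"
  have kK: "?k c d \<in> carrier K" if "c \<in> carrier C\<^sub>1" "d \<in> carrier C\<^sub>2" for c d
    using K.m_closed[OF c1(1)[OF that(1)] c2(1)[OF that(2)]] by (simp add: K_mult)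
  have \<eta>k: "\<eta> (IDR_pure a c d w) = ?k c d \<otimes>\<^bsub>SM\<^esub> (\<phi> a \<otimes>\<^bsub>SM\<^esub> Iw w)"
    if "a \<in> carrier R" "c \<in> carrier C\<^sub>1" "d \<in> carrier C\<^sub>2" "w \<in> W" for a c d w
    unfolding \<eta>p[OF that] using phi_closed[OF that(1)] c1(2)[OF that(2)] c2(2)[OF that(3)] Iw_closed[OF that(4)]
    by (simp only: SM.m_ac SM.m_closed)
  note \<eta>c = linear_mapD(1)[OF \<eta>]
  have \<eta>_deriv: "\<eta> (deriv_pure a c d w) = dS (\<eta> (IDR_pure a c d w))"
    if a: "a \<in> carrier R" and c: "c \<in> carrier C\<^sub>1" and d: "d \<in> carrier C\<^sub>2" and w: "w \<in> W" for a c d w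
  proof -
    have k: "?k c d \<in> carrier SM" "dS (?k c d) = \<zero>\<^bsub>SM\<^esub>" using kK[OF c d] by (simp_all add: K_dS)
    have ac: "\<phi> a \<in> carrier SM" "\<phi> (deriv a) \<in> carrier SM" using a by (auto intro: phi_closed deriv_closed)
    note wc = Iw_closed[OF w]
    have "dS (\<eta> (IDR_pure a c d w)) = ?k c d \<otimes>\<^bsub>SM\<^esub> dS (\<phi> a \<otimes>\<^bsub>SM\<^esub> Iw w)"
      unfolding \<eta>k[OF a c d w] by (rule dS_const[OF kK[OF c d] SM.m_closed[OF ac(1) wc]])
    also have "dS (\<phi> a \<otimes>\<^bsub>SM\<^esub> Iw w) = \<phi> (deriv a) \<otimes>\<^bsub>SM\<^esub> Iw w \<oplus>\<^bsub>SM\<^esub> \<phi> a \<otimes>\<^bsub>SM\<^esub> dS (Iw w)"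
      using dS_mult[OF ac(1) wc] phi_deriv[OF a] by simp
    finally have eq: "dS (\<eta> (IDR_pure a c d w)) =
        ?k c d \<otimes>\<^bsub>SM\<^esub> (\<phi> (deriv a) \<otimes>\<^bsub>SM\<^esub> Iw w \<oplus>\<^bsub>SM\<^esub> \<phi> a \<otimes>\<^bsub>SM\<^esub> dS (Iw w))" .
    show ?thesis
    proof (cases w)
      case Nil
      then show ?thesis
        unfolding eq using \<eta>k[OF deriv_closed[OF a] c d W_Nil] k ac by (simp add: dS_one)
    next
      case (Cons x v)
      then have x: "x \<in> carrier R" "v \<in> W" using w RT_R by auto
      have ax: "a \<otimes> x \<in> carrier R" using a x by simp
      have "\<eta> (deriv_pure a c d w) = \<eta> (IDR_pure (deriv a) c d w) \<oplus>\<^bsub>SM\<^esub> \<eta> (IDR_pure (a \<otimes> x) c d v)"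
        unfolding Cons deriv_pure.simps
        by (rule linear_mapD(2)[OF \<eta> IDR_pure_closed[OF deriv_closed[OF a] c d w[unfolded Cons]]
              IDR_pure_closed[OF ax c d x(2)]])
      also have "\<dots> = ?k c d \<otimes>\<^bsub>SM\<^esub> (\<phi> (deriv a) \<otimes>\<^bsub>SM\<^esub> Iw w) \<oplus>\<^bsub>SM\<^esub> ?k c d \<otimes>\<^bsub>SM\<^esub> (\<phi> a \<otimes>\<^bsub>SM\<^esub> (\<phi> x \<otimes>\<^bsub>SM\<^esub> Iw v))"
        unfolding \<eta>k[OF deriv_closed[OF a] c d w] \<eta>k[OF ax c d x(2)] phi_mult[OF a x(1)]
        using ac phi_closed[OF x(1)] Iw_closed[OF x(2)] by (simp add: SM.m_assoc)
      also have "\<dots> = dS (\<eta> (IDR_pure a c d w))"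
        unfolding eq dS_Iw_Cons[OF x, folded Cons]
        using k ac wc phi_closed[OF x(1)] Iw_closed[OF x(2)] by (simp add: SM.r_distr)
      finally show ?thesis .
    qed
  qed
  have km: "linear_map C SM SM (\<lambda>z. ?k c d \<otimes>\<^bsub>SM\<^esub> z)" if "c \<in> carrier C\<^sub>1" "d \<in> carrier C\<^sub>2" for c d
    by (rule SM_mult_linear(2)[OF K_SM[OF kK[OF that]]])
  have closed: "\<phi> (Q a) \<otimes>\<^bsub>SM\<^esub> Iw w \<in> carrier SM" "E (\<phi> (Q a) \<otimes>\<^bsub>SM\<^esub> Iw w) \<in> carrier SM"
    "L (a \<ominus> deriv (Q a)) (Iw w) \<in> carrier SM" if a: "a \<in> carrier R" and w: "w \<in> W" for a w
  proof -
    show u: "\<phi> (Q a) \<otimes>\<^bsub>SM\<^esub> Iw w \<in> carrier SM"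
      by (intro SM.m_closed phi_closed Q_closed Iw_closed a w)
    show "E (\<phi> (Q a) \<otimes>\<^bsub>SM\<^esub> Iw w) \<in> carrier SM" by (rule K_SM[OF E_closed[OF u]])
    show "L (a \<ominus> deriv (Q a)) (Iw w) \<in> carrier SM"
      unfolding L_def by (intro iS_closed SM.m_closed phi_closed RT_R rest_RT Iw_closed a w)
  qed
  \<comment> \<open>The three summands of \<open>integ_pure\<close> that are not recursive, matched
    with the corresponding terms of \<open>iS_parts\<close>; the constant in
    \<open>C\<^sub>1\<close> supplies the evaluation.\<close>
  have terms: "IDR_pure (Q a) c d w \<in> carrier IDR"
    "IDR_pure \<one> (c \<otimes>\<^bsub>C\<^sub>1\<^esub> \<epsilon>\<^sub>1 (Q a) (pure w)) d [] \<in> carrier IDR"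
    "IDR_pure \<one> c d ((a \<ominus> deriv (Q a)) # w) \<in> carrier IDR"
    "\<eta> (IDR_pure (Q a) c d w) = ?k c d \<otimes>\<^bsub>SM\<^esub> (\<phi> (Q a) \<otimes>\<^bsub>SM\<^esub> Iw w)"
    "\<eta> (IDR_pure \<one> (c \<otimes>\<^bsub>C\<^sub>1\<^esub> \<epsilon>\<^sub>1 (Q a) (pure w)) d []) = ?k c d \<otimes>\<^bsub>SM\<^esub> E (\<phi> (Q a) \<otimes>\<^bsub>SM\<^esub> Iw w)"
    "\<eta> (IDR_pure \<one> c d ((a \<ominus> deriv (Q a)) # w)) = ?k c d \<otimes>\<^bsub>SM\<^esub> L (a \<ominus> deriv (Q a)) (Iw w)"
    if a: "a \<in> carrier R" and c: "c \<in> carrier C\<^sub>1" and d: "d \<in> carrier C\<^sub>2" and w: "w \<in> W" for a c d w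
  proof -
    note ec = eps1_closed[OF a w]
    note cec = C1.m_closed[OF c ec]
    have rw: "(a \<ominus> deriv (Q a)) # w \<in> W" using rest_RT[OF a] w by simp
    have f1: "\<phi> \<one> = \<one>\<^bsub>SM\<^esub>" by (simp add: SM_simps)
    have qJ: "Q a \<in> carrier R\<^sub>J" using a by (simp add: RJ_carrier)
    have ee: "\<eta>1 (\<epsilon>\<^sub>1 (Q a) (pure w)) = E (\<phi> (Q a) \<otimes>\<^bsub>SM\<^esub> Iw w)"
      unfolding e1(4)[OF qJ T.pure_closed[OF w]] I_pure[OF w] ..
    show "IDR_pure (Q a) c d w \<in> carrier IDR" by (rule IDR_pure_closed[OF Q_closed[OF a] c d w])
    show "IDR_pure \<one> (c \<otimes>\<^bsub>C\<^sub>1\<^esub> \<epsilon>\<^sub>1 (Q a) (pure w)) d [] \<in> carrier IDR"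
      by (rule IDR_pure_closed[OF one_closed cec d W_Nil])
    show "IDR_pure \<one> c d ((a \<ominus> deriv (Q a)) # w) \<in> carrier IDR"
      by (rule IDR_pure_closed[OF one_closed c d rw])
    show "\<eta> (IDR_pure (Q a) c d w) = ?k c d \<otimes>\<^bsub>SM\<^esub> (\<phi> (Q a) \<otimes>\<^bsub>SM\<^esub> Iw w)"
      by (rule \<eta>k[OF Q_closed[OF a] c d w])
    show "\<eta> (IDR_pure \<one> (c \<otimes>\<^bsub>C\<^sub>1\<^esub> \<epsilon>\<^sub>1 (Q a) (pure w)) d []) = ?k c d \<otimes>\<^bsub>SM\<^esub> E (\<phi> (Q a) \<otimes>\<^bsub>SM\<^esub> Iw w)"
      unfolding \<eta>k[OF one_closed cec d W_Nil] e1(3)[OF c ec] ee K_mult f1 Iw.simps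
      using c1(2)[OF c] c2(2)[OF d] closed(2)[OF a w] by (simp add: SM.m_ac)
    have "L (a \<ominus> deriv (Q a)) (Iw w) \<in> carrier SM" by (rule closed(3)[OF a w])
    then show "\<eta> (IDR_pure \<one> c d ((a \<ominus> deriv (Q a)) # w)) = ?k c d \<otimes>\<^bsub>SM\<^esub> L (a \<ominus> deriv (Q a)) (Iw w)"
      unfolding \<eta>k[OF one_closed c d rw] f1 Iw_Cons by (simp only: SM.l_one)
  qed
  have \<eta>_integ: "\<eta> (integ_pure a c d w) = iS (\<eta> (IDR_pure a c d w))"
    if a: "a \<in> carrier R" and c: "c \<in> carrier C\<^sub>1" and d: "d \<in> carrier C\<^sub>2" and w: "w \<in> W" for a c d w
    using a w
  proof (induction w arbitrary: a)
    case Nil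
    note a = Nil(1) and w = Nil(2)
    let ?A = "\<phi> (Q a) \<otimes>\<^bsub>SM\<^esub> Iw []" and ?B = "E (\<phi> (Q a) \<otimes>\<^bsub>SM\<^esub> Iw [])"
      and ?D = "L (a \<ominus> deriv (Q a)) (Iw [])"
    note p = terms[OF a c d W_Nil] 
    note cl = closed[OF a W_Nil] and S = SM.M.minus_closed
    have "\<eta> (integ_pure a c d []) = ?k c d \<otimes>\<^bsub>SM\<^esub> ?A \<ominus>\<^bsub>SM\<^esub> ?k c d \<otimes>\<^bsub>SM\<^esub> ?B \<oplus>\<^bsub>SM\<^esub> ?k c d \<otimes>\<^bsub>SM\<^esub> ?D"
      unfolding integ_pure.simps linear_mapD(2)[OF \<eta> ID.M.minus_closed[OF p(1,2)] p(3)]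
        linear_map_minus[OF IDR_module SM_module \<eta> p(1,2)] p(4-6) ..
    also have "\<dots> = ?k c d \<otimes>\<^bsub>SM\<^esub> (?A \<ominus>\<^bsub>SM\<^esub> ?B \<oplus>\<^bsub>SM\<^esub> ?D)"
      unfolding linear_mapD(2)[OF km[OF c d] S[OF cl(1,2)] cl(3)]
        linear_map_minus[OF SM_module SM_module km[OF c d] cl(1,2)] ..
    also have "?A \<ominus>\<^bsub>SM\<^esub> ?B \<oplus>\<^bsub>SM\<^esub> ?D = iS (\<phi> a \<otimes>\<^bsub>SM\<^esub> Iw [])"
    proof -
      \<comment> \<open>For the empty word the derivative of the iterated integral is zero, so the
        term of \<open>iS_parts\<close> that matches the recursive call disappears, in accordance
        with the base case of \<open>integ_pure\<close>.\<close>
      have "iS (\<phi> (Q a) \<otimes>\<^bsub>SM\<^esub> dS (Iw [])) = \<zero>\<^bsub>SM\<^esub>"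
        using phi_closed[OF Q_closed[OF a]] by (simp add: dS_one iS_zero)
      then have "?A \<ominus>\<^bsub>SM\<^esub> ?B \<ominus>\<^bsub>SM\<^esub> iS (\<phi> (Q a) \<otimes>\<^bsub>SM\<^esub> dS (Iw [])) = ?A \<ominus>\<^bsub>SM\<^esub> ?B"
        using S[OF cl(1,2)] by (simp add: a_minus_def[of SM _ "\<zero>\<^bsub>SM\<^esub>"] del: Iw.simps)
      then show ?thesis using iS_parts[OF a W_Nil] by (simp del: Iw.simps)
    qed
    also have "?k c d \<otimes>\<^bsub>SM\<^esub> iS (\<phi> a \<otimes>\<^bsub>SM\<^esub> Iw []) = iS (\<eta> (IDR_pure a c d []))"
      unfolding \<eta>k[OF a c d W_Nil]
      by (rule iS_const[symmetric, OF kK[OF c d] SM.m_closed[OF phi_closed[OF a] Iw_closed[OF W_Nil]]])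
    finally show ?case .
  next
    case (Cons x v)
    note a = Cons.prems(1) and w = Cons.prems(2)
    have x: "x \<in> carrier R" "v \<in> W" using w RT_R by auto
    note qx = m_closed[OF Q_closed[OF a] x(1)]
    let ?A = "\<phi> (Q a) \<otimes>\<^bsub>SM\<^esub> Iw (x # v)" and ?B = "E (\<phi> (Q a) \<otimes>\<^bsub>SM\<^esub> Iw (x # v))"
      and ?X = "iS (\<phi> (Q a) \<otimes>\<^bsub>SM\<^esub> dS (Iw (x # v)))" and ?D = "L (a \<ominus> deriv (Q a)) (Iw (x # v))"
    note p = terms[OF a c d w]
    note cl = closed[OF a w] and S = SM.M.minus_closed and N = ID.M.minus_closed
    have X: "?X \<in> carrier SM"
      by (intro iS_closed SM.m_closed phi_closed dS_closed Iw_closed Q_closed a w)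
    note pi = integ_pure_closed[OF qx c d x(2)]
    \<comment> \<open>Differentiating an iterated integral strips its first letter, which then
      multiplies the coefficient. This is the coefficient and the word of the recursive call, whose
      coefficient changes, hence the induction with arbitrary \<open>a\<close>.\<close>
    have "iS (\<phi> (Q a \<otimes> x) \<otimes>\<^bsub>SM\<^esub> Iw v) = ?X"
      unfolding dS_Iw_Cons[OF x] phi_mult[OF Q_closed[OF a] x(1)]
      by (simp only: SM.m_assoc[OF phi_closed[OF Q_closed[OF a]] phi_closed[OF x(1)] Iw_closed[OF x(2)]])
    then have eX: "\<eta> (integ_pure (Q a \<otimes> x) c d v) = ?k c d \<otimes>\<^bsub>SM\<^esub> ?X"
      unfolding Cons.IH[OF qx x(2)] \<eta>k[OF qx c d x(2)]
        iS_const[OF kK[OF c d] SM.m_closed[OF phi_closed[OF qx] Iw_closed[OF x(2)]]] by (simp only:)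
    have "\<eta> (integ_pure a c d (x # v)) = ?k c d \<otimes>\<^bsub>SM\<^esub> ?A \<ominus>\<^bsub>SM\<^esub> ?k c d \<otimes>\<^bsub>SM\<^esub> ?B \<ominus>\<^bsub>SM\<^esub>
        ?k c d \<otimes>\<^bsub>SM\<^esub> ?X \<oplus>\<^bsub>SM\<^esub> ?k c d \<otimes>\<^bsub>SM\<^esub> ?D"
      unfolding integ_pure.simps linear_mapD(2)[OF \<eta> N[OF N[OF p(1,2)] pi] p(3)]
        linear_map_minus[OF IDR_module SM_module \<eta> N[OF p(1,2)] pi]
        linear_map_minus[OF IDR_module SM_module \<eta> p(1,2)] p(4-6) eX ..
    also have "\<dots> = ?k c d \<otimes>\<^bsub>SM\<^esub> (?A \<ominus>\<^bsub>SM\<^esub> ?B \<ominus>\<^bsub>SM\<^esub> ?X \<oplus>\<^bsub>SM\<^esub> ?D)"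
      unfolding linear_mapD(2)[OF km[OF c d] S[OF S[OF cl(1,2)] X] cl(3)]
        linear_map_minus[OF SM_module SM_module km[OF c d] S[OF cl(1,2)] X]
        linear_map_minus[OF SM_module SM_module km[OF c d] cl(1,2)] ..
    also have "\<dots> = iS (\<eta> (IDR_pure a c d (x # v)))"
      unfolding iS_parts[OF a w] \<eta>k[OF a c d w]
      by (rule iS_const[symmetric, OF kK[OF c d] SM.m_closed[OF phi_closed[OF a] Iw_closed[OF w]]])
    finally show ?case .
  qed
  have idx: "x \<in> carrier IDR \<Longrightarrow> \<eta> (IDR_deriv x) = dS (\<eta> x)" for x
    by (rule linear_map_eqI[OF IDR_module SM_module linear_map_comp[OF IDR_deriv_works(1) \<eta>]
          linear_map_comp[OF \<eta> dS_linear] IDR_span])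
      (auto simp: IDR_deriv_works(2)[unfolded in_lists_conv_set] \<eta>_deriv[unfolded in_lists_conv_set])
  have idi: "x \<in> carrier IDR \<Longrightarrow> \<eta> (IDR_integ x) = iS (\<eta> x)" for x
    by (rule linear_map_eqI[OF IDR_module SM_module linear_map_comp[OF IDR_integ_works(1) \<eta>]
          linear_map_comp[OF \<eta> iS_linear] IDR_span])
      (auto simp: IDR_integ_works(2)[unfolded in_lists_conv_set] \<eta>_integ[unfolded in_lists_conv_set])
  have inc: "\<eta> (IDR_incl a) = \<phi> a" if "a \<in> carrier R" for a
    unfolding IDR_incl_def \<eta>p[OF that one_C1 one_C2 W_Nil] using phi_closed[OF that] by (simp add: one)
  show thesis by (rule that[of \<eta>]) (fact \<eta> mult idx idi inc)+
qed

end

theorem theorem20: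
  fixes R :: "('r, 'm) ring_scheme" and dR Q :: "'r \<Rightarrow> 'r"
    and S :: "('s, 'n) ring_scheme" and dS intS :: "'s \<Rightarrow> 's"
    and \<phi> :: "'r \<Rightarrow> 's"
  assumes "comm_differential_ring_quasi R dR Q"
    and "comm_integro_differential_ring S dS intS"
    and "\<phi> \<in> differential_ring_hom R dR S dS"
  shows "\<exists>!\<eta>. \<eta> \<in> extensional (carrier (comm_differential_ring_quasi.IDR R dR Q)) \<and>
    \<eta> \<in> integro_differential_ring_hom
      (comm_differential_ring_quasi.IDR R dR Q)
      (comm_differential_ring_quasi.IDR_deriv R dR Q)
      (comm_differential_ring_quasi.IDR_integ R dR Q)
      S dS intS \<and>
    (\<forall>f\<in>carrier R. \<eta> (comm_differential_ring_quasi.IDR_incl R dR Q f) = \<phi> f)"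
proof -
  interpret differential_hom R dR Q S dS intS \<phi>
    by (intro differential_hom.intro differential_hom_axioms.intro assms)
  interpret ID: module C IDR by (rule IDR_module)
  note mult_closed = bilinear_map_closed[OF IDR_mult]
    and dcl = linear_mapD(1)[OF IDR_deriv_works(1)] and icl = linear_mapD(1)[OF IDR_integ_works(1)]
  have one_cl: "\<one>\<^bsub>IDR\<^esub> \<in> carrier IDR" unfolding IDR_one by (rule IDR_incl_closed[OF one_closed])
  obtain \<eta> where \<eta>: "linear_map C IDR SM \<eta>"
    "\<And>x y. x \<in> carrier IDR \<Longrightarrow> y \<in> carrier IDR \<Longrightarrow> \<eta> (x \<otimes>\<^bsub>IDR\<^esub> y) = \<eta> x \<otimes>\<^bsub>SM\<^esub> \<eta> y"
    "\<And>x. x \<in> carrier IDR \<Longrightarrow> \<eta> (IDR_deriv x) = dS (\<eta> x)"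
    "\<And>x. x \<in> carrier IDR \<Longrightarrow> \<eta> (IDR_integ x) = intS (\<eta> x)"
    "\<And>a. a \<in> carrier R \<Longrightarrow> \<eta> (IDR_incl a) = \<phi> a"
    using IDR_hom_exists by blast
  note \<eta>l = linear_mapD[OF \<eta>(1), unfolded SM_simps]
  have \<eta>1: "\<eta> \<one>\<^bsub>IDR\<^esub> = \<one>\<^bsub>S\<^esub>" unfolding IDR_one using \<eta>(5)[OF one_closed] by simp
  show ?thesis
  \<comment> \<open>Homomorphisms are determined on the carrier only. Restricting makes the function
    undefined elsewhere, so that uniqueness can be stated as equality of functions.\<close>
  proof (rule ex1I[of _ "restrict \<eta> (carrier IDR)"], intro conjI)
    show "restrict \<eta> (carrier IDR) \<in> integro_differential_ring_hom IDR IDR_deriv IDR_integ S dS intS"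
      unfolding integro_differential_ring_hom_def differential_ring_hom_def ring_hom_def
      using \<eta>(2-4) \<eta>l(1,2) \<eta>1 mult_closed dcl icl one_cl by (simp add: SM_simps)
    show "\<forall>f\<in>carrier R. restrict \<eta> (carrier IDR) (IDR_incl f) = \<phi> f"
      using \<eta>(5) IDR_incl_closed by simp
  next
    fix \<eta>' assume "\<eta>' \<in> extensional (carrier IDR) \<and>
      \<eta>' \<in> integro_differential_ring_hom IDR IDR_deriv IDR_integ S dS intS \<and>
      (\<forall>f\<in>carrier R. \<eta>' (IDR_incl f) = \<phi> f)"
    then have ext: "\<eta>' \<in> extensional (carrier IDR)" and hom: "\<eta>' \<in> ring_hom IDR S"
      and int: "\<And>x. x \<in> carrier IDR \<Longrightarrow> \<eta>' (IDR_integ x) = intS (\<eta>' x)"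
      and incl: "\<And>a. a \<in> carrier R \<Longrightarrow> \<eta>' (IDR_incl a) = \<phi> a"
      by (auto simp: integro_differential_ring_hom_def differential_ring_hom_def)
    \<comment> \<open>Agreement of the two maps is preserved by sums, products and integration, and
      it holds on the image of \<open>R\<close>, so the set where they agree qualifies for
      \<open>IDR_generated\<close>.\<close>
    have "x \<in> {x \<in> carrier IDR. \<eta>' x = \<eta> x}" if "x \<in> carrier IDR" for x
    proof (rule IDR_generated[OF _ _ _ _ _ that])
      show "IDR_incl a \<in> {x \<in> carrier IDR. \<eta>' x = \<eta> x}" if "a \<in> carrier R" for a
        using that incl \<eta>(5) IDR_incl_closed by simp
      show "x \<oplus>\<^bsub>IDR\<^esub> y \<in> {x \<in> carrier IDR. \<eta>' x = \<eta> x}"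
        if "x \<in> {x \<in> carrier IDR. \<eta>' x = \<eta> x}" "y \<in> {x \<in> carrier IDR. \<eta>' x = \<eta> x}" for x y
        using that ring_hom_add[OF hom] \<eta>l(2) by simp
      show "x \<otimes>\<^bsub>IDR\<^esub> y \<in> {x \<in> carrier IDR. \<eta>' x = \<eta> x}"
        if "x \<in> {x \<in> carrier IDR. \<eta>' x = \<eta> x}" "y \<in> {x \<in> carrier IDR. \<eta>' x = \<eta> x}" for x y
        using that ring_hom_mult[OF hom] \<eta>(2) mult_closed by (simp add: SM_simps)
      show "IDR_integ x \<in> {x \<in> carrier IDR. \<eta>' x = \<eta> x}" if "x \<in> {x \<in> carrier IDR. \<eta>' x = \<eta> x}" for x
        using that int \<eta>(4) icl by simp
    qed auto
    then show "\<eta>' = restrict \<eta> (carrier IDR)"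
      using ext by (intro extensionalityI[of _ "carrier IDR"]) auto
  qed auto
qed

end
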